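(* Let $G$ be a connected negative definite plumbing tree (all genera $0$), $[k]$ a class of characteristic elements with distinguished representative $k_r=k_{can}+2l'_{[k]}$, $\overline{\mathcal J}\subseteq\mathcal J$ a family of $\nu$ bad vertices, and $(\overline L,\overline w)=(\overline L,\overline w[k])$ the associated weighted first quadrant. Then: (1) $$\overline Z_{l'_{[k]}}(\overline{\mathbf t})=\sum_{\mathbf i\in\overline L}\Big(\sum_{\overline I\subseteq\overline{\mathcal J}}(-1)^{|\overline I|+1}\,\overline w(\mathbf i,\overline I)\Big)\,\overline{\mathbf t}^{\,\mathbf i+\phi(l'_{[k]})}.$$ (2) There exists $\mathbf i_0\in\overline{\mathcal S}$ such that for any $\mathbf i\in\mathbf i_0+\overline{\mathcal S}$ $$\sum_{\mathbf i'\not\ge\mathbf i}\overline p_{\mathbf i'+\phi(l'_{[k]})}=\overline w(\mathbf i)+eu(\mathbb H^*(\overline L,\overline w[k])).$$ Here $\overline w(\mathbf i)$ is a quasipolynomial and $eu(\mathbb H^*(\overline L,\overline w[k]))$ equals $eu(\mathbb H^*(G,k_r))$.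
   Context: **Lattice.** $\mathcal J$ is the vertex set, $b_j$ the decorations, $\delta_j$ the valencies. $L=\bigoplus_{j\in\mathcal J}\mathbb ZE_j$ with negative definite form $(E_j,E_j)=b_j$, $(E_i,E_j)=1$ or $0$ for $i\ne j$ adjacent or not. $L'=\{l'\in L\otimes\mathbb Q:(l',L)\subseteq\mathbb Z\}$; $E_j^*\in L'$ with $(E_j^*,E_i)=-1$ if $i=j$, $0$ otherwise; $H=L'/L$. $\le$ is the coordinatewise order. $k_{can}$: $(k_{can},E_j)=-b_j-2$ for all $j$; characteristic elements: $k_{can}+2L'$; $[k]=k+2L$. $\mathcal S'=\{l'\in L':(l',E_j)\le0\ \forall j\}$. If $[k]=k_{can}+2(l'+L)$, $l'_{[k]}$ is the unique minimal element of $(l'+L)\cap\mathcal S'$. $\chi_k(l)=-\frac12(l,l+k)$, $\chi=\chi_{k_{can}}$. **Bad vertices.** A negative definite graph is rational if $\chi(l)\ge1$ for all $l\in L$ with $l>0$. $\overline{\mathcal J}$ is a family of bad vertices if replacing $b_j$, $j\in\overline{\mathcal J}$, by some integers $b_j'\le b_j$ yields a rational graph. $\mathcal J^*=\mathcal J\setminus\overline{\mathcal J}$. $\phi$ is the projection of $L$ (and $L\otimes\mathbb Q$) to the $\overline{\mathcal J}$-coordinates. **Weighted quadrant.** $\overline L=(\mathbb Z_{\ge0})^\nu$ (coordinates indexed by $\overline{\mathcal J}$). For $\mathbf i\in\overline L$, $x(\mathbf i)\in L$ is the unique minimal element among those $x\in L$ with $\phi(x)=\mathbf i$ and $(x+l'_{[k]},E_j)\le0$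 for all $j\in\mathcal J^*$. $\overline w(\mathbf i)=\chi_{k_r}(x(\mathbf i))$ and $\overline w(\mathbf i,\overline I)=\max_{\overline J\subseteq\overline I}\overline w(\mathbf i+1_{\overline J})$ for $\overline I\subseteq\overline{\mathcal J}$, where $1_{\overline J}=\sum_{j\in\overline J}1_j$ is the indicator vector; this is the weight of the cube $(\mathbf i,\overline I)$ with vertices $\mathbf i+1_{\overline J}$. **Reduced series.** $Z(\mathbf t)=\sum p_{l'}\mathbf t^{l'}$ is the Taylor expansion at the origin of $\prod_j(1-\mathbf t^{E_j^*})^{\delta_j-2}$, $Z_h=\sum_{[l']=h}p_{l'}\mathbf t^{l'}$, $Z_{l'}:=Z_{[l']}$. $\overline Z_h(\overline{\mathbf t}):=Z_h(\mathbf t)|_{t_j=1,\ j\in\mathcal J^*}$ in variables $\overline{\mathbf t}=\{t_j\}_{j\in\overline{\mathcal J}}$; write $\overline Z_{l'_{[k]}}(\overline{\mathbf t})=\sum_{\mathbf i}\overline p_{\mathbf i+\phi(l'_{[k]})}\overline{\mathbf t}^{\,\mathbf i+\phi(l'_{[k]})}$. $\overline{\mathcal S}:=\phi(\mathcal S'\cap L)$. The sum in (2) is finite. **Lattice cohomology and $eu$.** Let $\mathcal T_0^+=\mathbb Z[U,U^{-1}]/U\cdot\mathbb Z[U]$ with $\deg U^{-d}=2d$. For a union $T$ of standard lattice cubes in $\mathbb R^s$ and a weight $w_0$ on its lattice points with finite sublevel sets, put $w(\square)=\max w_0$ over vertices of $\square$, $\mathcal F^q=\mathrm{Hom}_{\mathbb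 Z}(\mathcal C_q,\mathcal T_0^+)$ ($\mathcal C_q$ free on oriented $q$-cubes of $T$), and $(\delta_w\phi)(\square_{q+1})=\sum_k\varepsilon_kU^{w(\square_{q+1})-w(\square_q^k)}\phi(\square_q^k)$ if $\partial\square_{q+1}=\sum_k\varepsilon_k\square_q^k$. $\mathbb H^*(T,w)$ is the cohomology of $(\mathcal F^*,\delta_w)$, graded so that $\phi$ has degree $2d$ if each nonzero $\phi(\square_q)$ is homogeneous of degree $2d-2w(\square_q)$. With $\mathfrak m_w=\min w_0$ one has $\mathbb H^0=\mathcal T^+_{2\mathfrak m_w}\oplus\mathbb H^0_{red}$ (where $\mathcal T^+_{2\mathfrak m_w}$ is $\mathcal T_0^+$ with degrees shifted up by $2\mathfrak m_w$) and $\mathbb H^q_{red}=\mathbb H^q$ for $q>0$; $eu(\mathbb H^* )=-\mathfrak m_w+\sum_q(-1)^q\mathrm{rank}_{\mathbb Z}\mathbb H^q_{red}$. $\mathbb H^*(G,k_r)$: $T=L\otimes\mathbb R$, $w_0=\chi_{k_r}$. $\mathbb H^*(\overline L,\overline w[k])$: $T=[0,\infty)^\nu$, $w_0=\overline w$. *)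

theory Defs
  imports
    "HOL-Library.Function_Algebras"
    "HOL-Library.Countable"
    "HOL-Computational_Algebra.Formal_Power_Series"
begin

text \<open>
  The vertices are the elements of a finite type. All lattices live in \<open>L \<otimes> \<rat>\<close>, represented by
  coordinate functions \<open>'v \<Rightarrow> rat\<close> with respect to the basis \<open>E_j\<close>; sums are pointwise
  and \<open>\<le>\<close> is the coordinatewise order. Vectors in the coordinates of a subset \<open>B\<close> of
  the vertices are the functions that vanish outside \<open>B\<close>.
\<close>

type_synonym 'v qvec = "'v \<Rightarrow> rat"

record 'v plumbing =
  adj :: "'v \<Rightarrow> 'v \<Rightarrow> bool"
  dec :: "'v \<Rightarrow> int"

definition connected_tree :: "('v \<Rightarrow> 'v \<Rightarrow> bool) \<Rightarrow> bool" where
  "connected_tree A \<longleftrightarrow>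
     (\<forall>u v. A u v \<longrightarrow> A v u) \<and> (\<forall>v. \<not> A v v) \<and>
     (\<forall>u v. rtranclp A u v) \<and>
     \<not> (\<exists>vs. 3 \<le> length vs \<and> distinct vs \<and> successively A vs \<and> A (last vs) (hd vs))"

definition valency :: "'v::finite plumbing \<Rightarrow> 'v \<Rightarrow> nat" where
  "valency G j = card {i. adj G j i}"

definition ind :: "'v set \<Rightarrow> 'v qvec" where
  "ind S = (\<lambda>j. if j \<in> S then 1 else 0)"

abbreviation basis :: "'v \<Rightarrow> 'v qvec" where
  "basis j \<equiv> ind {j}"

definition entry :: "'v plumbing \<Rightarrow> 'v \<Rightarrow> 'v \<Rightarrow> int" where
  "entry G i j = (if i = j then dec G j else if adj G i j then 1 else 0)"

definition form :: "'v::finite plumbing \<Rightarrow> 'v qvec \<Rightarrow> 'v qvec \<Rightarrow> rat" where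
  "form G x y = (\<Sum>i\<in>UNIV. \<Sum>j\<in>UNIV. of_int (entry G i j) * x i * y j)"

definition Lat :: "'v qvec set" where
  "Lat = {l. \<forall>j. l j \<in> \<int>}"

definition negative_definite :: "'v::finite plumbing \<Rightarrow> bool" where
  "negative_definite G \<longleftrightarrow> (\<forall>l\<in>Lat. l \<noteq> 0 \<longrightarrow> form G l l < 0)"

definition dualLat :: "'v::finite plumbing \<Rightarrow> 'v qvec set" where
  "dualLat G = {l'. \<forall>l\<in>Lat. form G l' l \<in> \<int>}"

definition Estar :: "'v::finite plumbing \<Rightarrow> 'v \<Rightarrow> 'v qvec" where
  "Estar G j = (THE l'. l' \<in> dualLat G \<and> (\<forall>i. form G l' (basis i) = (if i = j then -1 else 0)))"

definition kcan :: "'v::finite plumbing \<Rightarrow> 'v qvec" where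
  "kcan G = (THE k. \<forall>j. form G k (basis j) = of_int (- dec G j - 2))"

definition characteristic :: "'v::finite plumbing \<Rightarrow> 'v qvec set" where
  "characteristic G = {kcan G + (\<lambda>j. 2 * l' j) | l'. l' \<in> dualLat G}"

definition lipman :: "'v::finite plumbing \<Rightarrow> 'v qvec set" where
  "lipman G = {l' \<in> dualLat G. \<forall>j. form G l' (basis j) \<le> 0}"

definition the_minimal :: "'a::order set \<Rightarrow> 'a" where
  "the_minimal X = (THE x. x \<in> X \<and> (\<forall>y\<in>X. \<not> y < x))"

text \<open>\<open>l'_{[k]}\<close>, where \<open>[k] = kcan + 2(l' + L)\<close> for \<open>l' = (k - kcan)/2\<close>.\<close>
definition ldist :: "'v::finite plumbing \<Rightarrow> 'v qvec \<Rightarrow> 'v qvec" where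
  "ldist G k = the_minimal ({(\<lambda>j. (k j - kcan G j) / 2) + l | l. l \<in> Lat} \<inter> lipman G)"

definition kdist :: "'v::finite plumbing \<Rightarrow> 'v qvec \<Rightarrow> 'v qvec" where
  "kdist G k = kcan G + (\<lambda>j. 2 * ldist G k j)"

definition chi :: "'v::finite plumbing \<Rightarrow> 'v qvec \<Rightarrow> 'v qvec \<Rightarrow> rat" where
  "chi G k l = - (1 / 2) * form G l (l + k)"

definition rational_graph :: "'v::finite plumbing \<Rightarrow> bool" where
  "rational_graph G \<longleftrightarrow>
     negative_definite G \<and> (\<forall>l\<in>Lat. l > 0 \<longrightarrow> chi G (kcan G) l \<ge> 1)"

definition bad_family :: "'v::finite plumbing \<Rightarrow> 'v set \<Rightarrow> bool" where
  "bad_family G B \<longleftrightarrow>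
     (\<exists>b'. (\<forall>j\<in>B. b' j \<le> dec G j) \<and> (\<forall>j. j \<notin> B \<longrightarrow> b' j = dec G j) \<and>
           rational_graph (G\<lparr>dec := b'\<rparr>))"

definition proj :: "'v set \<Rightarrow> 'v qvec \<Rightarrow> 'v qvec" where
  "proj B x = (\<lambda>j. if j \<in> B then x j else 0)"

definition quadrant :: "'v set \<Rightarrow> 'v qvec set" where
  "quadrant B = {i \<in> Lat. 0 \<le> i \<and> (\<forall>j. j \<notin> B \<longrightarrow> i j = 0)}"

definition Sbar :: "'v::finite plumbing \<Rightarrow> 'v set \<Rightarrow> 'v qvec set" where
  "Sbar G B = proj B ` (lipman G \<inter> Lat)"

definition xmin :: "'v::finite plumbing \<Rightarrow> 'v qvec \<Rightarrow> 'v set \<Rightarrow> 'v qvec \<Rightarrow> 'v qvec" where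
  "xmin G k B i =
     the_minimal {x \<in> Lat. proj B x = i \<and> (\<forall>j. j \<notin> B \<longrightarrow> form G (x + ldist G k) (basis j) \<le> 0)}"

definition wbar :: "'v::finite plumbing \<Rightarrow> 'v qvec \<Rightarrow> 'v set \<Rightarrow> 'v qvec \<Rightarrow> rat" where
  "wbar G k B i = chi G (kdist G k) (xmin G k B i)"

text \<open>A cube \<open>(i, I)\<close> has the vertices \<open>i + ind J\<close> with \<open>J \<subseteq> I\<close>.\<close>

type_synonym 'v cube = "'v qvec \<times> 'v set"

definition cube_weight :: "('v::finite qvec \<Rightarrow> 'a::linorder) \<Rightarrow> 'v cube \<Rightarrow> 'a" where
  "cube_weight w0 \<sigma> = Max ((\<lambda>J. w0 (fst \<sigma> + ind J)) ` Pow (snd \<sigma>))"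

text \<open>
  Polynomials in the coordinates of \<open>B\<close> with rational coefficients, and functions on the
  quadrant that agree with a polynomial on each class modulo some \<open>N\<close>. (Every sublattice of finite
  index contains some \<open>N \<int>\<^sup>\<nu>\<close>, so allowing arbitrary period lattices would define the same notion.)
\<close>

definition polynomial_in :: "'v::finite set \<Rightarrow> ('v qvec \<Rightarrow> rat) \<Rightarrow> bool" where
  "polynomial_in B p \<longleftrightarrow>
     (\<exists>(M :: ('v \<Rightarrow> nat) set) c. finite M \<and> p = (\<lambda>x. \<Sum>m\<in>M. c m * (\<Prod>j\<in>B. x j ^ m j)))"

definition quasipolynomial_on_quadrant :: "'v::finite set \<Rightarrow> ('v qvec \<Rightarrow> rat) \<Rightarrow> bool" where
  "quasipolynomial_on_quadrant B f \<longleftrightarrow>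
     (\<exists>N::nat. N > 0 \<and>
        (\<forall>r\<in>quadrant B. \<exists>p. polynomial_in B p \<and>
           (\<forall>i\<in>quadrant B. (\<forall>j\<in>B. (i j - r j) / of_nat N \<in> \<int>) \<longrightarrow> f i = p i)))"

text \<open>
  The coefficient of \<open>t^{l'}\<close> in the product over \<open>j\<close> of the expansions of
  \<open>(1 - X)^{\<delta>_j - 2}\<close> at \<open>X = t^{E_j^*}\<close>. The elements \<open>E_j^*\<close> are linearly independent,
  so the index set has at most one element.
\<close>
definition zeta_coeff :: "'v::finite plumbing \<Rightarrow> 'v qvec \<Rightarrow> rat" where
  "zeta_coeff G l' =
     (\<Sum>n\<in>{n :: 'v \<Rightarrow> nat. (\<lambda>i. \<Sum>j\<in>UNIV. of_nat (n j) * Estar G j i) = l'}.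
        \<Prod>j\<in>UNIV. fps_nth ((1 - fps_X) powi (int (valency G j) - 2)) (n j))"

text \<open>
  The coefficient at \<open>e\<close> of the series of the class of \<open>h\<close>, with the variables outside \<open>B\<close> set
  to \<open>1\<close>. For \<open>B \<noteq> {}\<close> only finitely many terms are nonzero, because all coordinates of each
  \<open>E_j^*\<close> are positive on a connected negative definite graph.
\<close>
definition Zbar_coeff :: "'v::finite plumbing \<Rightarrow> 'v set \<Rightarrow> 'v qvec \<Rightarrow> 'v qvec \<Rightarrow> rat" where
  "Zbar_coeff G B h e =
     (\<Sum>l'\<in>{l' \<in> dualLat G. l' - h \<in> Lat \<and> proj B l' = e \<and> zeta_coeff G l' \<noteq> 0}. zeta_coeff G l')"

text \<open>
  An element of \<open>T_0^+\<close> is the finitely supported sequence of its coefficients, the entry at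
  \<open>d\<close> being the coefficient of \<open>U^{-d}\<close>. A union of lattice cubes is given by the set of its
  cubes, which is closed under faces.
\<close>

definition T0plus :: "(nat \<Rightarrow> int) set" where
  "T0plus = {a. finite {d. a d \<noteq> 0}}"

definition Upow :: "nat \<Rightarrow> (nat \<Rightarrow> int) \<Rightarrow> nat \<Rightarrow> int" where
  "Upow n a = (\<lambda>d. a (d + n))"

definition Uinv :: "nat \<Rightarrow> nat \<Rightarrow> int" where
  "Uinv d = (\<lambda>d'. if d' = d then 1 else 0)"

type_synonym 'v cochain = "'v cube \<Rightarrow> nat \<Rightarrow> int"

definition cochains :: "'v cube set \<Rightarrow> nat \<Rightarrow> 'v cochain set" where
  "cochains T q =
     {\<phi>. (\<forall>\<sigma>. \<phi> \<sigma> \<in> T0plus) \<and> (\<forall>\<sigma>. \<sigma> \<notin> T \<or> card (snd \<sigma>) \<noteq> q \<longrightarrow> \<phi> \<sigma> = 0)}"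

text \<open>
  Each cube carries the orientation given by the enumeration \<open>to_nat\<close> of the vertices; the
  faces \<open>(i + E_j, I - {j})\<close> and \<open>(i, I - {j})\<close> then occur in the boundary of \<open>(i, I)\<close> with
  opposite signs. Weights increase from faces to cubes, so the truncation \<open>nat\<close> is harmless.
\<close>
definition cobd ::
    "'v::finite cube set \<Rightarrow> ('v qvec \<Rightarrow> int) \<Rightarrow> nat \<Rightarrow> 'v cochain \<Rightarrow> 'v cochain" where
  "cobd T w0 q \<phi> = (\<lambda>\<sigma>. if \<sigma> \<in> T \<and> card (snd \<sigma>) = q + 1
     then (\<lambda>d. \<Sum>j\<in>snd \<sigma>.
       let front = (fst \<sigma> + basis j, snd \<sigma> - {j}); back = (fst \<sigma>, snd \<sigma> - {j})
       in (-1) ^ card {l \<in> snd \<sigma>. to_nat l < to_nat j} *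
          (Upow (nat (cube_weight w0 \<sigma> - cube_weight w0 front)) (\<phi> front) d
           - Upow (nat (cube_weight w0 \<sigma> - cube_weight w0 back)) (\<phi> back) d))
     else 0)"

definition cocycles :: "'v::finite cube set \<Rightarrow> ('v qvec \<Rightarrow> int) \<Rightarrow> nat \<Rightarrow> 'v cochain set" where
  "cocycles T w0 q = {\<phi> \<in> cochains T q. cobd T w0 q \<phi> = 0}"

definition coboundaries :: "'v::finite cube set \<Rightarrow> ('v qvec \<Rightarrow> int) \<Rightarrow> nat \<Rightarrow> 'v cochain set" where
  "coboundaries T w0 q = (case q of 0 \<Rightarrow> {0} | Suc p \<Rightarrow> cobd T w0 p ` cochains T p)"

text \<open>
  The rank over \<open>\<int>\<close> of the quotient group \<open>Z / N\<close>: the largest number of elements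
  of \<open>Z\<close> that are linearly independent modulo \<open>N\<close>. The value is meaningful only for quotients of
  finite rank.
\<close>
definition quot_rank :: "'v cochain set \<Rightarrow> 'v cochain set \<Rightarrow> nat" where
  "quot_rank Z N = Sup {n. \<exists>z :: nat \<Rightarrow> 'v cochain. (\<forall>i<n. z i \<in> Z) \<and>
     (\<forall>c :: nat \<Rightarrow> int. (\<lambda>\<sigma> d. \<Sum>i<n. c i * z i \<sigma> d) \<in> N \<longrightarrow> (\<forall>i<n. c i = 0))}"

text \<open>The argument \<open>n\<close> is half of the degree.\<close>
definition homogeneous :: "('v::finite qvec \<Rightarrow> int) \<Rightarrow> int \<Rightarrow> 'v cochain \<Rightarrow> bool" where
  "homogeneous w0 n \<phi> \<longleftrightarrow> (\<forall>\<sigma> d. \<phi> \<sigma> d \<noteq> 0 \<longrightarrow> int d = n - cube_weight w0 \<sigma>)"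

definition graded_submodule :: "('v::finite qvec \<Rightarrow> int) \<Rightarrow> 'v cochain set \<Rightarrow> bool" where
  "graded_submodule w0 M \<longleftrightarrow>
     0 \<in> M \<and> (\<forall>\<phi>\<in>M. \<forall>\<psi>\<in>M. \<phi> - \<psi> \<in> M) \<and> (\<forall>\<phi>\<in>M. (\<lambda>\<sigma>. Upow 1 (\<phi> \<sigma>)) \<in> M) \<and>
     (\<forall>\<phi>\<in>M. \<forall>n. (\<lambda>\<sigma> d. if int d = n - cube_weight w0 \<sigma> then \<phi> \<sigma> d else 0) \<in> M)"

text \<open>\<open>P\<close> is isomorphic to \<open>T_0^+\<close> with degrees shifted up by \<open>2m\<close>, as a graded
  \<open>\<int>[U]\<close>-module.\<close>
definition is_tower :: "('v::finite qvec \<Rightarrow> int) \<Rightarrow> int \<Rightarrow> 'v cochain set \<Rightarrow> bool" where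
  "is_tower w0 m P \<longleftrightarrow>
     (\<exists>f. bij_betw f T0plus P \<and>
        (\<forall>a\<in>T0plus. \<forall>b\<in>T0plus. f (a + b) = f a + f b) \<and>
        (\<forall>a\<in>T0plus. f (Upow 1 a) = (\<lambda>\<sigma>. Upow 1 (f a \<sigma>))) \<and>
        (\<forall>d. homogeneous w0 (int d + m) (f (Uinv d))))"

definition min_weight :: "'v cube set \<Rightarrow> ('v qvec \<Rightarrow> int) \<Rightarrow> int" where
  "min_weight T w0 = (LEAST n. n \<in> w0 ` {i. (i, {}) \<in> T})"

text \<open>
  The rank of a complement of the tower in \<open>H^0\<close>, which is the group of \<open>0\<close>-cocycles; the
  rank does not depend on the choice of the decomposition.
\<close>
definition rank_H0_red :: "'v::finite cube set \<Rightarrow> ('v qvec \<Rightarrow> int) \<Rightarrow> nat" where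
  "rank_H0_red T w0 = (THE r. \<exists>P R.
     is_tower w0 (min_weight T w0) P \<and> graded_submodule w0 P \<and> graded_submodule w0 R \<and>
     P \<inter> R = {0} \<and> {\<phi> + \<psi> | \<phi> \<psi>. \<phi> \<in> P \<and> \<psi> \<in> R} = cocycles T w0 0 \<and>
     r = quot_rank R {0})"

text \<open>There are no cubes of dimension larger than the number of vertices.\<close>
definition eu :: "'v::finite cube set \<Rightarrow> ('v qvec \<Rightarrow> int) \<Rightarrow> int" where
  "eu T w0 = - min_weight T w0 + int (rank_H0_red T w0) +
     (\<Sum>q = 1..card (UNIV :: 'v set).
        (-1) ^ q * int (quot_rank (cocycles T w0 q) (coboundaries T w0 q)))"

text \<open>
  The values of \<open>chi\<close> on \<open>L\<close> are integers for characteristic \<open>k\<close>, so the floors below only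
  change the type.
\<close>

definition eu_graph :: "'v::finite plumbing \<Rightarrow> 'v qvec \<Rightarrow> int" where
  "eu_graph G k = eu {(i, I). i \<in> Lat} (\<lambda>i. \<lfloor>chi G (kdist G k) i\<rfloor>)"

definition eu_quadrant :: "'v::finite plumbing \<Rightarrow> 'v qvec \<Rightarrow> 'v set \<Rightarrow> int" where
  "eu_quadrant G k B = eu {(i, I). i \<in> quadrant B \<and> I \<subseteq> B} (\<lambda>i. \<lfloor>wbar G k B i\<rfloor>)"

end

theory Submission
  imports Defs "HOL-Analysis.Cartesian_Space"
begin

text \<open>
  For a box of lattice cubes consider the alternating sum of the weights of its cubes, with the sign
  opposite to the parity of the dimension. This Euler sum does not change when the box is enlarged by a
  layer along which the weights do not decrease, because the new cubes then come in pairs of equal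
  weight and neighbouring dimension. The weighted cochain complex does not see such a layer either. So
  \<open>eu\<close> of a union of boxes that collapse onto one finite box is the Euler sum of that box
  (\<open>eu_of_exhaustion\<close>). There, over the rationals and up to a large degree, the complex is a finite one
  whose Euler characteristic counts cubes, and beyond that degree it is the cochain complex of a
  contractible box.

  For the lattice and for the quadrant the increments of the weights are \<open>1 - (x + l', E_j)\<close>, at \<open>x\<close>
  or at the minimal point \<open>x(i)\<close>. Above a point deep in the Lipman cone they are positive, and below a
  sufficiently negative point they have the opposite sign, so both lattice cohomologies are given by
  Euler sums of boxes. Over a cube of the quadrant the fibre of the projection is a box of lattice
  points. Rationality of the graph with lowered decorations allows this box to be contracted, one
  monotone step at a time, to a single point (\<open>fibre_contraction\<close>): two ends of the box that admit no
  further step would differ by an effective cycle with nonpositive \<open>\<chi>\<close>. Summing over the fibres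
  identifies Euler sums in the lattice with Euler sums in the quadrant
  (\<open>euler_sum_projection\<close>), and in particular the two numbers \<open>eu\<close>.

  The coefficient of the zeta function at \<open>y + l'\<close> is the contribution to the Euler sum of the cubes
  with lowest vertex \<open>y\<close> (\<open>zeta_coeff_cubes\<close>). This is proved by growing the tree from a vertex by
  leaves: a leaf either contributes nothing or takes a difference in the variable of its neighbour,
  and taking differences raises the exponent of \<open>1 - X\<close> by one.

  The sum of the coefficients over a half-open box is an alternating sum of Euler sums of its upper faces.
  The faces other than the box itself do not depend on the lower corner if the upper corner is far
  away, since raising their lower ends leads to the same point (\<open>upper_face_independent\<close>). Hence the
  coefficients not above \<open>i\<close> sum up to \<open>eu\<close> minus the Euler sum of the part of the quadrant above \<open>i\<close>
  (\<open>sum_partial_support\<close>). Inclusion-exclusion at the corner \<open>i\<close> gives the formula for one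
  coefficient. For deep \<open>i\<close> the part above \<open>i\<close> collapses to \<open>i\<close>, and its Euler sum is the negative of
  the weight of \<open>i\<close>. Finally, moving \<open>i\<close> by a multiple of a common denominator moves \<open>x(i)\<close> linearly, and
  \<open>\<chi>\<close> is quadratic, so the weight is a quasipolynomial.
\<close>

section \<open>Boxes of lattice cubes and collapses\<close>

lemma ind_apply: "ind S j = (if j \<in> S then 1 else 0)"
  by (simp add: ind_def)

lemma ind_empty [simp]: "ind {} = 0"
  by (auto simp: ind_def)

lemma ind_insert: "j \<notin> S \<Longrightarrow> ind (insert j S) = basis j + ind S"
  by (auto simp: ind_def fun_eq_iff)

lemma Lat_ind [simp]: "ind S \<in> Lat"
  by (auto simp: ind_def Lat_def)

lemma Lat_zero [simp]: "0 \<in> Lat"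
  by (simp add: Lat_def)

lemma Lat_add [intro, simp]: "x \<in> Lat \<Longrightarrow> y \<in> Lat \<Longrightarrow> x + y \<in> Lat"
  by (simp add: Lat_def)

lemma Lat_diff [intro, simp]: "x \<in> Lat \<Longrightarrow> y \<in> Lat \<Longrightarrow> x - y \<in> Lat"
  by (simp add: Lat_def)

lemma Lat_minus [intro, simp]: "x \<in> Lat \<Longrightarrow> - x \<in> Lat"
  by (simp add: Lat_def)

lemma Ints_less_imp_le:
  fixes x y :: rat
  assumes "x \<in> \<int>" "y \<in> \<int>" "x < y"
  shows "x + 1 \<le> y"
proof -
  obtain m n where "x = of_int m" "y = of_int n" using assms by (auto elim!: Ints_cases)
  moreover from this have "m + 1 \<le> n" using assms(3) by simp
  hence "(of_int (m + 1) :: rat) \<le> of_int n" by (subst of_int_le_iff)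
  ultimately show ?thesis by simp
qed

definition box_cubes :: "'v qvec \<Rightarrow> 'v qvec \<Rightarrow> 'v cube set" where
  "box_cubes a b = {(x, I). x \<in> Lat \<and> a \<le> x \<and> x + ind I \<le> b}"

definition euler_sum :: "'v::finite cube set \<Rightarrow> ('v qvec \<Rightarrow> 'a::linordered_idom) \<Rightarrow> 'a" where
  "euler_sum T w = (\<Sum>\<sigma>\<in>T. (-1) ^ (card (snd \<sigma>) + 1) * cube_weight w \<sigma>)"

lemma finite_Lat_interval:
  fixes a b :: "'v::finite qvec"
  shows "finite {x \<in> Lat. a \<le> x \<and> x \<le> b}"
proof -
  define F where "F = (\<Pi>\<^sub>E j\<in>(UNIV::'v set). (of_int ` {\<lfloor>a j\<rfloor>..\<lceil>b j\<rceil>} :: rat set))"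
  have "finite F" unfolding F_def by (intro finite_PiE) auto
  moreover have "{x \<in> Lat. a \<le> x \<and> x \<le> b} \<subseteq> F"
  proof
    fix x assume x: "x \<in> {x \<in> Lat. a \<le> x \<and> x \<le> b}"
    show "x \<in> F" unfolding F_def
    proof (intro PiE_I)
      fix j
      from x obtain n where n: "x j = of_int n" by (auto simp: Lat_def elim: Ints_cases)
      have "a j \<le> of_int n" "of_int n \<le> b j" using x n by (auto simp: le_fun_def) (metis, metis)
      hence "\<lfloor>a j\<rfloor> \<le> n" "n \<le> \<lceil>b j\<rceil>" by linarith+
      thus "x j \<in> of_int ` {\<lfloor>a j\<rfloor>..\<lceil>b j\<rceil>}" using n by auto
    qed auto
  qed
  ultimately show ?thesis by (rule rev_finite_subset)
qed

lemma ind_nonneg: "(0::'v qvec) \<le> ind S"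
  by (auto simp: ind_def le_fun_def)

lemma box_cubesD:
  assumes "(x, I) \<in> box_cubes a b"
  shows "x \<in> Lat" "a \<le> x" "x + ind I \<le> b" "x \<le> b"
proof -
  show *: "x \<in> Lat" "a \<le> x" "x + ind I \<le> b" using assms by (auto simp: box_cubes_def)
  have "x \<le> x + ind I" using ind_nonneg[of I] by simp
  thus "x \<le> b" using *(3) by (rule order_trans)
qed

lemma finite_box_cubes: "finite (box_cubes a (b :: 'v::finite qvec))"
proof (rule finite_subset)
  show "box_cubes a b \<subseteq> {x \<in> Lat. a \<le> x \<and> x \<le> b} \<times> UNIV"
    by (auto dest: box_cubesD)
  show "finite ({x \<in> Lat. a \<le> x \<and> x \<le> b} \<times> (UNIV :: 'v set set))"
    by (intro finite_cartesian_product finite_Lat_interval) auto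
qed

lemma cube_weight_empty [simp]: "cube_weight w (x, {}) = w x"
  by (simp add: cube_weight_def)

lemma cube_weight_insert:
  fixes w :: "'v::finite qvec \<Rightarrow> 'a::linorder"
  assumes "j \<notin> I"
  shows "cube_weight w (x, insert j I) = max (cube_weight w (x, I)) (cube_weight w (x + basis j, I))"
proof -
  have "(\<lambda>J. w (x + ind J)) ` Pow (insert j I) =
      (\<lambda>J. w (x + ind J)) ` Pow I \<union> (\<lambda>J. w (x + basis j + ind J)) ` Pow I"
  proof -
    have "(\<lambda>J. w (x + ind J)) ` insert j ` Pow I = (\<lambda>J. w (x + basis j + ind J)) ` Pow I"
      unfolding image_image
    proof (intro image_cong refl)
      fix J assume "J \<in> Pow I"
      hence "j \<notin> J" using assms by auto
      show "w (x + ind (insert j J)) = w (x + basis j + ind J)"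
        by (subst ind_insert[OF \<open>j \<notin> J\<close>]) (simp add: add.assoc)
    qed
    thus ?thesis by (simp add: Pow_insert image_Un)
  qed
  thus ?thesis unfolding cube_weight_def fst_conv snd_conv by (simp, subst Max_Un) auto
qed

lemma cube_weight_mono:
  fixes w :: "'v::finite qvec \<Rightarrow> 'a::linorder"
  assumes "\<And>J. J \<subseteq> I \<Longrightarrow> w (x + ind J) \<le> w (y + ind J)"
  shows "cube_weight w (x, I) \<le> cube_weight w (y, I)"
  unfolding cube_weight_def fst_conv snd_conv
proof (rule Max.boundedI)
  fix r assume "r \<in> (\<lambda>J. w (x + ind J)) ` Pow I"
  then obtain J where J: "J \<subseteq> I" "r = w (x + ind J)" by auto
  have "w (y + ind J) \<le> Max ((\<lambda>J. w (y + ind J)) ` Pow I)"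
    using J by (intro Max_ge) auto
  thus "r \<le> Max ((\<lambda>J. w (y + ind J)) ` Pow I)" using assms[OF J(1)] J(2) by order
qed auto

lemma cube_weight_ge:
  fixes w :: "'v::finite qvec \<Rightarrow> 'a::linorder"
  shows "J \<subseteq> I \<Longrightarrow> w (x + ind J) \<le> cube_weight w (x, I)"
  unfolding cube_weight_def by (intro Max_ge) auto

lemma cube_weight_le_iff:
  fixes w :: "'v::finite qvec \<Rightarrow> 'a::linorder"
  shows "cube_weight w (x, I) \<le> c \<longleftrightarrow> (\<forall>J\<subseteq>I. w (x + ind J) \<le> c)"
  unfolding cube_weight_def by (subst Max_le_iff) auto

lemma cube_weight_facet_le:
  fixes w :: "'v::finite qvec \<Rightarrow> 'a::linorder"
  assumes "j \<in> I"
  shows "cube_weight w (x, I - {j}) \<le> cube_weight w (x, I)"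
    and "cube_weight w (x + basis j, I - {j}) \<le> cube_weight w (x, I)"
  using cube_weight_insert[of j "I - {j}" w x] assms by (auto simp: insert_absorb)

text \<open>
  The coboundary in one degree: on the cubes of weight at most \<open>n\<close> the weighted coboundary is the
  usual cubical one.
\<close>
definition cube_sign :: "'v::finite \<Rightarrow> 'v set \<Rightarrow> 'a::comm_ring_1" where
  "cube_sign j I = (-1) ^ card {l \<in> I. to_nat l < to_nat j}"

definition cubical_diff :: "('v::finite cube \<Rightarrow> 'a::comm_ring_1) \<Rightarrow> 'v cube \<Rightarrow> 'a" where
  "cubical_diff f \<sigma> = (\<Sum>j\<in>snd \<sigma>. cube_sign j (snd \<sigma>) *
     (f (fst \<sigma> + basis j, snd \<sigma> - {j}) - f (fst \<sigma>, snd \<sigma> - {j})))"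

lemma cube_sign_square [simp]: "cube_sign j I * cube_sign j I = (1::'a::comm_ring_1)"
  by (simp add: cube_sign_def flip: power_add mult_2)

lemma cube_sign_swap:
  fixes I :: "'v::finite set"
  assumes "j \<in> I" "l \<in> I" "j \<noteq> l"
  shows "cube_sign j I * cube_sign l (I - {j}) = - (cube_sign l I * cube_sign j (I - {l}) :: 'a::comm_ring_1)"
proof -
  have main: "cube_sign j I * cube_sign l (I - {j}) = - (cube_sign l I * cube_sign j (I - {l}) :: 'a)"
    if jl: "j \<in> I" "l \<in> I" "to_nat j < to_nat l" for j l :: 'v
  proof -
    have 1: "{m \<in> I. to_nat m < to_nat l} = insert j {m \<in> I - {j}. to_nat m < to_nat l}"
      using jl by auto
    have 2: "{m \<in> I - {l}. to_nat m < to_nat j} = {m \<in> I. to_nat m < to_nat j}"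
      using jl by auto
    show ?thesis unfolding cube_sign_def 2 by (subst 1) simp
  qed
  consider "to_nat j < to_nat l" | "to_nat l < to_nat j"
    using assms(3) by (metis linorder_neqE_nat inj_to_nat injD)
  thus ?thesis
  proof cases
    case 1 thus ?thesis using main assms by blast
  next
    case 2
    from main[OF assms(2,1) this] show ?thesis by simp
  qed
qed

lemma antisymmetric_double_sum:
  fixes g :: "'b \<Rightarrow> 'b \<Rightarrow> 'a::comm_ring_1"
  assumes "finite I" "\<And>j l. j \<in> I \<Longrightarrow> l \<in> I \<Longrightarrow> j \<noteq> l \<Longrightarrow> g j l = - g l j"
  shows "(\<Sum>j\<in>I. \<Sum>l\<in>I - {j}. g j l) = 0"
  using assms
proof (induction I rule: finite_induct)
  case (insert i I)
  have IH: "(\<Sum>j\<in>I. \<Sum>l\<in>I - {j}. g j l) = 0"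
    by (rule insert.IH) (rule insert.prems; simp)
  have eq: "(\<Sum>l\<in>insert i I - {j}. g j l) = g j i + (\<Sum>l\<in>I - {j}. g j l)" if "j \<in> I" for j
  proof -
    have "insert i I - {j} = insert i (I - {j})" using that insert.hyps by auto
    thus ?thesis using insert.hyps by simp
  qed
  have "(\<Sum>j\<in>insert i I. \<Sum>l\<in>insert i I - {j}. g j l) =
      (\<Sum>l\<in>I. g i l) + (\<Sum>j\<in>I. g j i + (\<Sum>l\<in>I - {j}. g j l))"
    using insert.hyps eq by simp
  also have "\<dots> = (\<Sum>l\<in>I. g i l + g l i)" using IH by (simp add: sum.distrib)
  also have "\<dots> = 0" 
  proof (rule sum.neutral, rule ballI)
    fix l assume "l \<in> I"
    moreover have "i \<noteq> l" using \<open>l \<in> I\<close> insert.hyps by auto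
    ultimately have "g i l = - g l i" by (intro insert.prems) auto
    thus "g i l + g l i = 0" by simp
  qed
  finally show ?case .
qed simp

lemma cubical_diff_cubical_diff: "cubical_diff (cubical_diff f) \<sigma> = (0 :: 'a::comm_ring_1)"
proof -
  obtain x I where \<sigma>: "\<sigma> = (x, I)" by force
  define u where "u j l = f (x + basis j + basis l, I - {j} - {l}) - f (x + basis j, I - {j} - {l})
      - f (x + basis l, I - {j} - {l}) + f (x, I - {j} - {l})" for j l
  have usym: "u j l = u l j" for j l
    by (simp add: u_def algebra_simps Diff_insert2[symmetric] insert_commute)
  have "cubical_diff (cubical_diff f) \<sigma> =
     (\<Sum>j\<in>I. \<Sum>l\<in>I - {j}. cube_sign j I * cube_sign l (I - {j}) * u j l)"
    unfolding cubical_diff_def \<sigma> fst_conv snd_conv u_def sum_subtractf[symmetric] sum_distrib_left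
    by (intro sum.cong refl) (simp add: algebra_simps)
  also have "\<dots> = 0"
  proof (rule antisymmetric_double_sum)
    fix j l assume "j \<in> I" "l \<in> I" "j \<noteq> l"
    show "cube_sign j I * cube_sign l (I - {j}) * u j l = - (cube_sign l I * cube_sign j (I - {l}) * u l j)"
      unfolding cube_sign_swap[OF \<open>j \<in> I\<close> \<open>l \<in> I\<close> \<open>j \<noteq> l\<close>] usym[of j l] by simp
  qed simp
  finally show ?thesis .
qed

lemma cubical_diff_minus: "cubical_diff (\<lambda>\<sigma>. f \<sigma> - g \<sigma>) \<sigma> = cubical_diff f \<sigma> - cubical_diff g \<sigma>"
  unfolding cubical_diff_def by (simp add: sum_subtractf[symmetric] algebra_simps)

lemma cubical_diff_cong:
  assumes "\<And>j. j \<in> snd \<sigma> \<Longrightarrow> f (fst \<sigma> + basis j, snd \<sigma> - {j}) = g (fst \<sigma> + basis j, snd \<sigma> - {j})"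
    and "\<And>j. j \<in> snd \<sigma> \<Longrightarrow> f (fst \<sigma>, snd \<sigma> - {j}) = g (fst \<sigma>, snd \<sigma> - {j})"
  shows "cubical_diff f \<sigma> = cubical_diff g \<sigma>"
  unfolding cubical_diff_def using assms by (intro sum.cong) auto

definition face_closed :: "'v cube set \<Rightarrow> bool" where
  "face_closed T \<longleftrightarrow> (\<forall>(x, I)\<in>T. \<forall>j\<in>I. (x, I - {j}) \<in> T \<and> (x + basis j, I - {j}) \<in> T)"

lemma face_closed_box: "face_closed (box_cubes a b)"
  unfolding face_closed_def
proof clarsimp
  fix x I j assume xI: "(x, I) \<in> box_cubes a b" and j: "j \<in> I"
  note D = box_cubesD[OF xI]
  have I: "ind I = basis j + ind (I - {j})" using ind_insert[of j "I - {j}"] j by (simp add: insert_absorb)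
  have 1: "(x + basis j) + ind (I - {j}) \<le> b" using D(3) unfolding I by (simp add: add.assoc)
  have 2: "x + ind (I - {j}) \<le> b"
  proof (rule order_trans[OF _ D(3)])
    show "x + ind (I - {j}) \<le> x + ind I" by (auto simp: le_fun_def ind_apply)
  qed
  have 3: "a \<le> x + basis j" using D(2) ind_nonneg[of "{j}"] by (simp add: add_increasing2)
  show "(x, I - {j}) \<in> box_cubes a b \<and> (x + basis j, I - {j}) \<in> box_cubes a b"
    using D 1 2 3 by (simp add: box_cubes_def)
qed

text \<open>
  An elementary collapse removes matched pairs of cubes \<open>\<alpha>\<close>, \<open>\<mu> \<alpha>\<close> of equal weight.
\<close>
definition collapse_step ::
    "('v::finite qvec \<Rightarrow> 'a::linordered_idom) \<Rightarrow> 'v cube set \<Rightarrow> 'v cube set \<Rightarrow> bool" where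
  "collapse_step w T0 T \<longleftrightarrow> face_closed T0 \<and> (\<exists>A \<mu> opp (c :: 'v cube \<Rightarrow> int).
     T = T0 \<union> A \<union> \<mu> ` A \<and> T0 \<inter> A = {} \<and> T0 \<inter> \<mu> ` A = {} \<and> A \<inter> \<mu> ` A = {} \<and> inj_on \<mu> A \<and>
     (\<forall>\<alpha>\<in>A. opp \<alpha> \<in> T0 \<and> card (snd (\<mu> \<alpha>)) = card (snd \<alpha>) + 1 \<and> card (snd (opp \<alpha>)) = card (snd \<alpha>) \<and>
        cube_weight w (\<mu> \<alpha>) = cube_weight w \<alpha> \<and> cube_weight w (opp \<alpha>) \<le> cube_weight w \<alpha> \<and> 
        c \<alpha> * c \<alpha> = 1 \<and>
        (\<forall>f :: 'v cube \<Rightarrow> int. (\<forall>\<gamma>\<in>\<mu> ` A. cube_weight w \<gamma> \<le> cube_weight w (\<mu> \<alpha>) \<longrightarrow> f \<gamma> = 0) \<longrightarrow>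
            cubical_diff f (\<mu> \<alpha>) = c \<alpha> * (f \<alpha> - f (opp \<alpha>)))))"

lemma euler_sum_collapse_step:
  assumes "collapse_step w T0 T" "finite T"
  shows "euler_sum T w = euler_sum T0 w"
proof -
  from assms(1) obtain A \<mu> opp and c :: "'a cube \<Rightarrow> int" where *:
     "T = T0 \<union> A \<union> \<mu> ` A" "T0 \<inter> A = {}" "T0 \<inter> \<mu> ` A = {}" "A \<inter> \<mu> ` A = {}" "inj_on \<mu> A"
     "\<And>\<alpha>. \<alpha> \<in> A \<Longrightarrow> card (snd (\<mu> \<alpha>)) = card (snd \<alpha>) + 1"
     "\<And>\<alpha>. \<alpha> \<in> A \<Longrightarrow> cube_weight w (\<mu> \<alpha>) = cube_weight w \<alpha>"
    unfolding collapse_step_def by blast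
  have fin: "finite T0" "finite A" using assms(2) * by auto
  have d: "T0 \<inter> (A \<union> \<mu> ` A) = {}" using * by auto
  have "euler_sum T w = euler_sum T0 w + euler_sum (A \<union> \<mu> ` A) w"
    unfolding euler_sum_def *(1) Un_assoc using fin d by (intro sum.union_disjoint) auto
  also have "euler_sum (A \<union> \<mu> ` A) w = euler_sum A w + euler_sum (\<mu> ` A) w"
    unfolding euler_sum_def using fin *(4) by (intro sum.union_disjoint) auto
  also have "euler_sum (\<mu> ` A) w = - euler_sum A w"
    unfolding euler_sum_def using *(5,6,7) by (simp add: sum.reindex sum_negf[symmetric])
  finally show ?thesis by simp
qed

lemma collapse_step_up:
  fixes w :: "'v::finite qvec \<Rightarrow> 'a::linordered_idom"
  assumes b: "b \<in> Lat"
    and ab: "a j \<le> b j"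
    and mono: "\<And>y. y \<in> Lat \<Longrightarrow> a \<le> y \<Longrightarrow> y \<le> b \<Longrightarrow> y j = b j \<Longrightarrow> w y \<le> w (y + basis j)"
  shows "collapse_step w (box_cubes a b) (box_cubes a (b + basis j))"
proof -
  define T where "T = box_cubes a (b + basis j)"
  define T0 where "T0 = box_cubes a b"
  define A where "A = {(x, I) \<in> T. j \<notin> I \<and> x j = b j + 1}"
  define \<mu> where "\<mu> = (\<lambda>(x, I). (x - basis j :: 'v qvec, insert j I))"
  define opp where "opp = (\<lambda>(x, I :: 'v set). (x - basis j :: 'v qvec, I))"
  have Amem: "(x, I) \<in> A \<longleftrightarrow> x \<in> Lat \<and> a \<le> x \<and> (\<forall>i. x i + ind I i \<le> b i + basis j i) \<and> j \<notin> I \<and> x j = b j + 1"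
    for x I unfolding A_def T_def by (auto simp: box_cubes_def le_fun_def)
  have Bmem: "(y, I) \<in> \<mu> ` A \<longleftrightarrow> (y, I) \<in> T \<and> j \<in> I \<and> y j = b j" for y I
  proof
    assume "(y, I) \<in> \<mu> ` A"
    then obtain x K where x: "(x, K) \<in> A" "y = x - basis j" "I = insert j K" by (auto simp: \<mu>_def)
    have xK: "x \<in> Lat" "a \<le> x" "\<And>i. x i + ind K i \<le> b i + basis j i" "j \<notin> K" "x j = b j + 1"
      using x(1) unfolding Amem by blast+
    have "y \<in> Lat" using x xK by auto
    moreover have "a \<le> y" using x(2) xK(2,5) ab by (auto simp: le_fun_def ind_apply)
    moreover have "y + ind I \<le> b + basis j"
      using xK(3) xK(4) unfolding x(2,3) ind_insert[OF xK(4)] by (auto simp: le_fun_def)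
    ultimately show "(y, I) \<in> T \<and> j \<in> I \<and> y j = b j"
      using x xK unfolding T_def box_cubes_def by (auto simp: ind_apply)
  next
    assume H: "(y, I) \<in> T \<and> j \<in> I \<and> y j = b j"
    have y: "y \<in> Lat" "a \<le> y" "\<And>i. y i + ind I i \<le> b i + basis j i"
      using H unfolding T_def box_cubes_def by (auto simp: le_fun_def)
    have ay: "a i \<le> y i" for i using y(2) by (auto simp: le_fun_def)
    have "(y + basis j, I - {j}) \<in> A" unfolding Amem
    proof (intro conjI allI)
      show "y + basis j \<in> Lat" using y by auto
      show "a \<le> y + basis j" using ay by (auto simp: le_fun_def ind_apply add_increasing2)
      show "(y + basis j) i + ind (I - {j}) i \<le> b i + basis j i" for i
        using y(3)[of i] H by (cases "i = j") (auto simp: ind_apply)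
    qed (use H in \<open>auto simp: ind_apply\<close>)
    moreover have "(y, I) = \<mu> (y + basis j, I - {j})" using H by (auto simp: \<mu>_def)
    ultimately show "(y, I) \<in> \<mu> ` A" by blast
  qed
  have Tcase: "(x, I) \<in> T \<longleftrightarrow> (x, I) \<in> T0 \<or> (x, I) \<in> A \<or> (x, I) \<in> \<mu> ` A" for x I
  proof
    assume H: "(x, I) \<in> T"
    have x: "x \<in> Lat" "a \<le> x" "\<And>i. x i + ind I i \<le> b i + basis j i"
      using H unfolding T_def box_cubes_def by (auto simp: le_fun_def)
    show "(x, I) \<in> T0 \<or> (x, I) \<in> A \<or> (x, I) \<in> \<mu> ` A"
    proof (cases "x j + ind I j \<le> b j")
      case True
      have "x i + ind I i \<le> b i" for i using x(3)[of i] True by (cases "i = j") (auto simp: ind_apply)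
      thus ?thesis using x unfolding T0_def box_cubes_def by (auto simp: le_fun_def)
    next
      case False
      hence "b j + 1 \<le> x j + ind I j"
        by (intro Ints_less_imp_le) (use x(1) b in \<open>auto simp: Lat_def ind_apply\<close>)
      hence "x j + ind I j = b j + 1" using x(3)[of j] by (auto simp: ind_apply)
      hence "(x, I) \<in> A \<or> (x, I) \<in> \<mu> ` A"
        unfolding Bmem using H by (cases "j \<in> I") (auto simp: ind_apply A_def)
      thus ?thesis by blast
    qed
  next
    assume "(x, I) \<in> T0 \<or> (x, I) \<in> A \<or> (x, I) \<in> \<mu> ` A"
    moreover have "(x, I) \<in> T" if "(x, I) \<in> T0"
      using that unfolding T_def T0_def box_cubes_def by (auto simp: le_fun_def ind_apply add_increasing2)
    ultimately show "(x, I) \<in> T" using Bmem by (auto simp: A_def)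
  qed
  have T0top: "x j + ind I j \<le> b j" if "(x, I) \<in> T0" for x I
    using that unfolding T0_def box_cubes_def by (auto simp: le_fun_def)
  have T: "T = T0 \<union> A \<union> \<mu> ` A"
    using Tcase by (simp add: set_eq_iff split_paired_all)
  have d1: "T0 \<inter> A = {}"
    using T0top by (force simp: A_def ind_apply)
  have d2: "T0 \<inter> \<mu> ` A = {}"
  proof -
    have False if "(y, I) \<in> T0" "(y, I) \<in> \<mu> ` A" for y I
      using that T0top[of y I] unfolding Bmem by (auto simp: ind_apply)
    thus ?thesis by (auto simp: disjoint_iff split_paired_all)
  qed
  have d3: "A \<inter> \<mu> ` A = {}"
  proof -
    have False if "(y, I) \<in> A" "(y, I) \<in> \<mu> ` A" for y I
      using that unfolding Bmem by (auto simp: A_def)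
    thus ?thesis by (auto simp: disjoint_iff split_paired_all)
  qed
  have inj: "inj_on \<mu> A" unfolding inj_on_def \<mu>_def A_def by auto
  have point: "opp \<alpha> \<in> T0 \<and> card (snd (\<mu> \<alpha>)) = card (snd \<alpha>) + 1 \<and> card (snd (opp \<alpha>)) = card (snd \<alpha>) \<and>
        cube_weight w (\<mu> \<alpha>) = cube_weight w \<alpha> \<and> cube_weight w (opp \<alpha>) \<le> cube_weight w \<alpha> \<and>
        cube_sign j (snd (\<mu> \<alpha>)) * cube_sign j (snd (\<mu> \<alpha>)) = (1::int) \<and>
        (\<forall>f :: 'v cube \<Rightarrow> int. (\<forall>\<gamma>\<in>\<mu> ` A. cube_weight w \<gamma> \<le> cube_weight w (\<mu> \<alpha>) \<longrightarrow> f \<gamma> = 0) \<longrightarrow>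
            cubical_diff f (\<mu> \<alpha>) = cube_sign j (snd (\<mu> \<alpha>)) * (f \<alpha> - f (opp \<alpha>)))" if "\<alpha> \<in> A" for \<alpha>
  proof -
    obtain x I where \<alpha>: "\<alpha> = (x, I)" by force
    have x: "x \<in> Lat" "a \<le> x" "\<And>i. x i + ind I i \<le> b i + basis j i" "j \<notin> I" "x j = b j + 1"
      using that unfolding \<alpha> Amem by blast+
    have ax: "a i \<le> x i" for i using x(2) by (auto simp: le_fun_def)
    have y: "x - basis j \<in> Lat" "a \<le> x - basis j" using x ax ab by (auto simp: le_fun_def ind_apply)
    have yI: "x - basis j + ind I \<le> b" using x(3) by (auto simp: le_fun_def algebra_simps)
    have le: "cube_weight w (x - basis j, I) \<le> cube_weight w (x, I)"
    proof (rule cube_weight_mono)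
      fix J assume J: "J \<subseteq> I"
      have "w (x - basis j + ind J) \<le> w (x - basis j + ind J + basis j)"
      proof (rule mono)
        show "a \<le> x - basis j + ind J" using y(2) ind_nonneg[of J]
          by (simp add: add_increasing2)
        show "x - basis j + ind J \<le> b"
        proof (rule order_trans[OF _ yI])
          show "x - basis j + ind J \<le> x - basis j + ind I" using J by (auto simp: le_fun_def ind_apply)
        qed
        show "(x - basis j + ind J) j = b j" using J x by (auto simp: ind_apply)
      qed (use x in auto)
      thus "w (x - basis j + ind J) \<le> w (x + ind J)" by (simp add: algebra_simps)
    qed
    have w: "cube_weight w (x - basis j, insert j I) = cube_weight w (x, I)"
      using cube_weight_insert[OF x(4), of w "x - basis j"] le by simp
    have D: "cubical_diff f (x - basis j, insert j I) = cube_sign j (insert j I) * (f (x, I) - f (x - basis j, I))"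
      if f: "\<forall>\<gamma>\<in>\<mu> ` A. cube_weight w \<gamma> \<le> cube_weight w (x - basis j, insert j I) \<longrightarrow> f \<gamma> = 0"
      for f :: "'v cube \<Rightarrow> int"
    proof -
      have z: "f (x - basis j + basis l, insert j I - {l}) = 0 \<and> f (x - basis j, insert j I - {l}) = 0"
        if l: "l \<in> I" for l
      proof -
        have ne: "l \<noteq> j" using l x by auto
        have fT: "(x - basis j, insert j I) \<in> T"
          using \<open>\<alpha> \<in> A\<close> T unfolding \<alpha> \<mu>_def by force
        have cl: "face_closed T" unfolding T_def by (rule face_closed_box)
        have "(x - basis j, insert j I - {l}) \<in> T" "(x - basis j + basis l, insert j I - {l}) \<in> T"
          using cl fT l unfolding face_closed_def by blast+
        hence "(x - basis j, insert j I - {l}) \<in> \<mu> ` A" "(x - basis j + basis l, insert j I - {l}) \<in> \<mu> ` A"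
          unfolding Bmem using ne x(5) by (auto simp: ind_apply)
        thus ?thesis using f cube_weight_facet_le[of l "insert j I" w "x - basis j"] l by blast
      qed
      have "insert j I - {j} = I" using x(4) by auto
      thus ?thesis using x(4) z unfolding cubical_diff_def by simp
    qed
    have "opp \<alpha> \<in> T0" using y yI unfolding \<alpha> opp_def T0_def box_cubes_def by auto
    moreover have "card (insert j I) = card I + 1" using x(4) by simp
    ultimately show ?thesis using w le D unfolding \<alpha> opp_def \<mu>_def by simp
  qed
  show ?thesis unfolding collapse_step_def T_def[symmetric] T0_def[symmetric]
    apply (rule conjI)
     apply (simp add: T0_def face_closed_box)
    apply (rule exI[of _ A], rule exI[of _ \<mu>], rule exI[of _ opp], rule exI[of _ "\<lambda>\<alpha>. cube_sign j (snd (\<mu> \<alpha>))"])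
    apply (intro conjI)
         apply (rule T, rule d1, rule d2, rule d3, rule inj)
    apply (rule ballI, rule point, assumption)
    done
qed

lemma collapse_step_down:
  fixes w :: "'v::finite qvec \<Rightarrow> 'a::linordered_idom"
  assumes a: "a \<in> Lat"
    and ab: "a j \<le> b j"
    and mono: "\<And>y. y \<in> Lat \<Longrightarrow> a \<le> y \<Longrightarrow> y \<le> b \<Longrightarrow> y j = a j \<Longrightarrow> w y \<le> w (y - basis j)"
  shows "collapse_step w (box_cubes a b) (box_cubes (a - basis j) b)"
proof -
  define T where "T = box_cubes (a - basis j) b"
  define T0 where "T0 = box_cubes a b"
  define A where "A = {(x, I) \<in> T. j \<notin> I \<and> x j = a j - 1}"
  define \<mu> where "\<mu> = (\<lambda>(x :: 'v qvec, I). (x, insert j I))"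
  define opp where "opp = (\<lambda>(x, I :: 'v set). (x + basis j :: 'v qvec, I))"
  have Tmem: "(x, I) \<in> T \<longleftrightarrow> x \<in> Lat \<and> (\<forall>i. a i \<le> x i + basis j i) \<and> (\<forall>i. x i + ind I i \<le> b i)"
    for x I unfolding T_def by (auto simp: box_cubes_def le_fun_def diff_le_eq)
  have T0mem: "(x, I) \<in> T0 \<longleftrightarrow> x \<in> Lat \<and> (\<forall>i. a i \<le> x i) \<and> (\<forall>i. x i + ind I i \<le> b i)"
    for x I unfolding T0_def by (auto simp: box_cubes_def le_fun_def)
  have Bmem: "(y, I) \<in> \<mu> ` A \<longleftrightarrow> (y, I) \<in> T \<and> j \<in> I \<and> y j = a j - 1" for y I
  proof
    assume "(y, I) \<in> \<mu> ` A"
    then obtain K where x: "(y, K) \<in> A" "I = insert j K" by (auto simp: \<mu>_def)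
    have K: "y \<in> Lat" "\<And>i. a i \<le> y i + basis j i" "\<And>i. y i + ind K i \<le> b i" "j \<notin> K" "y j = a j - 1"
      using x(1) unfolding A_def Tmem by auto
    have "y i + ind I i \<le> b i" for i
      using K(3)[of i] K(4,5) ab by (cases "i = j") (auto simp: ind_apply x(2))
    thus "(y, I) \<in> T \<and> j \<in> I \<and> y j = a j - 1" using K x(2) unfolding Tmem by auto
  next
    assume H: "(y, I) \<in> T \<and> j \<in> I \<and> y j = a j - 1"
    have y: "y \<in> Lat" "\<And>i. a i \<le> y i + basis j i" "\<And>i. y i + ind I i \<le> b i"
      using H unfolding Tmem by auto
    have "y i + ind (I - {j}) i \<le> b i" for i
      using y(3)[of i] H ab by (cases "i = j") (auto simp: ind_apply)
    hence "(y, I - {j}) \<in> A" unfolding A_def using H y unfolding Tmem by auto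
    moreover have "(y, I) = \<mu> (y, I - {j})" using H by (auto simp: \<mu>_def)
    ultimately show "(y, I) \<in> \<mu> ` A" by blast
  qed
  have Tcase: "(x, I) \<in> T \<longleftrightarrow> (x, I) \<in> T0 \<or> (x, I) \<in> A \<or> (x, I) \<in> \<mu> ` A" for x I
  proof
    assume H: "(x, I) \<in> T"
    have x: "x \<in> Lat" "\<And>i. a i \<le> x i + basis j i" "\<And>i. x i + ind I i \<le> b i"
      using H unfolding Tmem by auto
    show "(x, I) \<in> T0 \<or> (x, I) \<in> A \<or> (x, I) \<in> \<mu> ` A"
    proof (cases "a j \<le> x j")
      case True
      have "a i \<le> x i" for i using x(2)[of i] True by (cases "i = j") (auto simp: ind_apply)
      thus ?thesis using x unfolding T0mem by auto
    next
      case False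
      hence "x j + 1 \<le> a j"
        by (intro Ints_less_imp_le) (use x(1) a in \<open>auto simp: Lat_def ind_apply\<close>)
      hence "x j = a j - 1" using x(2)[of j] by (auto simp: ind_apply)
      hence "(x, I) \<in> A \<or> (x, I) \<in> \<mu> ` A"
        unfolding Bmem using H by (cases "j \<in> I") (auto simp: ind_apply A_def)
      thus ?thesis by blast
    qed
  next
    assume "(x, I) \<in> T0 \<or> (x, I) \<in> A \<or> (x, I) \<in> \<mu> ` A"
    moreover have "(x, I) \<in> T" if "(x, I) \<in> T0"
      using that unfolding Tmem T0mem by (auto simp: ind_apply add_increasing2)
    ultimately show "(x, I) \<in> T" using Bmem by (auto simp: A_def)
  qed
  have T0bot: "a j \<le> x j" if "(x, I) \<in> T0" for x I
    using that unfolding T0mem by auto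
  have T: "T = T0 \<union> A \<union> \<mu> ` A"
    using Tcase by (simp add: set_eq_iff split_paired_all)
  have d1: "T0 \<inter> A = {}"
    using T0bot by (force simp: A_def)
  have d2: "T0 \<inter> \<mu> ` A = {}"
  proof -
    have False if "(y, I) \<in> T0" "(y, I) \<in> \<mu> ` A" for y I
      using that T0bot[of y I] unfolding Bmem by auto
    thus ?thesis by (auto simp: disjoint_iff split_paired_all)
  qed
  have d3: "A \<inter> \<mu> ` A = {}"
  proof -
    have False if "(y, I) \<in> A" "(y, I) \<in> \<mu> ` A" for y I
      using that unfolding Bmem by (auto simp: A_def)
    thus ?thesis by (auto simp: disjoint_iff split_paired_all)
  qed
  have inj: "inj_on \<mu> A" unfolding inj_on_def \<mu>_def A_def by auto
  have point: "opp \<alpha> \<in> T0 \<and> card (snd (\<mu> \<alpha>)) = card (snd \<alpha>) + 1 \<and> card (snd (opp \<alpha>)) = card (snd \<alpha>) \<and>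
        cube_weight w (\<mu> \<alpha>) = cube_weight w \<alpha> \<and> cube_weight w (opp \<alpha>) \<le> cube_weight w \<alpha> \<and>
        (- cube_sign j (snd (\<mu> \<alpha>))) * (- cube_sign j (snd (\<mu> \<alpha>))) = (1::int) \<and>
        (\<forall>f :: 'v cube \<Rightarrow> int. (\<forall>\<gamma>\<in>\<mu> ` A. cube_weight w \<gamma> \<le> cube_weight w (\<mu> \<alpha>) \<longrightarrow> f \<gamma> = 0) \<longrightarrow>
            cubical_diff f (\<mu> \<alpha>) = (- cube_sign j (snd (\<mu> \<alpha>))) * (f \<alpha> - f (opp \<alpha>)))" if "\<alpha> \<in> A" for \<alpha>
  proof -
    obtain x I where \<alpha>: "\<alpha> = (x, I)" by force
    have x: "x \<in> Lat" "\<And>i. a i \<le> x i + basis j i" "\<And>i. x i + ind I i \<le> b i" "j \<notin> I" "x j = a j - 1"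
      using that unfolding \<alpha> A_def Tmem by auto
    have yI: "x i + basis j i + ind I i \<le> b i" for i
      using x(3)[of i] x(4,5) ab by (cases "i = j") (auto simp: ind_apply)
    have le: "cube_weight w (x + basis j, I) \<le> cube_weight w (x, I)"
    proof (rule cube_weight_mono)
      fix J assume J: "J \<subseteq> I"
      have "w (x + basis j + ind J) \<le> w (x + basis j + ind J - basis j)"
      proof (rule mono)
        show "a \<le> x + basis j + ind J" using x(2) ind_nonneg[of J]
          by (auto simp: le_fun_def add_increasing2)
        have "x i + basis j i + ind J i \<le> b i" for i
          using yI[of i] J by (auto simp: ind_apply split: if_splits)
        thus "x + basis j + ind J \<le> b" by (auto simp: le_fun_def)
        show "(x + basis j + ind J) j = a j" using J x by (auto simp: ind_apply)
      qed (use x in auto)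
      thus "w (x + basis j + ind J) \<le> w (x + ind J)" by (simp add: algebra_simps)
    qed
    have w: "cube_weight w (x, insert j I) = cube_weight w (x, I)"
      using cube_weight_insert[OF x(4), of w "x"] le by simp
    have D: "cubical_diff f (x, insert j I) = - cube_sign j (insert j I) * (f (x, I) - f (x + basis j, I))"
      if f: "\<forall>\<gamma>\<in>\<mu> ` A. cube_weight w \<gamma> \<le> cube_weight w (x, insert j I) \<longrightarrow> f \<gamma> = 0"
      for f :: "'v cube \<Rightarrow> int"
    proof -
      have z: "f (x + basis l, insert j I - {l}) = 0 \<and> f (x, insert j I - {l}) = 0"
        if l: "l \<in> I" for l
      proof -
        have ne: "l \<noteq> j" using l x by auto
        have fT: "(x, insert j I) \<in> T"
          using \<open>\<alpha> \<in> A\<close> T unfolding \<alpha> \<mu>_def by force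
        have cl: "face_closed T" unfolding T_def by (rule face_closed_box)
        have "(x, insert j I - {l}) \<in> T" "(x + basis l, insert j I - {l}) \<in> T"
          using cl fT l unfolding face_closed_def by blast+
        hence "(x, insert j I - {l}) \<in> \<mu> ` A" "(x + basis l, insert j I - {l}) \<in> \<mu> ` A"
          unfolding Bmem using ne x(5) by (auto simp: ind_apply)
        thus ?thesis using f cube_weight_facet_le[of l "insert j I" w "x"] l by blast
      qed
      have "insert j I - {j} = I" using x(4) by auto
      thus ?thesis using x(4) z unfolding cubical_diff_def by (simp add: algebra_simps)
    qed
    have ax: "a i \<le> x i + basis j i" for i by (rule x(2))
    have "x + basis j \<in> Lat" using x(1) by simp
    hence "(x + basis j, I) \<in> T0" unfolding T0mem using ax yI by auto
    hence "opp \<alpha> \<in> T0" unfolding \<alpha> opp_def by simp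
    moreover have "card (insert j I) = card I + 1" using x(4) by simp
    ultimately show ?thesis using w le D unfolding \<alpha> opp_def \<mu>_def by simp
  qed
  show ?thesis unfolding collapse_step_def T_def[symmetric] T0_def[symmetric]
    apply (rule conjI)
     apply (simp add: T0_def face_closed_box)
    apply (rule exI[of _ A], rule exI[of _ \<mu>], rule exI[of _ opp], rule exI[of _ "\<lambda>\<alpha>. - cube_sign j (snd (\<mu> \<alpha>))"])
    apply (intro conjI)
         apply (rule T, rule d1, rule d2, rule d3, rule inj)
    apply (rule ballI, rule point, assumption)
    done
qed

section \<open>Extending primitives of cochains\<close>

lemma collapse_step_subset: "collapse_step w T0 T \<Longrightarrow> T0 \<subseteq> T"
  unfolding collapse_step_def by blast

lemma collapse_step_vertex:
  assumes "collapse_step w T0 T" "(x, {}) \<in> T"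
  obtains y where "(y, {}) \<in> T0" "w y \<le> w x"
proof -
  from assms(1) obtain A \<mu> opp where *:
     "T = T0 \<union> A \<union> \<mu> ` A"
     "\<And>\<alpha>. \<alpha> \<in> A \<Longrightarrow> opp \<alpha> \<in> T0 \<and> card (snd (\<mu> \<alpha>)) = card (snd \<alpha>) + 1 \<and> card (snd (opp \<alpha>)) = card (snd \<alpha>)
        \<and> cube_weight w (opp \<alpha>) \<le> cube_weight w \<alpha>"
    unfolding collapse_step_def by blast
  from assms(2) consider "(x, {}) \<in> T0" | "(x, {}) \<in> A" | "(x, {}) \<in> \<mu> ` A" using *(1) by blast
  thus ?thesis
  proof cases
    case 1 thus ?thesis using that by blast
  next
    case 2
    obtain y I where y: "opp (x, {}) = (y, I)" by force
    from *(2)[OF 2] have "(y, I) \<in> T0" "I = {}" "cube_weight w (y, I) \<le> w x" by (auto simp: y)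
    thus ?thesis using that[of y] by simp
  next
    case 3
    then obtain \<alpha> where "\<alpha> \<in> A" "(x, {}) = \<mu> \<alpha>" by auto
    thus ?thesis using *(2)[of \<alpha>] by (metis add_is_0 card.empty one_neq_zero snd_conv)
  qed
qed

definition locally_finite :: "('v cube \<Rightarrow> int \<Rightarrow> int) \<Rightarrow> bool" where
  "locally_finite f \<longleftrightarrow> (\<forall>\<sigma>. finite {n. f \<sigma> n \<noteq> 0})"

definition extends_primitives ::
    "('v::finite qvec \<Rightarrow> int) \<Rightarrow> 'v cube set \<Rightarrow> 'v cube set \<Rightarrow> bool" where
  "extends_primitives w T0 T \<longleftrightarrow> T0 \<subseteq> T \<and> (\<forall>\<phi> \<psi>0. locally_finite \<phi> \<longrightarrow> locally_finite \<psi>0 \<longrightarrow>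
     (\<forall>\<sigma>\<in>T. \<forall>n\<ge>cube_weight w \<sigma>. cubical_diff (\<lambda>\<tau>. \<phi> \<tau> n) \<sigma> = 0) \<longrightarrow>
     (\<forall>\<sigma>\<in>T0. \<forall>n\<ge>cube_weight w \<sigma>. cubical_diff (\<lambda>\<tau>. \<psi>0 \<tau> n) \<sigma> = \<phi> \<sigma> n) \<longrightarrow>
     (\<exists>\<psi>. locally_finite \<psi> \<and> (\<forall>\<sigma>\<in>T0. \<psi> \<sigma> = \<psi>0 \<sigma>) \<and>
        (\<forall>\<sigma>\<in>T. \<forall>n\<ge>cube_weight w \<sigma>. cubical_diff (\<lambda>\<tau>. \<psi> \<tau> n) \<sigma> = \<phi> \<sigma> n)))"

lemma cubical_diff_cong_on:
  assumes "face_closed T" "\<sigma> \<in> T" "\<And>\<tau>. \<tau> \<in> T \<Longrightarrow> f \<tau> = g \<tau>"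
  shows "cubical_diff f \<sigma> = cubical_diff g \<sigma>"
proof (rule cubical_diff_cong)
  obtain x I where \<sigma>: "\<sigma> = (x, I)" by force
  fix j assume "j \<in> snd \<sigma>"
  hence "(x, I - {j}) \<in> T \<and> (x + basis j, I - {j}) \<in> T"
    using assms(1,2) unfolding face_closed_def \<sigma> by auto
  thus "f (fst \<sigma> + basis j, snd \<sigma> - {j}) = g (fst \<sigma> + basis j, snd \<sigma> - {j})"
    "f (fst \<sigma>, snd \<sigma> - {j}) = g (fst \<sigma>, snd \<sigma> - {j})" using assms(3) by (auto simp: \<sigma>)
qed

lemma collapse_step_extends_primitives:
  assumes "collapse_step w T0 T"
  shows "extends_primitives w T0 T"
proof -
  from assms obtain A \<mu> opp and c :: "'a cube \<Rightarrow> int" where *: "face_closed T0"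
     "T = T0 \<union> A \<union> \<mu> ` A" "T0 \<inter> A = {}" "T0 \<inter> \<mu> ` A = {}" "A \<inter> \<mu> ` A = {}" "inj_on \<mu> A"
     "\<forall>\<alpha>\<in>A. opp \<alpha> \<in> T0 \<and> card (snd (\<mu> \<alpha>)) = card (snd \<alpha>) + 1 \<and> card (snd (opp \<alpha>)) = card (snd \<alpha>) \<and>
        cube_weight w (\<mu> \<alpha>) = cube_weight w \<alpha> \<and> cube_weight w (opp \<alpha>) \<le> cube_weight w \<alpha> \<and> 
        c \<alpha> * c \<alpha> = 1 \<and>
        (\<forall>f :: 'a cube \<Rightarrow> int. (\<forall>\<gamma>\<in>\<mu> ` A. cube_weight w \<gamma> \<le> cube_weight w (\<mu> \<alpha>) \<longrightarrow> f \<gamma> = 0) \<longrightarrow>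
            cubical_diff f (\<mu> \<alpha>) = c \<alpha> * (f \<alpha> - f (opp \<alpha>)))"
    unfolding collapse_step_def by blast
  have A: "opp \<alpha> \<in> T0" "cube_weight w (\<mu> \<alpha>) = cube_weight w \<alpha>" "cube_weight w (opp \<alpha>) \<le> cube_weight w \<alpha>"
      "c \<alpha> * c \<alpha> = 1" if "\<alpha> \<in> A" for \<alpha> using *(7) that by blast+
  have D: "cubical_diff f (\<mu> \<alpha>) = c \<alpha> * (f \<alpha> - f (opp \<alpha>))"
    if "\<alpha> \<in> A" "\<forall>\<gamma>\<in>\<mu> ` A. cube_weight w \<gamma> \<le> cube_weight w (\<mu> \<alpha>) \<longrightarrow> f \<gamma> = 0" for \<alpha> and f :: "'a cube \<Rightarrow> int"
    using *(7) that by blast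
  show ?thesis unfolding extends_primitives_def
  proof (intro conjI allI impI)
    show "T0 \<subseteq> T" using * by auto
    fix \<phi> \<psi>0 :: "'a cube \<Rightarrow> int \<Rightarrow> int"
    assume lf: "locally_finite \<phi>" "locally_finite \<psi>0"
      and \<phi>: "\<forall>\<sigma>\<in>T. \<forall>n\<ge>cube_weight w \<sigma>. cubical_diff (\<lambda>\<tau>. \<phi> \<tau> n) \<sigma> = 0"
      and \<psi>0: "\<forall>\<sigma>\<in>T0. \<forall>n\<ge>cube_weight w \<sigma>. cubical_diff (\<lambda>\<tau>. \<psi>0 \<tau> n) \<sigma> = \<phi> \<sigma> n"
    define \<psi> where "\<psi> \<sigma> = (if \<sigma> \<in> A then (\<lambda>n. \<psi>0 (opp \<sigma>) n + c \<sigma> * \<phi> (\<mu> \<sigma>) n)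
        else if \<sigma> \<in> \<mu> ` A then (\<lambda>n. 0) else \<psi>0 \<sigma>)" for \<sigma>
    have \<psi>T0: "\<psi> \<sigma> = \<psi>0 \<sigma>" if "\<sigma> \<in> T0" for \<sigma> using that * unfolding \<psi>_def by auto
    have \<psi>B: "\<psi> \<sigma> n = 0" if "\<sigma> \<in> \<mu> ` A" for \<sigma> n using that *(5) unfolding \<psi>_def by auto
    have 1: "locally_finite \<psi>" unfolding locally_finite_def
    proof
      fix \<sigma>
      have "{n. \<psi> \<sigma> n \<noteq> 0} \<subseteq> {n. \<psi>0 (opp \<sigma>) n \<noteq> 0} \<union> {n. \<phi> (\<mu> \<sigma>) n \<noteq> 0} \<union> {n. \<psi>0 \<sigma> n \<noteq> 0}"
        by (auto simp: \<psi>_def split: if_splits)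
      thus "finite {n. \<psi> \<sigma> n \<noteq> 0}" using lf unfolding locally_finite_def
        by (meson finite_Un finite_subset)
    qed
    have 2: "cubical_diff (\<lambda>\<tau>. \<psi> \<tau> n) \<sigma> = \<phi> \<sigma> n" if "\<sigma> \<in> T0" "n \<ge> cube_weight w \<sigma>" for \<sigma> n
    proof -
      have "cubical_diff (\<lambda>\<tau>. \<psi> \<tau> n) \<sigma> = cubical_diff (\<lambda>\<tau>. \<psi>0 \<tau> n) \<sigma>"
        by (rule cubical_diff_cong_on[OF *(1) that(1)]) (simp add: \<psi>T0)
      thus ?thesis using \<psi>0 that by simp
    qed
    have 3: "cubical_diff (\<lambda>\<tau>. \<psi> \<tau> n) (\<mu> \<alpha>) = \<phi> (\<mu> \<alpha>) n" if "\<alpha> \<in> A" for \<alpha> n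
    proof -
      have "cubical_diff (\<lambda>\<tau>. \<psi> \<tau> n) (\<mu> \<alpha>) = c \<alpha> * (\<psi> \<alpha> n - \<psi> (opp \<alpha>) n)"
        by (rule D[OF that]) (simp add: \<psi>B)
      also have "\<psi> (opp \<alpha>) n = \<psi>0 (opp \<alpha>) n" using A(1)[OF that] \<psi>T0 by simp
      also have "\<psi> \<alpha> n = \<psi>0 (opp \<alpha>) n + c \<alpha> * \<phi> (\<mu> \<alpha>) n" using that by (simp add: \<psi>_def)
      finally show ?thesis using A(4)[OF that] by (simp add: mult.assoc[symmetric])
    qed
    have 4: "cubical_diff (\<lambda>\<tau>. \<psi> \<tau> n) \<alpha> = \<phi> \<alpha> n" if \<alpha>: "\<alpha> \<in> A" and n: "n \<ge> cube_weight w \<alpha>" for \<alpha> n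
    proof -
      define g where "g \<tau> = cubical_diff (\<lambda>\<tau>. \<psi> \<tau> n) \<tau> - \<phi> \<tau> n" for \<tau>
      have "cubical_diff g (\<mu> \<alpha>) = 0 - cubical_diff (\<lambda>\<tau>. \<phi> \<tau> n) (\<mu> \<alpha>)"
        unfolding g_def cubical_diff_minus by (simp add: cubical_diff_cubical_diff)
      also have "cubical_diff (\<lambda>\<tau>. \<phi> \<tau> n) (\<mu> \<alpha>) = 0" using \<phi> *(2) \<alpha> n A(2) by auto
      finally have "cubical_diff g (\<mu> \<alpha>) = 0" by simp
      moreover have "cubical_diff g (\<mu> \<alpha>) = c \<alpha> * (g \<alpha> - g (opp \<alpha>))"
        by (rule D[OF \<alpha>]) (auto simp: g_def 3)
      moreover have "g (opp \<alpha>) = 0" using 2[of "opp \<alpha>" n] A[OF \<alpha>] n by (simp add: g_def)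
      moreover have "c \<alpha> \<noteq> 0" using A(4)[OF \<alpha>] by auto
      ultimately have "g \<alpha> = 0" by simp
      thus ?thesis by (simp add: g_def)
    qed
    show "\<exists>\<psi>. locally_finite \<psi> \<and> (\<forall>\<sigma>\<in>T0. \<psi> \<sigma> = \<psi>0 \<sigma>) \<and>
        (\<forall>\<sigma>\<in>T. \<forall>n\<ge>cube_weight w \<sigma>. cubical_diff (\<lambda>\<tau>. \<psi> \<tau> n) \<sigma> = \<phi> \<sigma> n)"
    proof (intro exI[of _ \<psi>] conjI ballI allI impI)
      fix \<sigma> n assume \<sigma>: "\<sigma> \<in> T" "cube_weight w \<sigma> \<le> n"
      from \<sigma>(1) *(2) consider "\<sigma> \<in> T0" | "\<sigma> \<in> A" | \<alpha> where "\<alpha> \<in> A" "\<sigma> = \<mu> \<alpha>" by auto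
      thus "cubical_diff (\<lambda>\<tau>. \<psi> \<tau> n) \<sigma> = \<phi> \<sigma> n" using \<sigma>(2) 2 3 4 by cases auto
    qed (use 1 \<psi>T0 in auto)
  qed
qed

lemma extends_primitives_refl: "extends_primitives w T T"
  unfolding extends_primitives_def by auto

lemma extends_primitives_trans:
  assumes "extends_primitives w T0 T1" "extends_primitives w T1 T2"
  shows "extends_primitives w T0 T2"
  unfolding extends_primitives_def
proof (intro conjI allI impI)
  show "T0 \<subseteq> T2" using assms unfolding extends_primitives_def by blast
  fix \<phi> \<psi>0 :: "'a cube \<Rightarrow> int \<Rightarrow> int"
  assume lf: "locally_finite \<phi>" "locally_finite \<psi>0"
    and \<phi>: "\<forall>\<sigma>\<in>T2. \<forall>n\<ge>cube_weight w \<sigma>. cubical_diff (\<lambda>\<tau>. \<phi> \<tau> n) \<sigma> = 0"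
    and \<psi>0: "\<forall>\<sigma>\<in>T0. \<forall>n\<ge>cube_weight w \<sigma>. cubical_diff (\<lambda>\<tau>. \<psi>0 \<tau> n) \<sigma> = \<phi> \<sigma> n"
  have "\<forall>\<sigma>\<in>T1. \<forall>n\<ge>cube_weight w \<sigma>. cubical_diff (\<lambda>\<tau>. \<phi> \<tau> n) \<sigma> = 0"
    using \<phi> assms(2) unfolding extends_primitives_def by blast
  then obtain \<psi>1 where \<psi>1: "locally_finite \<psi>1" "\<forall>\<sigma>\<in>T0. \<psi>1 \<sigma> = \<psi>0 \<sigma>"
      "\<forall>\<sigma>\<in>T1. \<forall>n\<ge>cube_weight w \<sigma>. cubical_diff (\<lambda>\<tau>. \<psi>1 \<tau> n) \<sigma> = \<phi> \<sigma> n"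
    using assms(1) lf \<psi>0 unfolding extends_primitives_def by blast
  then obtain \<psi>2 where "locally_finite \<psi>2" "\<forall>\<sigma>\<in>T1. \<psi>2 \<sigma> = \<psi>1 \<sigma>"
      "\<forall>\<sigma>\<in>T2. \<forall>n\<ge>cube_weight w \<sigma>. cubical_diff (\<lambda>\<tau>. \<psi>2 \<tau> n) \<sigma> = \<phi> \<sigma> n"
    using assms(2) lf \<phi> unfolding extends_primitives_def by blast
  thus "\<exists>\<psi>. locally_finite \<psi> \<and> (\<forall>\<sigma>\<in>T0. \<psi> \<sigma> = \<psi>0 \<sigma>) \<and>
        (\<forall>\<sigma>\<in>T2. \<forall>n\<ge>cube_weight w \<sigma>. cubical_diff (\<lambda>\<tau>. \<psi> \<tau> n) \<sigma> = \<phi> \<sigma> n)"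
    using \<psi>1(2) assms(1) unfolding extends_primitives_def by (intro exI[of _ \<psi>2]) (metis subsetD)
qed

lemma extends_primitives_union:
  fixes T :: "nat \<Rightarrow> 'v::finite cube set"
  assumes step: "\<And>t. extends_primitives w (T t) (T (Suc t))" and closed: "\<And>t. face_closed (T t)"
  shows "extends_primitives w (T 0) (\<Union>t. T t)"
  unfolding extends_primitives_def
proof (intro conjI allI impI)
  show "T 0 \<subseteq> (\<Union>t. T t)" by auto
  fix \<phi> \<psi>0 :: "'v cube \<Rightarrow> int \<Rightarrow> int"
  assume lf: "locally_finite \<phi>" "locally_finite \<psi>0"
    and \<phi>: "\<forall>\<sigma>\<in>(\<Union>t. T t). \<forall>n\<ge>cube_weight w \<sigma>. cubical_diff (\<lambda>\<tau>. \<phi> \<tau> n) \<sigma> = 0"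
    and \<psi>0: "\<forall>\<sigma>\<in>T 0. \<forall>n\<ge>cube_weight w \<sigma>. cubical_diff (\<lambda>\<tau>. \<psi>0 \<tau> n) \<sigma> = \<phi> \<sigma> n"
  define good where "good t \<psi> \<longleftrightarrow> locally_finite \<psi> \<and> (t = 0 \<longrightarrow> \<psi> = \<psi>0) \<and>
      (\<forall>\<sigma>\<in>T t. \<forall>n\<ge>cube_weight w \<sigma>. cubical_diff (\<lambda>\<tau>. \<psi> \<tau> n) \<sigma> = \<phi> \<sigma> n)" for t \<psi>
  have "\<exists>\<psi>. \<forall>t. good t (\<psi> t) \<and> (\<forall>\<sigma>\<in>T t. \<psi> (Suc t) \<sigma> = \<psi> t \<sigma>)"
  proof (rule dependent_nat_choice)
    show "\<exists>x. good 0 x" using lf \<psi>0 by (auto simp: good_def)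
    fix x t assume "good t x"
    moreover have "\<forall>\<sigma>\<in>T (Suc t). \<forall>n\<ge>cube_weight w \<sigma>. cubical_diff (\<lambda>\<tau>. \<phi> \<tau> n) \<sigma> = 0"
      using \<phi> by blast
    ultimately show "\<exists>y. good (Suc t) y \<and> (\<forall>\<sigma>\<in>T t. y \<sigma> = x \<sigma>)"
      using step[of t] lf unfolding good_def extends_primitives_def by blast
  qed
  then obtain \<psi>s where \<psi>s: "\<And>t. good t (\<psi>s t)" "\<And>t \<sigma>. \<sigma> \<in> T t \<Longrightarrow> \<psi>s (Suc t) \<sigma> = \<psi>s t \<sigma>" by blast
  have mono: "T t \<subseteq> T u" if "t \<le> u" for t u
    using lift_Suc_mono_le[of T t u] step that unfolding extends_primitives_def by blast
  have agree: "\<psi>s u \<sigma> = \<psi>s t \<sigma>" if "t \<le> u" "\<sigma> \<in> T t" for t u \<sigma>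
    using that
  proof (induction u rule: dec_induct)
    case (step u)
    thus ?case using \<psi>s(2)[of \<sigma> u] mono[of t u] by auto
  qed simp
  define \<psi> where "\<psi> \<sigma> = \<psi>s (LEAST t. \<sigma> \<in> T t) \<sigma>" for \<sigma>
  have \<psi>: "\<psi> \<sigma> = \<psi>s t \<sigma>" if "\<sigma> \<in> T t" for \<sigma> t
    unfolding \<psi>_def by (rule agree[symmetric]) (use that in \<open>auto intro: Least_le LeastI\<close>)
  show "\<exists>\<psi>. locally_finite \<psi> \<and> (\<forall>\<sigma>\<in>T 0. \<psi> \<sigma> = \<psi>0 \<sigma>) \<and>
        (\<forall>\<sigma>\<in>\<Union>t. T t. \<forall>n\<ge>cube_weight w \<sigma>. cubical_diff (\<lambda>\<tau>. \<psi> \<tau> n) \<sigma> = \<phi> \<sigma> n)"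
  proof (intro exI[of _ \<psi>] conjI ballI allI impI)
    show "locally_finite \<psi>" using \<psi>s(1) unfolding locally_finite_def good_def \<psi>_def by blast
    show "\<psi> \<sigma> = \<psi>0 \<sigma>" if "\<sigma> \<in> T 0" for \<sigma> using \<psi>[OF that] \<psi>s(1)[of 0] by (simp add: good_def)
    fix \<sigma> n assume \<sigma>: "\<sigma> \<in> (\<Union>t. T t)" "cube_weight w \<sigma> \<le> n"
    then obtain t where t: "\<sigma> \<in> T t" by auto
    have "cubical_diff (\<lambda>\<tau>. \<psi> \<tau> n) \<sigma> = cubical_diff (\<lambda>\<tau>. \<psi>s t \<tau> n) \<sigma>"
      by (rule cubical_diff_cong_on[OF closed t]) (simp add: \<psi>)
    thus "cubical_diff (\<lambda>\<tau>. \<psi> \<tau> n) \<sigma> = \<phi> \<sigma> n" using \<psi>s(1)[of t] t \<sigma>(2) by (simp add: good_def)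
  qed
qed

section \<open>Ranks of quotients of integral cochain groups\<close>

interpretation fv: vector_space "\<lambda>(c::rat) (f :: 'x \<Rightarrow> rat). (\<lambda>x. c * f x)"
  by unfold_locales (auto simp: fun_eq_iff algebra_simps)

interpretation fvp: vector_space_pair "\<lambda>(c::rat) (f :: 'x \<Rightarrow> rat). (\<lambda>x. c * f x)"
    "\<lambda>(c::rat) (f :: 'y \<Rightarrow> rat). (\<lambda>x. c * f x)"
  by unfold_locales

definition supported :: "'x set \<Rightarrow> ('x \<Rightarrow> rat) set" where
  "supported X = {f. \<forall>x. x \<notin> X \<longrightarrow> f x = 0}"

definition delta :: "'x \<Rightarrow> 'x \<Rightarrow> rat" where
  "delta x = (\<lambda>y. if y = x then 1 else 0)"

lemma subspace_supported: "fv.subspace (supported X)"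
  by (auto simp: fv.subspace_def supported_def)

lemma sum_fun_apply: "(\<Sum>i\<in>A. f i) x = (\<Sum>i\<in>A. f i x :: rat)"
  by (induction A rule: infinite_finite_induct) auto

lemma supported_span:
  assumes "finite X"
  shows "supported X = fv.span (delta ` X)"
proof
  show "fv.span (delta ` X) \<subseteq> supported X"
    by (rule fv.span_minimal[OF _ subspace_supported]) (auto simp: supported_def delta_def)
  show "supported X \<subseteq> fv.span (delta ` X)"
  proof
    fix f :: "'a \<Rightarrow> rat" assume f: "f \<in> supported X"
    have "f = (\<Sum>x\<in>X. (\<lambda>y. f x * delta x y))"
    proof
      fix y
      have "(\<Sum>x\<in>X. (\<lambda>y. f x * delta x y)) y = (\<Sum>x\<in>X. if x = y then f y else 0)"
        unfolding sum_fun_apply by (intro sum.cong) (auto simp: delta_def)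
      thus "f y = (\<Sum>x\<in>X. (\<lambda>y. f x * delta x y)) y"
        using f assms by (auto simp: supported_def)
    qed
    also have "\<dots> \<in> fv.span (delta ` X)"
      by (intro fv.span_sum fv.span_scale fv.span_base) auto
    finally show "f \<in> fv.span (delta ` X)" .
  qed
qed

lemma finite_independent_supported:
  assumes "finite X" "S \<subseteq> supported X" "fv.independent B" "B \<subseteq> S"
  shows "finite B"
  using fv.independent_span_bound[of "delta ` X" B] assms supported_span[OF assms(1)] by auto

lemma dim_supported:
  assumes "finite X"
  shows "fv.dim (supported X) = card X"
proof (rule fv.dim_unique[of "delta ` X"])
  have inj: "inj_on delta X"
  proof (rule inj_onI)
    fix x y :: 'a assume "delta x = delta y"
    hence "delta x x = delta y x" by simp
    thus "x = y" by (simp add: delta_def split: if_splits)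
  qed
  show "card (delta ` X) = card X" using card_image[OF inj] .
  show "fv.independent (delta ` X)"
    unfolding fv.dependent_def
  proof
    assume "\<exists>a\<in>delta ` X. a \<in> fv.span (delta ` X - {a})"
    then obtain x where x: "x \<in> X" "delta x \<in> fv.span (delta ` X - {delta x})" by auto
    have "delta ` X - {delta x} \<subseteq> delta ` (X - {x})" by auto
    hence "delta x \<in> fv.span (delta ` (X - {x}))" using x(2) fv.span_mono by blast
    also have "\<dots> = supported (X - {x})" using supported_span[of "X - {x}"] assms by simp
    finally show False by (auto simp: supported_def delta_def)
  qed
qed (auto simp: supported_span[OF assms] intro: fv.span_base)

text \<open>Rank and nullity, for linear maps on function spaces that need not be finite-dimensional.\<close>
lemma rank_nullity:
  fixes f :: "('x \<Rightarrow> rat) \<Rightarrow> ('y \<Rightarrow> rat)"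
  assumes X: "finite X" and S: "fv.subspace S" "S \<subseteq> supported X"
    and lin: "Vector_Spaces.linear (\<lambda>c f x. c * f x) (\<lambda>c f x. c * f x) f"
  shows "fv.dim S = fv.dim {x \<in> S. f x = 0} + fv.dim (f ` S)"
proof -
  define N where "N = {x \<in> S. f x = 0}"
  obtain K where K: "K \<subseteq> N" "fv.independent K" "N \<subseteq> fv.span K" "card K = fv.dim N"
    by (rule fv.basis_exists)
  have KS: "K \<subseteq> S" using K(1) by (auto simp: N_def)
  obtain B where B: "K \<subseteq> B" "B \<subseteq> S" "fv.independent B" "S \<subseteq> fv.span B"
    using fv.maximal_independent_subset_extend[OF KS K(2)] .
  have finB: "finite B" by (rule finite_independent_supported[OF X S(2) B(3,2)])
  have dimS: "fv.dim S = card B" by (rule fv.dim_unique[OF B(2,4,3) refl])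
  have spanK: "fv.span K \<subseteq> N"
  proof (rule fv.span_minimal[OF K(1)])
    show "fv.subspace N" unfolding N_def using S(1)
      using fvp.linear_add[OF lin] fvp.linear_scale[OF lin] fvp.linear_0[OF lin]
      by (auto simp: fv.subspace_def)
  qed
  have ker: "x \<in> fv.span K" if "x \<in> fv.span (B - K)" "f x = 0" for x
  proof -
    have "x \<in> S" using that(1) fv.span_minimal[OF _ S(1), of "B - K"] B(2) by auto
    thus ?thesis using that K(3) by (auto simp: N_def)
  qed
  have zero: "x = 0" if "x \<in> fv.span (B - K)" "f x = 0" for x
  proof -
    note zx = that
    have fin: "finite K" "finite (B - K)" using finB B(1) finite_subset by auto
    obtain u where u: "x = (\<Sum>b\<in>K. (\<lambda>y. u b * b y))"
      using ker[OF zx] fv.span_finite[OF fin(1)] by auto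
    obtain v where v: "x = (\<Sum>b\<in>B - K. (\<lambda>y. v b * b y))"
      using zx(1) fv.span_finite[OF fin(2)] by auto
    define t where "t b = (if b \<in> K then - u b else v b)" for b
    have "(\<Sum>b\<in>B. (\<lambda>y. t b * b y)) = (\<Sum>b\<in>K. (\<lambda>y. t b * b y)) + (\<Sum>b\<in>B - K. (\<lambda>y. t b * b y))"
      using sum.subset_diff[OF B(1) finB, of "\<lambda>b y. t b * b y"] by (simp add: add.commute)
    also have "(\<Sum>b\<in>K. (\<lambda>y. t b * b y)) = - x"
      unfolding u sum_negf[symmetric] by (intro sum.cong) (auto simp: t_def)
    also have "(\<Sum>b\<in>B - K. (\<lambda>y. t b * b y)) = x"
      unfolding v by (intro sum.cong) (auto simp: t_def)
    finally have sum0: "(\<Sum>b\<in>B. (\<lambda>y. t b * b y)) = 0"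
      by (simp add: zero_fun_def)
    have t0: "t b = 0" if "b \<in> B" for b using fv.independentD[OF B(3) finB order_refl sum0 that] .
    have "v b = 0" if "b \<in> B - K" for b using that t0[of b] by (simp add: t_def)
    thus ?thesis unfolding v by (intro sum.neutral) (auto simp: fun_eq_iff)
  qed
  have inj: "inj_on f (fv.span (B - K))"
  proof (rule inj_onI)
    fix x y assume xy: "x \<in> fv.span (B - K)" "y \<in> fv.span (B - K)" "f x = f y"
    have "f (x - y) = 0" using xy(3) fvp.linear_diff[OF lin] by simp
    moreover have "x - y \<in> fv.span (B - K)" using xy fv.span_diff by blast
    ultimately have "x - y = 0" using zero by blast
    thus "x = y" by simp
  qed
  have ind: "fv.independent (f ` (B - K))"
    using fvp.linear_independent_injective_image[OF lin] fv.independent_mono[OF B(3)] inj by blast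
  have "fv.dim (f ` S) = card (f ` (B - K))"
  proof (rule fv.dim_unique[OF _ _ ind refl])
    show "f ` (B - K) \<subseteq> f ` S" using B(2) by auto
    show "f ` S \<subseteq> fv.span (f ` (B - K))"
    proof
      fix y assume "y \<in> f ` S"
      then obtain x where x: "x \<in> S" "y = f x" by auto
      have "x \<in> fv.span (K \<union> (B - K))" using x(1) B by (auto simp: Un_absorb1)
      then obtain u v where uv: "x = u + v" "u \<in> fv.span K" "v \<in> fv.span (B - K)"
        unfolding fv.span_Un by auto
      have "f u = 0" using uv(2) spanK by (auto simp: N_def)
      hence "y = f v" using x(2) uv(1) fvp.linear_add[OF lin] by simp
      thus "y \<in> fv.span (f ` (B - K))"
        using uv(3) fvp.linear_span_image[OF lin, of "B - K"] by auto
    qed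
  qed
  also have "\<dots> = card (B - K)"
    by (rule card_image, rule inj_on_subset[OF inj]) (auto intro: fv.span_base)
  also have "\<dots> = card B - card K" using finB B(1) by (simp add: card_Diff_subset finite_subset)
  finally show ?thesis using dimS K(4) card_mono[OF finB B(1)] unfolding N_def by simp
qed

lemma in_span_insert_family:
  fixes g :: "nat \<Rightarrow> 'x \<Rightarrow> rat"
  assumes "x \<in> fv.span (K \<union> g ` {..<m})"
  shows "\<exists>q. x - (\<Sum>i<m. (\<lambda>y. q i * g i y)) \<in> fv.span K"
  using assms
proof (induction m arbitrary: x)
  case (Suc m)
  have "K \<union> g ` {..<Suc m} = insert (g m) (K \<union> g ` {..<m})" by (auto simp: lessThan_Suc)
  with Suc.prems obtain k where "x - (\<lambda>y. k * g m y) \<in> fv.span (K \<union> g ` {..<m})"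
    by (auto simp: fv.span_insert)
  from Suc.IH[OF this] obtain q where q: "x - (\<lambda>y. k * g m y) - (\<Sum>i<m. (\<lambda>y. q i * g i y)) \<in> fv.span K"
    by blast
  have "(\<Sum>i<m. (\<lambda>y. (q(m := k)) i * g i y)) = (\<Sum>i<m. (\<lambda>y. q i * g i y))"
    by (intro sum.cong) auto
  hence "x - (\<Sum>i<Suc m. (\<lambda>y. (q(m := k)) i * g i y)) = x - (\<lambda>y. k * g m y) - (\<Sum>i<m. (\<lambda>y. q i * g i y))"
    by (simp add: algebra_simps)
  thus ?case using q by metis
qed simp

lemma common_denominator:
  assumes "finite A"
  shows "\<exists>M::int. M > 0 \<and> (\<forall>i\<in>A. \<exists>c::int. of_int M * (q i :: rat) = of_int c)"
  using assms
proof (induction rule: finite_induct)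
  case (insert i A)
  then obtain M where M: "M > 0" "\<And>i. i \<in> A \<Longrightarrow> \<exists>c::int. of_int M * q i = of_int c" by blast
  obtain a b where ab: "quotient_of (q i) = (a, b)" by force
  have b: "b > 0" using quotient_of_denom_pos[OF ab] .
  have q: "q i = of_int a / of_int b" using quotient_of_div[OF ab] .
  show ?case
  proof (rule exI[of _ "M * b"], rule conjI, use M b in simp, rule ballI)
    fix k assume k: "k \<in> insert i A"
    show "\<exists>c::int. of_int (M * b) * q k = of_int c"
    proof (cases "k = i")
      case True
      thus ?thesis using b q by (intro exI[of _ "M * a"]) auto
    next
      case False
      then obtain c where "of_int M * q k = of_int c" using M k by blast
      thus ?thesis by (intro exI[of _ "c * b"]) (simp add: mult.commute mult.left_commute)
    qed
  qed
qed (auto intro: exI[of _ 1])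

lemma quot_rank_eq_dim:
  fixes r :: "'v cochain \<Rightarrow> 'x \<Rightarrow> rat"
  assumes X: "finite X" and S: "fv.subspace S" "S \<subseteq> supported X" and B: "fv.subspace B" "B \<subseteq> S"
    and comb: "\<And>(n::nat) c z. (\<And>i. i < n \<Longrightarrow> z i \<in> Z) \<Longrightarrow> (\<lambda>\<sigma> d. \<Sum>i<n. c i * z i \<sigma> d) \<in> Z \<and>
        r (\<lambda>\<sigma> d. \<Sum>i<n. c i * z i \<sigma> d) = (\<Sum>i<n. (\<lambda>x. of_int (c i) * r (z i) x))"
    and rS: "\<And>z. z \<in> Z \<Longrightarrow> r z \<in> S"
    and surj: "\<And>f. f \<in> S \<Longrightarrow> \<exists>m::int. m > 0 \<and> (\<exists>z\<in>Z. r z = (\<lambda>x. of_int m * f x))"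
    and N1: "\<And>z. z \<in> N \<Longrightarrow> z \<in> Z \<Longrightarrow> r z \<in> B"
    and N2: "\<And>z. z \<in> Z \<Longrightarrow> r z \<in> B \<Longrightarrow> \<exists>m::int. m > 0 \<and> (\<lambda>\<sigma> d. m * z \<sigma> d) \<in> N"
  shows "quot_rank Z N + fv.dim B = fv.dim S"
proof -
  define P where "P n \<longleftrightarrow> (\<exists>z :: nat \<Rightarrow> 'v cochain. (\<forall>i<n. z i \<in> Z) \<and>
     (\<forall>c :: nat \<Rightarrow> int. (\<lambda>\<sigma> d. \<Sum>i<n. c i * z i \<sigma> d) \<in> N \<longrightarrow> (\<forall>i<n. c i = 0)))" for n
  obtain K where K: "K \<subseteq> B" "fv.independent K" "B \<subseteq> fv.span K" "card K = fv.dim B"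
    by (rule fv.basis_exists)
  have spanK: "fv.span K = B" using K fv.span_minimal[OF K(1) B(1)] by auto
  have KS: "K \<subseteq> S" using K(1) B by auto
  obtain L where L: "K \<subseteq> L" "L \<subseteq> S" "fv.independent L" "S \<subseteq> fv.span L"
    using fv.maximal_independent_subset_extend[OF KS K(2)] .
  have finL: "finite L" by (rule finite_independent_supported[OF X S(2) L(3,2)])
  have finK: "finite K" using finL L(1) finite_subset by auto
  have dimS: "fv.dim S = card L" by (rule fv.dim_unique[OF L(2,4,3) refl])
  have upper: "n + fv.dim B \<le> fv.dim S" if "P n" for n
  proof -
    from that obtain z where z: "\<And>i. i < n \<Longrightarrow> z i \<in> Z"
       "\<And>c. (\<lambda>\<sigma> d. \<Sum>i<n. c i * z i \<sigma> d) \<in> N \<Longrightarrow> (\<forall>i<n. c i = (0::int))" unfolding P_def by blast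
    have "fv.independent (K \<union> (r \<circ> z) ` {..<m}) \<and> card (K \<union> (r \<circ> z) ` {..<m}) = card K + m" if "m \<le> n" for m
      using that
    proof (induction m)
      case 0 thus ?case using K by simp
    next
      case (Suc m)
      hence IH: "fv.independent (K \<union> (r \<circ> z) ` {..<m})" "card (K \<union> (r \<circ> z) ` {..<m}) = card K + m" by auto
      have notin: "r (z m) \<notin> fv.span (K \<union> (r \<circ> z) ` {..<m})"
      proof
        assume "r (z m) \<in> fv.span (K \<union> (r \<circ> z) ` {..<m})"
        from in_span_insert_family[OF this] obtain q where
          q: "r (z m) - (\<Sum>i<m. (\<lambda>y. q i * r (z i) y)) \<in> fv.span K" by auto
        obtain M :: int where M: "M > 0" "\<forall>i\<in>{..<m}. \<exists>c::int. of_int M * q i = of_int c"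
          using common_denominator[of "{..<m}" q] by auto
        then obtain c where c: "\<And>i. i < m \<Longrightarrow> of_int M * q i = of_int (c i)" by (metis lessThan_iff)
        define c' where "c' i = (if i < m then - c i else if i = m then M else 0)" for i
        have "(\<Sum>i<n. (\<lambda>x. of_int (c' i) * r (z i) x)) = (\<Sum>i<Suc m. (\<lambda>x. of_int (c' i) * r (z i) x))"
          by (rule sum.mono_neutral_right) (use Suc.prems in \<open>auto simp: c'_def fun_eq_iff\<close>)
        also have "\<dots> = (\<lambda>y. of_int M * (r (z m) - (\<Sum>i<m. (\<lambda>y. q i * r (z i) y))) y)"
        proof
          fix x
          have "(\<Sum>i<m. of_int (c' i) * r (z i) x) = (\<Sum>i<m. - (of_int M * (q i * r (z i) x)))"
          proof (rule sum.cong[OF refl])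
            fix i assume "i \<in> {..<m}"
            hence "of_int (c' i) = - (of_int M * q i)" using c[of i] by (simp add: c'_def)
            thus "of_int (c' i) * r (z i) x = - (of_int M * (q i * r (z i) x))" by simp
          qed
          hence "(\<Sum>i<m. of_int (c' i) * r (z i) x) = - (of_int M * (\<Sum>i<m. q i * r (z i) x))"
            by (simp add: sum_negf sum_distrib_left)
          thus "(\<Sum>i<Suc m. (\<lambda>x. of_int (c' i) * r (z i) x)) x =
              of_int M * (r (z m) - (\<Sum>i<m. (\<lambda>y. q i * r (z i) y))) x"
            by (simp add: sum_fun_apply c'_def right_diff_distrib)
        qed
        also have "\<dots> \<in> B" by (rule fv.subspace_scale[OF B(1) q[unfolded spanK]])
        finally have "r (\<lambda>\<sigma> d. \<Sum>i<n. c' i * z i \<sigma> d) \<in> B" using comb[of n z c'] z(1) by simp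
        then obtain k :: int where k: "k > 0" "(\<lambda>\<sigma> d. k * (\<Sum>i<n. c' i * z i \<sigma> d)) \<in> N"
          using N2 comb[of n z c'] z(1) by blast
        have "(\<lambda>\<sigma> d. \<Sum>i<n. (k * c' i) * z i \<sigma> d) \<in> N" using k(2) by (simp add: sum_distrib_left mult.assoc)
        hence "k * c' m = 0" using z(2)[of "\<lambda>i. k * c' i"] Suc.prems by auto
        thus False using k(1) M(1) by (simp add: c'_def)
      qed
      have eq: "K \<union> (r \<circ> z) ` {..<Suc m} = insert (r (z m)) (K \<union> (r \<circ> z) ` {..<m})"
        by (auto simp: lessThan_Suc)
      have nm: "r (z m) \<notin> K \<union> (r \<circ> z) ` {..<m}"
        using notin by (rule contrapos_nn) (rule fv.span_base)
      have "finite (K \<union> (r \<circ> z) ` {..<m})" using finK by simp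
      hence "card (insert (r (z m)) (K \<union> (r \<circ> z) ` {..<m})) = card K + Suc m"
        using card_insert_disjoint[OF _ nm] IH(2) by simp
      thus ?case unfolding eq using fv.independent_insertI[OF notin IH(1)] by (rule conjI[rotated])
    qed
    from this[of n] have ind: "fv.independent (K \<union> (r \<circ> z) ` {..<n})" and
      card: "card (K \<union> (r \<circ> z) ` {..<n}) = card K + n" by auto
    have "K \<union> (r \<circ> z) ` {..<n} \<subseteq> fv.span L" using KS rS z(1) L(4) by auto
    hence "card (K \<union> (r \<circ> z) ` {..<n}) \<le> card L"
      using fv.independent_span_bound[OF finL ind] by blast
    thus ?thesis using card K(4) dimS by simp
  qed
  have lower: "P (card L - card K)"
  proof -
    define n where "n = card L - card K"
    have cardLK: "card (L - K) = n" unfolding n_def using finL L(1) finK by (simp add: card_Diff_subset)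
    obtain l where l: "bij_betw l {..<n} (L - K)"
      using ex_bij_betw_nat_finite[of "L - K"] finL cardLK by (auto simp: lessThan_atLeast0)
    have lS: "l i \<in> S" if "i < n" for i using l L(2) that by (auto simp: bij_betw_def)
    have "\<forall>i\<in>{..<n}. \<exists>u. fst u > (0::int) \<and> snd u \<in> Z \<and> r (snd u) = (\<lambda>x. of_int (fst u) * l i x)"
    proof
      fix i assume "i \<in> {..<n}"
      then obtain k y where "k > (0::int)" "y \<in> Z" "r y = (\<lambda>x. of_int k * l i x)" using surj[OF lS[of i]] by auto
      thus "\<exists>u. fst u > (0::int) \<and> snd u \<in> Z \<and> r (snd u) = (\<lambda>x. of_int (fst u) * l i x)"
        by (intro exI[of _ "(k, y)"]) simp
    qed
    from bchoice[OF this] obtain u where u: "\<forall>i\<in>{..<n}. fst (u i) > (0::int) \<and> snd (u i) \<in> Z \<and>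
      r (snd (u i)) = (\<lambda>x. of_int (fst (u i)) * l i x)" ..
    define m z where "m i = fst (u i)" and "z i = snd (u i)" for i
    have mz: "m i > 0" "z i \<in> Z" "r (z i) = (\<lambda>x. of_int (m i) * l i x)" if "i < n" for i
      using u that unfolding m_def z_def by auto
    have "c i = 0" if c: "(\<lambda>\<sigma> d. \<Sum>i<n. c i * z i \<sigma> d) \<in> N" and i: "i < n" for c :: "nat \<Rightarrow> int" and i
    proof (rule ccontr)
      assume ci: "c i \<noteq> 0"
      have cb: "(\<lambda>\<sigma> d. \<Sum>i<n. c i * z i \<sigma> d) \<in> Z"
        "r (\<lambda>\<sigma> d. \<Sum>i<n. c i * z i \<sigma> d) = (\<Sum>k<n. (\<lambda>x. of_int (c k) * r (z k) x))"
        using comb[of n z c, OF mz(2)] by blast+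
      have "(\<Sum>k<n. (\<lambda>x. of_int (c k) * r (z k) x)) = (\<Sum>k<n. (\<lambda>x. of_int (c k * m k) * l k x))"
      proof (rule sum.cong[OF refl])
        fix k assume "k \<in> {..<n}"
        hence k: "k < n" by simp
        show "(\<lambda>x. of_int (c k) * r (z k) x) = (\<lambda>x. of_int (c k * m k) * l k x)"
          unfolding mz(3)[OF k] of_int_mult mult.assoc ..
      qed
      also have "\<dots> = (\<lambda>x. of_int (c i * m i) * l i x) + (\<Sum>k\<in>{..<n} - {i}. (\<lambda>x. of_int (c k * m k) * l k x))"
        by (rule sum.remove) (use i in auto)
      finally have inB: "(\<lambda>x. of_int (c i * m i) * l i x) +
          (\<Sum>k\<in>{..<n} - {i}. (\<lambda>x. of_int (c k * m k) * l k x)) \<in> B"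
        using N1[OF c cb(1)] cb(2) by argo
      have "l i \<in> L - K" using l i by (auto simp: bij_betw_def)
      hence "K \<subseteq> L - {l i}" using L(1) by auto
      hence "B \<subseteq> fv.span (L - {l i})" using spanK fv.span_mono by blast
      note inB = subsetD[OF this inB]
      have "(\<Sum>k\<in>{..<n} - {i}. (\<lambda>x. of_int (c k * m k) * l k x)) \<in> fv.span (L - {l i})"
      proof (intro fv.span_sum fv.span_scale fv.span_base)
        fix k assume "k \<in> {..<n} - {i}"
        thus "l k \<in> L - {l i}" using l i by (auto simp: bij_betw_def inj_on_def)
      qed
      from fv.span_diff[OF inB this] have "(\<lambda>x. of_int (c i * m i) * l i x) \<in> fv.span (L - {l i})" by simp
      from fv.span_scale[OF this, of "1 / of_int (c i * m i)"] have "l i \<in> fv.span (L - {l i})"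
        using ci mz(1)[OF i] by simp
      moreover have "l i \<in> L" using l i by (auto simp: bij_betw_def)
      ultimately show False using L(3) unfolding fv.dependent_def by blast
    qed
    thus ?thesis unfolding P_def n_def[symmetric] using mz(2) by blast
  qed
  have "quot_rank Z N = Sup {n. P n}" unfolding quot_rank_def P_def ..
  also have "\<dots> = card L - card K"
  proof (rule cSup_eq_maximum)
    show "card L - card K \<in> {n. P n}" using lower by simp
    fix k assume "k \<in> {n. P n}"
    hence "k + fv.dim B \<le> fv.dim S" using upper by simp
    thus "k \<le> card L - card K" unfolding K(4) dimS by linarith
  qed
  finally show ?thesis using K(4) dimS card_mono[OF finL L(1)] by simp
qed

section \<open>Weighted cohomology in positive degrees\<close>

definition by_degree :: "('v::finite qvec \<Rightarrow> int) \<Rightarrow> 'v cochain \<Rightarrow> 'v cube \<Rightarrow> int \<Rightarrow> int" where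
  "by_degree w \<phi> \<sigma> n = (if cube_weight w \<sigma> \<le> n then \<phi> \<sigma> (nat (n - cube_weight w \<sigma>)) else 0)"

definition of_degrees :: "'v::finite cube set \<Rightarrow> ('v qvec \<Rightarrow> int) \<Rightarrow> nat \<Rightarrow> ('v cube \<Rightarrow> int \<Rightarrow> int) \<Rightarrow> 'v cochain" where
  "of_degrees T w q f \<sigma> = (if \<sigma> \<in> T \<and> card (snd \<sigma>) = q then (\<lambda>d. f \<sigma> (cube_weight w \<sigma> + int d)) else 0)"

lemma by_degree_shift: "by_degree w \<phi> \<sigma> (cube_weight w \<sigma> + int d) = \<phi> \<sigma> d"
  by (simp add: by_degree_def)

lemma cochainsD:
  assumes "\<phi> \<in> cochains T q"
  shows "finite {d. \<phi> \<sigma> d \<noteq> 0}" "\<sigma> \<notin> T \<or> card (snd \<sigma>) \<noteq> q \<Longrightarrow> \<phi> \<sigma> = 0"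
  using assms unfolding cochains_def T0plus_def mem_Collect_eq by blast+

lemma cochain_eqI:
  assumes "\<phi> \<in> cochains T q" "\<psi> \<in> cochains T q"
    and "\<And>\<sigma> n. \<sigma> \<in> T \<Longrightarrow> card (snd \<sigma>) = q \<Longrightarrow> cube_weight w \<sigma> \<le> n \<Longrightarrow> by_degree w \<phi> \<sigma> n = by_degree w \<psi> \<sigma> n"
  shows "\<phi> = \<psi>"
proof
  fix \<sigma>
  show "\<phi> \<sigma> = \<psi> \<sigma>"
  proof (cases "\<sigma> \<in> T \<and> card (snd \<sigma>) = q")
    case True
    show ?thesis
    proof
      fix d
      show "\<phi> \<sigma> d = \<psi> \<sigma> d"
        using assms(3)[of \<sigma> "cube_weight w \<sigma> + int d"] True by (simp add: by_degree_shift)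
    qed
  qed (use cochainsD(2)[OF assms(1)] cochainsD(2)[OF assms(2)] in auto)
qed

lemma locally_finite_by_degree:
  assumes "\<phi> \<in> cochains T q"
  shows "locally_finite (by_degree w \<phi>)"
  unfolding locally_finite_def
proof
  fix \<sigma>
  have "{n. by_degree w \<phi> \<sigma> n \<noteq> 0} \<subseteq> (\<lambda>d. cube_weight w \<sigma> + int d) ` {d. \<phi> \<sigma> d \<noteq> 0}"
  proof
    fix n assume "n \<in> {n. by_degree w \<phi> \<sigma> n \<noteq> 0}"
    hence "cube_weight w \<sigma> \<le> n" "\<phi> \<sigma> (nat (n - cube_weight w \<sigma>)) \<noteq> 0"
      by (auto simp: by_degree_def split: if_splits)
    thus "n \<in> (\<lambda>d. cube_weight w \<sigma> + int d) ` {d. \<phi> \<sigma> d \<noteq> 0}"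
      by (intro image_eqI[of _ _ "nat (n - cube_weight w \<sigma>)"]) auto
  qed
  moreover have "finite {d. \<phi> \<sigma> d \<noteq> 0}" by (rule cochainsD(1)[OF assms])
  ultimately show "finite {n. by_degree w \<phi> \<sigma> n \<noteq> 0}" by (meson finite_imageI finite_subset)
qed

lemma facet_weights:
  fixes w :: "'v::finite qvec \<Rightarrow> int"
  assumes "j \<in> snd \<sigma>"
  shows "cube_weight w (fst \<sigma>, snd \<sigma> - {j}) \<le> cube_weight w \<sigma>"
    "cube_weight w (fst \<sigma> + basis j, snd \<sigma> - {j}) \<le> cube_weight w \<sigma>"
  using cube_weight_facet_le[of j "snd \<sigma>" w "fst \<sigma>"] assms by auto

lemma cobd_by_degree:
  assumes "\<sigma> \<in> T" "card (snd \<sigma>) = q + 1"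
  shows "cobd T w q \<phi> \<sigma> d = cubical_diff (\<lambda>\<tau>. by_degree w \<phi> \<tau> (cube_weight w \<sigma> + int d)) \<sigma>"
proof -
  have *: "Upow (nat (cube_weight w \<sigma> - cube_weight w \<tau>)) (\<phi> \<tau>) d = by_degree w \<phi> \<tau> (cube_weight w \<sigma> + int d)"
    if "cube_weight w \<tau> \<le> cube_weight w \<sigma>" for \<tau>
  proof -
    have "d + nat (cube_weight w \<sigma> - cube_weight w \<tau>) = nat (cube_weight w \<sigma> + int d - cube_weight w \<tau>)"
      using that by linarith
    thus ?thesis using that by (simp add: Upow_def by_degree_def)
  qed
  have "cobd T w q \<phi> \<sigma> d = (\<Sum>j\<in>snd \<sigma>. cube_sign j (snd \<sigma>) *
     (Upow (nat (cube_weight w \<sigma> - cube_weight w (fst \<sigma> + basis j, snd \<sigma> - {j}))) (\<phi> (fst \<sigma> + basis j, snd \<sigma> - {j})) d -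
      Upow (nat (cube_weight w \<sigma> - cube_weight w (fst \<sigma>, snd \<sigma> - {j}))) (\<phi> (fst \<sigma>, snd \<sigma> - {j})) d))"
    using assms by (simp add: cobd_def Let_def cube_sign_def)
  also have "\<dots> = cubical_diff (\<lambda>\<tau>. by_degree w \<phi> \<tau> (cube_weight w \<sigma> + int d)) \<sigma>"
    unfolding cubical_diff_def by (intro sum.cong refl) (simp add: * facet_weights)
  finally show ?thesis .
qed

lemma cubical_diff_wrong_dim:
  assumes "\<And>\<tau>. card (snd \<tau>) \<noteq> q \<Longrightarrow> f \<tau> = (0::'a::comm_ring_1)" "card (snd \<sigma>) \<noteq> q + 1"
  shows "cubical_diff f \<sigma> = 0"
  unfolding cubical_diff_def
proof (rule sum.neutral, rule ballI)
  fix j assume j: "j \<in> snd \<sigma>"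
  have "card (snd \<sigma> - {j}) \<noteq> q" using assms(2) j card_Suc_Diff1[of "snd \<sigma>" j] by auto
  thus "cube_sign j (snd \<sigma>) * (f (fst \<sigma> + basis j, snd \<sigma> - {j}) - f (fst \<sigma>, snd \<sigma> - {j})) = 0"
    using assms(1) by simp
qed

lemma by_degree_wrong_dim: "\<phi> \<in> cochains T q \<Longrightarrow> card (snd \<sigma>) \<noteq> q \<Longrightarrow> by_degree w \<phi> \<sigma> n = 0"
  by (simp add: by_degree_def cochainsD(2))

lemma cocycle_iff:
  "\<phi> \<in> cocycles T w q \<longleftrightarrow> \<phi> \<in> cochains T q \<and>
     (\<forall>\<sigma>\<in>T. \<forall>n\<ge>cube_weight w \<sigma>. cubical_diff (\<lambda>\<tau>. by_degree w \<phi> \<tau> n) \<sigma> = 0)"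
proof (cases "\<phi> \<in> cochains T q")
  case True
  have "cobd T w q \<phi> = 0 \<longleftrightarrow> (\<forall>\<sigma>\<in>T. \<forall>n\<ge>cube_weight w \<sigma>. cubical_diff (\<lambda>\<tau>. by_degree w \<phi> \<tau> n) \<sigma> = 0)"
  proof (intro iffI ballI allI impI)
    fix \<sigma> n assume H: "cobd T w q \<phi> = 0" "\<sigma> \<in> T" "cube_weight w \<sigma> \<le> n"
    show "cubical_diff (\<lambda>\<tau>. by_degree w \<phi> \<tau> n) \<sigma> = 0"
    proof (cases "card (snd \<sigma>) = q + 1")
      case c: True
      have "cobd T w q \<phi> \<sigma> (nat (n - cube_weight w \<sigma>)) = 0" using H(1) by simp
      thus ?thesis using cobd_by_degree[OF H(2) c, of w \<phi> "nat (n - cube_weight w \<sigma>)"] H(3) by simp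
    next
      case False
      thus ?thesis by (intro cubical_diff_wrong_dim[of q]) (auto simp: by_degree_wrong_dim[OF True])
    qed
  next
    assume H: "\<forall>\<sigma>\<in>T. \<forall>n\<ge>cube_weight w \<sigma>. cubical_diff (\<lambda>\<tau>. by_degree w \<phi> \<tau> n) \<sigma> = 0"
    show "cobd T w q \<phi> = 0"
    proof (intro ext)
      fix \<sigma> d
      show "cobd T w q \<phi> \<sigma> d = 0 \<sigma> d"
      proof (cases "\<sigma> \<in> T \<and> card (snd \<sigma>) = q + 1")
        case True thus ?thesis using H cobd_by_degree[of \<sigma> T q w \<phi> d] by simp
      qed (auto simp: cobd_def)
    qed
  qed
  thus ?thesis using True by (simp add: cocycles_def)
qed (auto simp: cocycles_def)

lemma of_degrees_cochain:
  assumes "locally_finite f"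
  shows "of_degrees T w q f \<in> cochains T q"
proof -
  have "finite {d. f \<sigma> (cube_weight w \<sigma> + int d) \<noteq> 0}" for \<sigma>
  proof -
    have "finite {n. f \<sigma> n \<noteq> 0}" using assms unfolding locally_finite_def by blast
    hence "finite ((\<lambda>d. cube_weight w \<sigma> + int d) -` {n. f \<sigma> n \<noteq> 0})"
      by (rule finite_vimageI) (simp add: inj_on_def)
    thus ?thesis by (simp add: vimage_def)
  qed
  thus ?thesis by (auto simp: cochains_def of_degrees_def T0plus_def)
qed

lemma by_degree_of_degrees:
  "\<sigma> \<in> T \<Longrightarrow> card (snd \<sigma>) = q \<Longrightarrow> cube_weight w \<sigma> \<le> n \<Longrightarrow> by_degree w (of_degrees T w q f) \<sigma> n = f \<sigma> n"
  by (simp add: by_degree_def of_degrees_def)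

lemma face_closedD:
  assumes "face_closed T" "\<sigma> \<in> T" "j \<in> snd \<sigma>"
  shows "(fst \<sigma>, snd \<sigma> - {j}) \<in> T" "(fst \<sigma> + basis j, snd \<sigma> - {j}) \<in> T"
  using assms unfolding face_closed_def by (cases \<sigma>; auto)+

lemma cubical_diff_of_degrees:
  assumes "face_closed T" "\<sigma> \<in> T" "card (snd \<sigma>) = q + 1" "cube_weight w \<sigma> \<le> n"
  shows "cubical_diff (\<lambda>\<tau>. by_degree w (of_degrees T w q f) \<tau> n) \<sigma> = cubical_diff (\<lambda>\<tau>. f \<tau> n) \<sigma>"
proof (rule cubical_diff_cong)
  fix j assume j: "j \<in> snd \<sigma>"
  have c: "card (snd \<sigma> - {j}) = q" using assms(3) j by simp
  show "by_degree w (of_degrees T w q f) (fst \<sigma> + basis j, snd \<sigma> - {j}) n = f (fst \<sigma> + basis j, snd \<sigma> - {j}) n"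
    "by_degree w (of_degrees T w q f) (fst \<sigma>, snd \<sigma> - {j}) n = f (fst \<sigma>, snd \<sigma> - {j}) n"
    using face_closedD[OF assms(1,2) j] facet_weights[OF j, of w] assms(4) c
    by (auto intro!: by_degree_of_degrees)
qed

lemma of_degrees_cocycle:
  assumes "face_closed T" "locally_finite f"
    "\<And>\<sigma> n. \<sigma> \<in> T \<Longrightarrow> card (snd \<sigma>) = q + 1 \<Longrightarrow> cube_weight w \<sigma> \<le> n \<Longrightarrow> cubical_diff (\<lambda>\<tau>. f \<tau> n) \<sigma> = 0"
  shows "of_degrees T w q f \<in> cocycles T w q"
  unfolding cocycle_iff
proof (intro conjI ballI allI impI)
  show c: "of_degrees T w q f \<in> cochains T q" by (rule of_degrees_cochain[OF assms(2)])
  fix \<sigma> n assume *: "\<sigma> \<in> T" "cube_weight w \<sigma> \<le> n"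
  show "cubical_diff (\<lambda>\<tau>. by_degree w (of_degrees T w q f) \<tau> n) \<sigma> = 0"
  proof (cases "card (snd \<sigma>) = q + 1")
    case True
    thus ?thesis using cubical_diff_of_degrees[OF assms(1) *(1) True *(2)] assms(3) * by simp
  next
    case False
    thus ?thesis by (intro cubical_diff_wrong_dim[of q]) (auto simp: by_degree_wrong_dim[OF c])
  qed
qed

lemma cubical_diff_of_int: "cubical_diff (\<lambda>\<tau>. of_int (f \<tau>)) \<sigma> = of_int (cubical_diff f \<sigma>)"
  by (simp add: cubical_diff_def cube_sign_def)

lemma cubical_diff_scale: "cubical_diff (\<lambda>\<tau>. c * f \<tau>) \<sigma> = c * cubical_diff f \<sigma>"
  unfolding cubical_diff_def sum_distrib_left by (intro sum.cong) (auto simp: algebra_simps)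

lemma cubical_diff_add: "cubical_diff (\<lambda>\<tau>. f \<tau> + g \<tau>) \<sigma> = cubical_diff f \<sigma> + cubical_diff g \<sigma>"
  unfolding cubical_diff_def sum.distrib[symmetric] by (intro sum.cong) (auto simp: algebra_simps)

lemma cubical_diff_sum: "cubical_diff (\<lambda>\<tau>. \<Sum>i<(n::nat). f i \<tau>) \<sigma> = (\<Sum>i<n. cubical_diff (f i) \<sigma>)"
  by (induction n) (simp_all add: cubical_diff_add, simp add: cubical_diff_def)

lemma by_degree_combination:
  "by_degree w (\<lambda>\<sigma> d. \<Sum>i<(n::nat). c i * z i \<sigma> d) \<sigma> k = (\<Sum>i<n. c i * by_degree w (z i) \<sigma> k)"
  by (simp add: by_degree_def)

lemma cochains_combination:
  assumes "\<And>i. i < n \<Longrightarrow> z i \<in> cochains T q"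
  shows "(\<lambda>\<sigma> d. \<Sum>i<(n::nat). c i * z i \<sigma> d) \<in> cochains T q"
proof -
  have "finite {d. (\<Sum>i<n. c i * z i \<sigma> d) \<noteq> 0}" for \<sigma>
  proof (rule finite_subset)
    show "{d. (\<Sum>i<n. c i * z i \<sigma> d) \<noteq> 0} \<subseteq> (\<Union>i<n. {d. z i \<sigma> d \<noteq> 0})"
      using sum.not_neutral_contains_not_neutral by fastforce
    show "finite (\<Union>i<n. {d. z i \<sigma> d \<noteq> 0})"
      using cochainsD(1)[OF assms] by auto
  qed
  thus ?thesis using cochainsD(2)[OF assms] by (auto simp: cochains_def T0plus_def fun_eq_iff)
qed

lemma cocycles_combination:
  assumes "\<And>i. i < n \<Longrightarrow> z i \<in> cocycles T w q"
  shows "(\<lambda>\<sigma> d. \<Sum>i<(n::nat). c i * z i \<sigma> d) \<in> cocycles T w q"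
  using assms cochains_combination[of n z T q c] unfolding cocycle_iff
  by (simp add: by_degree_combination cubical_diff_sum cubical_diff_scale)

locale finite_core =
  fixes w :: "'v::finite qvec \<Rightarrow> int" and T T0 :: "'v cube set" and p0 x0 :: "'v qvec" and N :: int
  assumes closed0: "face_closed T0" and closed: "face_closed T" and fin: "finite T0"
    and extends: "extends_primitives w T0 T"
    and extends_const: "extends_primitives (\<lambda>_. N) {(p0, {})} T0"
    and N: "\<And>\<sigma>. \<sigma> \<in> T0 \<Longrightarrow> cube_weight w \<sigma> \<le> N"
    and x0: "(x0, {}) \<in> T0" "\<And>x. (x, {}) \<in> T \<Longrightarrow> w x0 \<le> w x"
begin

definition X :: "nat \<Rightarrow> ('v cube \<times> int) set" where
  "X q = {(\<sigma>, n). \<sigma> \<in> T0 \<and> card (snd \<sigma>) = q \<and> cube_weight w \<sigma> \<le> n \<and> n < N}"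

definition trunc :: "nat \<Rightarrow> 'v cochain \<Rightarrow> 'v cube \<times> int \<Rightarrow> rat" where
  "trunc q \<phi> = (\<lambda>(\<sigma>, n). if (\<sigma>, n) \<in> X q then of_int (by_degree w \<phi> \<sigma> n) else 0)"

definition bd :: "nat \<Rightarrow> ('v cube \<times> int \<Rightarrow> rat) \<Rightarrow> 'v cube \<times> int \<Rightarrow> rat" where
  "bd q f = (\<lambda>(\<sigma>, n). if (\<sigma>, n) \<in> X (q + 1) then cubical_diff (\<lambda>\<tau>. f (\<tau>, n)) \<sigma> else 0)"

definition ZQ :: "nat \<Rightarrow> ('v cube \<times> int \<Rightarrow> rat) set" where
  "ZQ q = {f \<in> supported (X q). bd q f = 0}"

definition BQ :: "nat \<Rightarrow> ('v cube \<times> int \<Rightarrow> rat) set" where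
  "BQ q = (case q of 0 \<Rightarrow> {0} | Suc p \<Rightarrow> bd p ` supported (X p))"

lemma T0_T: "T0 \<subseteq> T" using extends unfolding extends_primitives_def by blast

lemma finite_X: "finite (X q)"
proof (rule finite_subset)
  show "X q \<subseteq> Sigma T0 (\<lambda>\<sigma>. {cube_weight w \<sigma>..<N})" by (auto simp: X_def)
qed (use fin in auto)

lemma X_facets:
  assumes "(\<sigma>, n) \<in> X (q + 1)" "j \<in> snd \<sigma>"
  shows "((fst \<sigma>, snd \<sigma> - {j}), n) \<in> X q" "((fst \<sigma> + basis j, snd \<sigma> - {j}), n) \<in> X q"
  using assms face_closedD[OF closed0 _ assms(2)] facet_weights[OF assms(2), of w]
  by (auto simp: X_def)

lemma bd_linear: "Vector_Spaces.linear (\<lambda>c f x. c * f x) (\<lambda>c f x. c * f x) (bd q)"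
  unfolding Vector_Spaces.linear_iff
  using fv.vector_space_axioms
  by (auto simp: bd_def fun_eq_iff cubical_diff_add cubical_diff_scale)

lemma bd_supported: "bd q f \<in> supported (X (q + 1))"
  by (auto simp: bd_def supported_def)

lemma bd_bd: "bd (q + 1) (bd q f) = 0"
proof (intro ext, unfold split_paired_all)
  fix x I n
  show "bd (q + 1) (bd q f) ((x, I), n) = 0 ((x, I), n)"
  proof (cases "((x, I), n) \<in> X (q + 1 + 1)")
    case True
    have "bd (q + 1) (bd q f) ((x, I), n) = cubical_diff (\<lambda>\<tau>. bd q f (\<tau>, n)) (x, I)"
      using True by (simp add: bd_def)
    also have "\<dots> = cubical_diff (cubical_diff (\<lambda>\<tau>. f (\<tau>, n))) (x, I)"
      by (rule cubical_diff_cong) (use X_facets[OF True] in \<open>auto simp: bd_def\<close>)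
    finally show ?thesis by (simp add: cubical_diff_cubical_diff)
  qed (simp add: bd_def)
qed

lemma trunc_supported: "trunc q \<phi> \<in> supported (X q)"
  by (auto simp: trunc_def supported_def)

lemma bd_trunc:
  assumes "(\<sigma>, n) \<in> X (q + 1)"
  shows "bd q (trunc q \<phi>) (\<sigma>, n) = of_int (cubical_diff (\<lambda>\<tau>. by_degree w \<phi> \<tau> n) \<sigma>)"
proof -
  have "bd q (trunc q \<phi>) (\<sigma>, n) = cubical_diff (\<lambda>\<tau>. trunc q \<phi> (\<tau>, n)) \<sigma>"
    using assms by (simp add: bd_def)
  also have "\<dots> = cubical_diff (\<lambda>\<tau>. of_int (by_degree w \<phi> \<tau> n)) \<sigma>"
    by (rule cubical_diff_cong) (use X_facets[OF assms] in \<open>auto simp: trunc_def\<close>)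
  finally show ?thesis by (simp add: cubical_diff_of_int)
qed

lemma trunc_cocycle:
  assumes "z \<in> cocycles T w q"
  shows "trunc q z \<in> ZQ q"
proof -
  have "bd q (trunc q z) (\<sigma>, n) = 0" for \<sigma> n
  proof (cases "(\<sigma>, n) \<in> X (q + 1)")
    case True
    hence "\<sigma> \<in> T" "cube_weight w \<sigma> \<le> n" using T0_T by (auto simp: X_def)
    thus ?thesis using bd_trunc[OF True] assms by (simp add: cocycle_iff)
  qed (simp add: bd_def)
  thus ?thesis using trunc_supported by (auto simp: ZQ_def)
qed

lemma trunc_combination:
  "trunc q (\<lambda>\<sigma> d. \<Sum>i<(n::nat). c i * z i \<sigma> d) = (\<Sum>i<n. (\<lambda>x. of_int (c i) * trunc q (z i) x))"
  by (auto simp: fun_eq_iff trunc_def by_degree_combination sum_fun_apply)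

lemma integral_multiple:
  assumes "f \<in> supported (X q)"
  obtains M :: int and g :: "'v cube \<Rightarrow> int \<Rightarrow> int" where "M > 0"
    "\<And>\<sigma> n. of_int (g \<sigma> n) = of_int M * f (\<sigma>, n)" "locally_finite g"
    "\<And>\<sigma> n. (\<sigma>, n) \<notin> X q \<Longrightarrow> g \<sigma> n = 0"
proof -
  obtain M :: int where M: "M > 0" "\<forall>x\<in>X q. \<exists>c::int. of_int M * f x = of_int c"
    using common_denominator[OF finite_X] by blast
  have "\<forall>x. \<exists>c::int. of_int c = of_int M * f x"
  proof
    fix x show "\<exists>c::int. of_int c = of_int M * f x"
    proof (cases "x \<in> X q")
      case False
      hence "f x = 0" using assms unfolding supported_def by blast
      thus ?thesis by (intro exI[of _ 0]) simp
    qed (use M in metis)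
  qed
  then obtain h :: "'v cube \<times> int \<Rightarrow> int" where h: "\<And>x. of_int (h x) = of_int M * f x" by metis
  have h0: "h x = 0" if "x \<notin> X q" for x
  proof -
    have "f x = 0" using assms that unfolding supported_def by blast
    hence "(of_int (h x) :: rat) = 0" using h[of x] by simp
    thus ?thesis by simp
  qed
  have "finite {n. h (\<sigma>, n) \<noteq> 0}" for \<sigma>
  proof (rule finite_subset)
    show "{n. h (\<sigma>, n) \<noteq> 0} \<subseteq> snd ` X q"
    proof
      fix n assume "n \<in> {n. h (\<sigma>, n) \<noteq> 0}"
      hence "(\<sigma>, n) \<in> X q" using h0[of "(\<sigma>, n)"] by blast
      thus "n \<in> snd ` X q" by force
    qed
  qed (use finite_X in auto)
  thus ?thesis using that[of M "\<lambda>\<sigma> n. h (\<sigma>, n)"] M(1) h h0 by (auto simp: locally_finite_def)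
qed

lemma trunc_surj:
  assumes "f \<in> ZQ q"
  shows "\<exists>m::int. m > 0 \<and> (\<exists>z\<in>cocycles T w q. trunc q z = (\<lambda>x. of_int m * f x))"
proof -
  have f: "f \<in> supported (X q)" "bd q f = 0" using assms by (auto simp: ZQ_def)
  obtain M g where g: "M > 0" "\<And>\<sigma> n. of_int (g \<sigma> n) = of_int M * f (\<sigma>, n)" "locally_finite g"
    "\<And>\<sigma> n. (\<sigma>, n) \<notin> X q \<Longrightarrow> g \<sigma> n = 0" using integral_multiple[OF f(1)] by metis
  have gz: "cubical_diff (\<lambda>\<tau>. g \<tau> n) \<sigma> = 0" if \<sigma>: "\<sigma> \<in> T0" "cube_weight w \<sigma> \<le> n" for \<sigma> n
  proof (cases "card (snd \<sigma>) = q + 1 \<and> n < N")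
    case True
    hence in_X: "(\<sigma>, n) \<in> X (q + 1)" using \<sigma> by (auto simp: X_def)
    have "of_int (cubical_diff (\<lambda>\<tau>. g \<tau> n) \<sigma>) = (of_int M * cubical_diff (\<lambda>\<tau>. f (\<tau>, n)) \<sigma> :: rat)"
      by (simp add: cubical_diff_of_int[symmetric] g(2) cubical_diff_scale)
    also have "cubical_diff (\<lambda>\<tau>. f (\<tau>, n)) \<sigma> = bd q f (\<sigma>, n)" using in_X by (simp add: bd_def)
    finally show ?thesis using f(2) by simp
  next
    case False
    show ?thesis
    proof (cases "n < N")
      case True
      show ?thesis by (rule cubical_diff_wrong_dim[of q]) (use False True g(4) in \<open>auto simp: X_def\<close>)
    next
      case F: False
      have "g \<tau> n = 0" for \<tau> by (rule g(4)) (use F in \<open>auto simp: X_def\<close>)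
      thus ?thesis by (simp add: cubical_diff_def)
    qed
  qed
  have lf0: "locally_finite (\<lambda>\<sigma> n. 0)" by (simp add: locally_finite_def)
  have z1: "\<forall>\<sigma>\<in>T. \<forall>n\<ge>cube_weight w \<sigma>. cubical_diff (\<lambda>\<tau>. (0::int)) \<sigma> = 0" by (simp add: cubical_diff_def)
  have z2: "\<forall>\<sigma>\<in>T0. \<forall>n\<ge>cube_weight w \<sigma>. cubical_diff (\<lambda>\<tau>. g \<tau> n) \<sigma> = 0" using gz by blast
  obtain \<psi> where \<psi>: "locally_finite \<psi>" "\<forall>\<sigma>\<in>T0. \<psi> \<sigma> = g \<sigma>"
      "\<forall>\<sigma>\<in>T. \<forall>n\<ge>cube_weight w \<sigma>. cubical_diff (\<lambda>\<tau>. \<psi> \<tau> n) \<sigma> = 0"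
    using extends lf0 g(3) z1 z2 unfolding extends_primitives_def by blast
  have "of_degrees T w q \<psi> \<in> cocycles T w q"
    by (rule of_degrees_cocycle[OF closed \<psi>(1)]) (use \<psi>(3) in auto)
  moreover have "trunc q (of_degrees T w q \<psi>) = (\<lambda>x. of_int M * f x)"
  proof (intro ext, unfold split_paired_all)
    fix x I n
    show "trunc q (of_degrees T w q \<psi>) ((x, I), n) = of_int M * f ((x, I), n)"
    proof (cases "((x, I), n) \<in> X q")
      case True
      hence *: "(x, I) \<in> T0" "card I = q" "cube_weight w (x, I) \<le> n" by (auto simp: X_def)
      have "by_degree w (of_degrees T w q \<psi>) (x, I) n = g (x, I) n"
        using by_degree_of_degrees[of "(x, I)" T q w n \<psi>] * T0_T \<psi>(2) by auto
      thus ?thesis using True g(2) by (simp add: trunc_def)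
    next
      case False
      thus ?thesis using f(1) by (auto simp: trunc_def supported_def)
    qed
  qed
  ultimately show ?thesis using g(1) by blast
qed

lemma trunc_coboundary:
  assumes "z \<in> coboundaries T w q" "z \<in> cocycles T w q"
  shows "trunc q z \<in> BQ q"
proof (cases q)
  case 0
  hence "z = 0" using assms by (simp add: coboundaries_def)
  thus ?thesis using 0 by (auto simp: BQ_def trunc_def by_degree_def fun_eq_iff)
next
  case (Suc p)
  then obtain \<phi> where \<phi>: "\<phi> \<in> cochains T p" "z = cobd T w p \<phi>"
    using assms by (auto simp: coboundaries_def)
  have "trunc q z = bd p (trunc p \<phi>)"
  proof (intro ext, unfold split_paired_all)
    fix x I n
    show "trunc q z ((x, I), n) = bd p (trunc p \<phi>) ((x, I), n)"
    proof (cases "((x, I), n) \<in> X (p + 1)")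
      case True
      hence *: "(x, I) \<in> T" "card I = p + 1" "cube_weight w (x, I) \<le> n" using T0_T by (auto simp: X_def)
      have "by_degree w z (x, I) n = cubical_diff (\<lambda>\<tau>. by_degree w \<phi> \<tau> n) (x, I)"
        using cobd_by_degree[of "(x, I)" T p w \<phi> "nat (n - cube_weight w (x, I))"] * \<phi>(2)
        by (simp add: by_degree_def)
      thus ?thesis using True bd_trunc[OF True] Suc by (simp add: trunc_def)
    qed (simp add: trunc_def bd_def Suc)
  qed
  thus ?thesis using trunc_supported Suc by (auto simp: BQ_def)
qed

lemma primitive_of_trunc:
  assumes z: "z \<in> cocycles T w (Suc p)" and "trunc (Suc p) z \<in> BQ (Suc p)"
  shows "\<exists>m::int. m > 0 \<and> (\<lambda>\<sigma> d. m * z \<sigma> d) \<in> coboundaries T w (Suc p)"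
proof -
  obtain f where f: "f \<in> supported (X p)" "trunc (Suc p) z = bd p f" using assms(2) by (auto simp: BQ_def)
  obtain M g where g: "M > 0" "\<And>\<sigma> n. of_int (g \<sigma> n) = of_int M * f (\<sigma>, n)" "locally_finite g"
    "\<And>\<sigma> n. (\<sigma>, n) \<notin> X p \<Longrightarrow> g \<sigma> n = 0" using integral_multiple[OF f(1)] by metis
  have zc: "z \<in> cochains T (Suc p)" using z by (simp add: cocycle_iff)
  define \<phi> where "\<phi> \<sigma> n = M * by_degree w z \<sigma> n" for \<sigma> n
  have lf\<phi>: "locally_finite \<phi>"
    using locally_finite_by_degree[OF zc, of w] g(1) unfolding \<phi>_def locally_finite_def by simp
  have \<phi>z: "cubical_diff (\<lambda>\<tau>. \<phi> \<tau> n) \<sigma> = 0" if "\<sigma> \<in> T" "cube_weight w \<sigma> \<le> n" for \<sigma> n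
    using z that by (simp add: \<phi>_def cubical_diff_scale cocycle_iff)
  have lf0: "locally_finite (\<lambda>(\<sigma> :: 'v cube) n. 0)" by (simp add: locally_finite_def)
  have cN: "cube_weight (\<lambda>_. N) \<sigma> = N" for \<sigma> :: "'v cube"
    by (simp add: cube_weight_def image_constant_conv Pow_not_empty)
  have a1: "\<forall>\<sigma>\<in>T0. \<forall>n\<ge>cube_weight (\<lambda>_. N) \<sigma>. cubical_diff (\<lambda>\<tau>. \<phi> \<tau> n) \<sigma> = 0"
  proof (intro ballI allI impI)
    fix \<sigma> n assume "\<sigma> \<in> T0" "cube_weight (\<lambda>_. N) \<sigma> \<le> n"
    thus "cubical_diff (\<lambda>\<tau>. \<phi> \<tau> n) \<sigma> = 0" using N[of \<sigma>] T0_T cN[of \<sigma>] by (intro \<phi>z) auto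
  qed
  have a2: "\<forall>\<sigma>\<in>{(p0, {})}. \<forall>n\<ge>cube_weight (\<lambda>_. N) \<sigma>. cubical_diff (\<lambda>\<tau>. 0) \<sigma> = \<phi> \<sigma> n"
    using by_degree_wrong_dim[OF zc, of "(p0, {})" w] by (simp add: \<phi>_def cubical_diff_def)
  obtain \<psi>' where \<psi>': "locally_finite \<psi>'"
      "\<forall>\<sigma>\<in>T0. \<forall>n\<ge>cube_weight (\<lambda>_. N) \<sigma>. cubical_diff (\<lambda>\<tau>. \<psi>' \<tau> n) \<sigma> = \<phi> \<sigma> n"
    using extends_const lf\<phi> lf0 a1 a2 unfolding extends_primitives_def by blast
  define \<psi>0 where "\<psi>0 \<sigma> n = (if n < N then g \<sigma> n else \<psi>' \<sigma> n)" for \<sigma> n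
  have lf: "locally_finite \<psi>0" unfolding locally_finite_def
  proof
    fix \<sigma>
    have "{n. \<psi>0 \<sigma> n \<noteq> 0} \<subseteq> {n. g \<sigma> n \<noteq> 0} \<union> {n. \<psi>' \<sigma> n \<noteq> 0}" by (auto simp: \<psi>0_def)
    thus "finite {n. \<psi>0 \<sigma> n \<noteq> 0}" using g(3) \<psi>'(1) unfolding locally_finite_def
      by (meson finite_Un finite_subset)
  qed
  have b2: "\<forall>\<sigma>\<in>T0. \<forall>n\<ge>cube_weight w \<sigma>. cubical_diff (\<lambda>\<tau>. \<psi>0 \<tau> n) \<sigma> = \<phi> \<sigma> n"
  proof (intro ballI allI impI)
    fix \<sigma> n assume \<sigma>: "\<sigma> \<in> T0" "cube_weight w \<sigma> \<le> n"
    show "cubical_diff (\<lambda>\<tau>. \<psi>0 \<tau> n) \<sigma> = \<phi> \<sigma> n"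
    proof (cases "n < N")
      case True
      hence eq: "cubical_diff (\<lambda>\<tau>. \<psi>0 \<tau> n) \<sigma> = cubical_diff (\<lambda>\<tau>. g \<tau> n) \<sigma>" by (simp add: \<psi>0_def)
      show ?thesis
      proof (cases "card (snd \<sigma>) = p + 1")
        case c: True
        hence in_X: "(\<sigma>, n) \<in> X (p + 1)" using \<sigma> True by (auto simp: X_def)
        have "of_int (cubical_diff (\<lambda>\<tau>. g \<tau> n) \<sigma>) = (of_int M * cubical_diff (\<lambda>\<tau>. f (\<tau>, n)) \<sigma> :: rat)"
          by (simp add: cubical_diff_of_int[symmetric] g(2) cubical_diff_scale)
        also have "cubical_diff (\<lambda>\<tau>. f (\<tau>, n)) \<sigma> = trunc (Suc p) z (\<sigma>, n)"
          using in_X f(2) by (simp add: bd_def)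
        also have "\<dots> = of_int (by_degree w z \<sigma> n)" using in_X by (simp add: trunc_def)
        finally have "(of_int (cubical_diff (\<lambda>\<tau>. g \<tau> n) \<sigma>) :: rat) = of_int (\<phi> \<sigma> n)" by (simp add: \<phi>_def)
        thus ?thesis unfolding eq of_int_eq_iff .
      next
        case F: False
        have "cubical_diff (\<lambda>\<tau>. g \<tau> n) \<sigma> = 0"
          by (rule cubical_diff_wrong_dim[of p]) (use F g(4) in \<open>auto simp: X_def\<close>)
        thus ?thesis using F by_degree_wrong_dim[OF zc, of \<sigma> w n] by (simp add: eq \<phi>_def)
      qed
    next
      case False
      thus ?thesis using \<psi>'(2) \<sigma> cN by (simp add: \<psi>0_def)
    qed
  qed
  have b1: "\<forall>\<sigma>\<in>T. \<forall>n\<ge>cube_weight w \<sigma>. cubical_diff (\<lambda>\<tau>. \<phi> \<tau> n) \<sigma> = 0" using \<phi>z by blast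
  obtain \<psi> where \<psi>: "locally_finite \<psi>"
      "\<forall>\<sigma>\<in>T. \<forall>n\<ge>cube_weight w \<sigma>. cubical_diff (\<lambda>\<tau>. \<psi> \<tau> n) \<sigma> = \<phi> \<sigma> n"
    using extends lf\<phi> lf b1 b2 unfolding extends_primitives_def by blast
  have "cobd T w p (of_degrees T w p \<psi>) = (\<lambda>\<sigma> d. M * z \<sigma> d)"
  proof (intro ext)
    fix \<sigma> d
    show "cobd T w p (of_degrees T w p \<psi>) \<sigma> d = M * z \<sigma> d"
    proof (cases "\<sigma> \<in> T \<and> card (snd \<sigma>) = p + 1")
      case True
      thus ?thesis using cobd_by_degree[of \<sigma> T p w _ d] \<psi>(2)
        by (simp add: cubical_diff_of_degrees[OF closed] \<phi>_def by_degree_shift)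
    next
      case False
      thus ?thesis using cochainsD(2)[OF zc, of \<sigma>] by (auto simp: cobd_def)
    qed
  qed
  moreover have "of_degrees T w p \<psi> \<in> cochains T p" by (rule of_degrees_cochain[OF \<psi>(1)])
  ultimately have "(\<lambda>\<sigma> d. M * z \<sigma> d) \<in> coboundaries T w (Suc p)" by (force simp: coboundaries_def)
  thus ?thesis using g(1) by blast
qed

lemma subspace_ZQ: "fv.subspace (ZQ q)"
  unfolding ZQ_def using subspace_supported[of "X q"]
  by (auto simp: fv.subspace_def fvp.linear_add[OF bd_linear] fvp.linear_scale[OF bd_linear] fvp.linear_0[OF bd_linear])

lemma subspace_BQ: "fv.subspace (BQ q)"
proof (cases q)
  case (Suc p)
  thus ?thesis using fvp.linear_subspace_image[OF bd_linear subspace_supported] by (simp add: BQ_def)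
qed (simp add: BQ_def fv.subspace_def zero_fun_def)

lemma BQ_ZQ: "BQ q \<subseteq> ZQ q"
proof (cases q)
  case (Suc p)
  thus ?thesis using bd_bd[of p] bd_supported[of p] by (auto simp: BQ_def ZQ_def)
next
  case 0
  thus ?thesis using fvp.linear_0[OF bd_linear] by (auto simp: BQ_def ZQ_def supported_def)
qed

lemma quot_rank_cohomology:
  "quot_rank (cocycles T w (Suc p)) (coboundaries T w (Suc p)) + fv.dim (BQ (Suc p)) = fv.dim (ZQ (Suc p))"
proof (rule quot_rank_eq_dim[OF finite_X subspace_ZQ _ subspace_BQ BQ_ZQ, where r = "trunc (Suc p)"])
  show "ZQ (Suc p) \<subseteq> supported (X (Suc p))" by (auto simp: ZQ_def)
qed (use cocycles_combination trunc_combination trunc_cocycle trunc_surj trunc_coboundary primitive_of_trunc in blast)+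

lemma dim_ZQ_BQ: "card (X q) = fv.dim (ZQ q) + fv.dim (BQ (Suc q))"
  using rank_nullity[OF finite_X subspace_supported order_refl bd_linear, of q q] dim_supported[OF finite_X, of q]
  by (simp add: ZQ_def BQ_def)

end

section \<open>Weighted cohomology in degree zero and the Euler characteristic\<close>

context finite_core begin

lemma cw_vertex: "cube_weight w (x, {}) = w x" by simp

lemma vertex_cases: "card (snd \<sigma>) = 0 \<longleftrightarrow> (\<exists>x. \<sigma> = (x, {}))" for \<sigma> :: "'v cube"
  by (cases \<sigma>) auto

lemma vertices_of_edge:
  assumes "face_closed S" "\<sigma> \<in> S" "j \<in> snd \<sigma>" "card (snd \<sigma>) = 1"
  shows "(fst \<sigma>, {}) \<in> S" "(fst \<sigma> + basis j, {}) \<in> S" "snd \<sigma> - {j} = {}"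
  using face_closedD[OF assms(1-3)] assms(3,4) by (auto simp: card_1_singleton_iff)

text \<open>Vanishing of a degree-zero cocycle in one degree is decided on the core.\<close>
lemma cocycle0_vanishes:
  assumes z: "z \<in> cocycles T w 0" and zero: "\<And>x. (x, {}) \<in> T0 \<Longrightarrow> by_degree w z (x, {}) n = 0"
  shows "by_degree w z \<sigma> n = 0"
proof -
  have zc: "z \<in> cochains T 0" using z by (simp add: cocycle_iff)
  define \<phi> where "\<phi> \<sigma> k = (if k = n then by_degree w z \<sigma> n else 0)" for \<sigma> k
  have l1: "locally_finite \<phi>" unfolding locally_finite_def
    by (rule allI, rule finite_subset[of _ "{n}"]) (auto simp: \<phi>_def)
  have l0: "locally_finite (\<lambda>(\<sigma> :: 'v cube) n. 0)" by (simp add: locally_finite_def)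
  have a1: "\<forall>\<sigma>\<in>T. \<forall>k\<ge>cube_weight w \<sigma>. cubical_diff (\<lambda>\<tau>. \<phi> \<tau> k) \<sigma> = 0"
  proof (intro ballI allI impI)
    fix \<sigma> k assume *: "\<sigma> \<in> T" "cube_weight w \<sigma> \<le> k"
    show "cubical_diff (\<lambda>\<tau>. \<phi> \<tau> k) \<sigma> = 0"
    proof (cases "k = n")
      case True
      thus ?thesis using z * by (simp add: \<phi>_def cocycle_iff)
    qed (simp add: \<phi>_def cubical_diff_def)
  qed
  have a2: "\<forall>\<sigma>\<in>T0. \<forall>k\<ge>cube_weight w \<sigma>. cubical_diff (\<lambda>\<tau>. (0::int)) \<sigma> = \<phi> \<sigma> k"
  proof (intro ballI allI impI)
    fix \<sigma> k assume *: "\<sigma> \<in> T0" "cube_weight w \<sigma> \<le> k"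
    have "by_degree w z \<sigma> n = 0"
    proof (cases "card (snd \<sigma>) = 0")
      case True
      thus ?thesis using zero * vertex_cases[of \<sigma>] by auto
    qed (simp add: by_degree_wrong_dim[OF zc])
    thus "cubical_diff (\<lambda>\<tau>. (0::int)) \<sigma> = \<phi> \<sigma> k" by (simp add: \<phi>_def cubical_diff_def)
  qed
  obtain \<psi> where \<psi>: "\<forall>\<sigma>\<in>T. \<forall>k\<ge>cube_weight w \<sigma>. cubical_diff (\<lambda>\<tau>. \<psi> \<tau> k) \<sigma> = \<phi> \<sigma> k"
    using extends l1 l0 a1 a2 unfolding extends_primitives_def by blast
  show ?thesis
  proof (cases "\<sigma> \<in> T \<and> card (snd \<sigma>) = 0 \<and> cube_weight w \<sigma> \<le> n")
    case True
    then obtain x where x: "\<sigma> = (x, {})" using vertex_cases by blast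
    have "cubical_diff (\<lambda>\<tau>. \<psi> \<tau> n) \<sigma> = \<phi> \<sigma> n" using \<psi> True by blast
    thus ?thesis by (simp add: x cubical_diff_def \<phi>_def)
  next
    case False
    thus ?thesis using cochainsD(2)[OF zc, of \<sigma>]
      by (cases "cube_weight w \<sigma> \<le> n") (auto simp: by_degree_def simp del: card_0_eq)
  qed
qed

lemma cocycle_minus:
  assumes "z \<in> cocycles T w 0" "y \<in> cocycles T w 0"
  shows "z - y \<in> cocycles T w 0"
proof -
  have "(\<lambda>\<sigma> d. \<Sum>i<(2::nat). (if i = 0 then 1 else -1) * (if i = 0 then z else y) \<sigma> d) \<in> cocycles T w 0"
    by (rule cocycles_combination) (use assms in auto)
  moreover have "(\<lambda>\<sigma> d. \<Sum>i<(2::nat). (if i = 0 then 1 else -1) * (if i = 0 then z else y) \<sigma> d) = z - y"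
    by (auto simp: numeral_2_eq_2 fun_eq_iff)
  ultimately show ?thesis by simp
qed

lemma cocycle0_constant:
  assumes z: "z \<in> cocycles T w 0" and n: "n \<ge> N"
  shows "\<exists>c. \<forall>x. (x, {}) \<in> T \<longrightarrow> w x \<le> n \<longrightarrow> by_degree w z (x, {}) n = c"
proof -
  have zc: "z \<in> cochains T 0" using z by (simp add: cocycle_iff)
  define c where "c = by_degree w z (p0, {}) n"
  have cN: "cube_weight (\<lambda>_. N) \<sigma> = N" for \<sigma> :: "'v cube"
    by (simp add: cube_weight_def image_constant_conv Pow_not_empty)
  define \<phi> where "\<phi> \<sigma> k = (if k = n \<and> card (snd \<sigma>) = 0 then by_degree w z \<sigma> n - c else 0)"
    for \<sigma> :: "'v cube" and k
  have l1: "locally_finite \<phi>" unfolding locally_finite_def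
    by (rule allI, rule finite_subset[of _ "{n}"]) (auto simp: \<phi>_def)
  have l0: "locally_finite (\<lambda>(\<sigma> :: 'v cube) n. 0)" by (simp add: locally_finite_def)
  have a1: "\<forall>\<sigma>\<in>T0. \<forall>k\<ge>cube_weight (\<lambda>_. N) \<sigma>. cubical_diff (\<lambda>\<tau>. \<phi> \<tau> k) \<sigma> = 0"
  proof (intro ballI allI impI)
    fix \<sigma> k assume *: "\<sigma> \<in> T0" "cube_weight (\<lambda>_. N) \<sigma> \<le> k"
    show "cubical_diff (\<lambda>\<tau>. \<phi> \<tau> k) \<sigma> = 0"
    proof (cases "k = n \<and> card (snd \<sigma>) = 1")
      case True
      hence c1: "card (snd \<sigma>) = 1" by simp
      have "cubical_diff (\<lambda>\<tau>. \<phi> \<tau> k) \<sigma> = cubical_diff (\<lambda>\<tau>. by_degree w z \<tau> n - c) \<sigma>"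
        by (rule cubical_diff_cong) (use True in \<open>auto simp: \<phi>_def card_1_singleton_iff\<close>)
      also have "\<dots> = cubical_diff (\<lambda>\<tau>. by_degree w z \<tau> n) \<sigma> - cubical_diff (\<lambda>\<tau>. c) \<sigma>"
        by (rule cubical_diff_minus)
      also have "cubical_diff (\<lambda>\<tau>. c) \<sigma> = 0" by (simp add: cubical_diff_def)
      also have "cubical_diff (\<lambda>\<tau>. by_degree w z \<tau> n) \<sigma> = 0"
        using z * T0_T N[of \<sigma>] n by (auto simp: cocycle_iff)
      finally show ?thesis by simp
    next
      case False
      show ?thesis
      proof (cases "k = n")
        case True
        show ?thesis by (rule cubical_diff_wrong_dim[of 0]) (use False True in \<open>auto simp: \<phi>_def\<close>)
      qed (simp add: \<phi>_def cubical_diff_def)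
    qed
  qed
  have a2: "\<forall>\<sigma>\<in>{(p0, {})}. \<forall>k\<ge>cube_weight (\<lambda>_. N) \<sigma>. cubical_diff (\<lambda>\<tau>. (0::int)) \<sigma> = \<phi> \<sigma> k"
    by (simp add: \<phi>_def c_def cubical_diff_def)
  obtain \<psi> where \<psi>: "\<forall>\<sigma>\<in>T0. \<forall>k\<ge>cube_weight (\<lambda>_. N) \<sigma>. cubical_diff (\<lambda>\<tau>. \<psi> \<tau> k) \<sigma> = \<phi> \<sigma> k"
    using extends_const l1 l0 a1 a2 unfolding extends_primitives_def by blast
  have T0c: "by_degree w z (x, {}) n = c" if "(x, {}) \<in> T0" for x
  proof -
    have "cubical_diff (\<lambda>\<tau>. \<psi> \<tau> n) (x, {}) = \<phi> (x, {}) n" using \<psi> that n cN by simp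
    thus ?thesis by (simp add: cubical_diff_def \<phi>_def)
  qed
  define y where "y = z - of_degrees T w 0 (\<lambda>\<sigma> k. if k = n then c else 0)"
  have lk: "locally_finite (\<lambda>(\<sigma> :: 'v cube) k. if k = n then c else 0)" unfolding locally_finite_def
    by (rule allI, rule finite_subset[of _ "{n}"]) auto
  have kc: "of_degrees T w 0 (\<lambda>\<sigma> k. if k = n then c else 0) \<in> cocycles T w 0"
    by (rule of_degrees_cocycle[OF closed lk]) (simp add: cubical_diff_def)
  have yc: "y \<in> cocycles T w 0" unfolding y_def by (rule cocycle_minus[OF z kc])
  have ydeg: "by_degree w y (x, {}) n = by_degree w z (x, {}) n - c" if "(x, {}) \<in> T" "w x \<le> n" for x
    using that by (simp add: y_def by_degree_def of_degrees_def)
  have "by_degree w y (x, {}) n = 0" if "(x, {}) \<in> T0" for x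
  proof -
    have "w x \<le> n" using N[OF that] n by simp
    thus ?thesis using ydeg[of x] T0c[OF that] that T0_T by auto
  qed
  hence "by_degree w y \<sigma> n = 0" for \<sigma> by (rule cocycle0_vanishes[OF yc])
  thus ?thesis using ydeg by (intro exI[of _ c]) auto
qed

lemma degree0_eqI:
  assumes "\<phi> \<in> cocycles T w 0" "\<psi> \<in> cocycles T w 0"
    and "\<And>x n. (x, {}) \<in> T \<Longrightarrow> w x \<le> n \<Longrightarrow> by_degree w \<phi> (x, {}) n = by_degree w \<psi> (x, {}) n"
  shows "\<phi> = \<psi>"
proof (rule cochain_eqI)
  show "\<phi> \<in> cochains T 0" "\<psi> \<in> cochains T 0" using assms by (auto simp: cocycle_iff)
  fix \<sigma> n assume "\<sigma> \<in> T" "card (snd \<sigma>) = 0" "cube_weight w \<sigma> \<le> n"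
  thus "by_degree w \<phi> \<sigma> n = by_degree w \<psi> \<sigma> n" using assms(3) vertex_cases[of \<sigma>] by auto
qed

definition comp :: "int \<Rightarrow> 'v cochain \<Rightarrow> 'v cochain" where
  "comp n \<phi> = (\<lambda>\<sigma> d. if int d = n - cube_weight w \<sigma> then \<phi> \<sigma> d else 0)"

lemma by_degree_comp: "by_degree w (comp n \<phi>) \<sigma> k = (if k = n then by_degree w \<phi> \<sigma> n else 0)"
  by (auto simp: by_degree_def comp_def)

lemma comp_cocycle:
  assumes "z \<in> cocycles T w 0"
  shows "comp n z \<in> cocycles T w 0"
proof -
  have zc: "z \<in> cochains T 0" using assms by (simp add: cocycle_iff)
  have "finite {d. comp n z \<sigma> d \<noteq> 0}" for \<sigma>
    by (rule finite_subset[OF _ cochainsD(1)[OF zc, of \<sigma>]]) (auto simp: comp_def)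
  moreover have "comp n z \<sigma> = 0" if "\<sigma> \<notin> T \<or> card (snd \<sigma>) \<noteq> 0" for \<sigma>
    using cochainsD(2)[OF zc that] by (auto simp: comp_def fun_eq_iff)
  ultimately have c: "comp n z \<in> cochains T 0"
    unfolding cochains_def T0plus_def mem_Collect_eq by blast
  have "cubical_diff (\<lambda>\<tau>. by_degree w (comp n z) \<tau> k) \<sigma> = 0"
    if "\<sigma> \<in> T" "cube_weight w \<sigma> \<le> k" for \<sigma> k
  proof (cases "k = n")
    case True thus ?thesis using assms that by (simp add: by_degree_comp cocycle_iff)
  qed (simp add: by_degree_comp cubical_diff_def)
  thus ?thesis using c by (simp add: cocycle_iff)
qed

definition m where "m = w x0"

lemma mN: "m \<le> N" using N[OF x0(1)] by (simp add: m_def)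

lemma x0_T: "(x0, {}) \<in> T" using x0(1) T0_T by auto

lemma min_weight: "min_weight T w = m"
  unfolding min_weight_def m_def
  by (rule Least_equality) (use x0_T x0(2) in auto)

definition tower :: "(nat \<Rightarrow> int) \<Rightarrow> 'v cochain" where
  "tower a \<sigma> = (if \<sigma> \<in> T \<and> snd \<sigma> = {} then (\<lambda>d. a (d + nat (w (fst \<sigma>) - m))) else 0)"

lemma by_degree_tower:
  assumes "(x, {}) \<in> T" "w x \<le> n"
  shows "by_degree w (tower a) (x, {}) n = a (nat (n - m))"
proof -
  have "w x0 \<le> w x" using x0(2) assms(1) .
  hence "nat (n - w x) + nat (w x - m) = nat (n - m)" using assms(2) by (simp add: m_def)
  thus ?thesis using assms by (simp add: by_degree_def tower_def)
qed

lemma tower_cocycle: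
  assumes "a \<in> T0plus"
  shows "tower a \<in> cocycles T w 0"
proof -
  have "finite {d. a (d + k) \<noteq> 0}" for k
  proof -
    have "finite ((\<lambda>d. d + k) -` {d. a d \<noteq> 0})"
      by (rule finite_vimageI) (use assms in \<open>auto simp: T0plus_def inj_on_def\<close>)
    thus ?thesis by (simp add: vimage_def)
  qed
  hence c: "tower a \<in> cochains T 0" by (auto simp: cochains_def T0plus_def tower_def)
  have "cubical_diff (\<lambda>\<tau>. by_degree w (tower a) \<tau> n) \<sigma> = 0" if "\<sigma> \<in> T" "cube_weight w \<sigma> \<le> n" for \<sigma> n
  proof (cases "card (snd \<sigma>) = 0 + 1")
    case True
    have "cubical_diff (\<lambda>\<tau>. by_degree w (tower a) \<tau> n) \<sigma> = cubical_diff (\<lambda>\<tau>. a (nat (n - m))) \<sigma>"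
    proof (rule cubical_diff_cong)
      fix j assume j: "j \<in> snd \<sigma>"
      have e: "card (snd \<sigma>) = 1" using True by simp
      note V = vertices_of_edge[OF closed that(1) j e]
      have "w (fst \<sigma>) \<le> n" "w (fst \<sigma> + basis j) \<le> n"
        using facet_weights[OF j, of w] that(2) unfolding V(3) cw_vertex by auto
      thus "by_degree w (tower a) (fst \<sigma> + basis j, snd \<sigma> - {j}) n = a (nat (n - m))"
        "by_degree w (tower a) (fst \<sigma>, snd \<sigma> - {j}) n = a (nat (n - m))"
        unfolding V(3) using V(1,2) by (auto intro!: by_degree_tower)
    qed
    thus ?thesis by (simp add: cubical_diff_def)
  next
    case False
    show ?thesis
      by (rule cubical_diff_wrong_dim[of 0], rule by_degree_wrong_dim[OF c], assumption, rule False)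
  qed
  thus ?thesis using c by (simp add: cocycle_iff)
qed

lemma tower_x0: "tower a (x0, {}) = a"
  using x0_T by (simp add: tower_def m_def)

lemma Upow_cocycle:
  assumes "z \<in> cocycles T w 0"
  shows "(\<lambda>\<sigma>. Upow 1 (z \<sigma>)) \<in> cocycles T w 0"
proof -
  have zc: "z \<in> cochains T 0" using assms by (simp add: cocycle_iff)
  have "finite {d. z \<sigma> (d + 1) \<noteq> 0}" for \<sigma>
  proof -
    have "finite ((\<lambda>d. d + 1) -` {d. z \<sigma> d \<noteq> 0})"
      by (rule finite_vimageI[OF cochainsD(1)[OF zc]]) (auto simp: inj_on_def)
    thus ?thesis by (simp add: vimage_def)
  qed
  hence f: "Upow 1 (z \<sigma>) \<in> T0plus" for \<sigma> by (simp add: T0plus_def Upow_def)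
  have "Upow 1 (z \<sigma>) = 0" if "\<sigma> \<notin> T \<or> card (snd \<sigma>) \<noteq> 0" for \<sigma>
    using cochainsD(2)[OF zc that] by (auto simp: Upow_def fun_eq_iff)
  with f have c: "(\<lambda>\<sigma>. Upow 1 (z \<sigma>)) \<in> cochains T 0"
    unfolding cochains_def mem_Collect_eq by blast
  have "cubical_diff (\<lambda>\<tau>. by_degree w (\<lambda>\<sigma>. Upow 1 (z \<sigma>)) \<tau> n) \<sigma> = 0" if "\<sigma> \<in> T" "cube_weight w \<sigma> \<le> n" for \<sigma> n
  proof -
    have e: "by_degree w (\<lambda>\<sigma>. Upow 1 (z \<sigma>)) \<tau> n = by_degree w z \<tau> (n + 1)" if "cube_weight w \<tau> \<le> n" for \<tau>
    proof -
      have "nat (n - cube_weight w \<tau>) + 1 = nat (n + 1 - cube_weight w \<tau>)" using that by linarith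
      thus ?thesis using that by (simp add: by_degree_def Upow_def)
    qed
    have "cubical_diff (\<lambda>\<tau>. by_degree w (\<lambda>\<sigma>. Upow 1 (z \<sigma>)) \<tau> n) \<sigma> = cubical_diff (\<lambda>\<tau>. by_degree w z \<tau> (n + 1)) \<sigma>"
    proof (rule cubical_diff_cong)
      fix j assume j: "j \<in> snd \<sigma>"
      show "by_degree w (\<lambda>\<sigma>. Upow 1 (z \<sigma>)) (fst \<sigma> + basis j, snd \<sigma> - {j}) n =
          by_degree w z (fst \<sigma> + basis j, snd \<sigma> - {j}) (n + 1)"
        "by_degree w (\<lambda>\<sigma>. Upow 1 (z \<sigma>)) (fst \<sigma>, snd \<sigma> - {j}) n =
          by_degree w z (fst \<sigma>, snd \<sigma> - {j}) (n + 1)"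
        using facet_weights[OF j, of w] that(2) by (intro e; linarith)+
    qed
    thus ?thesis using assms that by (simp add: cocycle_iff)
  qed
  thus ?thesis using c by (simp add: cocycle_iff)
qed

lemma zero_cocycle: "0 \<in> cocycles T w q"
  using cocycles_combination[of 0 "\<lambda>_. 0" T w q "\<lambda>_. 0"] by (simp add: zero_fun_def)

abbreviation split_off :: "'v cochain set \<Rightarrow> 'v cochain set \<Rightarrow> bool" where
  "split_off P R \<equiv> is_tower w m P \<and> graded_submodule w P \<and> graded_submodule w R \<and>
     P \<inter> R = {0} \<and> {\<phi> + \<psi> | \<phi> \<psi>. \<phi> \<in> P \<and> \<psi> \<in> R} = cocycles T w 0"

lemma split_off_exists: "\<exists>P R. split_off P R"
proof -
  define P where "P = tower ` T0plus"
  define R where "R = {\<phi> \<in> cocycles T w 0. \<phi> (x0, {}) = 0}"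
  have add: "tower (a + b) = tower a + tower b" for a b by (auto simp: tower_def fun_eq_iff)
  have sub: "tower (a - b) = tower a - tower b" for a b by (auto simp: tower_def fun_eq_iff)
  have inj: "inj_on tower T0plus" by (rule inj_onI) (metis tower_x0)
  have Ut: "tower (Upow 1 a) = (\<lambda>\<sigma>. Upow 1 (tower a \<sigma>))" for a
    by (auto simp: tower_def fun_eq_iff Upow_def)
  have T0p: "a - b \<in> T0plus" if "a \<in> T0plus" "b \<in> T0plus" for a b
  proof -
    have "{d. (a - b) d \<noteq> 0} \<subseteq> {d. a d \<noteq> 0} \<union> {d. b d \<noteq> 0}" by auto
    thus ?thesis using that unfolding T0plus_def by (auto intro: finite_subset)
  qed
  have UT: "Upow 1 a \<in> T0plus" if "a \<in> T0plus" for a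
  proof -
    have "finite ((\<lambda>d. d + 1) -` {d. a d \<noteq> 0})"
      by (rule finite_vimageI) (use that in \<open>auto simp: T0plus_def inj_on_def\<close>)
    thus ?thesis by (simp add: vimage_def T0plus_def Upow_def)
  qed
  have tow: "is_tower w m P" unfolding is_tower_def
  proof (intro exI[of _ tower] conjI ballI allI)
    show "bij_betw tower T0plus P" using inj by (simp add: bij_betw_def P_def)
    show "homogeneous w (int d + m) (tower (Uinv d))" for d unfolding homogeneous_def
    proof (intro allI impI)
      fix \<sigma> k assume H: "tower (Uinv d) \<sigma> k \<noteq> 0"
      hence \<sigma>: "\<sigma> \<in> T" "snd \<sigma> = {}" "k + nat (w (fst \<sigma>) - m) = d"
        by (auto simp: tower_def Uinv_def split: if_splits)
      have "\<sigma> = (fst \<sigma>, {})" using \<sigma>(2) by (cases \<sigma>) auto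
      hence "m \<le> w (fst \<sigma>)" "cube_weight w \<sigma> = w (fst \<sigma>)"
        using x0(2)[of "fst \<sigma>"] \<sigma>(1) cw_vertex[of "fst \<sigma>"] by (auto simp: m_def)
      thus "int k = int d + m - cube_weight w \<sigma>" using \<sigma>(3) by linarith
    qed
  qed (use add Ut in auto)
  have gP: "graded_submodule w P" unfolding graded_submodule_def
  proof (intro conjI ballI allI)
    have "0 \<in> T0plus" by (simp add: T0plus_def)
    moreover have "tower 0 = 0" by (auto simp: tower_def fun_eq_iff)
    ultimately show "0 \<in> P" using imageI[of 0 T0plus tower] by (simp add: P_def)
    show "\<phi> - \<psi> \<in> P" if \<phi>: "\<phi> \<in> P" and \<psi>: "\<psi> \<in> P" for \<phi> \<psi>
    proof -
      obtain a b where "a \<in> T0plus" "\<phi> = tower a" "b \<in> T0plus" "\<psi> = tower b"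
        using \<phi> \<psi> by (auto simp: P_def)
      thus ?thesis using imageI[OF T0p[of a b], of tower] sub[of a b] by (simp add: P_def)
    qed
    show "(\<lambda>\<sigma>. Upow 1 (\<phi> \<sigma>)) \<in> P" if \<phi>: "\<phi> \<in> P" for \<phi>
    proof -
      obtain a where "a \<in> T0plus" "\<phi> = tower a" using \<phi> by (auto simp: P_def)
      thus ?thesis using imageI[OF UT[of a], of tower] Ut[of a] by (simp add: P_def)
    qed
    fix \<phi> n assume "\<phi> \<in> P"
    then obtain a where a: "a \<in> T0plus" "\<phi> = tower a" by (auto simp: P_def)
    define b where "b = (\<lambda>d. if int d + m = n then a d else 0)"
    have b: "b \<in> T0plus" using a(1) unfolding T0plus_def b_def mem_Collect_eq
      by (rule rev_finite_subset) auto
    have "comp n \<phi> = tower b"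
    proof (rule degree0_eqI)
      show "comp n \<phi> \<in> cocycles T w 0" "tower b \<in> cocycles T w 0"
        using comp_cocycle tower_cocycle a b by auto
      fix x k assume x: "(x, {}) \<in> T" "w x \<le> k"
      have "m \<le> k" using x0(2)[OF x(1)] x(2) by (simp add: m_def)
      thus "by_degree w (comp n \<phi>) (x, {}) k = by_degree w (tower b) (x, {}) k"
        using x by (auto simp: by_degree_comp a(2) by_degree_tower b_def)
    qed
    thus "(\<lambda>\<sigma> d. if int d = n - cube_weight w \<sigma> then \<phi> \<sigma> d else 0) \<in> P"
      using b unfolding comp_def P_def by auto
  qed
  have gR: "graded_submodule w R" unfolding graded_submodule_def
  proof (intro conjI ballI allI)
    show "0 \<in> R" using zero_cocycle by (simp add: R_def)
    show "\<phi> - \<psi> \<in> R" if "\<phi> \<in> R" "\<psi> \<in> R" for \<phi> \<psi>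
      using that cocycle_minus[of \<phi> \<psi>] by (simp add: R_def)
    show "(\<lambda>\<sigma>. Upow 1 (\<phi> \<sigma>)) \<in> R" if "\<phi> \<in> R" for \<phi>
      using that Upow_cocycle[of \<phi>] by (simp add: R_def Upow_def zero_fun_def)
    show "(\<lambda>\<sigma> d. if int d = n - cube_weight w \<sigma> then \<phi> \<sigma> d else 0) \<in> R" if "\<phi> \<in> R" for \<phi> n
      using that comp_cocycle[of \<phi> n] by (auto simp: R_def comp_def zero_fun_def fun_eq_iff)
  qed
  have PR: "P \<inter> R = {0}"
  proof -
    have "\<phi> = 0" if "\<phi> \<in> P" "\<phi> \<in> R" for \<phi>
    proof -
      obtain a where a: "\<phi> = tower a" using \<open>\<phi> \<in> P\<close> by (auto simp: P_def)
      have "a = 0" using that(2) tower_x0[of a] by (simp add: R_def a)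
      thus ?thesis unfolding a by (auto simp: tower_def fun_eq_iff)
    qed
    moreover have "0 \<in> P" "0 \<in> R" using gP gR unfolding graded_submodule_def by auto
    ultimately show ?thesis by auto
  qed
  have sum: "{\<phi> + \<psi> | \<phi> \<psi>. \<phi> \<in> P \<and> \<psi> \<in> R} = cocycles T w 0"
  proof (intro equalityI subsetI)
    fix z assume "z \<in> {\<phi> + \<psi> | \<phi> \<psi>. \<phi> \<in> P \<and> \<psi> \<in> R}"
    then obtain a \<psi> where z: "z = tower a + \<psi>" "a \<in> T0plus" "\<psi> \<in> cocycles T w 0" by (auto simp: P_def R_def)
    have "z = tower a - (0 - \<psi>)" using z(1) by simp
    moreover have "tower a - (0 - \<psi>) \<in> cocycles T w 0"
      by (intro cocycle_minus tower_cocycle zero_cocycle z)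
    ultimately show "z \<in> cocycles T w 0" by simp
  next
    fix z assume z: "z \<in> cocycles T w 0"
    define a where "a = z (x0, {})"
    have "z \<in> cochains T 0" using z by (simp add: cocycle_iff)
    hence a: "a \<in> T0plus" unfolding a_def T0plus_def using cochainsD(1) by blast
    have "z - tower a \<in> R" using cocycle_minus[OF z tower_cocycle[OF a]] tower_x0[of a]
      by (simp add: R_def a_def)
    moreover have "tower a \<in> P" using a by (simp add: P_def)
    moreover have "z = tower a + (z - tower a)" by simp
    ultimately show "z \<in> {\<phi> + \<psi> | \<phi> \<psi>. \<phi> \<in> P \<and> \<psi> \<in> R}" by blast
  qed
  show ?thesis using tow gP gR PR sum by blast
qed

lemma graded_submodule_scale:
  assumes "graded_submodule w M" "\<phi> \<in> M"
  shows "(\<lambda>\<sigma> d. (c::int) * \<phi> \<sigma> d) \<in> M"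
proof -
  have z: "0 \<in> M" and mi: "\<And>\<phi> \<psi>. \<phi> \<in> M \<Longrightarrow> \<psi> \<in> M \<Longrightarrow> \<phi> - \<psi> \<in> M"
    using assms(1) unfolding graded_submodule_def by blast+
  show ?thesis
  proof (induction c rule: int_induct[where k = 0])
    case base thus ?case using z by (simp add: zero_fun_def)
  next
    case (step1 i)
    have "(\<lambda>\<sigma> d. i * \<phi> \<sigma> d) - (0 - \<phi>) \<in> M" using mi step1 z assms(2) by blast
    moreover have "(\<lambda>\<sigma> d. i * \<phi> \<sigma> d) - (0 - \<phi>) = (\<lambda>\<sigma> d. (i + 1) * \<phi> \<sigma> d)"
      by (auto simp: fun_eq_iff algebra_simps)
    ultimately show ?case by simp
  next
    case (step2 i)
    have "(\<lambda>\<sigma> d. i * \<phi> \<sigma> d) - \<phi> \<in> M" using mi step2 assms(2) by blast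
    moreover have "(\<lambda>\<sigma> d. i * \<phi> \<sigma> d) - \<phi> = (\<lambda>\<sigma> d. (i - 1) * \<phi> \<sigma> d)"
      by (auto simp: fun_eq_iff algebra_simps)
    ultimately show ?case by simp
  qed
qed

lemma graded_submodule_combination:
  assumes "graded_submodule w M" "\<And>i. i < n \<Longrightarrow> z i \<in> M"
  shows "(\<lambda>\<sigma> d. \<Sum>i<(n::nat). c i * z i \<sigma> d) \<in> M"
  using assms(2)
proof (induction n)
  case 0
  have "0 \<in> M" using assms(1) unfolding graded_submodule_def by blast
  thus ?case by (simp add: zero_fun_def)
next
  case (Suc n)
  have mi: "\<And>\<phi> \<psi>. \<phi> \<in> M \<Longrightarrow> \<psi> \<in> M \<Longrightarrow> \<phi> - \<psi> \<in> M"
    using assms(1) unfolding graded_submodule_def by blast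
  have "(\<lambda>\<sigma> d. \<Sum>i<n. c i * z i \<sigma> d) - (\<lambda>\<sigma> d. - c n * z n \<sigma> d) \<in> M"
    by (rule mi[OF Suc.IH graded_submodule_scale[OF assms(1)]]) (use Suc.prems in auto)
  moreover have "(\<lambda>\<sigma> d. \<Sum>i<n. c i * z i \<sigma> d) - (\<lambda>\<sigma> d. - c n * z n \<sigma> d) = (\<lambda>\<sigma> d. \<Sum>i<Suc n. c i * z i \<sigma> d)"
    by (auto simp: fun_eq_iff)
  ultimately show ?case by simp
qed

lemma by_degree_scale: "by_degree w (\<lambda>\<sigma> d. c * \<phi> \<sigma> d) \<sigma> n = c * by_degree w \<phi> \<sigma> n"
  by (simp add: by_degree_def)

lemma by_degree_zero: "by_degree w 0 \<sigma> n = 0"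
  by (simp add: by_degree_def)

lemma trunc_add: "trunc q (\<phi> + \<psi>) = trunc q \<phi> + trunc q \<psi>"
  by (auto simp: trunc_def by_degree_def fun_eq_iff)

lemma trunc_minus: "trunc q (\<phi> - \<psi>) = trunc q \<phi> - trunc q \<psi>"
  by (auto simp: trunc_def by_degree_def fun_eq_iff)

lemma trunc_scale: "trunc q (\<lambda>\<sigma> d. c * \<phi> \<sigma> d) = (\<lambda>x. of_int c * trunc q \<phi> x)"
  by (auto simp: trunc_def by_degree_def fun_eq_iff)

lemma trunc_eq_0:
  assumes "z \<in> cocycles T w 0" "trunc 0 z = 0" "n < N"
  shows "by_degree w z \<sigma> n = 0"
proof (rule cocycle0_vanishes[OF assms(1)])
  fix x assume x: "(x, {}) \<in> T0"
  show "by_degree w z (x, {}) n = 0"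
  proof (cases "w x \<le> n")
    case True
    hence "((x, {}), n) \<in> X 0" using x assms(3) by (simp add: X_def)
    hence "trunc 0 z ((x, {}), n) = of_int (by_degree w z (x, {}) n)" by (simp add: trunc_def)
    thus ?thesis using assms(2) by simp
  qed (simp add: by_degree_def)
qed

lemma rank_split_off:
  assumes "split_off P R"
  shows "int (quot_rank R {0}) = int (fv.dim (ZQ 0)) - (N - m)"
proof -
  let ?Z = "cocycles T w 0"
  have gP: "graded_submodule w P" and gR: "graded_submodule w R" and PR: "P \<inter> R = {0}"
    and sum: "{\<phi> + \<psi> | \<phi> \<psi>. \<phi> \<in> P \<and> \<psi> \<in> R} = ?Z" and tow: "is_tower w m P"
    using assms by auto
  from tow obtain f where f: "bij_betw f T0plus P"
      "\<And>a b. a \<in> T0plus \<Longrightarrow> b \<in> T0plus \<Longrightarrow> f (a + b) = f a + f b"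
      "\<And>d. homogeneous w (int d + m) (f (Uinv d))" unfolding is_tower_def by blast
  have zP: "0 \<in> P" and zR: "0 \<in> R" using gP gR unfolding graded_submodule_def by blast+
  have PZ: "P \<subseteq> ?Z"
  proof
    fix \<phi> assume "\<phi> \<in> P"
    hence "\<phi> + 0 \<in> {\<phi> + \<psi> | \<phi> \<psi>. \<phi> \<in> P \<and> \<psi> \<in> R}" using zR by blast
    thus "\<phi> \<in> ?Z" using sum by simp
  qed
  have RZ: "R \<subseteq> ?Z"
  proof
    fix \<phi> assume "\<phi> \<in> R"
    hence "0 + \<phi> \<in> {\<phi> + \<psi> | \<phi> \<psi>. \<phi> \<in> P \<and> \<psi> \<in> R}" using zP by blast
    thus "\<phi> \<in> ?Z" using sum by simp
  qed
  have T00: "0 \<in> T0plus" by (simp add: T0plus_def)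
  have f0: "f 0 = 0" using f(2)[OF T00 T00] by simp
  have U: "Uinv d \<in> T0plus" for d by (simp add: T0plus_def Uinv_def)
  define e where "e d = f (Uinv d)" for d
  have eP: "e d \<in> P" for d using f(1) U unfolding e_def bij_betw_def by blast
  have eZ: "e d \<in> ?Z" for d using eP PZ by blast
  have e0: "e d \<noteq> 0" for d
  proof
    assume "e d = 0"
    hence "Uinv d = 0" using f(1) f0 U T00 unfolding e_def bij_betw_def inj_on_def by metis
    hence "Uinv d d = 0" by simp
    thus False by (simp add: Uinv_def)
  qed
  have e_deg: "by_degree w (e d) \<sigma> n = 0" if "n \<noteq> int d + m" for d \<sigma> n
  proof (rule ccontr)
    assume H: "by_degree w (e d) \<sigma> n \<noteq> 0"
    hence *: "cube_weight w \<sigma> \<le> n" "e d \<sigma> (nat (n - cube_weight w \<sigma>)) \<noteq> 0"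
      by (auto simp: by_degree_def split: if_splits)
    have "int (nat (n - cube_weight w \<sigma>)) = int d + m - cube_weight w \<sigma>"
      using f(3)[of d] *(2) unfolding homogeneous_def e_def by blast
    thus False using *(1) that by simp
  qed
  have R_comp: "comp n \<rho> \<in> R" if "\<rho> \<in> R" for \<rho> n
    using gR that unfolding graded_submodule_def comp_def by blast
  have P_comp: "comp n \<rho> \<in> P" if "\<rho> \<in> P" for \<rho> n
    using gP that unfolding graded_submodule_def comp_def by blast
  have R_high: "\<rho> = 0" if \<rho>: "\<rho> \<in> R" and low: "\<And>n \<sigma>. n < N \<Longrightarrow> by_degree w \<rho> \<sigma> n = 0" for \<rho>
  proof (rule degree0_eqI)
    show \<rho>Z: "\<rho> \<in> ?Z" using \<rho> RZ by blast
    show "0 \<in> ?Z" by (rule zero_cocycle)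
    fix x n assume x: "(x, {}) \<in> T" "w x \<le> n"
    show "by_degree w \<rho> (x, {}) n = by_degree w 0 (x, {}) n"
    proof (cases "n < N")
      case True thus ?thesis using low by (simp add: by_degree_zero)
    next
      case False
      hence n: "n \<ge> N" by simp
      define d where "d = nat (n - m)"
      have d: "int d + m = n" using n mN by (simp add: d_def)
      obtain c where c: "\<forall>x. (x, {}) \<in> T \<longrightarrow> w x \<le> n \<longrightarrow> by_degree w \<rho> (x, {}) n = c"
        using cocycle0_constant[OF \<rho>Z n] by blast
      obtain c' where c': "\<forall>x. (x, {}) \<in> T \<longrightarrow> w x \<le> n \<longrightarrow> by_degree w (e d) (x, {}) n = c'"
        using cocycle0_constant[OF eZ n] by blast
      have "c' \<noteq> 0"
      proof
        assume "c' = 0"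
        have "e d = 0"
        proof (rule degree0_eqI[OF eZ zero_cocycle])
          fix x k assume "(x, {}) \<in> T" "w x \<le> k"
          thus "by_degree w (e d) (x, {}) k = by_degree w 0 (x, {}) k"
            using c' \<open>c' = 0\<close> e_deg[of k d] d by (cases "k = n") (auto simp: by_degree_zero)
        qed
        thus False using e0 by blast
      qed
      have s1: "(\<lambda>\<sigma> k. c' * comp n \<rho> \<sigma> k) \<in> R" by (rule graded_submodule_scale[OF gR R_comp[OF \<rho>]])
      have s2: "(\<lambda>\<sigma> k. c * e d \<sigma> k) \<in> P" by (rule graded_submodule_scale[OF gP eP])
      have "(\<lambda>\<sigma> k. c' * comp n \<rho> \<sigma> k) = (\<lambda>\<sigma> k. c * e d \<sigma> k)"
      proof (rule degree0_eqI)
        show "(\<lambda>\<sigma> k. c' * comp n \<rho> \<sigma> k) \<in> ?Z" "(\<lambda>\<sigma> k. c * e d \<sigma> k) \<in> ?Z" using s1 s2 PZ RZ by auto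
        fix y k assume "(y, {}) \<in> T" "w y \<le> k"
        thus "by_degree w (\<lambda>\<sigma> k. c' * comp n \<rho> \<sigma> k) (y, {}) k = by_degree w (\<lambda>\<sigma> k. c * e d \<sigma> k) (y, {}) k"
          using c c' e_deg[of k d] d by (cases "k = n") (auto simp: by_degree_scale by_degree_comp)
      qed
      hence "(\<lambda>\<sigma> k. c' * comp n \<rho> \<sigma> k) = 0" using s1 s2 PR by auto
      hence "by_degree w (\<lambda>\<sigma> k. c' * comp n \<rho> \<sigma> k) (x, {}) n = 0" by (simp only: by_degree_zero)
      hence "c' * c = 0" using c x by (simp add: by_degree_scale by_degree_comp)
      thus ?thesis using \<open>c' \<noteq> 0\<close> c x by (simp add: by_degree_zero)
    qed
  qed
  have miP: "\<And>\<phi> \<psi>. \<phi> \<in> P \<Longrightarrow> \<psi> \<in> P \<Longrightarrow> \<phi> - \<psi> \<in> P"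
    using gP unfolding graded_submodule_def by blast
  have plP: "\<phi> + \<psi> \<in> P" if "\<phi> \<in> P" "\<psi> \<in> P" for \<phi> \<psi>
    using miP[OF that(1) miP[OF zP that(2)]] by simp
  \<comment> \<open>The complement has the rank of the quotient by the tower.\<close>
  have "quot_rank R {0} = quot_rank ?Z P"
  proof -
    have "(\<exists>z :: nat \<Rightarrow> 'v cochain. (\<forall>i<n. z i \<in> R) \<and>
       (\<forall>c :: nat \<Rightarrow> int. (\<lambda>\<sigma> d. \<Sum>i<n. c i * z i \<sigma> d) \<in> {0} \<longrightarrow> (\<forall>i<n. c i = 0))) \<longleftrightarrow>
      (\<exists>z :: nat \<Rightarrow> 'v cochain. (\<forall>i<n. z i \<in> ?Z) \<and>
       (\<forall>c :: nat \<Rightarrow> int. (\<lambda>\<sigma> d. \<Sum>i<n. c i * z i \<sigma> d) \<in> P \<longrightarrow> (\<forall>i<n. c i = 0)))" (is "?L \<longleftrightarrow> ?R") for n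
    proof
      assume ?L
      then obtain z where z: "\<And>i. i < n \<Longrightarrow> z i \<in> R"
        "\<And>c. (\<lambda>\<sigma> d. \<Sum>i<n. c i * z i \<sigma> d) = 0 \<Longrightarrow> (\<forall>i<n. c i = (0::int))" by auto
      have "(\<lambda>\<sigma> d. \<Sum>i<n. c i * z i \<sigma> d) \<in> R" for c
        by (rule graded_submodule_combination[OF gR z(1)])
      hence "(\<lambda>\<sigma> d. \<Sum>i<n. c i * z i \<sigma> d) \<in> P \<Longrightarrow> (\<forall>i<n. c i = (0::int))" for c
        using PR z(2)[of c] by blast
      thus ?R using z(1) RZ by blast
    next
      assume ?R
      then obtain z where z: "\<And>i. i < n \<Longrightarrow> z i \<in> ?Z"
        "\<And>c. (\<lambda>\<sigma> d. \<Sum>i<n. c i * z i \<sigma> d) \<in> P \<Longrightarrow> (\<forall>i<n. c i = (0::int))" by blast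
      have "\<exists>u. fst u \<in> P \<and> snd u \<in> R \<and> z i = fst u + snd u" if "i < n" for i
      proof -
        have "z i \<in> {\<phi> + \<psi> | \<phi> \<psi>. \<phi> \<in> P \<and> \<psi> \<in> R}" using z(1)[OF that] sum by simp
        then obtain \<phi> \<psi> where "\<phi> \<in> P" "\<psi> \<in> R" "z i = \<phi> + \<psi>" by blast
        thus ?thesis by (intro exI[of _ "(\<phi>, \<psi>)"]) simp
      qed
      then obtain u where u: "\<And>i. i < n \<Longrightarrow> fst (u i) \<in> P \<and> snd (u i) \<in> R \<and> z i = fst (u i) + snd (u i)"
        by metis
      have "\<forall>i<n. c i = 0" if c: "(\<lambda>\<sigma> d. \<Sum>i<n. c i * snd (u i) \<sigma> d) \<in> {0}" for c :: "nat \<Rightarrow> int"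
      proof (rule z(2))
        have c0: "(\<Sum>i<n. c i * snd (u i) \<sigma> d) = 0" for \<sigma> d
        proof -
          have "(\<lambda>\<sigma> d. \<Sum>i<n. c i * snd (u i) \<sigma> d) = 0" using c by blast
          from fun_cong[OF fun_cong[OF this, of \<sigma>], of d] show ?thesis by simp
        qed
        have "(\<lambda>\<sigma> d. \<Sum>i<n. c i * z i \<sigma> d) = (\<lambda>\<sigma> d. \<Sum>i<n. c i * fst (u i) \<sigma> d)"
        proof (intro HOL.ext)
          fix \<sigma> d
          have "(\<Sum>i<n. c i * z i \<sigma> d) = (\<Sum>i<n. c i * fst (u i) \<sigma> d) + (\<Sum>i<n. c i * snd (u i) \<sigma> d)"
            unfolding sum.distrib[symmetric] by (rule sum.cong) (auto simp: u algebra_simps)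
          thus "(\<Sum>i<n. c i * z i \<sigma> d) = (\<Sum>i<n. c i * fst (u i) \<sigma> d)" using c0 by simp
        qed
        also have "\<dots> \<in> P" by (rule graded_submodule_combination[OF gP]) (use u in auto)
        finally show "(\<lambda>\<sigma> d. \<Sum>i<n. c i * z i \<sigma> d) \<in> P" .
      qed
      thus ?L using u by (intro exI[of _ "\<lambda>i. snd (u i)"]) auto
    qed
    thus ?thesis unfolding quot_rank_def by simp
  qed
  moreover have "quot_rank ?Z P + fv.dim (fv.span (trunc 0 ` P)) = fv.dim (ZQ 0)"
  proof (rule quot_rank_eq_dim[OF finite_X subspace_ZQ, where r = "trunc 0"])
    show "ZQ 0 \<subseteq> supported (X 0)" by (auto simp: ZQ_def)
    show "fv.subspace (fv.span (trunc 0 ` P))" by (rule fv.subspace_span)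
    show "fv.span (trunc 0 ` P) \<subseteq> ZQ 0"
      by (rule fv.span_minimal[OF _ subspace_ZQ]) (use PZ trunc_cocycle in auto)
    show "trunc 0 z \<in> fv.span (trunc 0 ` P)" if "z \<in> P" for z using that by (intro fv.span_base) auto
    fix z assume z: "z \<in> ?Z" "trunc 0 z \<in> fv.span (trunc 0 ` P)"
    define H where "H = {x. \<exists>M::int. M > 0 \<and> (\<exists>p\<in>P. trunc 0 p = (\<lambda>y. of_int M * x y))}"
    have "fv.subspace H" unfolding fv.subspace_def
    proof (intro conjI ballI allI)
      have "trunc 0 0 = (\<lambda>y. of_int 1 * (0 :: 'v cube \<times> int \<Rightarrow> rat) y)"
        by (auto simp: trunc_def by_degree_def fun_eq_iff)
      thus "0 \<in> H" unfolding H_def mem_Collect_eq using zP zero_less_one by metis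
      fix x y assume "x \<in> H" "y \<in> H"
      then obtain M p M' p' where *: "M > 0" "p \<in> P" "trunc 0 p = (\<lambda>v. of_int M * x v)"
        "M' > 0" "p' \<in> P" "trunc 0 p' = (\<lambda>v. of_int M' * y v)" unfolding H_def by blast
      have "trunc 0 ((\<lambda>\<sigma> d. M' * p \<sigma> d) + (\<lambda>\<sigma> d. M * p' \<sigma> d)) = (\<lambda>v. of_int (M * M') * (x + y) v)"
      proof (rule HOL.ext)
        fix v
        have "trunc 0 ((\<lambda>\<sigma> d. M' * p \<sigma> d) + (\<lambda>\<sigma> d. M * p' \<sigma> d)) v =
            of_int M' * trunc 0 p v + of_int M * trunc 0 p' v"
          by (simp only: trunc_add trunc_scale plus_fun_apply)
        also have "\<dots> = of_int M' * (of_int M * x v) + of_int M * (of_int M' * y v)"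
          by (simp only: *(3,6))
        also have "\<dots> = of_int (M * M') * (x + y) v"
          by (simp only: of_int_mult plus_fun_apply distrib_left mult.assoc mult.left_commute mult.commute)
        finally show "trunc 0 ((\<lambda>\<sigma> d. M' * p \<sigma> d) + (\<lambda>\<sigma> d. M * p' \<sigma> d)) v = of_int (M * M') * (x + y) v" .
      qed
      moreover have "(\<lambda>\<sigma> d. M' * p \<sigma> d) + (\<lambda>\<sigma> d. M * p' \<sigma> d) \<in> P"
        by (intro plP graded_submodule_scale[OF gP] *)
      moreover have "M * M' > 0" using * by simp
      ultimately show "x + y \<in> H" unfolding H_def by blast
    next
      fix c x assume "x \<in> H"
      then obtain M p where *: "M > 0" "p \<in> P" "trunc 0 p = (\<lambda>v. of_int M * x v)" unfolding H_def by blast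
      obtain a b where ab: "quotient_of c = (a, b)" by force
      have b: "b > 0" using quotient_of_denom_pos[OF ab] .
      have c: "c = of_int a / of_int b" using quotient_of_div[OF ab] .
      have "trunc 0 (\<lambda>\<sigma> d. a * p \<sigma> d) = (\<lambda>v. of_int (M * b) * (c * x v))"
      proof (rule HOL.ext)
        fix v
        have "trunc 0 (\<lambda>\<sigma> d. a * p \<sigma> d) v = of_int a * (of_int M * x v)"
          by (simp only: trunc_scale *(3))
        thus "trunc 0 (\<lambda>\<sigma> d. a * p \<sigma> d) v = of_int (M * b) * (c * x v)"
          using b by (simp add: c)
      qed
      moreover have "(\<lambda>\<sigma> d. a * p \<sigma> d) \<in> P" by (intro graded_submodule_scale[OF gP] *)
      moreover have "M * b > 0" using * b by simp
      ultimately show "(\<lambda>v. c * x v) \<in> H" unfolding H_def by blast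
    qed
    moreover have "trunc 0 ` P \<subseteq> H"
    proof
      fix x assume "x \<in> trunc 0 ` P"
      then obtain p where "p \<in> P" "x = trunc 0 p" by blast
      thus "x \<in> H" unfolding H_def by (auto intro!: exI[of _ 1])
    qed
    ultimately have "trunc 0 z \<in> H" using z(2) fv.span_minimal by blast
    then obtain M p where *: "M > 0" "p \<in> P" "trunc 0 p = (\<lambda>v. of_int M * trunc 0 z v)" unfolding H_def by blast
    define y where "y = (\<lambda>\<sigma> d. M * z \<sigma> d) - p"
    have Mz: "(\<lambda>\<sigma> d. M * z \<sigma> d) \<in> ?Z"
      using cocycles_combination[of "Suc 0" "\<lambda>_. z" T w 0 "\<lambda>_. M"] z(1) by simp
    have yZ: "y \<in> ?Z" unfolding y_def using cocycle_minus[OF Mz] *(2) PZ by blast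
    have "trunc 0 y = 0" unfolding y_def trunc_minus trunc_scale *(3) by simp
    hence ylow: "by_degree w y \<sigma> n = 0" if "n < N" for \<sigma> n using trunc_eq_0[OF yZ _ that] by blast
    have "y \<in> {\<phi> + \<psi> | \<phi> \<psi>. \<phi> \<in> P \<and> \<psi> \<in> R}" using yZ sum by simp
    then obtain p' \<rho> where pr: "p' \<in> P" "\<rho> \<in> R" "y = p' + \<rho>" by blast
    have "\<rho> = 0"
    proof (rule R_high[OF pr(2)])
      fix n \<sigma> assume n: "n < N"
      have "comp n \<rho> = 0 - comp n p'"
      proof (rule degree0_eqI)
        show "comp n \<rho> \<in> ?Z" using pr RZ comp_cocycle by blast
        show "0 - comp n p' \<in> ?Z" using pr PZ comp_cocycle cocycle_minus zero_cocycle by blast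
        fix x k assume "(x, {}) \<in> T" "w x \<le> k"
        have "by_degree w (0 - comp n p') (x, {}) k = - by_degree w (comp n p') (x, {}) k"
          by (simp add: by_degree_def)
        moreover have "by_degree w p' (x, {}) n + by_degree w \<rho> (x, {}) n = 0"
          using ylow[OF n, of "(x, {})"] unfolding pr(3) by (simp add: by_degree_def split: if_splits)
        ultimately show "by_degree w (comp n \<rho>) (x, {}) k = by_degree w (0 - comp n p') (x, {}) k"
          by (simp add: by_degree_comp)
      qed
      moreover have "0 - comp n p' \<in> P" using miP[OF zP P_comp[OF pr(1)]] .
      ultimately have "comp n \<rho> \<in> P" by simp
      hence "comp n \<rho> \<in> P \<inter> R" using R_comp[OF pr(2), of n] by blast
      hence "comp n \<rho> = 0" using PR by simp
      thus "by_degree w \<rho> \<sigma> n = 0" using by_degree_comp[of n \<rho> \<sigma> n] by (simp add: by_degree_zero)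
    qed
    hence "(\<lambda>\<sigma> d. M * z \<sigma> d) = p' + p" using pr(3) unfolding y_def by (simp add: algebra_simps)
    hence "(\<lambda>\<sigma> d. M * z \<sigma> d) \<in> P" using plP[OF pr(1) *(2)] by simp
    thus "\<exists>m::int. m > 0 \<and> (\<lambda>\<sigma> d. m * z \<sigma> d) \<in> P" using *(1) by blast
  qed (use cocycles_combination trunc_combination trunc_cocycle trunc_surj in blast)+
  moreover have "fv.dim (fv.span (trunc 0 ` P)) = nat (N - m)"
  proof -
    define k where "k = nat (N - m)"
    define E where "E = (\<lambda>d. trunc 0 (e d)) ` {..<k}"
    have low_nz: "trunc 0 (e d) \<noteq> 0" if "d < k" for d
    proof
      assume "trunc 0 (e d) = 0"
      hence z: "by_degree w (e d) \<sigma> n = 0" if "n < N" for \<sigma> n using trunc_eq_0[OF eZ _ that] by blast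
      have "int d + m < N" using that by (simp add: k_def)
      have "e d = 0"
      proof (rule degree0_eqI[OF eZ zero_cocycle])
        fix x n
        show "by_degree w (e d) (x, {}) n = by_degree w 0 (x, {}) n"
          using z \<open>int d + m < N\<close> e_deg by (cases "n = int d + m") (auto simp: by_degree_zero)
      qed
      thus False using e0 by blast
    qed
    have high: "trunc 0 (e d) = 0" if "d \<ge> k" for d
    proof -
      have "int d + m \<ge> N" using that by (simp add: k_def)
      thus ?thesis using e_deg by (auto simp: trunc_def X_def fun_eq_iff)
    qed
    have deg: "trunc 0 (e d) (\<sigma>, n) = 0" if "n \<noteq> int d + m" for d \<sigma> n
      using e_deg[OF that] by (simp add: trunc_def)
    have spanE: "fv.span (trunc 0 ` P) = fv.span E"
    proof
      have "E \<subseteq> trunc 0 ` P" using eP by (auto simp: E_def)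
      thus "fv.span E \<subseteq> fv.span (trunc 0 ` P)" by (rule fv.span_mono)
      have eE: "trunc 0 (e d) \<in> fv.span E" for d
        using high[of d] fv.span_zero[of E] by (cases "d < k") (auto simp: E_def intro: fv.span_base)
      have mono: "trunc 0 (f (\<lambda>d'. if d' = d then c else 0)) \<in> fv.span E" for d and c :: int
      proof -
        have mT: "(\<lambda>d'. if d' = d then c else 0) \<in> T0plus" for c :: int by (simp add: T0plus_def)
        have "trunc 0 (f (\<lambda>d'. if d' = d then c else 0)) = (\<lambda>x. of_int c * trunc 0 (e d) x)"
        proof (induction c rule: int_induct[where k = 0])
          case base
          have eq: "(\<lambda>d'. if d' = d then 0 else 0) = (0 :: nat \<Rightarrow> int)" by auto
          show ?case unfolding eq f0 by (auto simp: trunc_def by_degree_def fun_eq_iff)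
        next
          case (step1 i)
          have "(\<lambda>d'. if d' = d then i + 1 else 0) = (\<lambda>d'. if d' = d then i else 0) + Uinv d"
            by (auto simp: fun_eq_iff Uinv_def)
          hence "f (\<lambda>d'. if d' = d then i + 1 else 0) = f (\<lambda>d'. if d' = d then i else 0) + e d"
            using f(2)[OF mT U, of i d] by (simp add: e_def)
          hence "trunc 0 (f (\<lambda>d'. if d' = d then i + 1 else 0)) =
              (\<lambda>x. of_int i * trunc 0 (e d) x) + trunc 0 (e d)"
            using step1 by (simp only: trunc_add)
          thus ?case by (simp add: fun_eq_iff algebra_simps)
        next
          case (step2 i)
          have "(\<lambda>d'. if d' = d then i else 0) = (\<lambda>d'. if d' = d then i - 1 else 0) + Uinv d"
            by (auto simp: fun_eq_iff Uinv_def)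
          hence "f (\<lambda>d'. if d' = d then i else 0) = f (\<lambda>d'. if d' = d then i - 1 else 0) + e d"
            using f(2)[OF mT U, of "i - 1" d] by (simp add: e_def)
          hence "trunc 0 (f (\<lambda>d'. if d' = d then i - 1 else 0)) =
              trunc 0 (f (\<lambda>d'. if d' = d then i else 0)) - trunc 0 (e d)"
            by (simp add: trunc_add)
          also have "\<dots> = (\<lambda>x. of_int i * trunc 0 (e d) x) - trunc 0 (e d)"
            using step2 by simp
          finally show ?case by (simp add: fun_eq_iff algebra_simps)
        qed
        thus ?thesis using fv.span_scale[OF eE[of d]] by simp
      qed
      have tr: "trunc 0 (f a) \<in> fv.span E" if "\<forall>d\<ge>b. a d = 0" for a :: "nat \<Rightarrow> int" and b :: nat
        using that
      proof (induction b arbitrary: a)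
        case 0
        hence "a = 0" by (auto simp: fun_eq_iff)
        hence "f a = 0" by (simp only: f0)
        hence "trunc 0 (f a) = 0" by (auto simp: trunc_def by_degree_def fun_eq_iff)
        thus ?case using fv.span_zero[of E] by (simp only:)
      next
        case (Suc b)
        define a' where "a' = a(b := 0)"
        have fa: "finite {d. a d \<noteq> 0}"
        proof (rule finite_subset[of _ "{..<Suc b}"])
          have "d < Suc b" if "a d \<noteq> 0" for d
            using Suc.prems that by (cases "d < Suc b") auto
          thus "{d. a d \<noteq> 0} \<subseteq> {..<Suc b}" by blast
        qed simp
        have a': "a' \<in> T0plus" unfolding T0plus_def a'_def mem_Collect_eq
          by (rule finite_subset[OF _ fa]) auto
        have "a = a' + (\<lambda>d'. if d' = b then a b else 0)" by (auto simp: a'_def fun_eq_iff)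
        hence "f a = f a' + f (\<lambda>d'. if d' = b then a b else 0)"
          using f(2)[OF a', of "\<lambda>d'. if d' = b then a b else 0"] by (simp add: T0plus_def)
        moreover have "trunc 0 (f a') \<in> fv.span E"
        proof (rule Suc.IH, intro allI impI)
          fix d assume "b \<le> d"
          thus "a' d = 0" using Suc.prems by (cases "d = b") (auto simp: a'_def)
        qed
        ultimately show ?case
          using fv.span_add[OF \<open>trunc 0 (f a') \<in> fv.span E\<close> mono[of b "a b"]] by (simp only: trunc_add)
      qed
      have "trunc 0 p \<in> fv.span E" if p: "p \<in> P" for p
      proof -
        obtain a where a: "a \<in> T0plus" "p = f a" using f(1) p unfolding bij_betw_def by blast
        obtain b where "\<forall>d\<in>{d. a d \<noteq> 0}. d < b"
          using a(1) finite_nat_set_iff_bounded unfolding T0plus_def by blast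
        hence "\<forall>d\<ge>b. a d = 0" using not_le by blast
        thus ?thesis using tr a(2) by blast
      qed
      thus "fv.span (trunc 0 ` P) \<subseteq> fv.span E" by (intro fv.span_minimal fv.subspace_span) auto
    qed
    have inj: "inj_on (\<lambda>d. trunc 0 (e d)) {..<k}"
    proof (rule inj_onI, rule ccontr)
      fix d d' assume *: "d \<in> {..<k}" "d' \<in> {..<k}" "trunc 0 (e d) = trunc 0 (e d')" "d \<noteq> d'"
      have "trunc 0 (e d) (\<sigma>, n) = 0" for \<sigma> n
        using deg[of n d \<sigma>] deg[of n d' \<sigma>] *(3,4) by (cases "n = int d + m") auto
      hence "trunc 0 (e d) = 0" by (intro HOL.ext) (simp add: split_paired_all)
      thus False using low_nz * by blast
    qed
    have ind: "fv.independent E" unfolding fv.dependent_def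
    proof
      assume "\<exists>a\<in>E. a \<in> fv.span (E - {a})"
      then obtain d where d: "d < k" "trunc 0 (e d) \<in> fv.span (E - {trunc 0 (e d)})" by (auto simp: E_def)
      have "E - {trunc 0 (e d)} \<subseteq> {g. \<forall>\<sigma>. g (\<sigma>, int d + m) = 0}"
      proof
        fix g assume "g \<in> E - {trunc 0 (e d)}"
        then obtain d' where "g = trunc 0 (e d')" "d' \<noteq> d" by (auto simp: E_def)
        thus "g \<in> {g. \<forall>\<sigma>. g (\<sigma>, int d + m) = 0}" using deg[of "int d + m" d'] by simp
      qed
      moreover have "fv.subspace {g :: 'v cube \<times> int \<Rightarrow> rat. \<forall>\<sigma>. g (\<sigma>, int d + m) = 0}"
        by (simp add: fv.subspace_def)
      ultimately have "trunc 0 (e d) \<in> {g. \<forall>\<sigma>. g (\<sigma>, int d + m) = 0}"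
        using d(2) fv.span_minimal by blast
      hence z0: "\<forall>\<sigma>. trunc 0 (e d) (\<sigma>, int d + m) = 0" unfolding mem_Collect_eq .
      have "trunc 0 (e d) (\<sigma>, n) = 0" for \<sigma> n
        using deg[of n d \<sigma>] spec[OF z0, of \<sigma>] by (cases "n = int d + m") simp_all
      hence "trunc 0 (e d) = 0" by (intro HOL.ext) (simp add: split_paired_all)
      thus False using low_nz d by blast
    qed
    have "fv.dim (fv.span E) = card E" by (rule fv.dim_span_eq_card_independent[OF ind])
    also have "card E = k" unfolding E_def using card_image[OF inj] by simp
    finally show ?thesis unfolding spanE k_def .
  qed
  ultimately show ?thesis using mN by simp
qed

lemma rank_H0_red: "int (rank_H0_red T w) = int (fv.dim (ZQ 0)) - (N - m)"
proof -
  obtain P R where PR: "split_off P R" using split_off_exists by blast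
  have "rank_H0_red T w = quot_rank R {0}" unfolding rank_H0_red_def min_weight
  proof (rule the_equality)
    show "\<exists>P R'. is_tower w m P \<and> graded_submodule w P \<and> graded_submodule w R' \<and>
     P \<inter> R' = {0} \<and> {\<phi> + \<psi> | \<phi> \<psi>. \<phi> \<in> P \<and> \<psi> \<in> R'} = cocycles T w 0 \<and> quot_rank R {0} = quot_rank R' {0}"
      using PR by blast
    fix r assume "\<exists>P R. is_tower w m P \<and> graded_submodule w P \<and> graded_submodule w R \<and>
     P \<inter> R = {0} \<and> {\<phi> + \<psi> | \<phi> \<psi>. \<phi> \<in> P \<and> \<psi> \<in> R} = cocycles T w 0 \<and> r = quot_rank R {0}"
    then obtain P' R' where "split_off P' R'" "r = quot_rank R' {0}" by blast
    thus "r = quot_rank R {0}" using rank_split_off[OF PR] rank_split_off[of P' R'] by simp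
  qed
  thus ?thesis using rank_split_off[OF PR] by simp
qed

theorem eu_eq_euler_sum:
  assumes "euler_sum T0 (\<lambda>_. 1 :: int) = -1"
  shows "eu T w = euler_sum T0 w"
proof -
  define D where "D = card (UNIV :: 'v set)"
  have XD: "X q = {}" if "q > D" for q
  proof -
    have le: "card (snd \<sigma>) \<le> D" for \<sigma> :: "'v cube" unfolding D_def by (rule card_mono) auto
    show ?thesis
    proof (rule equals0I)
      fix y assume "y \<in> X q"
      hence "card (snd (fst y)) = q" by (auto simp: X_def)
      thus False using le[of "fst y"] that by simp
    qed
  qed
  have ranks: "int (quot_rank (cocycles T w q) (coboundaries T w q)) = int (fv.dim (ZQ q)) - int (fv.dim (BQ q))"
    if "q \<ge> 1" for q
    using quot_rank_cohomology[of "q - 1"] that by simp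
  have d0: "fv.dim (BQ 0) = 0"
  proof -
    have "fv.dim (fv.span {} :: ('v cube \<times> int \<Rightarrow> rat) set) = card ({} :: ('v cube \<times> int \<Rightarrow> rat) set)"
      by (rule fv.dim_span_eq_card_independent) (rule fv.independent_empty)
    thus ?thesis by (simp add: BQ_def)
  qed
  have dD: "fv.dim (BQ (Suc D)) = 0"
  proof -
    have "card (X (Suc D)) = fv.dim (ZQ (Suc D)) + fv.dim (BQ (Suc (Suc D)))" by (rule dim_ZQ_BQ)
    hence "fv.dim (ZQ (Suc D)) = 0" using XD[of "Suc D"] by simp
    moreover have "BQ (Suc D) = {0}"
    proof -
      have "BQ (Suc D) \<subseteq> supported (X (Suc D))" using BQ_ZQ by (auto simp: ZQ_def)
      hence "BQ (Suc D) \<subseteq> {0}" using XD[of "Suc D"] by (auto simp: supported_def fun_eq_iff)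
      thus ?thesis using fv.subspace_0[OF subspace_BQ] by blast
    qed
    ultimately show ?thesis using d0 by (simp add: BQ_def)
  qed
  have "(\<Sum>q\<le>D. (-1) ^ q * int (card (X q))) =
      (\<Sum>q\<le>D. (-1) ^ q * int (fv.dim (ZQ q))) + (\<Sum>q\<le>D. (-1) ^ q * int (fv.dim (BQ (Suc q))))"
    by (simp add: dim_ZQ_BQ sum.distrib algebra_simps)
  also have "(\<Sum>q\<le>D. (-1) ^ q * int (fv.dim (BQ (Suc q)))) = - (\<Sum>q\<in>{1..Suc D}. (-1) ^ q * int (fv.dim (BQ q)))"
    unfolding sum_negf[symmetric] One_nat_def sum.atLeast_Suc_atMost_Suc_shift atMost_atLeast0
    by (rule sum.cong) auto
  also have "(\<Sum>q\<in>{1..Suc D}. (-1) ^ q * int (fv.dim (BQ q))) = (\<Sum>q\<in>{1..D}. (-1) ^ q * int (fv.dim (BQ q)))"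
    using dD by simp
  also have "(\<Sum>q\<le>D. (-1) ^ q * int (fv.dim (ZQ q))) =
      int (fv.dim (ZQ 0)) + (\<Sum>q\<in>{1..D}. (-1) ^ q * int (fv.dim (ZQ q)))"
    by (simp add: atMost_atLeast0 sum.atLeast_Suc_atMost)
  finally have E1: "(\<Sum>q\<le>D. (-1) ^ q * int (card (X q))) = int (fv.dim (ZQ 0)) +
      (\<Sum>q\<in>{1..D}. (-1) ^ q * int (quot_rank (cocycles T w q) (coboundaries T w q)))"
    by (simp add: ranks sum_subtractf[symmetric] algebra_simps)
  have cardX: "int (card (X q)) = (\<Sum>\<sigma>\<in>{\<sigma> \<in> T0. card (snd \<sigma>) = q}. N - cube_weight w \<sigma>)" for q
  proof -
    have "X q = Sigma {\<sigma> \<in> T0. card (snd \<sigma>) = q} (\<lambda>\<sigma>. {cube_weight w \<sigma>..<N})" by (auto simp: X_def)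
    hence "int (card (X q)) = (\<Sum>\<sigma>\<in>{\<sigma> \<in> T0. card (snd \<sigma>) = q}. int (card {cube_weight w \<sigma>..<N}))"
      using fin by simp
    also have "\<dots> = (\<Sum>\<sigma>\<in>{\<sigma> \<in> T0. card (snd \<sigma>) = q}. N - cube_weight w \<sigma>)"
      by (rule sum.cong) (use N in auto)
    finally show ?thesis .
  qed
  have "(\<Sum>q\<le>D. (-1) ^ q * int (card (X q))) =
      (\<Sum>q\<le>D. \<Sum>\<sigma>\<in>{\<sigma> \<in> T0. card (snd \<sigma>) = q}. (-1) ^ card (snd \<sigma>) * (N - cube_weight w \<sigma>))"
    unfolding cardX sum_distrib_left by (intro sum.cong) auto
  also have "\<dots> = (\<Sum>\<sigma>\<in>T0. (-1) ^ card (snd \<sigma>) * (N - cube_weight w \<sigma>))"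
    by (rule sum.group) (use fin in \<open>auto simp: D_def intro: card_mono\<close>)
  also have "\<dots> = euler_sum T0 w - N * euler_sum T0 (\<lambda>_. 1)"
    unfolding euler_sum_def sum_distrib_left sum_subtractf[symmetric]
    by (rule sum.cong) (auto simp: cube_weight_def image_constant_conv Pow_not_empty algebra_simps)
  finally have E2: "(\<Sum>q\<le>D. (-1) ^ q * int (card (X q))) = euler_sum T0 w + N" using assms by simp
  have "eu T w = - m + (int (fv.dim (ZQ 0)) - (N - m)) +
      (\<Sum>q\<in>{1..D}. (-1) ^ q * int (quot_rank (cocycles T w q) (coboundaries T w q)))"
    unfolding eu_def min_weight rank_H0_red D_def ..
  thus ?thesis using E1 E2 by simp
qed

end

section \<open>The lattice of a plumbing tree\<close>

lemma form_add_left: "form G (x + y) z = form G x z + form G y z"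
  by (simp add: form_def algebra_simps sum.distrib)

lemma form_add_right: "form G x (y + z) = form G x y + form G x z"
  by (simp add: form_def algebra_simps sum.distrib)

lemma form_diff_left: "form G (x - y) z = form G x z - form G y z"
  by (simp add: form_def algebra_simps sum_subtractf)

lemma form_zero [simp]: "form G 0 z = 0" "form G z 0 = 0"
  by (simp_all add: form_def)

lemma form_scale_left: "form G (\<lambda>j. c * x j) z = c * form G x z"
  unfolding form_def sum_distrib_left by (intro sum.cong) auto

lemma form_scale_right: "form G z (\<lambda>j. c * x j) = c * form G z x"
  unfolding form_def sum_distrib_left by (intro sum.cong) auto

lemma form_basis: "form G x (basis j) = (\<Sum>i\<in>UNIV. of_int (entry G i j) * x i)"
proof -
  have "form G x (basis j) = (\<Sum>i\<in>UNIV. \<Sum>k\<in>UNIV. if k = j then of_int (entry G i j) * x i else 0)"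
    unfolding form_def by (intro sum.cong) (auto simp: ind_apply)
  thus ?thesis by simp
qed

lemma form_basis_basis: "form G (basis i) (basis j) = of_int (entry G i j)"
proof -
  have "form G (basis i) (basis j) = (\<Sum>k\<in>UNIV. if k = i then of_int (entry G i j) else 0)"
    unfolding form_basis by (intro sum.cong) (auto simp: ind_apply)
  thus ?thesis by simp
qed

lemma form_expand: "form G x y = (\<Sum>j\<in>UNIV. y j * form G x (basis j))"
proof -
  have "form G x y = (\<Sum>j\<in>UNIV. \<Sum>i\<in>UNIV. of_int (entry G i j) * x i * y j)"
    unfolding form_def by (rule sum.swap)
  thus ?thesis unfolding form_basis sum_distrib_left by (simp add: algebra_simps)
qed

lemma entry_off_diagonal: "i \<noteq> j \<Longrightarrow> 0 \<le> entry G i j"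
  by (simp add: entry_def)

lemma form_basis_mono:
  assumes "\<And>i. x i \<le> y i" "x j = y j"
  shows "form G x (basis j) \<le> form G y (basis j)"
  unfolding form_basis
proof (rule sum_mono)
  fix i
  show "of_int (entry G i j) * x i \<le> of_int (entry G i j) * y i"
    using assms entry_off_diagonal[of i j G] by (cases "i = j") (auto intro: mult_left_mono)
qed

lemma form_Ints: "x \<in> Lat \<Longrightarrow> y \<in> Lat \<Longrightarrow> form G x y \<in> \<int>"
  unfolding form_def by (intro Ints_sum Ints_mult) (auto simp: Lat_def)

lemma Lat_dualLat: "Lat \<subseteq> dualLat G"
  using form_Ints by (auto simp: dualLat_def)

lemma dualLat_Ints: "x \<in> dualLat G \<Longrightarrow> form G x (basis j) \<in> \<int>"
  by (simp add: dualLat_def)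

lemma dualLat_add: "x \<in> dualLat G \<Longrightarrow> y \<in> dualLat G \<Longrightarrow> x + y \<in> dualLat G"
  by (simp add: dualLat_def form_add_left)

lemma dualLatI:
  assumes "\<And>j. form G x (basis j) \<in> \<int>"
  shows "x \<in> dualLat G"
  unfolding dualLat_def mem_Collect_eq
  by (subst form_expand) (use assms in \<open>auto simp: Lat_def intro!: Ints_sum Ints_mult\<close>)

lemma Lat_scale: "x \<in> Lat \<Longrightarrow> (\<lambda>j. of_nat n * x j) \<in> Lat"
  by (auto simp: Lat_def)

lemma integral_multiple_vector:
  fixes u :: "'v::finite qvec"
  obtains M :: nat where "M > 0" "(\<lambda>j. of_nat M * u j) \<in> Lat"
proof -
  obtain M :: int where M: "M > 0" "\<forall>j\<in>UNIV. \<exists>c::int. of_int M * u j = of_int c"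
    using common_denominator[of UNIV u] by auto
  have "(\<lambda>j. of_nat (nat M) * u j) \<in> Lat" unfolding Lat_def mem_Collect_eq
  proof
    fix j
    obtain c :: int where c: "of_int M * u j = of_int c" using M(2) by blast
    have "of_nat (nat M) * u j = of_int c" using M(1) c by simp
    thus "of_nat (nat M) * u j \<in> \<int>" by (metis Ints_of_int)
  qed
  thus ?thesis using that[of "nat M"] M(1) by simp
qed

locale plumbing_tree =
  fixes G :: "'v::finite plumbing"
  assumes tree: "connected_tree (adj G)" and neg: "negative_definite G"
begin

lemma adj_sym: "adj G u v \<Longrightarrow> adj G v u"
  using tree by (auto simp: connected_tree_def)

lemma entry_sym: "entry G i j = entry G j i"
  using adj_sym by (auto simp: entry_def)

lemma form_sym: "form G x y = form G y x"
proof -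
  have "form G x y = (\<Sum>j\<in>UNIV. \<Sum>i\<in>UNIV. of_int (entry G i j) * x i * y j)"
    unfolding form_def by (rule sum.swap)
  also have "\<dots> = form G y x" unfolding form_def
    by (intro sum.cong refl) (simp add: entry_sym)
  finally show ?thesis .
qed

lemma form_negative:
  assumes "x \<noteq> 0"
  shows "form G x x < 0"
proof -
  obtain M :: nat where M: "M > 0" "(\<lambda>j. of_nat M * x j) \<in> Lat" by (rule integral_multiple_vector)
  obtain j where "x j \<noteq> 0" using assms by (auto simp: fun_eq_iff)
  hence "(\<lambda>j. of_nat M * x j) j \<noteq> 0" using M(1) by simp
  hence "(\<lambda>j. of_nat M * x j) \<noteq> 0" by (metis zero_fun_apply)
  hence "form G (\<lambda>j. of_nat M * x j) (\<lambda>j. of_nat M * x j) < 0"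
    using neg M(2) unfolding negative_definite_def by blast
  hence "(of_nat M * of_nat M) * form G x x < 0"
    by (simp add: form_scale_left form_scale_right)
  thus ?thesis using M(1) by (simp add: mult_less_0_iff)
qed

lemma dec_negative: "dec G j \<le> -1"
proof -
  have "basis j \<noteq> 0" by (auto simp: fun_eq_iff ind_apply)
  hence "form G (basis j) (basis j) < 0" by (rule form_negative)
  thus ?thesis by (simp add: form_basis_basis entry_def)
qed

text \<open>
  Prescribing coordinates on \<open>K\<close> and intersection numbers off \<open>K\<close> determines a vector: a vector
  in the kernel is orthogonal to itself.
\<close>
lemma mixed_system_kernel:
  assumes "\<And>j. j \<in> K \<Longrightarrow> x j = 0" "\<And>j. j \<notin> K \<Longrightarrow> form G x (basis j) = 0"
  shows "x = 0"
proof (rule ccontr)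
  assume "x \<noteq> 0"
  hence "form G x x < 0" by (rule form_negative)
  moreover have "form G x x = 0"
    unfolding form_expand[of G x x] using assms by (intro sum.neutral) (metis mult_eq_0_iff)
  ultimately show False by simp
qed

lemma mixed_system_solvable:
  obtains x :: "'v qvec" where "\<And>j. j \<in> K \<Longrightarrow> x j = f j" "\<And>j. j \<notin> K \<Longrightarrow> form G x (basis j) = f j"
proof -
  define A :: "rat^'v^'v" where "A = (\<chi> i j. if i \<in> K then (if i = j then 1 else 0) else of_int (entry G j i))"
  have Av: "(A *v x) $ i = (if i \<in> K then x $ i else form G (\<lambda>j. x $ j) (basis i))" for x i
  proof (cases "i \<in> K")
    case True
    have "(A *v x) $ i = (\<Sum>j\<in>UNIV. A $ i $ j * x $ j)" by (simp add: matrix_vector_mult_def)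
    also have "\<dots> = (\<Sum>j\<in>UNIV. if j = i then x $ j else 0)"
      by (rule sum.cong) (use True in \<open>auto simp: A_def\<close>)
    finally have "(A *v x) $ i = (\<Sum>j\<in>UNIV. if j = i then x $ j else 0)" .
    thus ?thesis using True by simp
  next
    case False
    thus ?thesis by (simp add: matrix_vector_mult_def A_def form_basis)
  qed
  have "\<forall>x. A *v x = 0 \<longrightarrow> x = 0"
  proof (intro allI impI)
    fix x assume "A *v x = 0"
    hence z: "(A *v x) $ i = 0" for i by simp
    have "(\<lambda>j. x $ j) = 0"
    proof (rule mixed_system_kernel[of K])
      fix j show "j \<in> K \<Longrightarrow> x $ j = 0" "j \<notin> K \<Longrightarrow> form G (\<lambda>j. x $ j) (basis j) = 0"
        using z[of j] Av[of x j] by auto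
    qed
    thus "x = 0" by (simp add: vec_eq_iff fun_eq_iff)
  qed
  then obtain B where "B ** A = mat 1" unfolding matrix_left_invertible_ker[symmetric] by blast
  hence AB: "A ** B = mat 1" using matrix_left_right_inverse by blast
  define y where "y = B *v (\<chi> i. f i)"
  have "A *v y = (\<chi> i. f i)" unfolding y_def by (simp add: matrix_vector_mul_assoc AB)
  hence y: "(A *v y) $ i = f i" for i by simp
  show ?thesis
    by (rule that[of "\<lambda>j. y $ j"]) (use y Av[of y] in metis)+
qed

lemma form_eqI:
  assumes "\<And>j. form G x (basis j) = form G y (basis j)"
  shows "x = y"
proof -
  have "x - y = 0" by (rule mixed_system_kernel[of "{}"]) (use assms in \<open>auto simp: form_diff_left\<close>)
  thus ?thesis by simp
qed

lemma kcan: "form G (kcan G) (basis j) = of_int (- dec G j - 2)"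
proof -
  obtain x where x: "\<And>j. form G x (basis j) = of_int (- dec G j - 2)"
    using mixed_system_solvable[of "{}" "\<lambda>j. of_int (- dec G j - 2)"] by auto
  have "kcan G = x" unfolding kcan_def by (rule the_equality) (use x in \<open>auto intro: form_eqI\<close>)
  thus ?thesis using x by simp
qed

text \<open>The negative and the positive part of the vector meet nonnegatively, so the negative part would have nonnegative square.\<close>
lemma nonneg_if_antinef:
  assumes "\<And>j. j \<in> K \<Longrightarrow> 0 \<le> d j" "\<And>j. j \<notin> K \<Longrightarrow> form G d (basis j) \<le> 0"
  shows "0 \<le> d"
proof -
  define n where "n = (\<lambda>j. max 0 (- d j))"
  define p where "p = (\<lambda>j. max 0 (d j))"
  have d: "d = p - n" by (auto simp: fun_eq_iff n_def p_def)
  have "form G d n \<le> 0" unfolding form_expand[of G d n]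
  proof (rule sum_nonpos)
    fix j
    show "n j * form G d (basis j) \<le> 0"
    proof (cases "d j < 0")
      case True
      hence "form G d (basis j) \<le> 0" using assms[of j] by force
      thus ?thesis by (intro mult_nonneg_nonpos) (auto simp: n_def)
    qed (simp add: n_def)
  qed
  moreover have "form G p n \<ge> 0" unfolding form_def
  proof (intro sum_nonneg)
    fix i j
    show "0 \<le> of_int (entry G i j) * p i * n j"
    proof (cases "i = j")
      case True thus ?thesis by (simp add: p_def n_def max_def)
    next
      case False
      thus ?thesis using entry_off_diagonal[OF False, of G] by (intro mult_nonneg_nonneg) (auto simp: p_def n_def)
    qed
  qed
  moreover have "form G d n = form G p n - form G n n" unfolding d form_diff_left ..
  ultimately have "form G n n \<ge> 0" by simp
  hence "n = 0" using form_negative[of n] by (cases "n = 0") auto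
  hence "n j = 0" for j by simp
  hence "max 0 (- d j) = 0" for j unfolding n_def by simp
  hence "0 \<le> d j" for j by (metis max.absorb_iff1 neg_le_0_iff_le)
  thus ?thesis by (simp add: le_fun_def)
qed

lemma form_basis_expand:
  "form G x (basis j) = of_int (dec G j) * x j + (\<Sum>i\<in>{i. adj G j i}. x i)"
proof -
  have irr: "\<not> adj G j j" using tree by (auto simp: connected_tree_def)
  have "form G x (basis j) = of_int (entry G j j) * x j + (\<Sum>i\<in>UNIV - {j}. of_int (entry G i j) * x i)"
    unfolding form_basis by (rule sum.remove) auto
  also have "(\<Sum>i\<in>UNIV - {j}. of_int (entry G i j) * x i) = (\<Sum>i\<in>{i. adj G j i}. x i)"
    by (rule sum.mono_neutral_cong_right) (use irr adj_sym in \<open>auto simp: entry_def\<close>)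
  finally show ?thesis by (simp add: entry_def)
qed

lemma deep_vector:
  obtains v :: "'v qvec" where "v \<in> Lat" "\<And>j. 1 \<le> v j" "\<And>j. form G v (basis j) \<le> -1"
proof -
  obtain u where u: "\<And>j. form G u (basis j) = -1" using mixed_system_solvable[of "{}" "\<lambda>j. -1"] by auto
  obtain M :: nat where M: "M > 0" "(\<lambda>j. of_nat M * u j) \<in> Lat" by (rule integral_multiple_vector)
  define v where "v = (\<lambda>j. of_nat M * u j)"
  have f: "form G v (basis j) \<le> -1" for j using u M(1) unfolding v_def form_scale_left by simp
  have nn: "0 \<le> v"
  proof (rule nonneg_if_antinef[of "{}"])
    fix j show "form G v (basis j) \<le> 0" using f[of j] by linarith
  qed simp
  have "v j \<noteq> 0" for j
  proof
    assume "v j = 0"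
    hence "form G v (basis j) = (\<Sum>i\<in>{i. adj G j i}. v i)" by (simp add: form_basis_expand)
    also have "\<dots> \<ge> 0" using nn by (intro sum_nonneg) (auto simp: le_fun_def)
    finally show False using f[of j] by simp
  qed
  moreover have "0 \<le> v j" for j using nn by (simp add: le_fun_def)
  ultimately have pos: "0 < v j" for j by (simp add: less_le)
  have "0 + 1 \<le> v j" for j
    by (rule Ints_less_imp_le[OF _ _ pos]) (use M(2) in \<open>auto simp: v_def Lat_def\<close>)
  hence "1 \<le> v j" for j by simp
  thus ?thesis using that[of v] M(2) f unfolding v_def by blast
qed

text \<open>Along an edge an antinef vector decreases at most by the factor given by the decoration.\<close>
lemma growth_constant:
  obtains C :: rat where "C \<ge> 1"
    "\<And>K z t k j. 0 \<le> z \<Longrightarrow> (\<And>i. i \<in> K \<Longrightarrow> t \<le> z i) \<Longrightarrow> (\<And>i. i \<notin> K \<Longrightarrow> form G z (basis i) \<le> 0)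
       \<Longrightarrow> t \<le> z k \<Longrightarrow> t \<le> C * z j"
proof -
  define \<beta> :: rat where "\<beta> = of_int (Max (range (\<lambda>j. - dec G j)))"
  have \<beta>: "- of_int (dec G j) \<le> \<beta>" for j
  proof -
    have "- dec G j \<le> Max (range (\<lambda>j. - dec G j))" by (rule Max_ge) auto
    hence "of_int (- dec G j) \<le> \<beta>" unfolding \<beta>_def by (subst of_int_le_iff)
    thus ?thesis by simp
  qed
  have \<beta>1: "\<beta> \<ge> 1"
  proof -
    have "(of_int 1 :: rat) \<le> of_int (- dec G undefined)"
      using dec_negative[of undefined] by (subst of_int_le_iff) linarith
    thus ?thesis using \<beta>[of undefined] by simp
  qed
  have "\<forall>p. \<exists>n. ((adj G) ^^ n) (fst p) (snd p)"
    using tree unfolding connected_tree_def by (simp add: rtranclp_imp_relpowp)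
  then obtain len where len: "\<And>p. ((adj G) ^^ len p) (fst p) (snd p)" by metis
  define L where "L = Max (range len)"
  have L: "len p \<le> L" for p unfolding L_def by (rule Max_ge) auto
  have main: "t \<le> \<beta> ^ n * z j"
    if "((adj G) ^^ n) k j" and z: "0 \<le> z" "\<And>i. i \<in> K \<Longrightarrow> t \<le> z i" "\<And>i. i \<notin> K \<Longrightarrow> form G z (basis i) \<le> 0" "t \<le> z k"
    for K z t k j n
    using that(1)
  proof (induction n arbitrary: j)
    case 0 thus ?case using z(4) by simp
  next
    case (Suc n)
    then obtain i where i: "((adj G) ^^ n) k i" "adj G i j" by auto
    have zj: "0 \<le> z j" for j using z(1) by (simp add: le_fun_def)
    show ?case
    proof (cases "j \<in> K")
      case True
      have "1 * z j \<le> \<beta> ^ Suc n * z j" using \<beta>1 zj by (intro mult_right_mono one_le_power) auto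
      thus ?thesis using z(2)[OF True] by simp
    next
      case False
      have "z i \<le> (\<Sum>i\<in>{i. adj G j i}. z i)" using zj adj_sym[OF i(2)] by (intro member_le_sum) auto
      also have "\<dots> \<le> - of_int (dec G j) * z j" using z(3)[OF False] unfolding form_basis_expand by simp
      also have "\<dots> \<le> \<beta> * z j" using \<beta> zj by (intro mult_right_mono) auto
      finally have "\<beta> ^ n * z i \<le> \<beta> ^ n * (\<beta> * z j)" using \<beta>1 by (intro mult_left_mono) auto
      thus ?thesis using Suc.IH[OF i(1)] by (simp add: mult_ac)
    qed
  qed
  show ?thesis
  proof (rule that[of "\<beta> ^ L"])
    show "\<beta> ^ L \<ge> 1" using \<beta>1 by (rule one_le_power)
    fix K z t k j
    assume z: "0 \<le> z" "\<And>i. i \<in> K \<Longrightarrow> t \<le> z i" "\<And>i. i \<notin> K \<Longrightarrow> form G z (basis i) \<le> 0" "t \<le> z k"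
    have "t \<le> \<beta> ^ len (k, j) * z j" by (rule main[OF _ z]) (use len[of "(k, j)"] in auto)
    also have "\<dots> \<le> \<beta> ^ L * z j"
      using \<beta>1 L[of "(k, j)"] z(1) by (intro mult_right_mono power_increasing) (auto simp: le_fun_def)
    finally show "t \<le> \<beta> ^ L * z j" .
  qed
qed

end

lemma least_lattice_point:
  fixes X :: "'v::finite qvec set"
  assumes X: "X \<subseteq> Lat" "X \<noteq> {}" and bd: "\<And>x. x \<in> X \<Longrightarrow> p \<le> x"
    and inf: "\<And>x y. x \<in> X \<Longrightarrow> y \<in> X \<Longrightarrow> (\<lambda>j. min (x j) (y j)) \<in> X"
  obtains m where "m \<in> X" "\<And>x. x \<in> X \<Longrightarrow> m \<le> x"
proof -
  define S where "S x = nat \<lfloor>(\<Sum>j\<in>UNIV. x j - of_int \<lfloor>p j\<rfloor>)\<rfloor>" for x :: "'v qvec"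
  obtain x1 where "x1 \<in> X" using X(2) by blast
  then obtain m where m: "m \<in> X" "\<And>x. x \<in> X \<Longrightarrow> S m \<le> S x"
    using ex_has_least_nat[of "\<lambda>x. x \<in> X" x1 S] by blast
  have "m \<le> x" if x: "x \<in> X" for x
  proof (rule ccontr)
    assume "\<not> m \<le> x"
    then obtain j where j: "x j < m j" by (auto simp: le_fun_def not_le)
    define y where "y = (\<lambda>j. min (m j) (x j))"
    have y: "y \<in> X" unfolding y_def using inf m(1) x by blast
    have int: "(\<Sum>j\<in>UNIV. z j - of_int \<lfloor>p j\<rfloor>) \<in> \<int>" if "z \<in> X" for z
      using that X(1) by (intro Ints_sum Ints_diff) (auto simp: Lat_def)
    have nn: "0 \<le> (\<Sum>j\<in>UNIV. z j - of_int \<lfloor>p j\<rfloor>)" if "z \<in> X" for z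
    proof (rule sum_nonneg)
      fix j
      have "p j \<le> z j" using bd[OF that] by (simp add: le_fun_def)
      thus "0 \<le> z j - of_int \<lfloor>p j\<rfloor>" using of_int_floor_le[of "p j"] by linarith
    qed
    have "(\<Sum>j\<in>UNIV. y j - of_int \<lfloor>p j\<rfloor>) < (\<Sum>j\<in>UNIV. m j - of_int \<lfloor>p j\<rfloor>)"
      by (rule sum_strict_mono_ex1) (use j in \<open>auto simp: y_def min_less_iff_disj\<close>)
    hence "S y < S m" using int[OF y] int[OF m(1)] nn[OF y] nn[OF m(1)]
      unfolding S_def by (auto elim!: Ints_cases)
    thus False using m(2)[OF y] by simp
  qed
  thus ?thesis using that m(1) by blast
qed

lemma the_minimal_eq:
  fixes m :: "'a::order"
  assumes "m \<in> X" "\<And>x. x \<in> X \<Longrightarrow> m \<le> x"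
  shows "the_minimal X = m"
  unfolding the_minimal_def
proof (rule the_equality)
  show "m \<in> X \<and> (\<forall>y\<in>X. \<not> y < m)" using assms by (auto simp: less_le_not_le)
  fix x assume "x \<in> X \<and> (\<forall>y\<in>X. \<not> y < x)"
  thus "x = m" using assms by (metis order.not_eq_order_implies_strict)
qed

text \<open>Every lattice point is reached from the origin by unit steps.\<close>
lemma Lat_unit_steps_induct:
  fixes x :: "'v::finite qvec"
  assumes "x \<in> Lat" "P 0" "\<And>y j. y \<in> Lat \<Longrightarrow> P y \<Longrightarrow> P (y + basis j)" "\<And>y j. y \<in> Lat \<Longrightarrow> P y \<Longrightarrow> P (y - basis j)"
  shows "P x"
proof -
  have "P (\<lambda>j. if j \<in> S then x j else 0)" for S
    using finite[of S]
  proof (induction S rule: finite_induct)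
    case empty thus ?case using assms(2) by (simp add: zero_fun_def)
  next
    case (insert s S)
    define y where "y = (\<lambda>j. if j \<in> S then x j else 0)"
    have yL: "y \<in> Lat" using assms(1) by (auto simp: y_def Lat_def)
    have st: "P (\<lambda>j. if j = s then of_int c else y j)" for c :: int
    proof (induction c rule: int_induct[where k = 0])
      case base
      have "(\<lambda>j. if j = s then of_int 0 else y j) = y" using insert.hyps by (auto simp: y_def fun_eq_iff)
      thus ?case using insert.IH by (simp add: y_def)
    next
      case (step1 i)
      have "(\<lambda>j. if j = s then of_int (i + 1) else y j) = (\<lambda>j. if j = s then of_int i else y j) + basis s"
        by (auto simp: fun_eq_iff ind_apply)
      moreover have "(\<lambda>j. if j = s then of_int i else y j) \<in> Lat" using yL by (auto simp: Lat_def)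
      ultimately show ?case using assms(3)[OF _ step1(2), of s] by simp
    next
      case (step2 i)
      have "(\<lambda>j. if j = s then of_int (i - 1) else y j) = (\<lambda>j. if j = s then of_int i else y j) - basis s"
        by (auto simp: fun_eq_iff ind_apply)
      moreover have "(\<lambda>j. if j = s then of_int i else y j) \<in> Lat" using yL by (auto simp: Lat_def)
      ultimately show ?case using assms(4)[OF _ step2(2), of s] by simp
    qed
    obtain c where "x s = of_int c" using assms(1) by (auto simp: Lat_def elim: Ints_cases)
    hence "(\<lambda>j. if j \<in> insert s S then x j else 0) = (\<lambda>j. if j = s then of_int c else y j)"
      by (auto simp: fun_eq_iff y_def)
    thus ?case using st by simp
  qed
  from this[of UNIV] show ?thesis by simp
qed

lemma chi_add: "chi G k (x + u) = chi G k x + chi G k u - (form G x u + form G u x) / 2"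
  by (simp add: chi_def form_add_left form_add_right field_simps)

locale characteristic_tree = plumbing_tree G for G :: "'v::finite plumbing" +
  fixes k :: "'v qvec"
  assumes char: "k \<in> characteristic G"
begin

abbreviation l' :: "'v qvec" where "l' \<equiv> ldist G k"

definition w :: "'v qvec \<Rightarrow> rat" where "w = chi G (kdist G k)"

abbreviation chican :: "'v qvec \<Rightarrow> rat" where "chican \<equiv> chi G (kcan G)"

lemma ldist_least:
  shows ldist_lipman: "l' \<in> lipman G"
    and ldist_minimal: "\<And>x. x \<in> Lat \<Longrightarrow> (\<And>j. form G (x + l') (basis j) \<le> 0) \<Longrightarrow> 0 \<le> x"
proof -
  obtain h where h: "h \<in> dualLat G" "k = kcan G + (\<lambda>j. 2 * h j)"
    using char by (auto simp: characteristic_def)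
  have hk: "(\<lambda>j. (k j - kcan G j) / 2) = h" by (auto simp: h(2) fun_eq_iff)
  define Y where "Y = {x \<in> Lat. \<forall>j. form G (x + h) (basis j) \<le> 0}"
  obtain v where v: "v \<in> Lat" "\<And>j. 1 \<le> v j" "\<And>j. form G v (basis j) \<le> -1" by (rule deep_vector) blast
  obtain n :: nat where n: "\<And>j. form G h (basis j) \<le> of_nat n"
  proof -
    obtain n :: nat where "Max (range (\<lambda>j. form G h (basis j))) \<le> of_nat n" using real_arch_simple by blast
    moreover have "form G h (basis j) \<le> Max (range (\<lambda>j. form G h (basis j)))" for j by (rule Max_ge) auto
    ultimately show ?thesis using that order_trans by blast
  qed
  have ne: "(\<lambda>j. of_nat n * v j) \<in> Y" unfolding Y_def mem_Collect_eq
  proof (intro conjI allI)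
    show "(\<lambda>j. of_nat n * v j) \<in> Lat" by (rule Lat_scale[OF v(1)])
    fix j
    have "of_nat n * form G v (basis j) \<le> of_nat n * (-1)" using v(3) by (intro mult_left_mono) auto
    thus "form G ((\<lambda>j. of_nat n * v j) + h) (basis j) \<le> 0"
      using n[of j] by (simp add: form_add_left form_scale_left)
  qed
  have bd: "- h \<le> x" if "x \<in> Y" for x
  proof -
    have "0 \<le> x + h" by (rule nonneg_if_antinef[of "{}"]) (use that in \<open>auto simp: Y_def\<close>)
    hence "0 \<le> x j + h j" for j by (simp add: le_fun_def)
    hence "- h j \<le> x j" for j by (metis add.commute add.right_inverse add_le_cancel_left)
    thus ?thesis by (simp add: le_fun_def)
  qed
  have inf: "(\<lambda>j. min (x j) (y j)) \<in> Y" if xy: "x \<in> Y" "y \<in> Y" for x y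
    unfolding Y_def mem_Collect_eq
  proof (intro conjI allI)
    show "(\<lambda>j. min (x j) (y j)) \<in> Lat" using xy by (auto simp: Y_def Lat_def min_def)
    fix j
    define z where "z = (if x j \<le> y j then x else y)"
    have "form G ((\<lambda>j. min (x j) (y j)) + h) (basis j) \<le> form G (z + h) (basis j)"
      by (rule form_basis_mono) (auto simp: z_def)
    also have "\<dots> \<le> 0" using xy by (auto simp: Y_def z_def)
    finally show "form G ((\<lambda>j. min (x j) (y j)) + h) (basis j) \<le> 0" .
  qed
  have YL: "Y \<subseteq> Lat" by (auto simp: Y_def)
  obtain m where m: "m \<in> Y" "\<And>x. x \<in> Y \<Longrightarrow> m \<le> x"
    using least_lattice_point[OF YL _ bd inf] ne by blast
  have set: "{(\<lambda>j. (k j - kcan G j) / 2) + l | l. l \<in> Lat} \<inter> lipman G = (\<lambda>x. x + h) ` Y"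
    unfolding hk
  proof (intro equalityI subsetI)
    fix y assume "y \<in> {h + l | l. l \<in> Lat} \<inter> lipman G"
    then obtain l where l: "y = h + l" "l \<in> Lat" "y \<in> lipman G" by blast
    have "l \<in> Y" using l unfolding Y_def lipman_def by (simp add: add.commute)
    thus "y \<in> (\<lambda>x. x + h) ` Y" using l(1) by (metis add.commute image_eqI)
  next
    fix y assume "y \<in> (\<lambda>x. x + h) ` Y"
    then obtain x where x: "x \<in> Y" "y = x + h" by blast
    have "x + h \<in> dualLat G" using x(1) h(1) Lat_dualLat by (intro dualLat_add) (auto simp: Y_def)
    hence "y \<in> lipman G" using x by (simp add: Y_def lipman_def)
    moreover have "y = h + x" using x(2) by (simp add: add.commute)
    ultimately show "y \<in> {h + l | l. l \<in> Lat} \<inter> lipman G" using x(1) unfolding Y_def by blast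
  qed
  have l: "l' = m + h" unfolding ldist_def set
    by (rule the_minimal_eq) (use m in auto)
  have "m + h \<in> (\<lambda>x. x + h) ` Y" using m(1) by blast
  thus "l' \<in> lipman G" unfolding l set[symmetric] by blast
  fix x assume x: "x \<in> Lat" "\<And>j. form G (x + l') (basis j) \<le> 0"
  have "x + m \<in> Y" using x m(1) unfolding Y_def l by (auto simp: add.assoc)
  hence "m \<le> x + m" using m(2) by blast
  thus "0 \<le> x" by (simp add: le_add_same_cancel2)
qed

lemma ldist_form_nonpos: "form G l' (basis j) \<le> 0"
  using ldist_lipman by (simp add: lipman_def)

lemma ldist_dualLat: "l' \<in> dualLat G"
  using ldist_lipman by (simp add: lipman_def)

lemma ldist_nonneg: "0 \<le> l'"
  by (rule nonneg_if_antinef[of "{}"]) (use ldist_form_nonpos in auto)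

lemma form_shift_Ints: "x \<in> Lat \<Longrightarrow> form G (x + l') (basis j) \<in> \<int>"
  using dualLat_Ints[OF dualLat_add[OF _ ldist_dualLat]] Lat_dualLat by blast

lemma chican_basis: "chican (basis j) = 1"
  using kcan[of j] by (simp add: chi_def form_add_right form_sym[of "basis j" "kcan G"] form_basis_basis entry_def)

lemma w_add: "w (x + u) = w x + chican u - form G (x + l') u"
  using form_sym[of u "kcan G"] form_sym[of u l'] form_sym[of u x]
  by (simp add: w_def chi_def kdist_def form_add_left form_add_right form_scale_right field_simps)

lemma w_step: "w (x + basis j) = w x + 1 - form G (x + l') (basis j)"
  by (simp add: w_add chican_basis)

lemma w_step_back: "w (x - basis j) = w x - 1 + form G (x - basis j + l') (basis j)"
  using w_step[of "x - basis j" j] by simp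

lemma w_Ints:
  assumes "x \<in> Lat"
  shows "w x \<in> \<int>"
proof (rule Lat_unit_steps_induct[OF assms, where P = "\<lambda>x. w x \<in> \<int>"])
  show "w 0 \<in> \<int>" by (simp add: w_def chi_def)
next
  fix y :: "'v qvec" and j assume "y \<in> Lat" "w y \<in> \<int>"
  thus "w (y + basis j) \<in> \<int>" "w (y - basis j) \<in> \<int>"
    unfolding w_step w_step_back using form_shift_Ints[of y] form_shift_Ints[of "y - basis j"]
    by (auto intro!: Ints_diff Ints_add)
qed

end

section \<open>Exhaustions by boxes and rationality\<close>

lemma box_cubes_same: "a \<in> Lat \<Longrightarrow> box_cubes a a = {(a, {})}"
proof (intro equalityI subsetI)
  fix \<sigma> assume "\<sigma> \<in> box_cubes a a"
  then obtain x I where \<sigma>: "\<sigma> = (x, I)" "(x, I) \<in> box_cubes a a" by (cases \<sigma>) auto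
  note D = box_cubesD[OF \<sigma>(2)]
  have x: "x = a" using D(2,4) by (rule order_antisym[rotated])
  have "j \<notin> I" for j
  proof
    assume "j \<in> I"
    moreover have "a j + ind I j \<le> a j" using D(3) unfolding x by (simp add: le_fun_def)
    ultimately show False by (simp add: ind_apply)
  qed
  thus "\<sigma> \<in> {(a, {})}" using \<sigma> x by auto
qed (auto simp: box_cubes_def)

lemma collapses_euler_sum:
  assumes "(collapse_step w)\<^sup>*\<^sup>* T0 T" "finite T"
  shows "euler_sum T w = euler_sum T0 w"
  using assms
proof (induction rule: rtranclp_induct)
  case (step y z)
  have "finite y" using step.prems collapse_step_subset[OF step.hyps(2)] finite_subset by blast
  thus ?case using step.IH euler_sum_collapse_step[OF step.hyps(2) step.prems] by simp
qed simp

lemma collapses_extend: "(collapse_step w)\<^sup>*\<^sup>* T0 T \<Longrightarrow> extends_primitives w T0 T"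
proof (induction rule: rtranclp_induct)
  case base show ?case by (rule extends_primitives_refl)
next
  case (step y z)
  thus ?case using extends_primitives_trans collapse_step_extends_primitives by blast
qed

lemma collapses_vertex:
  assumes "(collapse_step w)\<^sup>*\<^sup>* T0 T" "(x, {}) \<in> T"
  shows "\<exists>y. (y, {}) \<in> T0 \<and> w y \<le> w x"
  using assms
proof (induction arbitrary: x rule: rtranclp_induct)
  case (step y z)
  obtain u where "(u, {}) \<in> y" "w u \<le> w x" using collapse_step_vertex[OF step.hyps(2) step.prems] .
  thus ?case using step.IH order_trans by blast
qed blast

lemma nonneg_lattice_induct [consumes 2, case_names zero step]:
  fixes r :: "'v::finite qvec"
  assumes "r \<in> Lat" "0 \<le> r" "P 0"
    and step: "\<And>r j. r \<in> Lat \<Longrightarrow> 0 \<le> r \<Longrightarrow> P r \<Longrightarrow> P (r + basis j)"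
  shows "P r"
proof -
  have "\<forall>r. r \<in> Lat \<longrightarrow> 0 \<le> r \<longrightarrow> (\<Sum>j\<in>UNIV. r j) \<le> of_nat n \<longrightarrow> P r" for n
  proof (induction n)
    case 0
    show ?case
    proof (intro allI impI)
      fix r :: "'v qvec" assume r: "r \<in> Lat" "0 \<le> r" "(\<Sum>j\<in>UNIV. r j) \<le> of_nat 0"
      have nn: "0 \<le> r j" for j using r(2) by (simp add: le_fun_def)
      hence "(\<Sum>j\<in>UNIV. r j) = 0" using r(3) sum_nonneg[of UNIV r] by force
      hence "r j = 0" for j using nn sum_nonneg_eq_0_iff[of UNIV r] by simp
      hence "r = 0" by (simp add: fun_eq_iff)
      thus "P r" using assms(3) by simp
    qed
  next
    case (Suc n)
    show ?case
    proof (intro allI impI)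
      fix r :: "'v qvec" assume r: "r \<in> Lat" "0 \<le> r" "(\<Sum>j\<in>UNIV. r j) \<le> of_nat (Suc n)"
      show "P r"
      proof (cases "r = 0")
        case False
        then obtain j where "r j \<noteq> 0" by (auto simp: fun_eq_iff)
        moreover have nn: "0 \<le> r j" for j using r(2) by (simp add: le_fun_def)
        ultimately have "0 < r j" by (simp add: less_le)
        hence "0 + 1 \<le> r j" by (intro Ints_less_imp_le) (use r(1) in \<open>auto simp: Lat_def\<close>)
        hence nn': "0 \<le> r - basis j" using nn by (auto simp: le_fun_def ind_apply)
        have "(\<Sum>i\<in>UNIV. (r - basis j) i) = (\<Sum>i\<in>UNIV. r i) - 1"
          by (simp add: sum_subtractf ind_apply)
        hence le: "(\<Sum>i\<in>UNIV. (r - basis j) i) \<le> of_nat n" using r(3) by simp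
        have L: "r - basis j \<in> Lat" using r(1) by (rule Lat_diff) (rule Lat_ind)
        from Suc[rule_format, OF L nn' le] have "P (r - basis j)" .
        from step[OF L nn' this, of j] show ?thesis by (simp only: diff_add_cancel)
      qed (use assms(3) in simp)
    qed
  qed
  moreover obtain n :: nat where "(\<Sum>j\<in>UNIV. r j) \<le> of_nat n" using real_arch_simple by blast
  ultimately show ?thesis using assms(1,2) by (metis (no_types))
qed

text \<open>Enlarging the upper end by unit steps, each of which adds a layer along which the weight does not decrease.\<close>
lemma collapses_up:
  fixes w :: "'v::finite qvec \<Rightarrow> 'a::linordered_idom"
  assumes "b \<in> Lat" "a \<le> b" "r \<in> Lat" "0 \<le> r"
    and "\<And>q j y. q \<in> Lat \<Longrightarrow> 0 \<le> q \<Longrightarrow> q \<le> r \<Longrightarrow> q j + 1 \<le> r j \<Longrightarrow> y \<in> Lat \<Longrightarrow> a \<le> y \<Longrightarrow> y \<le> b + q \<Longrightarrow> y j = b j + q j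
          \<Longrightarrow> w y \<le> w (y + basis j)"
  shows "(collapse_step w)\<^sup>*\<^sup>* (box_cubes a b) (box_cubes a (b + r))"
  using assms(3-5)
proof (induction rule: nonneg_lattice_induct)
  case (step r j)
  have "(collapse_step w)\<^sup>*\<^sup>* (box_cubes a b) (box_cubes a (b + r))"
  proof (rule step.IH)
    fix q i y assume *: "q \<in> Lat" "0 \<le> q" "q \<le> r" "q i + 1 \<le> r i" "y \<in> Lat" "a \<le> y" "y \<le> b + q" "y i = b i + q i"
    have "r \<le> r + basis j" using ind_nonneg[of "{j}"] by (simp add: le_add_same_cancel1)
    hence "q \<le> r + basis j" "q i + 1 \<le> (r + basis j) i" using *(3,4) by (auto simp: le_fun_def intro: order_trans)
    thus "w y \<le> w (y + basis i)" using step.prems[of q i y] * by blast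
  qed
  moreover have "collapse_step w (box_cubes a (b + r)) (box_cubes a (b + r + basis j))"
  proof (rule collapse_step_up)
    show "b + r \<in> Lat" using assms(1) step.hyps by blast
    show "a j \<le> (b + r) j" using assms(2) step.hyps(2) by (simp add: le_fun_def add_increasing2)
    fix y assume "y \<in> Lat" "a \<le> y" "y \<le> b + r" "y j = (b + r) j"
    moreover have "r \<le> r + basis j" using ind_nonneg[of "{j}"] by (simp add: le_add_same_cancel1)
    moreover have "r j + 1 \<le> (r + basis j) j" by (simp add: ind_apply)
    ultimately show "w y \<le> w (y + basis j)"
      using step.hyps by (intro step.prems[of r j y]) (auto simp: le_fun_def)
  qed
  ultimately have "(collapse_step w)\<^sup>*\<^sup>* (box_cubes a b) (box_cubes a (b + (r + basis j)))"
    by (simp only: add.assoc rtranclp.rtrancl_into_rtrancl)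
  thus ?case by (simp only: plus_fun_def)
next
  case zero
  have "(collapse_step w)\<^sup>*\<^sup>* (box_cubes a b) (box_cubes a (b + 0))"
    unfolding add_0_right by (rule rtranclp.rtrancl_refl)
  thus ?case by (simp only: plus_fun_def zero_fun_def)
qed

lemma collapses_down:
  fixes w :: "'v::finite qvec \<Rightarrow> 'a::linordered_idom"
  assumes "a \<in> Lat" "a \<le> b" "r \<in> Lat" "0 \<le> r"
    and "\<And>q j y. q \<in> Lat \<Longrightarrow> 0 \<le> q \<Longrightarrow> q \<le> r \<Longrightarrow> y \<in> Lat \<Longrightarrow> a - q \<le> y \<Longrightarrow> y \<le> b \<Longrightarrow> y j = a j - q j
          \<Longrightarrow> w y \<le> w (y - basis j)"
  shows "(collapse_step w)\<^sup>*\<^sup>* (box_cubes a b) (box_cubes (a - r) b)"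
  using assms(3-5)
proof (induction rule: nonneg_lattice_induct)
  case (step r j)
  have rr: "r \<le> r + basis j" using ind_nonneg[of "{j}"] by (simp add: le_add_same_cancel1)
  have "(collapse_step w)\<^sup>*\<^sup>* (box_cubes a b) (box_cubes (a - r) b)"
  proof (rule step.IH)
    fix q i y assume *: "q \<in> Lat" "0 \<le> q" "q \<le> r" "y \<in> Lat" "a - q \<le> y" "y \<le> b" "y i = a i - q i"
    thus "w y \<le> w (y - basis i)" using step.prems[of q y i] order_trans[OF *(3) rr] by blast
  qed
  moreover have "collapse_step w (box_cubes (a - r) b) (box_cubes (a - r - basis j) b)"
  proof (rule collapse_step_down)
    show "a - r \<in> Lat" using assms(1) step.hyps by blast
    have "0 \<le> r j" "a j \<le> b j" using assms(2) step.hyps(2) by (auto simp: le_fun_def)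
    thus "(a - r) j \<le> b j" by simp
    fix y assume "y \<in> Lat" "a - r \<le> y" "y \<le> b" "y j = (a - r) j"
    thus "w y \<le> w (y - basis j)"
      using step.hyps rr by (intro step.prems[of r y j]) (auto simp: le_fun_def)
  qed
  ultimately have "(collapse_step w)\<^sup>*\<^sup>* (box_cubes a b) (box_cubes (a - (r + basis j)) b)"
    by (simp only: diff_diff_eq rtranclp.rtrancl_into_rtrancl)
  thus ?case by (simp only: plus_fun_def fun_diff_def)
next
  case zero
  have "(collapse_step w)\<^sup>*\<^sup>* (box_cubes a b) (box_cubes (a - 0) b)"
    unfolding diff_0_right by (rule rtranclp.rtrancl_refl)
  thus ?case by (simp only: fun_diff_def zero_fun_def)
qed

text \<open>A union of boxes that grow by collapses has the Euler characteristic of the first box.\<close>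
lemma eu_of_exhaustion:
  fixes w :: "'v::finite qvec \<Rightarrow> int"
  assumes a: "\<And>t::nat. a t \<in> Lat" and b: "b 0 \<in> Lat" and ab: "a 0 \<le> b 0"
    and step: "\<And>t. (collapse_step w)\<^sup>*\<^sup>* (box_cubes (a t) (b t)) (box_cubes (a (Suc t)) (b (Suc t)))"
  shows "eu (\<Union>t. box_cubes (a t) (b t)) w = euler_sum (box_cubes (a 0) (b 0)) w"
proof -
  define T where "T = (\<Union>t. box_cubes (a t) (b t))"
  define T0 where "T0 = box_cubes (a 0) (b 0)"
  have chain: "(collapse_step w)\<^sup>*\<^sup>* T0 (box_cubes (a t) (b t))" for t
  proof (induction t)
    case (Suc t) thus ?case using step[of t] by (rule rtranclp_trans)
  qed (simp add: T0_def)
  have const: "(collapse_step (\<lambda>_. c))\<^sup>*\<^sup>* {(a 0, {})} T0" for c :: int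
  proof -
    have "(collapse_step (\<lambda>_. c))\<^sup>*\<^sup>* (box_cubes (a 0) (a 0)) (box_cubes (a 0) (a 0 + (b 0 - a 0)))"
      by (rule collapses_up) (use a b ab in auto)
    thus ?thesis using a[of 0] by (simp add: T0_def box_cubes_same)
  qed
  have fin: "finite T0" by (simp add: T0_def finite_box_cubes)
  have a0: "(a 0, {}) \<in> T0" using a ab by (simp add: T0_def box_cubes_def)
  define V where "V = {x. (x, {}) \<in> T0}"
  have finV: "finite V" 
  proof (rule finite_subset)
    show "V \<subseteq> fst ` T0" by (force simp: V_def)
  qed (use fin in simp)
  have "V \<noteq> {}" using a0 by (auto simp: V_def)
  then obtain x0 where x0: "x0 \<in> V" "\<And>x. x \<in> V \<Longrightarrow> w x0 \<le> w x"
    using finV ex_min_if_finite[of "w ` V"] by (metis (no_types, lifting) finite_imageI image_iff image_is_empty linorder_not_less)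
  define N where "N = Max (cube_weight w ` T0)"
  interpret finite_core w T T0 "a 0" x0 N
  proof
    show "face_closed T0" by (simp add: T0_def face_closed_box)
    show "face_closed T" using face_closed_box unfolding T_def face_closed_def by fastforce
    show "finite T0" by (rule fin)
    show "extends_primitives w T0 T" unfolding T0_def T_def
      by (rule extends_primitives_union[of w "\<lambda>t. box_cubes (a t) (b t)"])
        (use collapses_extend[OF step] face_closed_box in auto)
    show "extends_primitives (\<lambda>_. N) {(a 0, {})} T0" by (rule collapses_extend[OF const])
    show "cube_weight w \<sigma> \<le> N" if "\<sigma> \<in> T0" for \<sigma> unfolding N_def using that fin by (intro Max_ge) auto
    show "(x0, {}) \<in> T0" using x0(1) by (simp add: V_def)
    fix x assume "(x, {}) \<in> T"
    then obtain t where "(x, {}) \<in> box_cubes (a t) (b t)" by (auto simp: T_def)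
    then obtain y where "(y, {}) \<in> T0" "w y \<le> w x" using collapses_vertex[OF chain] by blast
    thus "w x0 \<le> w x" using x0(2)[of y] by (simp add: V_def)
  qed
  have "euler_sum T0 (\<lambda>_. 1 :: int) = euler_sum {(a 0, {})} (\<lambda>_. 1)"
    by (rule collapses_euler_sum[OF const fin])
  also have "\<dots> = -1" by (simp add: euler_sum_def)
  finally show ?thesis using eu_eq_euler_sum unfolding T_def T0_def by blast
qed

lemma (in plumbing_tree) chi_kcan_expand:
  "chi G (kcan G) u = - (1/2) * (\<Sum>j\<in>UNIV. u j * (form G u (basis j) + form G (kcan G) (basis j)))"
proof -
  have "form G u (u + kcan G) = form G (u + kcan G) u" by (rule form_sym)
  also have "\<dots> = (\<Sum>j\<in>UNIV. u j * form G (u + kcan G) (basis j))" by (rule form_expand)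
  finally show ?thesis unfolding chi_def by (simp only: form_add_left)
qed

locale bad_tree = characteristic_tree G k for G :: "'v::finite plumbing" and k +
  fixes B :: "'v set"
  assumes bad: "bad_family G B"
begin

text \<open>On vectors with entries zero and one on \<open>B\<close> the value of \<open>\<chi>\<close> does not depend on the decorations in \<open>B\<close>, so it can be computed in the rational graph.\<close>
lemma rational_chi:
  assumes u: "u \<in> Lat" "0 \<le> u" "u \<noteq> 0" and uB: "\<And>l. l \<in> B \<Longrightarrow> u l = 0 \<or> u l = 1"
  shows "1 \<le> chican u"
proof -
  obtain b' where b': "\<And>j. j \<notin> B \<Longrightarrow> b' j = dec G j" "rational_graph (G\<lparr>dec := b'\<rparr>)"
    using bad by (auto simp: bad_family_def)
  define G' where "G' = G\<lparr>dec := b'\<rparr>"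
  interpret G': plumbing_tree G'
    by unfold_locales (use tree b' in \<open>auto simp: G'_def rational_graph_def\<close>)
  have f: "form G' x (basis j) = form G x (basis j) + of_int (b' j - dec G j) * x j" for x j
    unfolding form_basis_expand G'.form_basis_expand by (simp add: G'_def algebra_simps)
  have "chi G' (kcan G') u = - (1/2) * (\<Sum>j\<in>UNIV. u j * (form G' u (basis j) + form G' (kcan G') (basis j)))"
    by (rule G'.chi_kcan_expand)
  also have "(\<Sum>j\<in>UNIV. u j * (form G' u (basis j) + form G' (kcan G') (basis j))) =
      (\<Sum>j\<in>UNIV. u j * (form G u (basis j) + form G (kcan G) (basis j)))"
  proof (rule sum.cong[OF refl])
    fix j
    have d: "dec G' j = b' j" by (simp add: G'_def)
    have k1: "form G' (kcan G') (basis j) = - of_int (b' j) - 2" using G'.kcan[of j] d by simp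
    have k2: "form G (kcan G) (basis j) = - of_int (dec G j) - 2" using kcan[of j] by simp
    show "u j * (form G' u (basis j) + form G' (kcan G') (basis j)) = u j * (form G u (basis j) + form G (kcan G) (basis j))"
    proof (cases "j \<in> B")
      case True
      thus ?thesis using uB[OF True] f[of u j] k1 k2 by auto
    next
      case False
      thus ?thesis using b'(1)[OF False] f[of u j] k1 k2 by simp
    qed
  qed
  also have "- (1/2) * (\<Sum>j\<in>UNIV. u j * (form G u (basis j) + form G (kcan G) (basis j))) = chican u"
    by (rule chi_kcan_expand[symmetric])
  finally have "chi G' (kcan G') u = chican u" .
  moreover have "0 < u" using u(2,3) by (simp add: less_le)
  moreover have "\<forall>l\<in>Lat. l > 0 \<longrightarrow> chi G' (kcan G') l \<ge> 1"
    using b'(2) unfolding rational_graph_def G'_def by (rule conjunct2)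
  ultimately show ?thesis using u(1) by metis
qed

text \<open>
  A nonzero vector with these properties would have \<open>\<chi>\<close> at most zero, against rationality.
\<close>
lemma vanishes_if_steep:
  assumes u: "u \<in> Lat" "0 \<le> u" and uB: "\<And>l. l \<in> B \<Longrightarrow> u l = 0 \<or> u l = 1"
    and steep: "\<And>j. 0 < u j \<Longrightarrow> of_int (dec G j) + 2 \<le> form G u (basis j)"
  shows "u = 0"
proof (rule ccontr)
  assume "u \<noteq> 0"
  hence "1 \<le> chican u" by (rule rational_chi[OF u _ uB])
  also have "chican u = - (1/2) * (\<Sum>j\<in>UNIV. u j * (form G u (basis j) + form G (kcan G) (basis j)))"
    by (rule chi_kcan_expand)
  also have "\<dots> \<le> 0"
  proof -
    have "0 \<le> u j * (form G u (basis j) + form G (kcan G) (basis j))" for j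
    proof (cases "0 < u j")
      case True
      thus ?thesis using steep[OF True] kcan[of j] by (intro mult_nonneg_nonneg) auto
    next
      case False
      moreover have "0 \<le> u j" using u(2) by (simp add: le_fun_def)
      ultimately show ?thesis by simp
    qed
    hence "0 \<le> (\<Sum>j\<in>UNIV. u j * (form G u (basis j) + form G (kcan G) (basis j)))" by (rule sum_nonneg)
    thus ?thesis by simp
  qed
  finally show False by simp
qed

lemma w_step_antimono:
  assumes "\<And>i. x i \<le> y i" "x j = y j" "form G (x + l') (basis j) \<ge> 1"
  shows "w (y + basis j) \<le> w y"
proof -
  have "form G (x + l') (basis j) \<le> form G (y + l') (basis j)" by (rule form_basis_mono) (use assms in auto)
  thus ?thesis using assms(3) by (simp add: w_step)
qed

lemma w_step_mono:
  assumes "\<And>i. x i \<le> y i" "x j = y j" "form G (y + l') (basis j) \<le> 1"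
  shows "w x \<le> w (x + basis j)"
proof -
  have "form G (x + l') (basis j) \<le> form G (y + l') (basis j)" by (rule form_basis_mono) (use assms in auto)
  thus ?thesis using assms(3) by (simp add: w_step)
qed

lemma form_gt_1_imp:
  assumes "x \<in> Lat" "\<not> form G (x + l') (basis j) \<le> 1"
  shows "2 \<le> form G (x + l') (basis j)"
proof -
  have "1 + 1 \<le> form G (x + l') (basis j)"
    by (rule Ints_less_imp_le[OF _ form_shift_Ints[OF assms(1)]]) (use assms(2) in \<open>simp_all only: Ints_1 not_le\<close>)
  thus ?thesis by (simp only: one_add_one)
qed

lemma form_lt_1_imp:
  assumes "x \<in> Lat" "\<not> 1 \<le> form G (x + l') (basis j)"
  shows "form G (x + l') (basis j) \<le> 0"
proof -
  have "form G (x + l') (basis j) + 1 \<le> 1"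
    by (rule Ints_less_imp_le[OF form_shift_Ints[OF assms(1)]]) (use assms(2) in \<open>simp_all only: Ints_1 not_le\<close>)
  thus ?thesis by simp
qed

end

section \<open>The weights on the quadrant\<close>

lemma cube_weight_cong:
  assumes "\<And>J. J \<subseteq> K \<Longrightarrow> f (y + ind J) = g (z + ind J)"
  shows "cube_weight f (y, K) = cube_weight g (z, K)"
proof -
  have "(\<lambda>J. f (y + ind J)) ` Pow K = (\<lambda>J. g (z + ind J)) ` Pow K"
    using assms by (intro image_cong) auto
  thus ?thesis by (simp add: cube_weight_def)
qed

lemma cube_weight_Un:
  fixes w :: "'v::finite qvec \<Rightarrow> 'a::linorder"
  assumes "I \<inter> K = {}"
  shows "cube_weight w (y, I \<union> K) = cube_weight (\<lambda>x. cube_weight w (x, I)) (y, K)"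
proof (rule antisym)
  show "cube_weight w (y, I \<union> K) \<le> cube_weight (\<lambda>x. cube_weight w (x, I)) (y, K)"
    unfolding cube_weight_le_iff
  proof (intro allI impI)
    fix J assume J: "J \<subseteq> I \<union> K"
    have "ind J = ind (J \<inter> K) + ind (J \<inter> I)" using J assms by (auto simp: fun_eq_iff ind_apply)
    hence "w (y + ind J) = w (y + ind (J \<inter> K) + ind (J \<inter> I))" by (simp only: add.assoc)
    also have "\<dots> \<le> cube_weight w (y + ind (J \<inter> K), I)" by (rule cube_weight_ge) simp
    also have "\<dots> \<le> cube_weight (\<lambda>x. cube_weight w (x, I)) (y, K)"
      by (rule cube_weight_ge[of "J \<inter> K" K "\<lambda>x. cube_weight w (x, I)"]) simp
    finally show "w (y + ind J) \<le> cube_weight (\<lambda>x. cube_weight w (x, I)) (y, K)" .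
  qed
  show "cube_weight (\<lambda>x. cube_weight w (x, I)) (y, K) \<le> cube_weight w (y, I \<union> K)"
    unfolding cube_weight_le_iff
  proof (intro allI impI)
    fix J J' assume J: "J \<subseteq> K" "J' \<subseteq> I"
    have "ind (J \<union> J') = ind J + ind J'" using J assms by (auto simp: fun_eq_iff ind_apply)
    hence "w (y + ind J + ind J') = w (y + ind (J \<union> J'))" by (simp only: add.assoc)
    also have "\<dots> \<le> cube_weight w (y, I \<union> K)" by (rule cube_weight_ge) (use J in auto)
    finally show "w (y + ind J + ind J') \<le> cube_weight w (y, I \<union> K)" .
  qed
qed

lemma proj_eq_iff: "proj B x = i \<longleftrightarrow> (\<forall>j\<in>B. x j = i j) \<and> (\<forall>j. j \<notin> B \<longrightarrow> i j = 0)"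
  by (auto simp: proj_def fun_eq_iff)

lemma proj_apply: "proj B x j = (if j \<in> B then x j else 0)"
  by (simp add: proj_def)

lemma proj_add: "proj B (x + y) = proj B x + proj B y"
  by (auto simp: proj_def fun_eq_iff)

lemma Lat_proj [simp]: "x \<in> Lat \<Longrightarrow> proj B x \<in> Lat"
  by (auto simp: proj_def Lat_def)

context bad_tree begin

definition xm :: "'v qvec \<Rightarrow> 'v qvec" where "xm i = xmin G k B i"

abbreviation wb :: "'v qvec \<Rightarrow> rat" where "wb \<equiv> wbar G k B"

lemma wb_eq: "wb i = w (xm i)"
  by (simp add: wbar_def w_def xm_def)

abbreviation feasible :: "'v qvec \<Rightarrow> 'v qvec set" where
  "feasible i \<equiv> {x \<in> Lat. proj B x = i \<and> (\<forall>j. j \<notin> B \<longrightarrow> form G (x + l') (basis j) \<le> 0)}"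

lemma finite_max_nat:
  fixes f :: "'v \<Rightarrow> rat"
  obtains n :: nat where "\<And>j. f j \<le> of_nat n"
proof -
  obtain n :: nat where "Max (range f) \<le> of_nat n" using real_arch_simple by blast
  moreover have "f j \<le> Max (range f)" for j by (rule Max_ge) auto
  ultimately show ?thesis using that order_trans by blast
qed

lemma min_feasible:
  assumes "x \<in> Lat" "y \<in> Lat" "\<And>j. j \<notin> B \<Longrightarrow> form G (x + l') (basis j) \<le> 0" "\<And>j. j \<notin> B \<Longrightarrow> form G (y + l') (basis j) \<le> 0"
  shows "(\<lambda>j. min (x j) (y j)) \<in> Lat"
    and "j \<notin> B \<Longrightarrow> form G ((\<lambda>j. min (x j) (y j)) + l') (basis j) \<le> 0"
proof -
  show "(\<lambda>j. min (x j) (y j)) \<in> Lat" using assms(1,2) by (auto simp: Lat_def min_def)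
  assume j: "j \<notin> B"
  define z where "z = (if x j \<le> y j then x else y)"
  have "form G ((\<lambda>j. min (x j) (y j)) + l') (basis j) \<le> form G (z + l') (basis j)"
    by (rule form_basis_mono) (auto simp: z_def)
  also have "\<dots> \<le> 0" using assms(3,4)[OF j] by (simp add: z_def)
  finally show "form G ((\<lambda>j. min (x j) (y j)) + l') (basis j) \<le> 0" .
qed

lemma xm_feasible_least:
  assumes i: "i \<in> Lat" "proj B i = i"
  shows "xm i \<in> feasible i \<and> (\<forall>x\<in>feasible i. xm i \<le> x)"
proof -
  obtain u where u: "\<And>j. j \<in> B \<Longrightarrow> u j = 0" "\<And>j. j \<notin> B \<Longrightarrow> form G u (basis j) = -1"
    using mixed_system_solvable[of B "\<lambda>j. if j \<in> B then 0 else -1"] by auto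
  obtain M :: nat where M: "M > 0" "(\<lambda>j. of_nat M * u j) \<in> Lat" by (rule integral_multiple_vector)
  obtain n :: nat where n: "\<And>j. form G (i + l') (basis j) \<le> of_nat n"
    using finite_max_nat[of "\<lambda>j. form G (i + l') (basis j)"] by blast
  define x where "x = i + (\<lambda>j. of_nat n * (of_nat M * u j))"
  have xL: "x \<in> Lat" unfolding x_def using i(1) Lat_scale[OF M(2), of n] by (rule Lat_add)
  have ne: "x \<in> feasible i" unfolding mem_Collect_eq
  proof (intro conjI allI impI xL)
    show "proj B x = i" using i(2) u(1) unfolding proj_eq_iff by (auto simp: x_def)
    fix j assume j: "j \<notin> B"
    have "form G (x + l') (basis j) = form G (i + l') (basis j) - of_nat n * of_nat M"
      unfolding x_def form_add_left form_scale_left using u(2)[OF j] by simp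
    moreover have "of_nat n * 1 \<le> (of_nat n * of_nat M :: rat)" using M(1) by (intro mult_left_mono) auto
    ultimately show "form G (x + l') (basis j) \<le> 0" using n[of j] by simp
  qed
  obtain p where p: "\<And>j. j \<in> B \<Longrightarrow> p j = i j" "\<And>j. j \<notin> B \<Longrightarrow> form G p (basis j) = - form G l' (basis j)"
    using mixed_system_solvable[of B "\<lambda>j. if j \<in> B then i j else - form G l' (basis j)"] by auto
  have bd: "p \<le> y" if y: "y \<in> feasible i" for y
  proof -
    have "0 \<le> y - p"
    proof (rule nonneg_if_antinef[of B])
      show "0 \<le> (y - p) j" if "j \<in> B" for j using y that p(1)[OF that] unfolding proj_eq_iff by auto
      show "form G (y - p) (basis j) \<le> 0" if "j \<notin> B" for j
        using y that p(2)[OF that] by (auto simp: form_diff_left form_add_left)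
    qed
    thus ?thesis by (simp only: diff_ge_0_iff_ge)
  qed
  have inf: "(\<lambda>j. min (x j) (y j)) \<in> feasible i" if "x \<in> feasible i" "y \<in> feasible i" for x y
    using that min_feasible[of x y] unfolding mem_Collect_eq proj_eq_iff by auto
  have sub: "feasible i \<subseteq> Lat" by blast
  obtain m where m: "m \<in> feasible i" "\<And>x. x \<in> feasible i \<Longrightarrow> m \<le> x"
    using least_lattice_point[OF sub _ bd inf] ne by blast
  have "xm i = m" unfolding xm_def xmin_def by (rule the_minimal_eq[OF m])
  thus ?thesis using m by blast
qed

lemma
  assumes i: "i \<in> Lat" "proj B i = i"
  shows xm_Lat: "xm i \<in> Lat"
    and xm_B: "\<And>j. j \<in> B \<Longrightarrow> xm i j = i j"
    and xm_form: "\<And>j. j \<notin> B \<Longrightarrow> form G (xm i + l') (basis j) \<le> 0"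
    and xm_least: "\<And>x. x \<in> Lat \<Longrightarrow> (\<And>j. j \<in> B \<Longrightarrow> x j = i j) \<Longrightarrow>
        (\<And>j. j \<notin> B \<Longrightarrow> form G (x + l') (basis j) \<le> 0) \<Longrightarrow> xm i \<le> x"
proof -
  have f: "xm i \<in> feasible i" and l: "\<forall>x\<in>feasible i. xm i \<le> x" using xm_feasible_least[OF i] by blast+
  have i0: "i j = 0" if "j \<notin> B" for j using i(2) that unfolding proj_eq_iff by blast
  show "xm i \<in> Lat" "\<And>j. j \<in> B \<Longrightarrow> xm i j = i j" "\<And>j. j \<notin> B \<Longrightarrow> form G (xm i + l') (basis j) \<le> 0"
    using f unfolding mem_Collect_eq proj_eq_iff by blast+
  fix x assume "x \<in> Lat" "\<And>j. j \<in> B \<Longrightarrow> x j = i j" "\<And>j. j \<notin> B \<Longrightarrow> form G (x + l') (basis j) \<le> 0"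
  hence "x \<in> feasible i" using i0 unfolding mem_Collect_eq proj_eq_iff by blast
  thus "xm i \<le> x" using l by blast
qed

lemma xm_mono:
  assumes i: "i \<in> Lat" "proj B i = i" and i': "i' \<in> Lat" "proj B i' = i'" and le: "i \<le> i'"
  shows "xm i \<le> xm i'"
proof -
  define y where "y = (\<lambda>j. min (xm i j) (xm i' j))"
  note m = min_feasible[OF xm_Lat[OF i] xm_Lat[OF i'] xm_form[OF i] xm_form[OF i'], folded y_def]
  have "xm i \<le> y"
  proof (rule xm_least[OF i m(1) _ m(2)])
    fix j assume "j \<in> B"
    thus "y j = i j" using xm_B[OF i] xm_B[OF i'] le by (simp add: y_def le_fun_def)
  qed
  also have "y \<le> xm i'" by (auto simp: y_def le_fun_def)
  finally show ?thesis .
qed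

lemma w_above_xm:
  assumes i: "i \<in> Lat" "proj B i = i" and u: "u \<in> Lat" "0 \<le> u" "\<And>j. j \<in> B \<Longrightarrow> u j = 0"
  shows "w (xm i) \<le> w (xm i + u)"
proof (cases "u = 0")
  case False
  have "1 \<le> chican u" by (rule rational_chi[OF u(1,2) False]) (use u(3) in blast)
  moreover have "form G (xm i + l') u \<le> 0" unfolding form_expand[of G _ u]
  proof (rule sum_nonpos)
    fix j
    show "u j * form G (xm i + l') (basis j) \<le> 0"
      using u(2,3) xm_form[OF i, of j] by (cases "j \<in> B") (auto intro: mult_nonneg_nonpos simp: le_fun_def)
  qed
  ultimately show ?thesis unfolding w_add[of "xm i" u] by simp
qed simp

text \<open>A step down from \<open>x(i)\<close> can be undone along vertices off \<open>B\<close> at which the inequality fails, and these steps do not increase the weight.\<close>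
lemma w_below_xm:
  assumes i: "i \<in> Lat" "proj B i = i"
    and u: "u \<in> Lat" "0 \<le> u" "\<And>j. j \<in> B \<Longrightarrow> u j = 0"
  shows "w (xm i) \<le> w (xm i - u)"
proof -
  have "\<forall>u. u \<in> Lat \<longrightarrow> 0 \<le> u \<longrightarrow> (\<forall>j\<in>B. u j = 0) \<longrightarrow> (\<Sum>j\<in>UNIV. u j) \<le> of_nat n \<longrightarrow> w (xm i) \<le> w (xm i - u)" for n
  proof (induction n)
    case 0
    show ?case
    proof (intro allI impI)
      fix u :: "'v qvec" assume u: "u \<in> Lat" "0 \<le> u" "(\<Sum>j\<in>UNIV. u j) \<le> of_nat 0"
      have nn: "0 \<le> u j" for j using u(2) by (simp add: le_fun_def)
      have "(\<Sum>j\<in>UNIV. u j) = 0" using u(3) nn sum_nonneg[of UNIV u] by (simp add: order_antisym)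
      hence "u j = 0" for j using nn sum_nonneg_eq_0_iff[of UNIV u] by simp
      hence "u = 0" by (simp add: fun_eq_iff)
      thus "w (xm i) \<le> w (xm i - u)" by simp
    qed
  next
    case (Suc n)
    show ?case
    proof (intro allI impI)
      fix u :: "'v qvec"
      assume u: "u \<in> Lat" "0 \<le> u" "\<forall>j\<in>B. u j = 0" "(\<Sum>j\<in>UNIV. u j) \<le> of_nat (Suc n)"
      show "w (xm i) \<le> w (xm i - u)"
      proof (cases "u = 0")
        case False
        have nn: "0 \<le> u j" for j using u(2) by (simp add: le_fun_def)
        have yL: "xm i - u \<in> Lat" using xm_Lat[OF i] u(1) by (rule Lat_diff)
        have "\<exists>j. j \<notin> B \<and> 1 \<le> form G (xm i - u + l') (basis j)"
        proof (rule ccontr)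
          assume H: "\<nexists>j. j \<notin> B \<and> 1 \<le> form G (xm i - u + l') (basis j)"
          have "xm i \<le> xm i - u"
          proof (rule xm_least[OF i yL])
            fix j show "j \<in> B \<Longrightarrow> (xm i - u) j = i j" using xm_B[OF i] u(3) by simp
            show "j \<notin> B \<Longrightarrow> form G (xm i - u + l') (basis j) \<le> 0" using H form_lt_1_imp[OF yL] by blast
          qed
          hence "u \<le> 0" by (simp add: le_fun_def)
          thus False using False u(2) by (simp add: order_antisym)
        qed
        then obtain j where j: "j \<notin> B" "1 \<le> form G (xm i - u + l') (basis j)" by blast
        have "u j \<noteq> 0"
        proof
          assume "u j = 0"
          have "form G (xm i - u + l') (basis j) \<le> form G (xm i + l') (basis j)"
            by (rule form_basis_mono) (use nn \<open>u j = 0\<close> in auto)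
          thus False using j(2) xm_form[OF i j(1)] by simp
        qed
        hence "0 < u j" using nn[of j] by simp
        hence "0 + 1 \<le> u j" by (intro Ints_less_imp_le) (use u(1) in \<open>auto simp: Lat_def\<close>)
        hence nn': "0 \<le> u - basis j" using nn by (auto simp: le_fun_def ind_apply)
        have "(\<Sum>i\<in>UNIV. (u - basis j) i) = (\<Sum>i\<in>UNIV. u i) - 1" by (simp add: sum_subtractf ind_apply)
        hence le: "(\<Sum>i\<in>UNIV. (u - basis j) i) \<le> of_nat n" using u(4) by simp
        have L: "u - basis j \<in> Lat" using u(1) by (rule Lat_diff) (rule Lat_ind)
        have z: "\<forall>i\<in>B. (u - basis j) i = 0" using u(3) j(1) by (auto simp: ind_apply)
        have "w (xm i) \<le> w (xm i - (u - basis j))" by (rule Suc[rule_format, OF L nn' _ le]) (use z in blast)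
        also have "xm i - (u - basis j) = xm i - u + basis j" by simp
        also have "w (xm i - u + basis j) \<le> w (xm i - u)" unfolding w_step using j(2) by simp
        finally show ?thesis .
      qed simp
    qed
  qed
  moreover obtain n :: nat where "(\<Sum>j\<in>UNIV. u j) \<le> of_nat n" using real_arch_simple by blast
  ultimately show ?thesis using u by blast
qed

text \<open>The value at \<open>xm i\<close> is minimal in its fibre: pass to the meet with \<open>xm i\<close> by submodularity.\<close>
lemma wb_le:
  assumes i: "i \<in> Lat" "proj B i = i" and y: "y \<in> Lat" "\<And>j. j \<in> B \<Longrightarrow> y j = i j"
  shows "wb i \<le> w y"
proof -
  define z where "z = (\<lambda>j. min (xm i j) (y j))"
  define a where "a = xm i - z"
  define b where "b = y - z"
  have zL: "z \<in> Lat" using xm_Lat[OF i] y(1) by (auto simp: z_def Lat_def min_def)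
  have aL: "a \<in> Lat" "b \<in> Lat" unfolding a_def b_def using zL xm_Lat[OF i] y(1) by auto
  have a0: "0 \<le> a" "0 \<le> b" by (auto simp: a_def b_def z_def le_fun_def)
  have aB: "j \<in> B \<Longrightarrow> a j = 0" "j \<in> B \<Longrightarrow> b j = 0" for j
    using xm_B[OF i, of j] y(2)[of j] by (auto simp: a_def b_def z_def)
  have "0 \<le> form G a b" unfolding form_def
  proof (intro sum_nonneg)
    fix p q
    show "0 \<le> of_int (entry G p q) * a p * b q"
    proof (cases "p = q")
      case True
      have "a q * b q = 0" by (auto simp: a_def b_def z_def min_def)
      thus ?thesis unfolding True mult.assoc by (simp only: mult_zero_right)
    next
      case False
      thus ?thesis using entry_off_diagonal[OF False, of G] a0
        by (intro mult_nonneg_nonneg) (auto simp: le_fun_def)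
    qed
  qed
  hence "w (z + a + b) - w (z + a) \<le> w (z + b) - w z"
    unfolding w_add[of "z + a" b] w_add[of z b] by (simp add: form_add_left)
  moreover have "z + a = xm i" "z + b = y" by (auto simp: a_def b_def)
  moreover have "w (xm i) \<le> w (xm i + b)" by (rule w_above_xm[OF i aL(2) a0(2) aB(2)])
  moreover have "w (xm i) \<le> w z"
  proof -
    have "xm i - a = z" by (auto simp: a_def fun_eq_iff)
    thus ?thesis using w_below_xm[OF i aL(1) a0(1) aB(1)] by (simp only:)
  qed
  ultimately show ?thesis unfolding wb_eq by simp
qed

text \<open>By rationality the weight at \<open>x(i + E_l)\<close> is the weight at \<open>x(i) + E_l\<close>.\<close>
lemma wb_step:
  assumes i: "i \<in> Lat" "proj B i = i" and l: "l \<in> B"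
  shows "wb (i + basis l) = wb i + 1 - form G (xm i + l') (basis l)"
proof -
  have bl: "proj B (basis l) = basis l" using l by (auto simp: proj_def fun_eq_iff ind_apply)
  have i': "i + basis l \<in> Lat" "proj B (i + basis l) = i + basis l"
    using i bl by (auto simp: proj_add)
  have "wb (i + basis l) \<le> w (xm i + basis l)"
    by (rule wb_le[OF i']) (use xm_Lat[OF i] xm_B[OF i] in auto)
  moreover have "w (xm i + basis l) \<le> wb (i + basis l)"
  proof -
    define u where "u = xm (i + basis l) - xm i - basis l"
    have uL: "u \<in> Lat" unfolding u_def using xm_Lat[OF i] xm_Lat[OF i'] by auto
    have uB: "u j = 0" if "j \<in> B" for j using xm_B[OF i that] xm_B[OF i' that] by (simp add: u_def)
    have "xm i \<le> xm (i + basis l)"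
      by (rule xm_mono[OF i i']) (use ind_nonneg[of "{l}"] in \<open>simp add: le_add_same_cancel1\<close>)
    have u0: "0 \<le> u j" for j
    proof (cases "j \<in> B")
      case False
      hence "j \<noteq> l" using l by auto
      thus ?thesis using \<open>xm i \<le> xm (i + basis l)\<close> by (simp add: u_def le_fun_def ind_apply)
    qed (simp add: uB)
    define v where "v = basis l + u"
    have "v l = 1" using uB[OF l] by (simp add: v_def ind_apply)
    have "1 \<le> chican v"
    proof (rule rational_chi)
      show "v \<in> Lat" unfolding v_def using uL by auto
      show "0 \<le> v" using u0 ind_nonneg[of "{l}"] by (simp add: v_def le_fun_def)
      show "v \<noteq> 0" using \<open>v l = 1\<close> by auto
      show "v j = 0 \<or> v j = 1" if "j \<in> B" for j using uB[OF that] by (auto simp: v_def ind_apply)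
    qed
    moreover have "form G (xm i + l') u \<le> 0" unfolding form_expand[of G _ u]
    proof (rule sum_nonpos)
      fix j
      show "u j * form G (xm i + l') (basis j) \<le> 0"
        using u0[of j] uB xm_form[OF i, of j] by (cases "j \<in> B") (auto intro: mult_nonneg_nonpos)
    qed
    moreover have "xm (i + basis l) = xm i + v" by (simp add: u_def v_def)
    ultimately show ?thesis unfolding wb_eq w_step using w_add[of "xm i" v] by (simp add: v_def form_add_right)
  qed
  ultimately show ?thesis unfolding wb_eq w_step by simp
qed

text \<open>
  Contracting a fibre. The box \<open>[a, b]\<close> and the set \<open>I\<close> are shrunk as long as an
  end can be moved without changing the relevant maxima and minima; a position from which nothing
  can be moved is excluded by \<open>vanishes_if_steep\<close>.
\<close>
lemma fibre_contraction:
  assumes "a \<in> Lat" "b \<in> Lat" "a \<le> b" "I \<subseteq> B" "\<And>j. j \<in> B \<Longrightarrow> a j = b j"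
  shows "\<exists>x J. x \<in> Lat \<and> a \<le> x \<and> x \<le> b \<and> J \<subseteq> I \<and>
    euler_sum (box_cubes a b) (\<lambda>x. cube_weight w (x, I)) = - w (x + ind J) \<and>
    (\<forall>J'\<subseteq>I. w (x + ind J') \<le> w (x + ind J)) \<and>
    (\<forall>y\<in>Lat. a \<le> y \<longrightarrow> y \<le> b \<longrightarrow> w (x + ind J) \<le> w (y + ind J))"
proof -
  have main: "\<forall>a b I. a \<in> Lat \<longrightarrow> b \<in> Lat \<longrightarrow> a \<le> b \<longrightarrow> I \<subseteq> B \<longrightarrow> (\<forall>j\<in>B. a j = b j) \<longrightarrow>
     of_nat (card I) + (\<Sum>j\<in>UNIV. b j - a j) \<le> of_nat n \<longrightarrow>
    (\<exists>x J. x \<in> Lat \<and> a \<le> x \<and> x \<le> b \<and> J \<subseteq> I \<and>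
    euler_sum (box_cubes a b) (\<lambda>x. cube_weight w (x, I)) = - w (x + ind J) \<and>
    (\<forall>J'\<subseteq>I. w (x + ind J') \<le> w (x + ind J)) \<and>
    (\<forall>y\<in>Lat. a \<le> y \<longrightarrow> y \<le> b \<longrightarrow> w (x + ind J) \<le> w (y + ind J)))" for n
  proof (induction n rule: less_induct)
    case (less n)
    show ?case
    proof (intro allI impI)
      fix a b :: "'v qvec" and I
      assume a: "a \<in> Lat" and b: "b \<in> Lat" and ab: "a \<le> b" and I: "I \<subseteq> B" and B: "\<forall>j\<in>B. a j = b j"
        and sz: "of_nat (card I) + (\<Sum>j\<in>UNIV. b j - a j) \<le> (of_nat n :: rat)"
      let ?goal = "\<exists>x J. x \<in> Lat \<and> a \<le> x \<and> x \<le> b \<and> J \<subseteq> I \<and>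
        euler_sum (box_cubes a b) (\<lambda>x. cube_weight w (x, I)) = - w (x + ind J) \<and>
        (\<forall>J'\<subseteq>I. w (x + ind J') \<le> w (x + ind J)) \<and>
        (\<forall>y\<in>Lat. a \<le> y \<longrightarrow> y \<le> b \<longrightarrow> w (x + ind J) \<le> w (y + ind J))"
      have IH: "\<exists>x J. x \<in> Lat \<and> a' \<le> x \<and> x \<le> b' \<and> J \<subseteq> I' \<and>
        euler_sum (box_cubes a' b') (\<lambda>x. cube_weight w (x, I')) = - w (x + ind J) \<and>
        (\<forall>J'\<subseteq>I'. w (x + ind J') \<le> w (x + ind J)) \<and>
        (\<forall>y\<in>Lat. a' \<le> y \<longrightarrow> y \<le> b' \<longrightarrow> w (x + ind J) \<le> w (y + ind J))"
        if "a' \<in> Lat" "b' \<in> Lat" "a' \<le> b'" "I' \<subseteq> B" "\<forall>j\<in>B. a' j = b' j"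
          "of_nat (card I') + (\<Sum>j\<in>UNIV. b' j - a' j) + 1 \<le> (of_nat n :: rat)" for a' b' I'
      proof -
        have nn: "0 \<le> (\<Sum>j\<in>UNIV. b' j - a' j)"
          by (rule sum_nonneg) (use that(3) in \<open>auto simp: le_fun_def\<close>)
        have "0 < n"
        proof (rule ccontr)
          assume "\<not> 0 < n"
          hence "of_nat (card I') + (\<Sum>j\<in>UNIV. b' j - a' j) + 1 \<le> (0 :: rat)" using that(6) by simp
          moreover have "(0::rat) \<le> of_nat (card I')" by simp
          ultimately show False using nn by linarith
        qed
        hence "(of_nat n :: rat) = of_nat (n - 1) + 1" by (simp add: of_nat_diff)
        hence "of_nat (card I') + (\<Sum>j\<in>UNIV. b' j - a' j) \<le> (of_nat (n - 1) :: rat)" using that(6) by linarith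
        moreover have "n - 1 < n" using \<open>0 < n\<close> by simp
        ultimately show ?thesis using less.IH[of "n - 1"] that(1-5) by blast
      qed
      have pin: "y l = a l" "y l = b l" if "a \<le> y" "y \<le> b" "l \<in> B" for y l
        using le_funD[OF that(1), of l] le_funD[OF that(2), of l] bspec[OF B that(3)] by linarith+
      consider (dropl) l where "l \<in> I" "1 \<le> form G (a + l') (basis l)"
        | (keepl) l where "l \<in> I" "form G (b + ind I - basis l + l') (basis l) \<le> 1"
        | (up) j where "j \<notin> B" "a j < b j" "1 \<le> form G (a + l') (basis j)"
        | (down) j where "j \<notin> B" "a j < b j" "form G (b + ind I - basis j + l') (basis j) \<le> 1"
        | (stuck) "\<And>l. l \<in> I \<Longrightarrow> \<not> 1 \<le> form G (a + l') (basis l)"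
            "\<And>l. l \<in> I \<Longrightarrow> \<not> form G (b + ind I - basis l + l') (basis l) \<le> 1"
            "\<And>j. j \<notin> B \<Longrightarrow> a j < b j \<Longrightarrow> \<not> 1 \<le> form G (a + l') (basis j)"
            "\<And>j. j \<notin> B \<Longrightarrow> a j < b j \<Longrightarrow> \<not> form G (b + ind I - basis j + l') (basis j) \<le> 1"
        by blast
      thus ?goal
      proof cases
        case dropl
        have mono: "w (y + ind J + basis l) \<le> w (y + ind J)" if "a \<le> y" "y \<le> b" "J \<subseteq> I - {l}" for y J
        proof (rule w_step_antimono[OF _ _ dropl(2)])
          show "a i \<le> (y + ind J) i" for i using that(1) by (simp add: le_fun_def ind_apply add_increasing2)
          have "l \<in> B" "l \<notin> J" using that(3) dropl(1) I by auto
          thus "a l = (y + ind J) l" using pin(1)[OF that(1,2)] by (simp add: ind_apply)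
        qed
        have wt: "cube_weight w (y, I) = cube_weight w (y, I - {l})" if "a \<le> y" "y \<le> b" for y
        proof -
          have "cube_weight w (y + basis l, I - {l}) \<le> cube_weight w (y, I - {l})"
          proof (rule cube_weight_mono)
            fix J assume "J \<subseteq> I - {l}"
            from mono[OF that this] show "w (y + basis l + ind J) \<le> w (y + ind J)" by (simp only: ac_simps)
          qed
          thus ?thesis using cube_weight_insert[of l "I - {l}" w y] dropl(1) by (simp add: insert_absorb)
        qed
        have "card I = Suc (card (I - {l}))" using dropl(1) by (intro card.remove) auto
        hence "of_nat (card (I - {l})) + (\<Sum>j\<in>UNIV. b j - a j) + 1 \<le> (of_nat n :: rat)" using sz by simp
        then obtain x J where xJ: "x \<in> Lat" "a \<le> x" "x \<le> b" "J \<subseteq> I - {l}"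
          "euler_sum (box_cubes a b) (\<lambda>x. cube_weight w (x, I - {l})) = - w (x + ind J)"
          "\<forall>J'\<subseteq>I - {l}. w (x + ind J') \<le> w (x + ind J)"
          "\<forall>y\<in>Lat. a \<le> y \<longrightarrow> y \<le> b \<longrightarrow> w (x + ind J) \<le> w (y + ind J)"
          using IH[OF a b ab _ B, of "I - {l}"] I by blast
        have e: "euler_sum (box_cubes a b) (\<lambda>x. cube_weight w (x, I)) = euler_sum (box_cubes a b) (\<lambda>x. cube_weight w (x, I - {l}))"
          unfolding euler_sum_def
        proof (rule sum.cong[OF refl], rule arg_cong[where f = "\<lambda>x. _ * x"])
          fix \<sigma> assume "\<sigma> \<in> box_cubes a b"
          then obtain y K where \<sigma>: "\<sigma> = (y, K)" "(y, K) \<in> box_cubes a b" by (cases \<sigma>) auto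
          show "cube_weight (\<lambda>x. cube_weight w (x, I)) \<sigma> = cube_weight (\<lambda>x. cube_weight w (x, I - {l})) \<sigma>"
            unfolding \<sigma>(1)
          proof (rule cube_weight_cong)
            fix J assume "J \<subseteq> K"
            have "y + ind J \<le> y + ind K" using \<open>J \<subseteq> K\<close> by (auto simp: le_fun_def ind_apply)
            hence "y + ind J \<le> b" using box_cubesD(3)[OF \<sigma>(2)] by (rule order_trans)
            moreover have "a \<le> y + ind J" using box_cubesD(2)[OF \<sigma>(2)] ind_nonneg[of J] by (simp only: add_increasing2)
            ultimately show "cube_weight w (y + ind J, I) = cube_weight w (y + ind J, I - {l})" by (rule wt[rotated])
          qed
        qed
        have m: "w (x + ind J') \<le> w (x + ind J)" if "J' \<subseteq> I" for J'
        proof (cases "l \<in> J'")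
          case True
          have e': "x + ind J' = x + ind (J' - {l}) + basis l"
            using True by (auto simp: fun_eq_iff ind_apply)
          have "J' - {l} \<subseteq> I - {l}" using that by auto
          from mono[OF xJ(2,3) this] have "w (x + ind J') \<le> w (x + ind (J' - {l}))" unfolding e' .
          also have "\<dots> \<le> w (x + ind J)" using xJ(6) that by blast
          finally show ?thesis .
        qed (use xJ(6) that in blast)
        show ?goal
        proof (rule exI[of _ x], rule exI[of _ J], intro conjI)
          show "x \<in> Lat" by (rule xJ(1))
          show "a \<le> x" by (rule xJ(2))
          show "x \<le> b" by (rule xJ(3))
          show "J \<subseteq> I" using xJ(4) by blast
          show "euler_sum (box_cubes a b) (\<lambda>x. cube_weight w (x, I)) = - w (x + ind J)" using e xJ(5) by (simp only:)
          show "\<forall>J'\<subseteq>I. w (x + ind J') \<le> w (x + ind J)" using m by blast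
          show "\<forall>y\<in>Lat. a \<le> y \<longrightarrow> y \<le> b \<longrightarrow> w (x + ind J) \<le> w (y + ind J)" by (rule xJ(7))
        qed
      next
        case keepl
        have bI: "(b + ind I - basis l) = b + ind (I - {l})" using keepl(1) by (auto simp: fun_eq_iff ind_apply)
        have mono: "w (y + ind J) \<le> w (y + ind J + basis l)" if "a \<le> y" "y \<le> b" "J \<subseteq> I - {l}" for y J
        proof (rule w_step_mono[OF _ _ keepl(2)])
          show "(y + ind J) i \<le> (b + ind I - basis l) i" for i
          proof -
            have "ind J i \<le> ind (I - {l}) i" using that(3) by (auto simp: ind_apply)
            thus ?thesis unfolding bI using le_funD[OF that(2), of i] by (simp add: add_mono)
          qed
          have "l \<in> B" "l \<notin> J" using that(3) keepl(1) I by auto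
          thus "(y + ind J) l = (b + ind I - basis l) l"
            unfolding bI using pin(2)[OF that(1,2)] by (simp add: ind_apply)
        qed
        have wt: "cube_weight w (y, I) = cube_weight w (y + basis l, I - {l})" if "a \<le> y" "y \<le> b" for y
        proof -
          have "cube_weight w (y, I - {l}) \<le> cube_weight w (y + basis l, I - {l})"
          proof (rule cube_weight_mono)
            fix J assume "J \<subseteq> I - {l}"
            from mono[OF that this] show "w (y + ind J) \<le> w (y + basis l + ind J)" by (simp only: ac_simps)
          qed
          thus ?thesis using cube_weight_insert[of l "I - {l}" w y] keepl(1) by (simp add: insert_absorb)
        qed
        have "card I = Suc (card (I - {l}))" using keepl(1) by (intro card.remove) auto
        hence "of_nat (card (I - {l})) + (\<Sum>j\<in>UNIV. (b + basis l) j - (a + basis l) j) + 1 \<le> (of_nat n :: rat)" using sz by simp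
        moreover have "a + basis l \<in> Lat" "b + basis l \<in> Lat" "a + basis l \<le> b + basis l"
          "\<forall>j\<in>B. (a + basis l) j = (b + basis l) j" using a b ab B by auto
        ultimately obtain x J where xJ: "x \<in> Lat" "a + basis l \<le> x" "x \<le> b + basis l" "J \<subseteq> I - {l}"
          "euler_sum (box_cubes (a + basis l) (b + basis l)) (\<lambda>x. cube_weight w (x, I - {l})) = - w (x + ind J)"
          "\<forall>J'\<subseteq>I - {l}. w (x + ind J') \<le> w (x + ind J)"
          "\<forall>y\<in>Lat. a + basis l \<le> y \<longrightarrow> y \<le> b + basis l \<longrightarrow> w (x + ind J) \<le> w (y + ind J)"
          using IH[of "a + basis l" "b + basis l" "I - {l}"] I by blast
        have e: "euler_sum (box_cubes a b) (\<lambda>x. cube_weight w (x, I)) =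
            euler_sum (box_cubes (a + basis l) (b + basis l)) (\<lambda>x. cube_weight w (x, I - {l}))"
          unfolding euler_sum_def
        proof (rule sum.reindex_bij_witness[of _ "\<lambda>(y, K). (y - basis l, K)" "\<lambda>(y, K). (y + basis l, K)"])
          fix \<sigma> assume "\<sigma> \<in> box_cubes a b"
          then obtain y K where \<sigma>: "\<sigma> = (y, K)" "(y, K) \<in> box_cubes a b" by (cases \<sigma>) auto
          note D = box_cubesD[OF \<sigma>(2)]
          have c: "y + basis l + ind K \<le> b + basis l"
            using D(3) by (simp add: le_fun_def algebra_simps)
          show "(case \<sigma> of (y, K) \<Rightarrow> (y + basis l, K)) \<in> box_cubes (a + basis l) (b + basis l)"
            unfolding \<sigma>(1) using D c by (auto simp: box_cubes_def)
          show "(case case \<sigma> of (y, K) \<Rightarrow> (y + basis l, K) of (y, K) \<Rightarrow> (y - basis l, K)) = \<sigma>"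
            by (simp add: \<sigma>(1))
          have "cube_weight (\<lambda>x. cube_weight w (x, I)) (y, K) = cube_weight (\<lambda>x. cube_weight w (x, I - {l})) (y + basis l, K)"
          proof (rule cube_weight_cong)
            fix J assume "J \<subseteq> K"
            have "y + ind J \<le> y + ind K" using \<open>J \<subseteq> K\<close> by (auto simp: le_fun_def ind_apply)
            hence "y + ind J \<le> b" using D(3) by (rule order_trans)
            moreover have "a \<le> y + ind J" using D(2) ind_nonneg[of J] by (simp only: add_increasing2)
            ultimately have "cube_weight w (y + ind J, I) = cube_weight w (y + ind J + basis l, I - {l})" by (rule wt[rotated])
            thus "cube_weight w (y + ind J, I) = cube_weight w (y + basis l + ind J, I - {l})" by (simp only: ac_simps)
          qed
          thus "(- 1) ^ (card (snd (case \<sigma> of (y, K) \<Rightarrow> (y + basis l, K))) + 1) *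
             cube_weight (\<lambda>x. cube_weight w (x, I - {l})) (case \<sigma> of (y, K) \<Rightarrow> (y + basis l, K)) =
             (- 1) ^ (card (snd \<sigma>) + 1) * cube_weight (\<lambda>x. cube_weight w (x, I)) \<sigma>"
            unfolding \<sigma>(1) by simp
        next
          fix \<sigma> assume "\<sigma> \<in> box_cubes (a + basis l) (b + basis l)"
          then obtain y K where \<sigma>: "\<sigma> = (y, K)" "(y, K) \<in> box_cubes (a + basis l) (b + basis l)" by (cases \<sigma>) auto
          note D = box_cubesD[OF \<sigma>(2)]
          have "a \<le> y - basis l" "y - basis l + ind K \<le> b"
            using D(2,3) by (simp_all add: le_fun_def algebra_simps)
          thus "(case \<sigma> of (y, K) \<Rightarrow> (y - basis l, K)) \<in> box_cubes a b"
            unfolding \<sigma>(1) using D(1) by (auto simp: box_cubes_def)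
          show "(case case \<sigma> of (y, K) \<Rightarrow> (y - basis l, K) of (y, K) \<Rightarrow> (y + basis l, K)) = \<sigma>"
            by (simp add: \<sigma>(1))
        qed
        define x' J' where "x' = x - basis l" and "J' = insert l J"
        have sh: "x' + ind J' = x + ind J" using xJ(4) by (auto simp: x'_def J'_def fun_eq_iff ind_apply)
        have x': "x' \<in> Lat" "a \<le> x'" "x' \<le> b" 
          using xJ(1-3) by (auto simp: x'_def le_fun_def le_diff_eq diff_le_eq)
        have m: "w (x' + ind L) \<le> w (x' + ind J')" if "L \<subseteq> I" for L
        proof (cases "l \<in> L")
          case True
          have eL: "x' + ind L = x + ind (L - {l})" using True by (auto simp: x'_def fun_eq_iff ind_apply)
          have "L - {l} \<subseteq> I - {l}" using that by auto
          thus ?thesis unfolding sh eL by (rule xJ(6)[rule_format])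
        next
          case False
          hence "w (x' + ind L) \<le> w (x' + ind L + basis l)" using mono[OF x'(2,3), of L] that by blast
          also have "x' + ind L + basis l = x + ind L" by (simp add: x'_def)
          also have "w (x + ind L) \<le> w (x + ind J)" using xJ(6) that False by blast
          finally show ?thesis unfolding sh .
        qed
        have mm: "w (x' + ind J') \<le> w (y + ind J')" if "y \<in> Lat" "a \<le> y" "y \<le> b" for y
        proof -
          have "y + ind J' = (y + basis l) + ind J" using xJ(4) by (auto simp: J'_def fun_eq_iff ind_apply)
          moreover have "y + basis l \<in> Lat" "a + basis l \<le> y + basis l" "y + basis l \<le> b + basis l" using that by auto
          ultimately show ?thesis unfolding sh using xJ(7) by (simp only:)
        qed
        have "J' \<subseteq> I" using xJ(4) keepl(1) by (auto simp: J'_def)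
        show ?goal
        proof (rule exI[of _ x'], rule exI[of _ J'], intro conjI)
          show "x' \<in> Lat" by (rule x'(1))
          show "a \<le> x'" by (rule x'(2))
          show "x' \<le> b" by (rule x'(3))
          show "J' \<subseteq> I" by (rule \<open>J' \<subseteq> I\<close>)
          show "euler_sum (box_cubes a b) (\<lambda>x. cube_weight w (x, I)) = - w (x' + ind J')" using e xJ(5) sh by (simp only:)
          show "\<forall>L\<subseteq>I. w (x' + ind L) \<le> w (x' + ind J')" using m by blast
          show "\<forall>y\<in>Lat. a \<le> y \<longrightarrow> y \<le> b \<longrightarrow> w (x' + ind J') \<le> w (y + ind J')" using mm by blast
        qed
      next
        case up
        have jI: "j \<notin> I" using up(1) I by blast
        have mono: "w (y + ind J + basis j) \<le> w (y + ind J)" if "a \<le> y" "y j = a j" "J \<subseteq> I" for y J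
        proof (rule w_step_antimono[OF _ _ up(3)])
          show "a i \<le> (y + ind J) i" for i using that(1) by (simp add: le_fun_def ind_apply add_increasing2)
          show "a j = (y + ind J) j" using that jI by (auto simp: ind_apply)
        qed
        have step1: "a j + 1 \<le> b j" by (rule Ints_less_imp_le[OF _ _ up(2)]) (use a b in \<open>auto simp: Lat_def\<close>)
        have ab': "a + basis j \<le> b" using ab step1 by (auto simp: le_fun_def ind_apply)
        have "collapse_step (\<lambda>x. cube_weight w (x, I)) (box_cubes (a + basis j) b) (box_cubes (a + basis j - basis j) b)"
        proof (rule collapse_step_down)
          show "a + basis j \<in> Lat" using a by auto
          show "(a + basis j) j \<le> b j" using step1 by (simp add: ind_apply)
          fix y assume y: "y \<in> Lat" "a + basis j \<le> y" "y \<le> b" "y j = (a + basis j) j"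
          show "cube_weight w (y, I) \<le> cube_weight w (y - basis j, I)"
          proof (rule cube_weight_mono)
            fix J assume J: "J \<subseteq> I"
            have "a \<le> y - basis j" "(y - basis j) j = a j" using y by (auto simp: le_fun_def le_diff_eq ind_apply)
            note m = mono[OF this J]
            have "y - basis j + ind J + basis j = y + ind J" by simp
            with m show "w (y + ind J) \<le> w (y - basis j + ind J)" by (simp only:)
          qed
        qed
        hence e: "euler_sum (box_cubes a b) (\<lambda>x. cube_weight w (x, I)) = euler_sum (box_cubes (a + basis j) b) (\<lambda>x. cube_weight w (x, I))"
          using euler_sum_collapse_step[OF _ finite_box_cubes] by (simp only: add_diff_cancel_right')
        have "(\<Sum>i\<in>UNIV. b i - (a + basis j) i) = (\<Sum>i\<in>UNIV. b i - a i) - 1"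
          by (simp add: sum_subtractf sum.distrib ind_apply)
        hence "of_nat (card I) + (\<Sum>i\<in>UNIV. b i - (a + basis j) i) + 1 \<le> (of_nat n :: rat)" using sz by simp
        moreover have "a + basis j \<in> Lat" "\<forall>i\<in>B. (a + basis j) i = b i" using a B up(1) by (auto simp: ind_apply)
        ultimately obtain x J where xJ: "x \<in> Lat" "a + basis j \<le> x" "x \<le> b" "J \<subseteq> I"
          "euler_sum (box_cubes (a + basis j) b) (\<lambda>x. cube_weight w (x, I)) = - w (x + ind J)"
          "\<forall>J'\<subseteq>I. w (x + ind J') \<le> w (x + ind J)"
          "\<forall>y\<in>Lat. a + basis j \<le> y \<longrightarrow> y \<le> b \<longrightarrow> w (x + ind J) \<le> w (y + ind J)"
          using IH[of "a + basis j" b I] I b ab' by blast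
        have "a \<le> a + basis j" using ind_nonneg[of "{j}"] by (simp add: le_add_same_cancel1)
        hence ax: "a \<le> x" using xJ(2) by (rule order_trans)
        have mm: "w (x + ind J) \<le> w (y + ind J)" if "y \<in> Lat" "a \<le> y" "y \<le> b" for y
        proof (cases "y j = a j")
          case True
          have "y i + basis j i \<le> b i" for i using that(3) step1 True by (cases "i = j") (auto simp: le_fun_def ind_apply)
          hence "y + basis j \<in> Lat" "a + basis j \<le> y + basis j" "y + basis j \<le> b" using that by (auto simp: le_fun_def)
          hence "w (x + ind J) \<le> w (y + basis j + ind J)" using xJ(7) by blast
          also have "\<dots> \<le> w (y + ind J)" using mono[OF that(2) True xJ(4)] by (simp only: ac_simps)
          finally show ?thesis .
        next
          case False
          hence "a j < y j" using that(2) by (simp add: le_fun_def less_le)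
          hence "a j + 1 \<le> y j" by (intro Ints_less_imp_le) (use a that(1) in \<open>auto simp: Lat_def\<close>)
          hence "a + basis j \<le> y" using that(2) by (auto simp: le_fun_def ind_apply)
          thus ?thesis using xJ(7) that by blast
        qed
        show ?goal
        proof (rule exI[of _ x], rule exI[of _ J], intro conjI)
          show "x \<in> Lat" by (rule xJ(1))
          show "a \<le> x" by (rule ax)
          show "x \<le> b" by (rule xJ(3))
          show "J \<subseteq> I" by (rule xJ(4))
          show "euler_sum (box_cubes a b) (\<lambda>x. cube_weight w (x, I)) = - w (x + ind J)" using e xJ(5) by (simp only:)
          show "\<forall>J'\<subseteq>I. w (x + ind J') \<le> w (x + ind J)" by (rule xJ(6))
          show "\<forall>y\<in>Lat. a \<le> y \<longrightarrow> y \<le> b \<longrightarrow> w (x + ind J) \<le> w (y + ind J)" using mm by blast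
        qed
      next
        case down
        have jI: "j \<notin> I" using down(1) I by blast
        have mono: "w (y + ind J) \<le> w (y + ind J + basis j)" if "y \<le> b" "y j = b j - 1" "J \<subseteq> I" for y J
        proof (rule w_step_mono[OF _ _ down(3)])
          show "(y + ind J) i \<le> (b + ind I - basis j) i" for i
          proof -
            have "ind J i \<le> ind I i" "j \<notin> J" using that(3) jI by (auto simp: ind_apply)
            thus ?thesis using le_funD[OF that(1), of i] that(2) jI
              by (cases "i = j") (auto simp: ind_apply[of "{j}"] ind_apply[of _ j] add_mono)
          qed
          show "(y + ind J) j = (b + ind I - basis j) j" using that jI by (auto simp: ind_apply)
        qed
        have step1: "a j + 1 \<le> b j" by (rule Ints_less_imp_le[OF _ _ down(2)]) (use a b in \<open>auto simp: Lat_def\<close>)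
        have ab': "a \<le> b - basis j" using ab step1 by (auto simp: le_fun_def ind_apply)
        have "collapse_step (\<lambda>x. cube_weight w (x, I)) (box_cubes a (b - basis j)) (box_cubes a (b - basis j + basis j))"
        proof (rule collapse_step_up)
          show "b - basis j \<in> Lat" using b by auto
          show "a j \<le> (b - basis j) j" using step1 by (simp add: ind_apply)
          fix y assume y: "y \<in> Lat" "a \<le> y" "y \<le> b - basis j" "y j = (b - basis j) j"
          show "cube_weight w (y, I) \<le> cube_weight w (y + basis j, I)"
          proof (rule cube_weight_mono)
            fix J assume J: "J \<subseteq> I"
            have "b - basis j \<le> b" using ind_nonneg[of "{j}"] by simp
            hence "y \<le> b" "y j = b j - 1" using y by (auto simp: ind_apply intro: order_trans)
            from mono[OF this J] show "w (y + ind J) \<le> w (y + basis j + ind J)" by (simp only: ac_simps)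
          qed
        qed
        hence e: "euler_sum (box_cubes a b) (\<lambda>x. cube_weight w (x, I)) = euler_sum (box_cubes a (b - basis j)) (\<lambda>x. cube_weight w (x, I))"
          using euler_sum_collapse_step[OF _ finite_box_cubes] by (simp only: diff_add_cancel)
        have "(\<Sum>i\<in>UNIV. (b - basis j) i - a i) = (\<Sum>i\<in>UNIV. b i - a i) - 1"
          by (simp add: sum_subtractf ind_apply)
        hence "of_nat (card I) + (\<Sum>i\<in>UNIV. (b - basis j) i - a i) + 1 \<le> (of_nat n :: rat)" using sz by simp
        moreover have "b - basis j \<in> Lat" "\<forall>i\<in>B. a i = (b - basis j) i" using b B down(1) by (auto simp: ind_apply)
        ultimately obtain x J where xJ: "x \<in> Lat" "a \<le> x" "x \<le> b - basis j" "J \<subseteq> I"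
          "euler_sum (box_cubes a (b - basis j)) (\<lambda>x. cube_weight w (x, I)) = - w (x + ind J)"
          "\<forall>J'\<subseteq>I. w (x + ind J') \<le> w (x + ind J)"
          "\<forall>y\<in>Lat. a \<le> y \<longrightarrow> y \<le> b - basis j \<longrightarrow> w (x + ind J) \<le> w (y + ind J)"
          using IH[of a "b - basis j" I] I a ab' by blast
        have "b - basis j \<le> b" using ind_nonneg[of "{j}"] by simp
        hence xb: "x \<le> b" using xJ(3) by (rule order_trans[rotated])
        have mm: "w (x + ind J) \<le> w (y + ind J)" if "y \<in> Lat" "a \<le> y" "y \<le> b" for y
        proof (cases "y j = b j")
          case True
          have "a i \<le> y i - basis j i" for i using that(2) step1 True by (cases "i = j") (auto simp: le_fun_def ind_apply)
          hence yy: "y - basis j \<in> Lat" "a \<le> y - basis j" "y - basis j \<le> b - basis j" using that by (auto simp: le_fun_def)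
          hence "w (x + ind J) \<le> w (y - basis j + ind J)" using xJ(7) by blast
          also have "\<dots> \<le> w (y - basis j + ind J + basis j)"
          proof (rule mono[OF _ _ xJ(4)])
            show "y - basis j \<le> b" using yy(3) \<open>b - basis j \<le> b\<close> by (rule order_trans)
            show "(y - basis j) j = b j - 1" using True by (simp add: ind_apply)
          qed
          also have "y - basis j + ind J + basis j = y + ind J" by simp
          finally show ?thesis .
        next
          case False
          hence "y j < b j" using that(3) by (simp add: le_fun_def less_le)
          hence "y j + 1 \<le> b j" by (intro Ints_less_imp_le) (use b that(1) in \<open>auto simp: Lat_def\<close>)
          hence "y \<le> b - basis j" using that(3) by (auto simp: le_fun_def ind_apply)
          thus ?thesis using xJ(7) that by blast
        qed
        show ?goal
        proof (rule exI[of _ x], rule exI[of _ J], intro conjI)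
          show "x \<in> Lat" by (rule xJ(1))
          show "a \<le> x" by (rule xJ(2))
          show "x \<le> b" by (rule xb)
          show "J \<subseteq> I" by (rule xJ(4))
          show "euler_sum (box_cubes a b) (\<lambda>x. cube_weight w (x, I)) = - w (x + ind J)" using e xJ(5) by (simp only:)
          show "\<forall>J'\<subseteq>I. w (x + ind J') \<le> w (x + ind J)" by (rule xJ(6))
          show "\<forall>y\<in>Lat. a \<le> y \<longrightarrow> y \<le> b \<longrightarrow> w (x + ind J) \<le> w (y + ind J)" using mm by blast
        qed
      next
        case stuck
        define u where "u = b + ind I - a"
        have uL: "u \<in> Lat" using a b by (auto simp: u_def)
        have u0: "0 \<le> u" using ab ind_nonneg[of I] by (auto simp: u_def le_fun_def add_increasing2)
        have uB: "u l = 0 \<or> u l = 1" if "l \<in> B" for l using B that by (auto simp: u_def ind_apply)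
        have "u = 0"
        proof (rule vanishes_if_steep[OF uL u0 uB])
          fix j assume uj: "0 < u j"
          have f1: "\<not> 1 \<le> form G (a + l') (basis j)" and f2: "\<not> form G (b + ind I - basis j + l') (basis j) \<le> 1"
          proof -
            have "j \<in> I \<or> (j \<notin> B \<and> a j < b j)"
              using uj B I by (cases "j \<in> I"; cases "j \<in> B") (auto simp: u_def ind_apply)
            thus "\<not> 1 \<le> form G (a + l') (basis j)" "\<not> form G (b + ind I - basis j + l') (basis j) \<le> 1"
              using stuck by blast+
          qed
          have g1: "form G (a + l') (basis j) \<le> 0" by (rule form_lt_1_imp[OF a f1])
          have "b + ind I - basis j \<in> Lat" using b by auto
          hence g2: "2 \<le> form G (b + ind I - basis j + l') (basis j)" using f2 by (rule form_gt_1_imp)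
          have d: "form G (basis j) (basis j) = of_int (dec G j)" by (simp add: form_basis_basis entry_def)
          have "form G u (basis j) = form G (b + ind I - basis j + l') (basis j) + form G (basis j) (basis j) - form G (a + l') (basis j)"
            by (simp add: u_def form_add_left form_diff_left)
          thus "of_int (dec G j) + 2 \<le> form G u (basis j)" using g1 g2 d by simp
        qed
        hence uz: "b j + ind I j = a j" for j by (simp add: u_def fun_eq_iff)
        have "j \<notin> I" for j using uz[of j] le_funD[OF ab, of j] by (auto simp: ind_apply)
        hence I0: "I = {}" by blast
        hence "b = a" using uz by (auto simp: fun_eq_iff)
        have e: "euler_sum (box_cubes a b) (\<lambda>x. cube_weight w (x, I)) = - w (a + ind {})"
          unfolding \<open>b = a\<close> I0 box_cubes_same[OF a] by (simp add: euler_sum_def)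
        have y: "y = a" if "a \<le> y" "y \<le> b" for y using that unfolding \<open>b = a\<close> by (rule order_antisym[rotated])
        show ?goal
        proof (rule exI[of _ a], rule exI[of _ "{}"], intro conjI)
          show "\<forall>J'\<subseteq>I. w (a + ind J') \<le> w (a + ind {})" unfolding I0 by simp
          show "\<forall>y\<in>Lat. a \<le> y \<longrightarrow> y \<le> b \<longrightarrow> w (a + ind {}) \<le> w (y + ind {})"
          proof (intro ballI impI)
            fix z assume "a \<le> z" "z \<le> b"
            from y[OF this] show "w (a + ind {}) \<le> w (z + ind {})" by simp
          qed
        qed (rule a, rule order_refl, rule ab, rule empty_subsetI, rule e)
      qed
    qed
  qed
  obtain n :: nat where n: "of_nat (card I) + (\<Sum>j\<in>UNIV. b j - a j) \<le> (of_nat n :: rat)"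
    using real_arch_simple by blast
  show ?thesis by (rule main[rule_format, OF assms(1-4) _ n]) (rule assms(5))
qed

end

section \<open>Fibres of the projection and deep points\<close>

context bad_tree begin

text \<open>The box is contracted to one point, at which the minimum over the fibre and the maximum over the vertices of the cube are attained together.\<close>
lemma fibre_euler_sum:
  assumes i: "i \<in> Lat" "proj B i = i" and I: "I \<subseteq> B" and ab: "a \<in> Lat" "b \<in> Lat" "a \<le> b"
    and aB: "\<And>j. j \<in> B \<Longrightarrow> a j = i j" "\<And>j. j \<in> B \<Longrightarrow> b j = i j"
    and inside: "\<And>J. J \<subseteq> I \<Longrightarrow> a \<le> xm (i + ind J) - ind J \<and> xm (i + ind J) - ind J \<le> b"
  shows "euler_sum (box_cubes a b) (\<lambda>x. cube_weight w (x, I)) = - cube_weight wb (i, I)"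
proof -
  have ir: "i + ind J \<in> Lat" "proj B (i + ind J) = i + ind J" if "J \<subseteq> I" for J
  proof -
    have "proj B (ind J) = ind J" using that I by (auto simp: proj_def fun_eq_iff ind_apply)
    thus "proj B (i + ind J) = i + ind J" using i(2) by (simp only: proj_add)
    show "i + ind J \<in> Lat" using i(1) by (intro Lat_add Lat_ind)
  qed
  have abB: "a j = b j" if "j \<in> B" for j using aB that by simp
  obtain x J where x: "x \<in> Lat" "a \<le> x" "x \<le> b" "J \<subseteq> I"
    "euler_sum (box_cubes a b) (\<lambda>x. cube_weight w (x, I)) = - w (x + ind J)"
    "\<forall>J'\<subseteq>I. w (x + ind J') \<le> w (x + ind J)"
    "\<forall>y\<in>Lat. a \<le> y \<longrightarrow> y \<le> b \<longrightarrow> w (x + ind J) \<le> w (y + ind J)"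
    using fibre_contraction[OF ab I abB] by blast
  have xB: "x j = i j" if "j \<in> B" for j
    using le_funD[OF x(2), of j] le_funD[OF x(3), of j] aB[OF that] by simp
  have below: "wb (i + ind J') \<le> w (x + ind J')" if "J' \<subseteq> I" for J'
    by (rule wb_le[OF ir[OF that]]) (use x(1) xB in auto)
  have y: "xm (i + ind J) - ind J \<in> Lat" using xm_Lat[OF ir[OF x(4)]] by (rule Lat_diff) (rule Lat_ind)
  have "w (x + ind J) \<le> w (xm (i + ind J) - ind J + ind J)"
    using x(7)[rule_format, OF y] inside[OF x(4)] by blast
  also have "\<dots> = wb (i + ind J)" by (simp add: wb_eq)
  finally have top: "w (x + ind J) = wb (i + ind J)" using below[OF x(4)] by (rule order_antisym)
  have "cube_weight wb (i, I) = wb (i + ind J)"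
  proof (rule order_antisym)
    show "cube_weight wb (i, I) \<le> wb (i + ind J)" unfolding cube_weight_le_iff
    proof (intro allI impI)
      fix J' assume J': "J' \<subseteq> I"
      have "wb (i + ind J') \<le> w (x + ind J')" by (rule below[OF J'])
      also have "\<dots> \<le> w (x + ind J)" using x(6) J' by blast
      finally show "wb (i + ind J') \<le> wb (i + ind J)" unfolding top .
    qed
    show "wb (i + ind J) \<le> cube_weight wb (i, I)" by (rule cube_weight_ge[OF x(4)])
  qed
  thus ?thesis using x(5) top by simp
qed

text \<open>Summing over the fibres of the projection to the coordinates of \<open>B\<close>.\<close>
lemma euler_sum_projection:
  assumes ab: "a \<in> Lat" "b \<in> Lat" "a \<le> b"
    and inside: "\<And>i. i \<in> Lat \<Longrightarrow> proj B i = i \<Longrightarrow> proj B a \<le> i \<Longrightarrow> i \<le> proj B b \<Longrightarrow> a \<le> xm i \<and> xm i \<le> b"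
  shows "euler_sum (box_cubes a b) w = euler_sum (box_cubes (proj B a) (proj B b)) wb"
proof -
  define F where "F = (\<lambda>(i :: 'v qvec, I :: 'v set). box_cubes (\<lambda>j. if j \<in> B then i j else a j) (\<lambda>j. if j \<in> B then i j else b j))"
  define S where "S = box_cubes (proj B a) (proj B b)"
  have base: "i \<in> Lat" "proj B i = i" "proj B a \<le> i" "i + ind I \<le> proj B b" "I \<subseteq> B" if "(i, I) \<in> S" for i I
  proof -
    note D = box_cubesD[OF that[unfolded S_def]]
    show "i \<in> Lat" "proj B a \<le> i" "i + ind I \<le> proj B b" by (rule D)+
    have i0: "i j = 0" if "j \<notin> B" for j
      using le_funD[OF D(2), of j] le_funD[OF D(4), of j] that by (simp add: proj_apply)
    thus "proj B i = i" unfolding proj_eq_iff by auto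
    show "I \<subseteq> B"
    proof
      fix j assume "j \<in> I"
      show "j \<in> B"
      proof (rule ccontr)
        assume "j \<notin> B"
        thus False using le_funD[OF D(3), of j] i0[of j] \<open>j \<in> I\<close> by (simp add: proj_apply ind_apply)
      qed
    qed
  qed
  have fib: "y \<in> Lat" "\<And>j. j \<in> B \<Longrightarrow> y j = i j" "\<And>j. j \<notin> B \<Longrightarrow> a j \<le> y j" "\<And>j. j \<notin> B \<Longrightarrow> y j + ind K j \<le> b j" "K \<inter> B = {}"
    if "(y, K) \<in> F (i, I)" for y K i I
  proof -
    note D = box_cubesD[OF that[unfolded F_def prod.case]]
    show "y \<in> Lat" by (rule D)
    have yB: "y j = i j" "y j + ind K j \<le> i j" if "j \<in> B" for j
      using le_funD[OF D(2), of j] le_funD[OF D(4), of j] le_funD[OF D(3), of j] that by simp_all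
    show "\<And>j. j \<in> B \<Longrightarrow> y j = i j" by (rule yB)
    show "\<And>j. j \<notin> B \<Longrightarrow> a j \<le> y j" subgoal for j using le_funD[OF D(2), of j] by simp done
    show "\<And>j. j \<notin> B \<Longrightarrow> y j + ind K j \<le> b j" subgoal for j using le_funD[OF D(3), of j] by simp done
    have "j \<notin> K" if "j \<in> B" for j using yB[OF that] by (auto simp: ind_apply)
    thus "K \<inter> B = {}" by blast
  qed
  have fibI: "(y, K) \<in> F (i, I)" if "y \<in> Lat" "\<And>j. j \<in> B \<Longrightarrow> y j = i j" "\<And>j. j \<notin> B \<Longrightarrow> a j \<le> y j"
      "\<And>j. j \<notin> B \<Longrightarrow> y j + ind K j \<le> b j" "K \<inter> B = {}" for y K i I
  proof -
    have "j \<in> B \<Longrightarrow> ind K j = (0::rat)" for j using that(5) by (auto simp: ind_apply)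
    thus ?thesis using that unfolding F_def prod.case box_cubes_def mem_Collect_eq le_fun_def by auto
  qed
  have "euler_sum S wb = (\<Sum>(i, I)\<in>S. (-1) ^ card I * euler_sum (F (i, I)) (\<lambda>x. cube_weight w (x, I)))"
    unfolding euler_sum_def[of S]
  proof (rule sum.cong[OF refl])
    fix \<sigma> assume "\<sigma> \<in> S"
    then obtain i I where \<sigma>: "\<sigma> = (i, I)" "(i, I) \<in> S" by (cases \<sigma>) auto
    note b = base[OF \<sigma>(2)]
    have "euler_sum (F (i, I)) (\<lambda>x. cube_weight w (x, I)) = - cube_weight wb (i, I)"
      unfolding F_def prod.case
    proof (rule fibre_euler_sum[OF b(1,2,5)])
      show "(\<lambda>j. if j \<in> B then i j else a j) \<in> Lat" "(\<lambda>j. if j \<in> B then i j else b j) \<in> Lat"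
        using ab b(1) by (auto simp: Lat_def)
      show "(\<lambda>j. if j \<in> B then i j else a j) \<le> (\<lambda>j. if j \<in> B then i j else b j)"
        using ab(3) by (simp add: le_fun_def)
      fix J assume J: "J \<subseteq> I"
      have pJ: "proj B (ind J) = ind J" using J b(5) by (auto simp: proj_def fun_eq_iff ind_apply)
      have iJ: "i + ind J \<in> Lat" "proj B (i + ind J) = i + ind J"
        using b(1,2) pJ by (auto simp: proj_add)
      have "i \<le> i + ind J" using ind_nonneg[of J] by (simp add: le_add_same_cancel1)
      hence l1: "proj B a \<le> i + ind J" using b(3) by (rule order_trans[rotated])
      have "i + ind J \<le> i + ind I" using J by (auto simp: le_fun_def ind_apply)
      hence l2: "i + ind J \<le> proj B b" using b(4) by (rule order_trans)
      note ins = inside[OF iJ l1 l2]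
      have c: "(if j \<in> B then i j else a j) \<le> xm (i + ind J) j - ind J j \<and>
          xm (i + ind J) j - ind J j \<le> (if j \<in> B then i j else b j)" for j
      proof (cases "j \<in> B")
        case True thus ?thesis using xm_B[OF iJ True] by simp
      next
        case False
        hence "j \<notin> J" using J b(5) by auto
        thus ?thesis using False le_funD[OF conjunct1[OF ins], of j] le_funD[OF conjunct2[OF ins], of j]
          by (simp add: ind_apply)
      qed
      show "(\<lambda>j. if j \<in> B then i j else a j) \<le> xm (i + ind J) - ind J \<and>
          xm (i + ind J) - ind J \<le> (\<lambda>j. if j \<in> B then i j else b j)"
        using c by (simp add: le_fun_def)
    qed auto
    thus "(- 1) ^ (card (snd \<sigma>) + 1) * cube_weight wb \<sigma> =
        (case \<sigma> of (i, I) \<Rightarrow> (- 1) ^ card I * euler_sum (F (i, I)) (\<lambda>x. cube_weight w (x, I)))"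
      by (simp add: \<sigma>(1))
  qed
  also have "\<dots> = (\<Sum>\<sigma>\<in>S. \<Sum>\<tau>\<in>F \<sigma>. (-1) ^ (card (snd \<sigma>) + card (snd \<tau>) + 1) *
      cube_weight w (fst \<tau>, snd \<sigma> \<union> snd \<tau>))"
  proof (rule sum.cong[OF refl])
    fix \<sigma> assume "\<sigma> \<in> S"
    then obtain i I where \<sigma>: "\<sigma> = (i, I)" "(i, I) \<in> S" by (cases \<sigma>) auto
    note b = base[OF \<sigma>(2)]
    have "(-1) ^ card I * euler_sum (F (i, I)) (\<lambda>x. cube_weight w (x, I)) =
        (\<Sum>\<tau>\<in>F (i, I). (-1) ^ (card I + card (snd \<tau>) + 1) * cube_weight w (fst \<tau>, I \<union> snd \<tau>))"
      unfolding euler_sum_def sum_distrib_left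
    proof (rule sum.cong[OF refl])
      fix \<tau> assume "\<tau> \<in> F (i, I)"
      then obtain y K where \<tau>: "\<tau> = (y, K)" "(y, K) \<in> F (i, I)" by (cases \<tau>) auto
      have "I \<inter> K = {}" using fib(5)[OF \<tau>(2)] b(5) by blast
      hence "cube_weight w (y, I \<union> K) = cube_weight (\<lambda>x. cube_weight w (x, I)) (y, K)" by (rule cube_weight_Un)
      thus "(- 1) ^ card I * ((- 1) ^ (card (snd \<tau>) + 1) * cube_weight (\<lambda>x. cube_weight w (x, I)) \<tau>) =
         (- 1) ^ (card I + card (snd \<tau>) + 1) * cube_weight w (fst \<tau>, I \<union> snd \<tau>)"
        unfolding \<tau>(1) by (simp add: power_add)
    qed
    thus "(case \<sigma> of (i, I) \<Rightarrow> (- 1) ^ card I * euler_sum (F (i, I)) (\<lambda>x. cube_weight w (x, I))) =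
       (\<Sum>\<tau>\<in>F \<sigma>. (- 1) ^ (card (snd \<sigma>) + card (snd \<tau>) + 1) * cube_weight w (fst \<tau>, snd \<sigma> \<union> snd \<tau>))"
      by (simp add: \<sigma>(1))
  qed
  also have "\<dots> = (\<Sum>(\<sigma>, \<tau>)\<in>Sigma S F. (-1) ^ (card (snd \<sigma>) + card (snd \<tau>) + 1) *
      cube_weight w (fst \<tau>, snd \<sigma> \<union> snd \<tau>))"
    by (rule sum.Sigma) (auto simp: S_def F_def finite_box_cubes)
  also have "\<dots> = euler_sum (box_cubes a b) w" unfolding euler_sum_def
  proof (rule sum.reindex_bij_witness[of _ "\<lambda>(x, K). ((proj B x, K \<inter> B), (x, K - B))" "\<lambda>(\<sigma>, \<tau>). (fst \<tau>, snd \<sigma> \<union> snd \<tau>)"])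
    fix p assume "p \<in> Sigma S F"
    then obtain i I y K where p: "p = ((i, I), (y, K))" "(i, I) \<in> S" "(y, K) \<in> F (i, I)" by force
    note b = base[OF p(2)] and f = fib[OF p(3)]
    have "proj B y = i" unfolding proj_eq_iff using f(2) b(2) unfolding proj_eq_iff by blast
    thus "(case case p of (\<sigma>, \<tau>) \<Rightarrow> (fst \<tau>, snd \<sigma> \<union> snd \<tau>) of (x, K) \<Rightarrow> ((proj B x, K \<inter> B), x, K - B)) = p"
      unfolding p(1) using b(5) f(5) by auto
    have "a \<le> y" unfolding le_fun_def
    proof
      fix j show "a j \<le> y j" using f(2,3)[of j] le_funD[OF b(3), of j] by (cases "j \<in> B") (auto simp: proj_apply)
    qed
    moreover have "y + ind (I \<union> K) \<le> b" unfolding le_fun_def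
    proof
      fix j
      show "(y + ind (I \<union> K)) j \<le> b j"
      proof (cases "j \<in> B")
        case True
        thus ?thesis using f(2)[OF True] le_funD[OF b(4), of j] f(5) by (auto simp: proj_apply ind_apply)
      next
        case False
        hence "j \<notin> I" using b(5) by blast
        thus ?thesis using f(4)[OF False] by (simp add: ind_apply)
      qed
    qed
    ultimately show "(case p of (\<sigma>, \<tau>) \<Rightarrow> (fst \<tau>, snd \<sigma> \<union> snd \<tau>)) \<in> box_cubes a b"
      unfolding p(1) using f(1) by (simp add: box_cubes_def)
    have "card (I \<union> K) = card I + card K" by (rule card_Un_disjoint) (use b(5) f(5) in auto)
    thus "(- 1) ^ (card (snd (case p of (\<sigma>, \<tau>) \<Rightarrow> (fst \<tau>, snd \<sigma> \<union> snd \<tau>))) + 1) *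
         cube_weight w (case p of (\<sigma>, \<tau>) \<Rightarrow> (fst \<tau>, snd \<sigma> \<union> snd \<tau>)) =
         (case p of (\<sigma>, \<tau>) \<Rightarrow> (- 1) ^ (card (snd \<sigma>) + card (snd \<tau>) + 1) * cube_weight w (fst \<tau>, snd \<sigma> \<union> snd \<tau>))"
      unfolding p(1) by simp
  next
    fix q assume "q \<in> box_cubes a b"
    then obtain x K where q: "q = (x, K)" "(x, K) \<in> box_cubes a b" by (cases q) auto
    note D = box_cubesD[OF q(2)]
    show "(case case q of (x, K) \<Rightarrow> ((proj B x, K \<inter> B), x, K - B) of (\<sigma>, \<tau>) \<Rightarrow> (fst \<tau>, snd \<sigma> \<union> snd \<tau>)) = q"
      unfolding q(1) by auto
    have "(proj B x, K \<inter> B) \<in> S" unfolding S_def box_cubes_def mem_Collect_eq prod.case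
    proof (intro conjI)
      show "proj B x \<in> Lat" using D(1) by simp
      show "proj B a \<le> proj B x" using le_funD[OF D(2)] by (simp add: le_fun_def proj_apply)
      show "proj B x + ind (K \<inter> B) \<le> proj B b" unfolding le_fun_def
      proof
        fix j show "(proj B x + ind (K \<inter> B)) j \<le> proj B b j"
          using le_funD[OF D(3), of j] by (simp add: proj_apply ind_apply split: if_splits)
      qed
    qed
    moreover have "(x, K - B) \<in> F (proj B x, K \<inter> B)"
    proof (rule fibI)
      fix j assume "j \<notin> B"
      thus "x j + ind (K - B) j \<le> b j" using le_funD[OF D(3), of j] by (simp add: ind_apply split: if_splits)
    qed (use D(1) le_funD[OF D(2)] in \<open>auto simp: proj_apply\<close>)
    ultimately show "(case q of (x, K) \<Rightarrow> ((proj B x, K \<inter> B), x, K - B)) \<in> Sigma S F"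
      unfolding q(1) by simp
  qed
  finally show ?thesis unfolding S_def by simp
qed

text \<open>
  A lower end that violates an inequality off \<open>K\<close> can be moved up. The process ends at the least
  point above it that satisfies all of them.
\<close>
lemma euler_sum_raise_bottom:
  assumes s: "s \<in> Lat" "s \<le> c" "\<And>j. j \<notin> K \<Longrightarrow> form G (s + l') (basis j) \<le> 0"
    and a: "a \<in> Lat" "a \<le> s" "\<And>j. j \<in> K \<Longrightarrow> a j = s j"
    and least: "\<And>y. y \<in> Lat \<Longrightarrow> a \<le> y \<Longrightarrow> (\<And>j. j \<in> K \<Longrightarrow> y j = s j) \<Longrightarrow>
       (\<And>j. j \<notin> K \<Longrightarrow> form G (y + l') (basis j) \<le> 0) \<Longrightarrow> s \<le> y"
  shows "euler_sum (box_cubes a c) w = euler_sum (box_cubes s c) w"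
proof -
  have main: "\<forall>a. a \<in> Lat \<longrightarrow> a \<le> s \<longrightarrow> (\<forall>j\<in>K. a j = s j) \<longrightarrow>
     (\<forall>y\<in>Lat. a \<le> y \<longrightarrow> (\<forall>j\<in>K. y j = s j) \<longrightarrow> (\<forall>j. j \<notin> K \<longrightarrow> form G (y + l') (basis j) \<le> 0) \<longrightarrow> s \<le> y) \<longrightarrow>
     (\<Sum>j\<in>UNIV. s j - a j) \<le> of_nat n \<longrightarrow> euler_sum (box_cubes a c) w = euler_sum (box_cubes s c) w" for n
  proof (induction n)
    case 0
    show ?case
    proof (intro allI impI)
      fix a assume a: "a \<in> Lat" "a \<le> s" "(\<Sum>j\<in>UNIV. s j - a j) \<le> of_nat 0"
      have nn: "0 \<le> s j - a j" for j using le_funD[OF a(2), of j] by simp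
      have "s j - a j \<le> (\<Sum>j\<in>UNIV. s j - a j)" for j by (rule member_le_sum) (use nn in auto)
      hence "s j - a j \<le> 0" for j using a(3) order_trans by (metis of_nat_0)
      hence "a j = s j" for j using nn[of j] by (metis diff_ge_0_iff_ge order_antisym diff_le_0_iff_le)
      hence "a = s" by (rule HOL.ext)
      thus "euler_sum (box_cubes a c) w = euler_sum (box_cubes s c) w" by simp
    qed
  next
    case (Suc n)
    show ?case
    proof (intro allI impI)
      fix a :: "'v qvec"
      assume a: "a \<in> Lat" "a \<le> s" "\<forall>j\<in>K. a j = s j"
        and least: "\<forall>y\<in>Lat. a \<le> y \<longrightarrow> (\<forall>j\<in>K. y j = s j) \<longrightarrow> (\<forall>j. j \<notin> K \<longrightarrow> form G (y + l') (basis j) \<le> 0) \<longrightarrow> s \<le> y"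
        and sz: "(\<Sum>j\<in>UNIV. s j - a j) \<le> of_nat (Suc n)"
      show "euler_sum (box_cubes a c) w = euler_sum (box_cubes s c) w"
      proof (cases "a = s")
        case False
        have "\<exists>j. j \<notin> K \<and> 1 \<le> form G (a + l') (basis j)"
        proof (rule ccontr)
          assume "\<nexists>j. j \<notin> K \<and> 1 \<le> form G (a + l') (basis j)"
          hence "\<forall>j. j \<notin> K \<longrightarrow> form G (a + l') (basis j) \<le> 0" using form_lt_1_imp[OF a(1)] by blast
          hence "s \<le> a" using least a(1,3) by blast
          thus False using False a(2) by (simp add: order_antisym)
        qed
        then obtain j where j: "j \<notin> K" "1 \<le> form G (a + l') (basis j)" by blast
        have "a j \<noteq> s j"
        proof
          assume "a j = s j"
          have "form G (a + l') (basis j) \<le> form G (s + l') (basis j)"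
            by (rule form_basis_mono) (use le_funD[OF a(2)] \<open>a j = s j\<close> in auto)
          thus False using j(2) s(3)[OF j(1)] by simp
        qed
        hence "a j < s j" using le_funD[OF a(2), of j] by simp
        hence st: "a j + 1 \<le> s j" by (intro Ints_less_imp_le) (use a(1) s(1) in \<open>auto simp: Lat_def\<close>)
        have a': "a + basis j \<in> Lat" "a + basis j \<le> s" "\<forall>i\<in>K. (a + basis j) i = s i"
          using a st j(1) by (auto simp: le_fun_def ind_apply)
        have aa: "a \<le> a + basis j" using ind_nonneg[of "{j}"] by (simp add: le_add_same_cancel1)
        have "collapse_step w (box_cubes (a + basis j) c) (box_cubes (a + basis j - basis j) c)"
        proof (rule collapse_step_down)
          show "a + basis j \<in> Lat" by (rule a')
          show "(a + basis j) j \<le> c j" using st le_funD[OF s(2), of j] by (simp add: ind_apply)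
          fix y assume y: "y \<in> Lat" "a + basis j \<le> y" "y \<le> c" "y j = (a + basis j) j"
          have "w (y - basis j + basis j) \<le> w (y - basis j)"
          proof (rule w_step_antimono[OF _ _ j(2)])
            fix i show "a i \<le> (y - basis j) i" using le_funD[OF y(2), of i] by simp
            show "a j = (y - basis j) j" using y(4) by simp
          qed
          thus "w y \<le> w (y - basis j)" by simp
        qed
        hence "euler_sum (box_cubes a c) w = euler_sum (box_cubes (a + basis j) c) w"
          using euler_sum_collapse_step[OF _ finite_box_cubes] by (simp only: add_diff_cancel_right')
        also have "\<dots> = euler_sum (box_cubes s c) w"
        proof (rule Suc.IH[THEN spec, of "a + basis j", THEN mp, THEN mp, THEN mp, THEN mp, THEN mp])
          show "a + basis j \<in> Lat" "a + basis j \<le> s" "\<forall>i\<in>K. (a + basis j) i = s i" by (rule a')+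
          show "\<forall>y\<in>Lat. a + basis j \<le> y \<longrightarrow> (\<forall>j\<in>K. y j = s j) \<longrightarrow>
              (\<forall>j. j \<notin> K \<longrightarrow> form G (y + l') (basis j) \<le> 0) \<longrightarrow> s \<le> y"
            using least order_trans[OF aa] by blast
          have "(\<Sum>i\<in>UNIV. s i - (a + basis j) i) = (\<Sum>i\<in>UNIV. s i - a i) - 1"
            by (simp add: sum_subtractf sum.distrib ind_apply)
          thus "(\<Sum>i\<in>UNIV. s i - (a + basis j) i) \<le> of_nat n" using sz by simp
        qed
        finally show ?thesis .
      qed simp
    qed
  qed
  obtain n :: nat where n: "(\<Sum>j\<in>UNIV. s j - a j) \<le> of_nat n" using real_arch_simple by blast
  show ?thesis by (rule main[rule_format, OF a(1,2) _ _ n]) (use a(3) least in auto)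
qed

definition dv :: "'v qvec" where
  "dv = (SOME v. v \<in> Lat \<and> (\<forall>j. 1 \<le> v j) \<and> (\<forall>j. form G v (basis j) \<le> -1))"

lemma dv: "dv \<in> Lat" "1 \<le> dv j" "form G dv (basis j) \<le> -1"
proof -
  have "\<exists>v. v \<in> Lat \<and> (\<forall>j. 1 \<le> v j) \<and> (\<forall>j. form G v (basis j) \<le> -1)" using deep_vector by metis
  hence "dv \<in> Lat \<and> (\<forall>j. 1 \<le> dv j) \<and> (\<forall>j. form G dv (basis j) \<le> -1)" unfolding dv_def by (rule someI_ex)
  thus "dv \<in> Lat" "1 \<le> dv j" "form G dv (basis j) \<le> -1" by blast+
qed

lemma dv_nonneg: "0 \<le> dv j" using dv(2)[of j] by simp

text \<open>The points from which all steps towards \<open>c + dv\<close> keep the inequalities.\<close>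
definition deep :: "'v qvec \<Rightarrow> bool" where
  "deep c \<longleftrightarrow> c \<in> Lat \<and> (\<forall>r\<in>Lat. 0 \<le> r \<longrightarrow> r \<le> dv \<longrightarrow> (\<forall>j. form G (c + r) (basis j) \<le> 0))"

lemma deepD: "deep c \<Longrightarrow> c \<in> Lat" "deep c \<Longrightarrow> r \<in> Lat \<Longrightarrow> 0 \<le> r \<Longrightarrow> r \<le> dv \<Longrightarrow> form G (c + r) (basis j) \<le> 0"
  unfolding deep_def by blast+

lemma deep_form: "deep c \<Longrightarrow> form G c (basis j) \<le> 0"
  using deepD(2)[of c 0 j] dv_nonneg by (simp add: le_fun_def)

lemma deep_nonneg: "deep c \<Longrightarrow> 0 \<le> c"
  by (rule nonneg_if_antinef[of "{}"]) (use deep_form in auto)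

lemma deep_add:
  assumes "deep c" "s \<in> Lat" "\<And>j. form G s (basis j) \<le> 0"
  shows "deep (c + s)"
  unfolding deep_def
proof (intro conjI ballI impI allI)
  show "c + s \<in> Lat" using deepD(1)[OF assms(1)] assms(2) by (rule Lat_add)
  fix r j assume "r \<in> Lat" "0 \<le> r" "r \<le> dv"
  from deepD(2)[OF assms(1) this, of j] assms(3)[of j] show "form G (c + s + r) (basis j) \<le> 0"
    by (simp add: form_add_left)
qed

lemma form_dv_multiple: "form G (\<lambda>j. of_nat n * dv j) (basis j) \<le> - of_nat n"
proof -
  have "of_nat n * form G dv (basis j) \<le> of_nat n * (-1)" using dv(3) by (intro mult_left_mono) auto
  thus ?thesis by (simp add: form_scale_left)
qed

lemma deep_add_dv: "deep c \<Longrightarrow> deep (c + (\<lambda>j. of_nat n * dv j))"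
proof (rule deep_add)
  show "form G (\<lambda>j. of_nat n * dv j) (basis j) \<le> 0" for j using form_dv_multiple[of n j] by (rule order_trans) simp
qed (use Lat_scale[OF dv(1)] in auto)

lemma form_small:
  assumes "0 \<le> r" "r \<le> dv"
  shows "form G r (basis j) \<le> (\<Sum>i\<in>UNIV. dv i)"
proof -
  have r: "0 \<le> r i" "r i \<le> dv i" for i using le_funD[OF assms(1), of i] le_funD[OF assms(2), of i] by simp_all
  have "(of_int (dec G j) :: rat) \<le> of_int 0" using dec_negative[of j] by (subst of_int_le_iff) simp
  hence "of_int (dec G j) * r j \<le> 0" using r(1)[of j] by (simp add: mult_nonpos_nonneg)
  moreover have "(\<Sum>i\<in>{i. adj G j i}. r i) \<le> (\<Sum>i\<in>{i. adj G j i}. dv i)" by (rule sum_mono) (rule r)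
  moreover have "(\<Sum>i\<in>{i. adj G j i}. dv i) \<le> (\<Sum>i\<in>UNIV. dv i)" by (rule sum_mono2) (use dv_nonneg in auto)
  ultimately show ?thesis unfolding form_basis_expand by linarith
qed

text \<open>Large multiples of \<open>dv\<close> outweigh both the bounded perturbations \<open>r\<close> and the shift \<open>l\<close>.\<close>
lemma deep_exists:
  obtains M where "\<And>n. n \<ge> M \<Longrightarrow> deep (\<lambda>j. of_nat n * dv j)"
    "\<And>n r j. n \<ge> M \<Longrightarrow> 0 \<le> r \<Longrightarrow> r \<le> dv \<Longrightarrow> 0 \<le> form G (- (\<lambda>j. of_nat n * dv j) - r + l') (basis j)"
proof -
  obtain M1 :: nat where M1: "(\<Sum>i\<in>UNIV. dv i) \<le> of_nat M1" using real_arch_simple by blast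
  obtain M2 :: nat where M2: "\<And>j. - form G l' (basis j) \<le> of_nat M2"
    using finite_max_nat[of "\<lambda>j. - form G l' (basis j)"] by blast
  show ?thesis
  proof (rule that[of "M1 + M2"])
    fix n assume n: "M1 + M2 \<le> n"
    hence n': "(of_nat M1 + of_nat M2 :: rat) \<le> of_nat n" by (metis of_nat_add of_nat_le_iff)
    have n1: "(of_nat M1 :: rat) \<le> of_nat n" using n by simp
    show "deep (\<lambda>j. of_nat n * dv j)" unfolding deep_def
    proof (intro conjI ballI impI allI)
      show "(\<lambda>j. of_nat n * dv j) \<in> Lat" by (rule Lat_scale[OF dv(1)])
      fix r j assume r: "r \<in> Lat" "0 \<le> r" "r \<le> dv"
      have "form G (\<lambda>j. of_nat n * dv j) (basis j) + form G r (basis j) \<le> 0"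
        using form_small[OF r(2,3), of j] form_dv_multiple[of n j] M1 n1 by linarith
      thus "form G ((\<lambda>j. of_nat n * dv j) + r) (basis j) \<le> 0" by (simp only: form_add_left)
    qed
    fix r j assume r: "0 \<le> r" "r \<le> dv"
    have "form G (- (\<lambda>j. of_nat n * dv j) - r + l') (basis j) =
        - form G (\<lambda>j. of_nat n * dv j) (basis j) - form G r (basis j) + form G l' (basis j)"
      using form_diff_left[of G 0 "\<lambda>j. of_nat n * dv j" "basis j"]
      by (simp only: form_add_left form_diff_left diff_0 form_zero)
    thus "0 \<le> form G (- (\<lambda>j. of_nat n * dv j) - r + l') (basis j)"
      using form_small[OF r, of j] form_dv_multiple[of n j] M1 M2[of j] n' by linarith
  qed
qed

end

section \<open>Euler characteristics as sums over boxes\<close>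

lemma of_int_euler_sum_floor_on:
  fixes w :: "'v::finite qvec \<Rightarrow> rat"
  assumes "\<And>y. y \<in> Lat \<Longrightarrow> a \<le> y \<Longrightarrow> y \<le> b \<Longrightarrow> w y \<in> \<int>"
  shows "of_int (euler_sum (box_cubes a b) (\<lambda>i. \<lfloor>w i\<rfloor>)) = euler_sum (box_cubes a b) w"
  unfolding euler_sum_def of_int_sum
proof (rule sum.cong[OF refl])
  fix \<sigma> assume "\<sigma> \<in> box_cubes a b"
  then obtain x I where \<sigma>: "\<sigma> = (x, I)" "(x, I) \<in> box_cubes a b" by (cases \<sigma>) auto
  note D = box_cubesD[OF \<sigma>(2)]
  have f: "of_int \<lfloor>w (x + ind J)\<rfloor> = w (x + ind J)" if "J \<in> Pow I" for J
  proof -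
    have "x + ind J \<in> Lat" using D(1) by (intro Lat_add Lat_ind)
    moreover have "a \<le> x + ind J" unfolding le_fun_def
      using le_funD[OF D(2)] by (auto simp: ind_apply intro: add_increasing2)
    moreover have "x + ind J \<le> b" unfolding le_fun_def
    proof
      fix j show "(x + ind J) j \<le> b j" using le_funD[OF D(3), of j] le_funD[OF D(4), of j] that
        by (auto simp: ind_apply split: if_splits)
    qed
    ultimately have "w (x + ind J) \<in> \<int>" by (rule assms)
    thus ?thesis by (auto elim: Ints_cases)
  qed
  have "of_int (Max ((\<lambda>J. \<lfloor>w (x + ind J)\<rfloor>) ` Pow I)) = (Max (of_int ` (\<lambda>J. \<lfloor>w (x + ind J)\<rfloor>) ` Pow I) :: rat)"
    by (rule mono_Max_commute) (auto simp: mono_def)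
  also have "of_int ` (\<lambda>J. \<lfloor>w (x + ind J)\<rfloor>) ` Pow I = (\<lambda>J. w (x + ind J)) ` Pow I"
    unfolding image_image by (rule image_cong[OF refl]) (rule f)
  finally have "of_int (cube_weight (\<lambda>i. \<lfloor>w i\<rfloor>) (x, I)) = cube_weight w (x, I)"
    by (simp only: cube_weight_def fst_conv snd_conv)
  thus "of_int ((- 1) ^ (card (snd \<sigma>) + 1) * cube_weight (\<lambda>i. \<lfloor>w i\<rfloor>) \<sigma>) =
      (- 1) ^ (card (snd \<sigma>) + 1) * cube_weight w \<sigma>"
    unfolding \<sigma>(1) by simp
qed

context bad_tree begin

lemma w_up_ok:
  assumes c: "deep c" and q: "q \<in> Lat" "0 \<le> q" "q \<le> dv" and y: "y \<le> c + q" "y j = c j + q j"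
  shows "w y \<le> w (y + basis j)"
proof (rule w_step_mono)
  show "y i \<le> (c + q) i" for i using le_funD[OF y(1), of i] .
  show "y j = (c + q) j" using y(2) by simp
  show "form G (c + q + l') (basis j) \<le> 1"
    using deepD(2)[OF c q, of j] ldist_form_nonpos[of j] by (simp only: form_add_left)
qed

lemma proj_le_dv: "q \<le> proj B dv \<Longrightarrow> q \<le> dv"
  using dv_nonneg by (fastforce simp: le_fun_def proj_apply intro: order_trans split: if_splits)

lemma xm_le_deep:
  assumes c: "deep c" and q: "q \<in> Lat" "0 \<le> q" "q \<le> proj B dv"
  shows "xm (proj B c + q) \<le> c + q"
proof -
  have q0: "q j = 0" if "j \<notin> B" for j
    using le_funD[OF q(2), of j] le_funD[OF q(3), of j] that by (simp add: proj_apply)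
  have i: "proj B c + q \<in> Lat" "proj B (proj B c + q) = proj B c + q"
  proof -
    show "proj B c + q \<in> Lat" by (rule Lat_add[OF Lat_proj[OF deepD(1)[OF c]] q(1)])
    show "proj B (proj B c + q) = proj B c + q" using q0 by (auto simp: proj_def fun_eq_iff)
  qed
  show ?thesis
  proof (rule xm_least[OF i])
    show "c + q \<in> Lat" using deepD(1)[OF c] q(1) by (rule Lat_add)
    show "(c + q) j = (proj B c + q) j" if "j \<in> B" for j using that by (simp add: proj_apply)
    show "form G (c + q + l') (basis j) \<le> 0" for j
      using deepD(2)[OF c q(1,2) proj_le_dv[OF q(3)], of j] ldist_form_nonpos[of j] by (simp only: form_add_left)
  qed
qed

lemma wb_up_ok:
  assumes c: "deep c" and q: "q \<in> Lat" "0 \<le> q" "q \<le> proj B dv" "q j + 1 \<le> proj B dv j"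
    and y: "y \<in> Lat" "proj B y = y" "y \<le> proj B c + q" "y j = proj B c j + q j"
  shows "wb y \<le> wb (y + basis j)"
proof -
  have j: "j \<in> B"
  proof (rule ccontr)
    assume "j \<notin> B"
    thus False using le_funD[OF q(2), of j] q(4) by (simp add: proj_apply)
  qed
  have q0: "q j = 0" if "j \<notin> B" for j
    using le_funD[OF q(2), of j] le_funD[OF q(3), of j] that by (simp add: proj_apply)
  have i: "proj B c + q \<in> Lat" "proj B (proj B c + q) = proj B c + q"
  proof -
    show "proj B c + q \<in> Lat" by (rule Lat_add[OF Lat_proj[OF deepD(1)[OF c]] q(1)])
    show "proj B (proj B c + q) = proj B c + q" using q0 by (auto simp: proj_def fun_eq_iff)
  qed
  have le: "xm y \<le> c + q" using xm_mono[OF y(1,2) i y(3)] xm_le_deep[OF c q(1-3)] by (rule order_trans)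
  have "form G (xm y + l') (basis j) \<le> form G (c + q + l') (basis j)"
  proof (rule form_basis_mono)
    show "(xm y + l') i \<le> (c + q + l') i" for i using le_funD[OF le, of i] by simp
    show "(xm y + l') j = (c + q + l') j" using xm_B[OF y(1,2) j] y(4) j by (simp add: proj_apply)
  qed
  also have "\<dots> \<le> 0"
    using deepD(2)[OF c q(1,2) proj_le_dv[OF q(3)], of j] ldist_form_nonpos[of j] by (simp only: form_add_left)
  finally show ?thesis using wb_step[OF y(1,2) j] by simp
qed

lemma proj_dv: "proj B dv \<in> Lat" "0 \<le> proj B dv"
  using dv(1) dv_nonneg by (auto simp: le_fun_def proj_apply)

lemma w_collapses_up:
  fixes g :: "rat \<Rightarrow> 'a::linordered_idom"
  assumes "mono g" "deep c" "a \<le> c"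
  shows "(collapse_step (\<lambda>x. g (w x)))\<^sup>*\<^sup>* (box_cubes a c) (box_cubes a (c + dv))"
proof (rule collapses_up)
  show "c \<in> Lat" by (rule deepD(1)[OF assms(2)])
  show "a \<le> c" "dv \<in> Lat" by (rule assms(3), rule dv(1))
  show "0 \<le> dv" using dv_nonneg by (simp add: le_fun_def)
  fix q j y assume q: "q \<in> Lat" "0 \<le> q" "q \<le> dv" and y: "y \<le> c + q" "y j = c j + q j"
  show "g (w y) \<le> g (w (y + basis j))" by (rule monoD[OF assms(1) w_up_ok[OF assms(2) q y]])
qed

lemma wb_collapses_up:
  fixes g :: "rat \<Rightarrow> 'a::linordered_idom"
  assumes "mono g" "deep c" "a \<le> proj B c" "proj B a = a"
  shows "(collapse_step (\<lambda>x. g (wb x)))\<^sup>*\<^sup>* (box_cubes a (proj B c)) (box_cubes a (proj B c + proj B dv))"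
proof (rule collapses_up)
  show "proj B c \<in> Lat" by (rule Lat_proj[OF deepD(1)[OF assms(2)]])
  show "a \<le> proj B c" by (rule assms(3))
  show "proj B dv \<in> Lat" "0 \<le> proj B dv" by (rule proj_dv)+
  fix q j y assume q: "q \<in> Lat" "0 \<le> q" "q \<le> proj B dv" "q j + 1 \<le> proj B dv j"
    and y: "y \<in> Lat" "a \<le> y" "y \<le> proj B c + q" "y j = proj B c j + q j"
  have y0: "y j = 0" if "j \<notin> B" for j
  proof -
    have "a j = 0" using assms(4) that unfolding proj_eq_iff by blast
    thus ?thesis using le_funD[OF y(2), of j] le_funD[OF y(3), of j]
        le_funD[OF q(2), of j] le_funD[OF q(3), of j] that by (simp add: proj_apply)
  qed
  have "proj B y = y" unfolding proj_eq_iff using y0 by blast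
  thus "g (wb y) \<le> g (wb (y + basis j))"
    using monoD[OF assms(1) wb_up_ok[OF assms(2) q y(1) _ y(3,4)]] by blast
qed

lemma w_collapses_down:
  fixes g :: "rat \<Rightarrow> 'a::linordered_idom"
  assumes g: "mono g"
    and a: "a \<in> Lat" "a \<le> b" "\<And>r j. 0 \<le> r \<Longrightarrow> r \<le> dv \<Longrightarrow> 0 \<le> form G (a - r + l') (basis j)"
  shows "(collapse_step (\<lambda>x. g (w x)))\<^sup>*\<^sup>* (box_cubes a b) (box_cubes (a - dv) b)"
proof (rule collapses_down)
  show "a \<in> Lat" "a \<le> b" "dv \<in> Lat" by (rule a(1), rule a(2), rule dv(1))
  show "0 \<le> dv" using dv_nonneg by (simp add: le_fun_def)
  fix q j y assume q: "q \<in> Lat" "0 \<le> q" "q \<le> dv" and y: "y \<in> Lat" "a - q \<le> y" "y j = a j - q j"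
  have "0 \<le> form G (a - q + l') (basis j)" by (rule a(3)[OF q(2,3)])
  also have "\<dots> \<le> form G (y + l') (basis j)"
  proof (rule form_basis_mono)
    show "(a - q + l') i \<le> (y + l') i" for i using le_funD[OF y(2), of i] by simp
    show "(a - q + l') j = (y + l') j" using y(3) by simp
  qed
  finally have "0 \<le> form G (y + l') (basis j)" .
  moreover have "form G (basis j) (basis j) \<le> -1"
  proof -
    have "(of_int (dec G j) :: rat) \<le> of_int (-1)" using dec_negative[of j] by (subst of_int_le_iff)
    thus ?thesis by (simp add: form_basis_basis entry_def)
  qed
  ultimately have "w y \<le> w (y - basis j)" by (simp add: w_step_back form_add_left form_diff_left)
  thus "g (w y) \<le> g (w (y - basis j))" by (rule monoD[OF g])
qed

text \<open>The lattice is exhausted by boxes between multiples of \<open>dv\<close>; the lower end is then raised to the origin, the least point satisfying all inequalities.\<close>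
lemma eu_graph_eq:
  assumes c: "deep c"
  shows "of_int (eu_graph G k) = euler_sum (box_cubes 0 c) w"
proof -
  have fl: "mono (floor :: rat \<Rightarrow> int)" by (simp add: mono_def floor_mono)
  obtain M where M: "\<And>n r j. n \<ge> M \<Longrightarrow> 0 \<le> r \<Longrightarrow> r \<le> dv \<Longrightarrow> 0 \<le> form G (- (\<lambda>j. of_nat n * dv j) - r + l') (basis j)"
    using deep_exists by metis
  define a where "a t = - (\<lambda>j. of_nat (M + t) * dv j)" for t :: nat
  define b where "b t = c + (\<lambda>j. of_nat t * dv j)" for t :: nat
  have aL: "a t \<in> Lat" for t unfolding a_def using Lat_scale[OF dv(1), of "M + t"] by (rule Lat_minus)
  have bd: "deep (b t)" for t unfolding b_def by (rule deep_add_dv[OF c])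
  have c0: "0 \<le> c j" for j using le_funD[OF deep_nonneg[OF c], of j] by simp
  have a0: "a t j \<le> 0" for t j unfolding a_def using dv_nonneg[of j] by simp
  have b0: "0 \<le> b t j" for t j unfolding b_def using dv_nonneg[of j] c0[of j] by simp
  have ab: "a t \<le> b t'" for t t' unfolding le_fun_def using a0 b0 order_trans by blast
  have aS: "a (Suc t) = a t - dv" for t unfolding a_def by (simp add: fun_eq_iff algebra_simps)
  have bS: "b (Suc t) = b t + dv" for t unfolding b_def by (simp add: fun_eq_iff algebra_simps)
  have "(collapse_step (\<lambda>x. \<lfloor>w x\<rfloor>))\<^sup>*\<^sup>* (box_cubes (a t) (b t)) (box_cubes (a (Suc t)) (b (Suc t)))" for t
  proof -
    have "(collapse_step (\<lambda>x. \<lfloor>w x\<rfloor>))\<^sup>*\<^sup>* (box_cubes (a t) (b t)) (box_cubes (a t) (b (Suc t)))"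
      unfolding bS by (rule w_collapses_up[OF fl bd ab])
    moreover have "(collapse_step (\<lambda>x. \<lfloor>w x\<rfloor>))\<^sup>*\<^sup>* (box_cubes (a t) (b (Suc t))) (box_cubes (a (Suc t)) (b (Suc t)))"
      unfolding aS
    proof (rule w_collapses_down[OF fl aL ab])
      fix r j assume "0 \<le> r" "r \<le> dv"
      thus "0 \<le> form G (a t - r + l') (basis j)" unfolding a_def by (intro M) auto
    qed
    ultimately show ?thesis by (rule rtranclp_trans)
  qed
  from eu_of_exhaustion[of a b, OF aL deepD(1)[OF bd] ab this]
  have eq: "eu (\<Union>t. box_cubes (a t) (b t)) (\<lambda>x. \<lfloor>w x\<rfloor>) = euler_sum (box_cubes (a 0) (b 0)) (\<lambda>x. \<lfloor>w x\<rfloor>)" .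
  have U: "(\<Union>t. box_cubes (a t) (b t)) = {(i, I). i \<in> Lat}"
  proof (rule set_eqI)
    fix \<sigma> :: "'v cube"
    obtain i I where \<sigma>: "\<sigma> = (i, I)" by (cases \<sigma>)
    show "\<sigma> \<in> (\<Union>t. box_cubes (a t) (b t)) \<longleftrightarrow> \<sigma> \<in> {(i, I). i \<in> Lat}"
    proof
      assume "\<sigma> \<in> {(i, I). i \<in> Lat}"
      hence i: "i \<in> Lat" unfolding \<sigma> by simp
      obtain n :: nat where n: "\<And>j. \<bar>i j\<bar> + 1 \<le> of_nat n" using finite_max_nat[of "\<lambda>j. \<bar>i j\<bar> + 1"] by blast
      have "a n \<le> i" unfolding le_fun_def
      proof
        fix j
        have "of_nat n * 1 \<le> of_nat (M + n) * dv j" using dv(2)[of j] by (intro mult_mono) auto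
        thus "a n j \<le> i j" unfolding a_def using n[of j] by (simp add: abs_le_iff algebra_simps)
      qed
      moreover have "i + ind I \<le> b n" unfolding le_fun_def
      proof
        fix j
        have "of_nat n * 1 \<le> of_nat n * dv j" using dv(2)[of j] by (intro mult_mono) auto
        moreover have "ind I j \<le> (1 :: rat)" by (simp add: ind_apply)
        ultimately show "(i + ind I) j \<le> b n j" unfolding b_def using n[of j] c0[of j] abs_ge_self[of "i j"] by simp
      qed
      ultimately show "\<sigma> \<in> (\<Union>t. box_cubes (a t) (b t))" unfolding \<sigma> using i by (auto simp: box_cubes_def)
    qed (auto simp: box_cubes_def)
  qed
  have "of_int (eu_graph G k) = (of_int (euler_sum (box_cubes (a 0) (b 0)) (\<lambda>x. \<lfloor>w x\<rfloor>)) :: rat)"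
    unfolding eu_graph_def w_def[symmetric] U[symmetric] eq ..
  also have "\<dots> = euler_sum (box_cubes (a 0) (b 0)) w"
    by (rule of_int_euler_sum_floor_on) (rule w_Ints)
  also have "b 0 = c" unfolding b_def by (simp add: fun_eq_iff)
  also have "euler_sum (box_cubes (a 0) c) w = euler_sum (box_cubes 0 c) w"
  proof (rule euler_sum_raise_bottom[of _ _ "{}"])
    show "0 \<in> Lat" "a 0 \<in> Lat" by (rule Lat_zero, rule aL)
    show "0 \<le> c" by (rule deep_nonneg[OF c])
    show "a 0 \<le> 0" using a0 by (simp add: le_fun_def)
    show "form G (0 + l') (basis j) \<le> 0" for j using ldist_form_nonpos by simp
    fix y assume "y \<in> Lat" "\<And>j. j \<notin> {} \<Longrightarrow> form G (y + l') (basis j) \<le> 0"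
    thus "0 \<le> y" by (intro ldist_minimal) auto
  qed auto
  finally show ?thesis .
qed

text \<open>The minimum of \<open>x(i)\<close> and \<open>0\<close> satisfies all inequalities, so it is nonnegative by the minimality of the distinguished representative.\<close>
lemma xm_nonneg:
  assumes i: "i \<in> Lat" "proj B i = i" "0 \<le> i"
  shows "0 \<le> xm i"
proof -
  define y where "y = (\<lambda>j. min (xm i j) 0)"
  have "0 \<le> y"
  proof (rule ldist_minimal)
    show "y \<in> Lat" unfolding y_def Lat_def using xm_Lat[OF i(1,2)] by (auto simp: Lat_def min_def)
    fix j
    show "form G (y + l') (basis j) \<le> 0"
    proof (cases "0 \<le> xm i j")
      case True
      have "form G (y + l') (basis j) \<le> form G l' (basis j)"
        by (rule form_basis_mono) (use True in \<open>auto simp: y_def\<close>)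
      thus ?thesis using ldist_form_nonpos[of j] by simp
    next
      case False
      have "j \<notin> B"
      proof
        assume "j \<in> B"
        thus False using False xm_B[OF i(1,2)] le_funD[OF i(3), of j] by simp
      qed
      have "form G (y + l') (basis j) \<le> form G (xm i + l') (basis j)"
        by (rule form_basis_mono) (use False in \<open>auto simp: y_def\<close>)
      thus ?thesis using xm_form[OF i(1,2) \<open>j \<notin> B\<close>] by simp
    qed
  qed
  thus ?thesis unfolding y_def le_fun_def by simp
qed

lemma wb_Ints: "i \<in> Lat \<Longrightarrow> proj B i = i \<Longrightarrow> wb i \<in> \<int>"
  unfolding wb_eq by (intro w_Ints xm_Lat)

lemma quadrantD:
  assumes "i \<in> quadrant B"
  shows "i \<in> Lat" "0 \<le> i" "proj B i = i" "j \<notin> B \<Longrightarrow> i j = 0"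
  using assms unfolding quadrant_def proj_eq_iff by auto

lemma quadrant_proj: "y \<in> Lat \<Longrightarrow> 0 \<le> y \<Longrightarrow> proj B y \<in> quadrant B"
  unfolding quadrant_def by (auto simp: le_fun_def proj_apply)

text \<open>Boxes whose lower end lies in the quadrant have the same Euler sum upstairs and downstairs.\<close>
lemma euler_sum_box_eq:
  assumes i: "i \<in> quadrant B" and c: "deep c" and le: "i \<le> proj B c"
  shows "euler_sum (box_cubes i c) w = euler_sum (box_cubes i (proj B c)) wb"
proof -
  note q = quadrantD[OF i]
  note c0 = deep_nonneg[OF c]
  have "i \<le> c" unfolding le_fun_def
  proof
    fix j show "i j \<le> c j" using le_funD[OF le, of j] le_funD[OF c0, of j] by (simp add: proj_apply split: if_splits)
  qed
  have "euler_sum (box_cubes i c) w = euler_sum (box_cubes (proj B i) (proj B c)) wb"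
  proof (rule euler_sum_projection[OF q(1) deepD(1)[OF c] \<open>i \<le> c\<close>])
    fix t assume t: "t \<in> Lat" "proj B t = t" "proj B i \<le> t" "t \<le> proj B c"
    have it: "i \<le> t" using t(3) q(3) by simp
    have n: "0 \<le> xm t" by (rule xm_nonneg[OF t(1,2) order_trans[OF q(2) it]])
    have "i \<le> xm t" unfolding le_fun_def
    proof
      fix j
      show "i j \<le> xm t j"
      proof (cases "j \<in> B")
        case True thus ?thesis using xm_B[OF t(1,2) True] le_funD[OF it, of j] by simp
      next
        case False thus ?thesis using q(4)[OF False] le_funD[OF n, of j] by simp
      qed
    qed
    moreover have "xm t \<le> c"
    proof -
      have pc: "proj B c \<in> Lat" "proj B (proj B c) = proj B c"
        by (rule Lat_proj[OF deepD(1)[OF c]]) (auto simp: proj_def)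
      have "xm (proj B c + 0) \<le> c + 0" by (rule xm_le_deep[OF c Lat_zero]) (use proj_dv in auto)
      thus ?thesis using xm_mono[OF t(1,2) pc t(4)] by simp
    qed
    ultimately show "i \<le> xm t \<and> xm t \<le> c" by blast
  qed
  thus ?thesis using q(3) by simp
qed

text \<open>In the quadrant the lower end is already the origin, and only the upper end moves.\<close>
lemma eu_quadrant_eq:
  assumes c: "deep c"
  shows "of_int (eu_quadrant G k B) = euler_sum (box_cubes 0 (proj B c)) wb"
proof -
  have fl: "mono (floor :: rat \<Rightarrow> int)" by (simp add: mono_def floor_mono)
  define b where "b t = proj B (c + (\<lambda>j. of_nat t * dv j))" for t :: nat
  note cd = deep_add_dv[OF c]
  have c0: "0 \<le> c j" for j using le_funD[OF deep_nonneg[OF c], of j] by simp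
  have bL: "b t \<in> Lat" for t unfolding b_def using deepD(1)[OF cd] by simp
  have b0: "0 \<le> b t" for t unfolding b_def le_fun_def using dv_nonneg c0 by (simp add: proj_apply)
  have bS: "b (Suc t) = b t + proj B dv" for t
    unfolding b_def by (simp add: fun_eq_iff proj_apply algebra_simps)
  have z: "proj B 0 = 0" by (simp add: proj_def fun_eq_iff)
  have "(collapse_step (\<lambda>x. \<lfloor>wb x\<rfloor>))\<^sup>*\<^sup>* (box_cubes 0 (b t)) (box_cubes 0 (b (Suc t)))" for t
    unfolding bS unfolding b_def by (rule wb_collapses_up[OF fl cd b0[unfolded b_def] z])
  from eu_of_exhaustion[of "\<lambda>_. 0" b, OF Lat_zero bL b0 this]
  have eq: "eu (\<Union>t. box_cubes 0 (b t)) (\<lambda>x. \<lfloor>wb x\<rfloor>) = euler_sum (box_cubes 0 (b 0)) (\<lambda>x. \<lfloor>wb x\<rfloor>)" .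
  have U: "(\<Union>t. box_cubes 0 (b t)) = {(i, I). i \<in> quadrant B \<and> I \<subseteq> B}"
  proof (rule set_eqI)
    fix \<sigma> :: "'v cube"
    obtain i I where \<sigma>: "\<sigma> = (i, I)" by (cases \<sigma>)
    show "\<sigma> \<in> (\<Union>t. box_cubes 0 (b t)) \<longleftrightarrow> \<sigma> \<in> {(i, I). i \<in> quadrant B \<and> I \<subseteq> B}"
    proof
      assume "\<sigma> \<in> {(i, I). i \<in> quadrant B \<and> I \<subseteq> B}"
      hence i: "i \<in> quadrant B" and I: "I \<subseteq> B" unfolding \<sigma> by auto
      note q = quadrantD[OF i]
      obtain n :: nat where n: "\<And>j. \<bar>i j\<bar> + 1 \<le> of_nat n" using finite_max_nat[of "\<lambda>j. \<bar>i j\<bar> + 1"] by blast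
      have "i + ind I \<le> b n" unfolding le_fun_def
      proof
        fix j
        have "of_nat n * 1 \<le> of_nat n * dv j" using dv(2)[of j] by (intro mult_mono) auto
        moreover have "ind I j \<le> (1 :: rat)" by (simp add: ind_apply)
        moreover have "j \<notin> B \<Longrightarrow> i j = 0 \<and> ind I j = (0 :: rat)" using q(4) I by (auto simp: ind_apply)
        ultimately show "(i + ind I) j \<le> b n j"
          unfolding b_def using n[of j] c0[of j] abs_ge_self[of "i j"] by (simp add: proj_apply)
      qed
      thus "\<sigma> \<in> (\<Union>t. box_cubes 0 (b t))" unfolding \<sigma> using q by (auto simp: box_cubes_def)
    next
      assume "\<sigma> \<in> (\<Union>t. box_cubes 0 (b t))"
      then obtain t where "(i, I) \<in> box_cubes 0 (b t)" unfolding \<sigma> by blast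
      note D = box_cubesD[OF this]
      have o: "i j = 0 \<and> j \<notin> I" if "j \<notin> B" for j
        using le_funD[OF D(2), of j] le_funD[OF D(3), of j] that unfolding b_def
        by (auto simp: proj_apply ind_apply split: if_splits)
      show "\<sigma> \<in> {(i, I). i \<in> quadrant B \<and> I \<subseteq> B}" unfolding \<sigma> quadrant_def using D(1,2) o by auto
    qed
  qed
  have "of_int (eu_quadrant G k B) = (of_int (euler_sum (box_cubes 0 (b 0)) (\<lambda>x. \<lfloor>wb x\<rfloor>)) :: rat)"
    unfolding eu_quadrant_def U[symmetric] eq ..
  also have "\<dots> = euler_sum (box_cubes 0 (b 0)) wb"
  proof (rule of_int_euler_sum_floor_on)
    fix y assume y: "y \<in> Lat" "0 \<le> y" "y \<le> b 0"
    have "proj B y = y" unfolding proj_eq_iff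
    proof (intro conjI ballI allI impI refl)
      fix j assume "j \<notin> B"
      thus "y j = 0" using le_funD[OF y(2), of j] le_funD[OF y(3), of j] unfolding b_def by (simp add: proj_apply)
    qed
    thus "wb y \<in> \<int>" using y(1) by (intro wb_Ints)
  qed
  also have "b 0 = proj B c" unfolding b_def by (simp add: fun_eq_iff proj_apply)
  finally show ?thesis .
qed

lemma zero_quadrant: "0 \<in> quadrant B"
  unfolding quadrant_def by simp

text \<open>The two Euler sums agree by projection to the coordinates of \<open>B\<close>.\<close>
lemma eu_quadrant_eq_eu_graph: "eu_quadrant G k B = eu_graph G k"
proof -
  obtain M where "\<And>n. n \<ge> M \<Longrightarrow> deep (\<lambda>j. of_nat n * dv j)" using deep_exists by metis
  hence c: "deep (\<lambda>j. of_nat M * dv j)" by blast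
  have "0 \<le> proj B (\<lambda>j. of_nat M * dv j)" using dv_nonneg by (simp add: le_fun_def proj_apply)
  from euler_sum_box_eq[OF zero_quadrant c this]
  have "(of_int (eu_quadrant G k B) :: rat) = of_int (eu_graph G k)"
    by (simp only: eu_quadrant_eq[OF c] eu_graph_eq[OF c])
  thus ?thesis by (simp only: of_int_eq_iff)
qed

text \<open>Above a deep point the quadrant collapses to that point.\<close>
lemma euler_sum_deep:
  assumes "deep z"
  shows "euler_sum (box_cubes (proj B z) (proj B (z + (\<lambda>j. of_nat n * dv j)))) wb = - wb (proj B z)"
proof (induction n)
  case 0
  have "z + (\<lambda>j. of_nat 0 * dv j) = z" by (simp add: fun_eq_iff)
  moreover have "box_cubes (proj B z) (proj B z) = {(proj B z, {})}"
    by (rule box_cubes_same) (rule Lat_proj[OF deepD(1)[OF assms]])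
  ultimately show ?case by (simp add: euler_sum_def)
next
  case (Suc n)
  let ?c = "z + (\<lambda>j. of_nat n * dv j)"
  have e: "proj B (z + (\<lambda>j. of_nat (Suc n) * dv j)) = proj B ?c + proj B dv"
    by (simp add: fun_eq_iff proj_apply algebra_simps)
  have col: "(collapse_step (\<lambda>x. wb x))\<^sup>*\<^sup>* (box_cubes (proj B z) (proj B ?c)) (box_cubes (proj B z) (proj B ?c + proj B dv))"
  proof (rule wb_collapses_up[of "\<lambda>x. x"])
    show "mono (\<lambda>x. x :: rat)" by (simp add: mono_def)
    show "deep ?c" by (rule deep_add_dv[OF assms])
    show "proj B z \<le> proj B ?c" using dv_nonneg by (simp add: le_fun_def proj_apply)
    show "proj B (proj B z) = proj B z" by (simp add: proj_def fun_eq_iff)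
  qed
  show ?case unfolding e by (simp only: collapses_euler_sum[OF col finite_box_cubes] Suc)
qed

end

section \<open>The zeta function of a tree\<close>

inductive grown :: "('v \<Rightarrow> 'v \<Rightarrow> bool) \<Rightarrow> 'v set \<Rightarrow> bool" for A where
  single: "grown A {r}"
| leaf: "grown A S \<Longrightarrow> u \<in> S \<Longrightarrow> v \<notin> S \<Longrightarrow> A v u \<Longrightarrow> (\<And>i. i \<in> S \<Longrightarrow> A v i \<Longrightarrow> i = u) \<Longrightarrow> grown A (insert v S)"

definition simple_path :: "('v \<Rightarrow> 'v \<Rightarrow> bool) \<Rightarrow> 'v set \<Rightarrow> 'v \<Rightarrow> 'v \<Rightarrow> 'v list \<Rightarrow> bool" where
  "simple_path A S x y p \<longleftrightarrow> p \<noteq> [] \<and> hd p = x \<and> last p = y \<and> distinct p \<and> successively A p \<and> set p \<subseteq> S"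

text \<open>These paths exclude a second neighbour of a new leaf: together with the leaf they would form a cycle.\<close>
lemma grown_simple_path:
  assumes "grown A S" and sym: "\<And>u v. A u v \<Longrightarrow> A v u"
  shows "\<forall>x\<in>S. \<forall>y\<in>S. \<exists>p. simple_path A S x y p"
  using assms(1)
proof induction
  case (single r)
  have "simple_path A {r} r r [r]" by (simp add: simple_path_def)
  hence "\<exists>p. simple_path A {r} r r p" by (rule exI)
  thus ?case by simp
next
  case (leaf S u v)
  show ?case
  proof (intro ballI)
    fix x y assume x: "x \<in> insert v S" and y: "y \<in> insert v S"
    consider "x = v" "y = v" | "x = v" "y \<in> S" | "x \<in> S" "y = v" | "x \<in> S" "y \<in> S" using x y unfolding insert_iff by argo
    thus "\<exists>p. simple_path A (insert v S) x y p"
    proof cases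
      case 1
      have "simple_path A (insert v S) v v [v]" by (simp add: simple_path_def)
      thus ?thesis unfolding 1 by (rule exI)
    next
      case 2
      obtain p where p: "simple_path A S u y p" using bspec[OF bspec[OF leaf.IH leaf.hyps(2)] 2(2)] by (rule exE)
      hence p': "p \<noteq> []" "hd p = u" "last p = y" "distinct p" "successively A p" "set p \<subseteq> S"
        unfolding simple_path_def by simp_all
      have "v \<notin> set p" using p'(6) leaf.hyps(3) by (rule contra_subsetD)
      hence "simple_path A (insert v S) v y (v # p)"
        using p' leaf.hyps(4) unfolding simple_path_def successively_Cons by (simp add: subset_insertI2)
      thus ?thesis unfolding 2(1) by (rule exI)
    next
      case 3
      obtain p where p: "simple_path A S x u p" using bspec[OF bspec[OF leaf.IH 3(1)] leaf.hyps(2)] by (rule exE)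
      hence p': "p \<noteq> []" "hd p = x" "last p = u" "distinct p" "successively A p" "set p \<subseteq> S"
        unfolding simple_path_def by simp_all
      have "v \<notin> set p" using p'(6) leaf.hyps(3) by (rule contra_subsetD)
      hence "simple_path A (insert v S) x v (p @ [v])"
        using p' sym[OF leaf.hyps(4)] unfolding simple_path_def successively_append_iff by (simp add: subset_insertI2)
      thus ?thesis unfolding 3(2) by (rule exI)
    next
      case 4
      obtain p where p: "simple_path A S x y p" using bspec[OF bspec[OF leaf.IH 4(1)] 4(2)] by (rule exE)
      hence "simple_path A (insert v S) x y p" unfolding simple_path_def by (simp add: subset_insertI2)
      thus ?thesis by (rule exI)
    qed
  qed
qed

lemma rtranclp_leaves_set:
  assumes "r\<^sup>*\<^sup>* x y" "x \<in> S" "y \<notin> S"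
  shows "\<exists>u v. u \<in> S \<and> v \<notin> S \<and> r u v"
  using assms by (induction rule: rtranclp_induct) blast+

text \<open>A grown set of largest size is everything: otherwise an edge leaves it, and its outer end is a leaf since a second neighbour inside would close a cycle.\<close>
lemma connected_tree_grown:
  fixes A :: "'v::finite \<Rightarrow> 'v \<Rightarrow> bool"
  assumes "connected_tree A"
  shows "grown A UNIV"
proof -
  have sym: "\<And>u v. A u v \<Longrightarrow> A v u" and conn: "\<And>u v. A\<^sup>*\<^sup>* u v"
    and acyc: "\<And>vs. 3 \<le> length vs \<Longrightarrow> distinct vs \<Longrightarrow> successively A vs \<Longrightarrow> \<not> A (last vs) (hd vs)"
    using assms unfolding connected_tree_def by blast+
  define N where "N = Max (card ` {S. grown A S})"
  have fin: "finite (card ` {S. grown A S})" by simp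
  have ne: "card ` {S. grown A S} \<noteq> {}" using grown.single by fast
  have "N \<in> card ` {S. grown A S}" unfolding N_def by (rule Max_in[OF fin ne])
  then obtain S where S: "grown A S" "card S = N" by auto
  have Smax: "card T \<le> N" if "grown A T" for T unfolding N_def using fin that by (intro Max_ge) auto
  have "S \<noteq> {}" using S(1) by (cases rule: grown.cases) auto
  then obtain x where x: "x \<in> S" by blast
  have "S = UNIV"
  proof (rule ccontr)
    assume "S \<noteq> UNIV"
    then obtain y where y: "y \<notin> S" by blast
    obtain u v where uv: "u \<in> S" "v \<notin> S" "A u v" using rtranclp_leaves_set[OF conn x y] by blast
    have "grown A (insert v S)"
    proof (rule grown.leaf[OF S(1) uv(1,2) sym[OF uv(3)]])
      fix i assume i: "i \<in> S" "A v i"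
      show "i = u"
      proof (rule ccontr)
        assume iu: "i \<noteq> u"
        obtain p where p: "simple_path A S u i p" using bspec[OF bspec[OF grown_simple_path[OF S(1) sym] uv(1)] i(1)] by (rule exE)
        have p': "p \<noteq> []" "hd p = u" "last p = i" "distinct p" "successively A p" "set p \<subseteq> S"
          using p unfolding simple_path_def by simp_all
        have "2 \<le> length p"
        proof (rule ccontr)
          assume "\<not> 2 \<le> length p"
          then obtain q where "p = [q]" using p'(1) by (cases p) (auto simp: Suc_le_eq)
          thus False using p'(2,3) iu by simp
        qed
        hence "3 \<le> length (v # p)" by simp
        moreover have "distinct (v # p)" using p'(4,6) uv(2) by auto
        moreover have "successively A (v # p)" using p' sym[OF uv(3)] by (auto simp: successively_Cons)
        ultimately have "\<not> A (last (v # p)) (hd (v # p))" by (rule acyc)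
        thus False using p'(1,3) sym[OF i(2)] by simp
      qed
    qed
    from Smax[OF this] uv(2) S(2) show False by simp
  qed
  thus ?thesis using S(1) by simp
qed


definition binomial_coeff :: "int \<Rightarrow> int \<Rightarrow> rat" where
  "binomial_coeff d n = (if n < 0 then 0 else fps_nth ((1 - fps_X) powi d) (nat n))"

lemma one_minus_X_powi_Suc: "(1 - fps_X :: rat fps) powi (d + 1) = (1 - fps_X) * (1 - fps_X) powi d"
proof (cases "0 \<le> d")
  case True
  thus ?thesis by (simp add: power_int_def nat_add_distrib)
next
  case False
  define m where "m = nat (- d - 1)"
  have m: "nat (- d) = Suc m" "nat (- (d + 1)) = m" using False unfolding m_def by auto
  have inv: "(1 - fps_X :: rat fps) * inverse (1 - fps_X) = 1" by (rule inverse_mult_eq_1') simp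
  have "(1 - fps_X :: rat fps) * (1 - fps_X) powi d = (1 - fps_X) * (inverse (1 - fps_X) * inverse (1 - fps_X) ^ m)"
    using False m by (simp add: power_int_def)
  also have "\<dots> = ((1 - fps_X) * inverse (1 - fps_X)) * inverse (1 - fps_X) ^ m" by (simp only: mult.assoc)
  also have "\<dots> = inverse (1 - fps_X) ^ m" by (simp only: inv mult_1)
  also have "\<dots> = (1 - fps_X) powi (d + 1)"
  proof (cases "d = -1")
    case True thus ?thesis by (simp add: m_def)
  next
    case d: False
    thus ?thesis using False m by (simp add: power_int_def)
  qed
  finally show ?thesis ..
qed

text \<open>Multiplication by \<open>1 - X\<close>.\<close>
lemma binomial_coeff_rec: "binomial_coeff (d + 1) n = binomial_coeff d n - binomial_coeff d (n - 1)"
proof -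
  define f where "f = (1 - fps_X :: rat fps) powi d"
  have nth: "fps_nth ((1 - fps_X) * f) i = fps_nth f i - (if i = 0 then 0 else fps_nth f (i - 1))" for i
    by (simp add: algebra_simps)
  consider "n < 0" | "n = 0" | "0 < n" by linarith
  thus ?thesis
  proof cases
    case 3
    hence "nat (n - 1) = nat n - 1" "nat n \<noteq> 0" by auto
    thus ?thesis using 3 unfolding binomial_coeff_def one_minus_X_powi_Suc f_def[symmetric] nth by simp
  qed (unfold binomial_coeff_def one_minus_X_powi_Suc f_def[symmetric] nth, simp_all)
qed

lemma binomial_coeff_0: "binomial_coeff 0 n = (if n = 0 then 1 else 0)"
  by (auto simp: binomial_coeff_def)

lemma binomial_coeff_minus_1: "binomial_coeff (-1) n = (if n < 0 then 0 else 1)"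
proof (cases "n < 0")
  case False
  have "binomial_coeff (-1) (int m) = 1" for m
  proof (induction m)
    case 0
    show ?case using binomial_coeff_rec[of "-1" 0] by (simp add: binomial_coeff_0 binomial_coeff_def)
  next
    case (Suc m)
    show ?case using binomial_coeff_rec[of "-1" "int (Suc m)"] Suc by (simp add: binomial_coeff_0)
  qed
  from this[of "nat n"] False show ?thesis by simp
qed (simp add: binomial_coeff_def)

lemma binomial_coeff_minus_2: "binomial_coeff (-2) n = max 0 (1 + of_int n)"
proof (cases "n < 0")
  case False
  have "binomial_coeff (-2) (int m) = 1 + of_nat m" for m
  proof (induction m)
    case 0
    show ?case using binomial_coeff_rec[of "-2" 0] by (simp add: binomial_coeff_minus_1 binomial_coeff_def)
  next
    case (Suc m)
    show ?case using binomial_coeff_rec[of "-2" "int (Suc m)"] Suc by (simp add: binomial_coeff_minus_1)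
  qed
  from this[of "nat n"] False show ?thesis by simp
next
  case True
  hence "(of_int (n + 1) :: rat) \<le> of_int 0" by (subst of_int_le_iff) simp
  thus ?thesis using True by (simp add: binomial_coeff_def)
qed


definition subset_max :: "('v set \<Rightarrow> rat) \<Rightarrow> 'v::finite set \<Rightarrow> rat" where
  "subset_max f I = Max (f ` Pow I)"

lemma subset_max_empty: "subset_max f {} = f {}"
  by (simp add: subset_max_def)

lemma subset_max_cong: "(\<And>J. J \<subseteq> I \<Longrightarrow> f J = g J) \<Longrightarrow> subset_max f I = subset_max g I"
  unfolding subset_max_def by (intro arg_cong[where f = Max] image_cong) auto

lemma subset_max_insert: "subset_max f (insert v I) = max (subset_max f I) (subset_max (\<lambda>J. f (insert v J)) I)"
proof -
  have *: "f ` Pow (insert v I) = f ` Pow I \<union> (\<lambda>J. f (insert v J)) ` Pow I"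
    by (auto simp: Pow_insert image_Un image_image)
  show ?thesis unfolding subset_max_def * by (rule Max_Un) auto
qed

lemma subset_max_mono:
  assumes "\<And>J. J \<subseteq> I \<Longrightarrow> f J \<le> g J"
  shows "subset_max f I \<le> subset_max g I"
proof -
  have "f J \<le> Max (g ` Pow I)" if "J \<subseteq> I" for J
  proof -
    have "g J \<le> Max (g ` Pow I)" using that by (intro Max_ge) auto
    with assms[OF that] show ?thesis by (rule order_trans)
  qed
  thus ?thesis unfolding subset_max_def by (subst Max_le_iff) auto
qed

lemma subset_max_shift: "subset_max (\<lambda>J. c + f J) I = c + subset_max f I"
proof -
  have "c + Max (f ` Pow I) = Max ((\<lambda>x. c + x) ` f ` Pow I)"
    by (rule mono_Max_commute) (auto simp: mono_def)
  thus ?thesis unfolding subset_max_def image_image by (rule HOL.sym)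
qed

definition alternating_max :: "('v set \<Rightarrow> rat) \<Rightarrow> 'v::finite set \<Rightarrow> rat" where
  "alternating_max f S = (\<Sum>I\<in>Pow S. (-1) ^ (card I + 1) * subset_max f I)"

lemma sum_Pow_insert:
  fixes h :: "'v::finite set \<Rightarrow> rat"
  assumes "v \<notin> S"
  shows "sum h (Pow (insert v S)) = (\<Sum>I\<in>Pow S. h I + h (insert v I))"
proof -
  have inj: "inj_on (insert v) (Pow S)" using assms by (auto simp: inj_on_def)
  have "sum h (Pow S \<union> insert v ` Pow S) = sum h (Pow S) + sum h (insert v ` Pow S)"
    using assms by (intro sum.union_disjoint) auto
  thus ?thesis by (simp add: Pow_insert sum.reindex[OF inj] sum.distrib)
qed

lemma sum_alternating_Pow:
  fixes S :: "'v::finite set"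
  assumes "S \<noteq> {}"
  shows "(\<Sum>I\<in>Pow S. (-1) ^ card I) = (0 :: rat)"
proof -
  obtain v where v: "v \<in> S" using assms by blast
  have "(\<Sum>I\<in>Pow (insert v (S - {v})). (-1) ^ card I) = (\<Sum>I\<in>Pow (S - {v}). (-1) ^ card I + (-1 :: rat) ^ card (insert v I))"
    by (rule sum_Pow_insert) simp
  also have "\<dots> = 0"
  proof (rule sum.neutral, rule ballI)
    fix I assume "I \<in> Pow (S - {v})"
    hence "card (insert v I) = card I + 1" by (subst card_insert_disjoint) auto
    thus "(-1) ^ card I + (-1 :: rat) ^ card (insert v I) = 0" by simp
  qed
  finally show ?thesis using v by (simp add: insert_absorb)
qed

lemma alternating_max_insert:
  assumes "v \<notin> S"
  shows "alternating_max f (insert v S) =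
     (\<Sum>I\<in>Pow S. (-1) ^ (card I + 1) * (subset_max f I - subset_max f (insert v I)))"
  unfolding alternating_max_def sum_Pow_insert[OF assms]
proof (rule sum.cong[OF refl])
  fix I assume "I \<in> Pow S"
  hence "card (insert v I) = card I + 1" using assms by (subst card_insert_disjoint) auto
  thus "(- 1) ^ (card I + 1) * subset_max f I + (- 1) ^ (card (insert v I) + 1) * subset_max f (insert v I) =
     (- 1) ^ (card I + 1) * (subset_max f I - subset_max f (insert v I))" by (simp add: algebra_simps)
qed

lemma alternating_max_shift:
  assumes "S \<noteq> {}"
  shows "alternating_max (\<lambda>J. c + f J) S = alternating_max f S"
proof -
  have "alternating_max (\<lambda>J. c + f J) S = (\<Sum>I\<in>Pow S. - c * (-1) ^ card I + (-1) ^ (card I + 1) * subset_max f I)"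
    unfolding alternating_max_def subset_max_shift by (simp add: algebra_simps)
  also have "\<dots> = - c * (\<Sum>I\<in>Pow S. (-1) ^ card I) + alternating_max f S"
    unfolding alternating_max_def sum.distrib sum_distrib_left ..
  finally show ?thesis unfolding sum_alternating_Pow[OF assms] by simp
qed

definition edges :: "('v \<Rightarrow> 'v \<Rightarrow> bool) \<Rightarrow> 'v set \<Rightarrow> rat" where
  "edges A J = (\<Sum>i\<in>J. \<Sum>j\<in>J. of_bool (A i j)) / 2"

definition tree_weight :: "('v \<Rightarrow> 'v \<Rightarrow> bool) \<Rightarrow> ('v \<Rightarrow> int) \<Rightarrow> 'v set \<Rightarrow> rat" where
  "tree_weight A n J = (\<Sum>j\<in>J. 1 + of_int (n j)) - edges A J"

lemma edges_insert:
  fixes J :: "'v::finite set"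
  assumes "v \<notin> J" "symp A" "\<not> A v v"
  shows "edges A (insert v J) = edges A J + (\<Sum>i\<in>J. of_bool (A v i))"
proof -
  have s: "(of_bool (A i v) :: rat) = of_bool (A v i)" for i
    using sympD[OF assms(2), of i v] sympD[OF assms(2), of v i] by (cases "A v i") auto
  have z: "(of_bool (A v v) :: rat) = 0" using assms(3) by simp
  have gen: "(\<Sum>i\<in>insert v J. \<Sum>j\<in>insert v J. h i j) = h v v + (\<Sum>i\<in>J. h v i) + (\<Sum>i\<in>J. h i v) + (\<Sum>i\<in>J. \<Sum>j\<in>J. h i j)"
    for h :: "'v \<Rightarrow> 'v \<Rightarrow> rat" using assms(1) by (simp add: sum.distrib)
  define a where "a = (\<Sum>i\<in>J. of_bool (A v i) :: rat)"
  show ?thesis unfolding edges_def gen z unfolding s a_def[symmetric] by (simp add: add_divide_distrib)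
qed

lemma tree_weight_leaf:
  fixes J :: "'v::finite set"
  assumes "v \<notin> J" "symp A" "\<not> A v v" "A v u" "\<And>i. i \<in> J \<Longrightarrow> A v i \<Longrightarrow> i = u"
  shows "tree_weight A n (insert v J) = 1 + of_int (n v) + tree_weight A (n(u := n u - 1)) J"
proof -
  have "(\<Sum>i\<in>J. of_bool (A v i) :: rat) = (\<Sum>i\<in>J. if i = u then 1 else 0)"
  proof (rule sum.cong[OF refl])
    fix i assume "i \<in> J"
    hence "A v i \<longleftrightarrow> i = u" using assms(4) assms(5)[of i] by blast
    thus "(of_bool (A v i) :: rat) = (if i = u then 1 else 0)" by simp
  qed
  moreover have "(\<Sum>j\<in>J. 1 + of_int ((n(u := n u - 1)) j) :: rat) = (\<Sum>j\<in>J. (1 + of_int (n j)) - (if j = u then 1 else 0))"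
    by (intro sum.cong) auto
  ultimately show ?thesis unfolding tree_weight_def edges_insert[OF assms(1) assms(2) assms(3)]
    using assms(1) by (simp add: sum_subtractf)
qed

text \<open>Induction on leaves. A leaf with a negative entry never increases the maximum, so the terms cancel. Otherwise including the leaf is always optimal and lowers the entry of its neighbour by one, which leaves a difference of two instances of the smaller tree.\<close>
lemma alternating_max_tree:
  fixes A :: "'v::finite \<Rightarrow> 'v \<Rightarrow> bool"
  assumes "grown A S" and sym: "symp A" and irr: "\<And>v. \<not> A v v"
  shows "alternating_max (tree_weight A n) S = (\<Prod>j\<in>S. binomial_coeff (int (card {i\<in>S. A j i}) - 2) (n j))"
  using assms(1)
proof (induction arbitrary: n)
  case (single r)
  have rn: "r \<notin> {}" by simp
  have "alternating_max (tree_weight A n) (insert r {}) = max 0 (1 + of_int (n r))"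
    unfolding alternating_max_insert[OF rn] subset_max_insert
    using irr by (simp add: subset_max_empty tree_weight_def edges_def)
  thus ?case using irr by (simp add: binomial_coeff_minus_2 cong: conj_cong)
next
  case (leaf S u v)
  have Sne: "S \<noteq> {}" using leaf.hyps(2) by blast
  define n' where "n' = n(u := n u - 1)"
  have lw: "tree_weight A n (insert v J) = (1 + of_int (n v)) + tree_weight A n' J" if "J \<subseteq> S" for J
    unfolding n'_def
  proof (rule tree_weight_leaf[of v J A u n, OF _ sym irr leaf.hyps(4)])
    show "v \<notin> J" using that leaf.hyps(3) by blast
    show "i = u" if "i \<in> J" "A v i" for i by (rule leaf.hyps(5)[OF subsetD[OF \<open>J \<subseteq> S\<close> that(1)] that(2)])
  qed
  have n'_le: "tree_weight A n' J \<le> tree_weight A n J" "tree_weight A n J \<le> 1 + tree_weight A n' J" for J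
  proof -
    have "(\<Sum>j\<in>J. 1 + of_int (n' j) :: rat) = (\<Sum>j\<in>J. (1 + of_int (n j)) - (if j = u then 1 else 0))"
      unfolding n'_def by (intro sum.cong) auto
    hence "tree_weight A n' J = tree_weight A n J - (if u \<in> J then 1 else 0)"
      unfolding tree_weight_def by (simp add: sum_subtractf)
    thus "tree_weight A n' J \<le> tree_weight A n J" "tree_weight A n J \<le> 1 + tree_weight A n' J" by auto
  qed
  have sm: "subset_max (\<lambda>J. tree_weight A n (insert v J)) I = (1 + of_int (n v)) + subset_max (tree_weight A n') I"
    if "I \<subseteq> S" for I
    unfolding subset_max_shift[symmetric] by (rule subset_max_cong) (use lw that in blast)
  define P where "P = (\<Prod>j\<in>S - {u}. binomial_coeff (int (card {i\<in>S. A j i}) - 2) (n j))"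
  define d where "d = int (card {i\<in>S. A u i}) - 2"
  have IH: "alternating_max (tree_weight A n) S = binomial_coeff d (n u) * P"
    unfolding leaf.IH P_def d_def using leaf.hyps(2) by (simp add: prod.remove[of S u])
  have IH': "alternating_max (tree_weight A n') S = binomial_coeff d (n u - 1) * P"
  proof -
    have "(\<Prod>j\<in>S - {u}. binomial_coeff (int (card {i\<in>S. A j i}) - 2) (n' j)) = P"
      unfolding P_def n'_def by (intro prod.cong) auto
    thus ?thesis unfolding leaf.IH d_def using leaf.hyps(2)
      by (simp add: prod.remove[of S u] n'_def)
  qed
  have prod': "(\<Prod>j\<in>insert v S. binomial_coeff (int (card {i\<in>insert v S. A j i}) - 2) (n j)) =
      binomial_coeff (-1) (n v) * (binomial_coeff (d + 1) (n u) * P)"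
  proof -
    have v1: "{i\<in>insert v S. A v i} = {u}"
    proof (intro set_eqI iffI)
      fix i assume "i \<in> {i\<in>insert v S. A v i}"
      hence "i = v \<or> i \<in> S" "A v i" by auto
      thus "i \<in> {u}" using irr[of v] leaf.hyps(5)[of i] by blast
    qed (use leaf.hyps(2,4) in simp)
    have "{i\<in>insert v S. A u i} = insert v {i\<in>S. A u i}" using sympD[OF sym leaf.hyps(4)] by auto
    hence u1: "int (card {i\<in>insert v S. A u i}) - 2 = d + 1" unfolding d_def using leaf.hyps(3) by simp
    have o1: "{i\<in>insert v S. A j i} = {i\<in>S. A j i}" if "j \<in> S - {u}" for j
      using leaf.hyps(5)[of j] sympD[OF sym, of j v] that by auto
    have "(\<Prod>j\<in>insert v S. binomial_coeff (int (card {i\<in>insert v S. A j i}) - 2) (n j)) =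
      binomial_coeff (int (card {i\<in>insert v S. A v i}) - 2) (n v) *
      (binomial_coeff (int (card {i\<in>insert v S. A u i}) - 2) (n u) *
       (\<Prod>j\<in>S - {u}. binomial_coeff (int (card {i\<in>insert v S. A j i}) - 2) (n j)))"
      using leaf.hyps(2,3) by (simp add: prod.remove[of S u])
    also have "(\<Prod>j\<in>S - {u}. binomial_coeff (int (card {i\<in>insert v S. A j i}) - 2) (n j)) = P"
      unfolding P_def by (rule prod.cong[OF refl]) (simp only: o1)
    finally show ?thesis unfolding u1 v1 by simp
  qed
  show ?case
  proof (cases "n v < 0")
    case True
    have "(of_int (n v) :: rat) \<le> of_int (-1)" by (subst of_int_le_iff) (use True in simp)
    hence c: "1 + of_int (n v) \<le> (0 :: rat)" by simp
    have "alternating_max (tree_weight A n) (insert v S) = 0" unfolding alternating_max_insert[OF leaf.hyps(3)]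
    proof (rule sum.neutral, rule ballI)
      fix I assume I: "I \<in> Pow S"
      have "subset_max (\<lambda>J. tree_weight A n (insert v J)) I \<le> subset_max (tree_weight A n) I"
      proof (rule subset_max_mono)
        fix J assume "J \<subseteq> I"
        hence "J \<subseteq> S" using I by blast
        show "tree_weight A n (insert v J) \<le> tree_weight A n J"
          unfolding lw[OF \<open>J \<subseteq> S\<close>] using c n'_le(1)[of J] by linarith
      qed
      thus "(- 1) ^ (card I + 1) * (subset_max (tree_weight A n) I - subset_max (tree_weight A n) (insert v I)) = 0"
        unfolding subset_max_insert by (simp add: max_absorb1)
    qed
    thus ?thesis unfolding prod' using True by (simp add: binomial_coeff_minus_1)
  next
    case False
    hence "(of_int 0 :: rat) \<le> of_int (n v)" by (subst of_int_le_iff) simp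
    hence c: "(0 :: rat) \<le> of_int (n v)" by simp
    have "alternating_max (tree_weight A n) (insert v S) =
       (\<Sum>I\<in>Pow S. (-1) ^ (card I + 1) * (subset_max (tree_weight A n) I) -
         (-1) ^ (card I + 1) * subset_max (\<lambda>J. (1 + of_int (n v)) + tree_weight A n' J) I)"
      unfolding alternating_max_insert[OF leaf.hyps(3)]
    proof (rule sum.cong[OF refl])
      fix I assume I: "I \<in> Pow S"
      have "subset_max (tree_weight A n) I \<le> subset_max (\<lambda>J. tree_weight A n (insert v J)) I"
      proof (rule subset_max_mono)
        fix J assume "J \<subseteq> I"
        hence "J \<subseteq> S" using I by blast
        show "tree_weight A n J \<le> tree_weight A n (insert v J)"
          unfolding lw[OF \<open>J \<subseteq> S\<close>] using c n'_le(2)[of J] by linarith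
      qed
      hence "subset_max (tree_weight A n) (insert v I) = subset_max (\<lambda>J. tree_weight A n (insert v J)) I"
        unfolding subset_max_insert by (rule max_absorb2)
      also have "\<dots> = subset_max (\<lambda>J. (1 + of_int (n v)) + tree_weight A n' J) I"
        using sm I by (simp only: subset_max_shift PowD)
      finally show "(- 1) ^ (card I + 1) * (subset_max (tree_weight A n) I - subset_max (tree_weight A n) (insert v I)) =
         (-1) ^ (card I + 1) * (subset_max (tree_weight A n) I) -
         (-1) ^ (card I + 1) * subset_max (\<lambda>J. (1 + of_int (n v)) + tree_weight A n' J) I"
        by (simp only: right_diff_distrib)
    qed
    also have "\<dots> = alternating_max (tree_weight A n) S - alternating_max (\<lambda>J. (1 + of_int (n v)) + tree_weight A n' J) S"
      unfolding alternating_max_def sum_subtractf ..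
    also have "\<dots> = binomial_coeff d (n u) * P - binomial_coeff d (n u - 1) * P"
      unfolding alternating_max_shift[OF Sne] IH IH' ..
    also have "\<dots> = binomial_coeff (d + 1) (n u) * P"
      unfolding binomial_coeff_rec by (rule left_diff_distrib[symmetric])
    finally show ?thesis unfolding prod' using False by (simp add: binomial_coeff_minus_1)
  qed
qed

context plumbing_tree begin

lemma Estar: "form G (Estar G j) (basis i) = (if i = j then -1 else 0)"
proof -
  obtain x where x: "\<And>i. form G x (basis i) = (if i = j then -1 else 0)"
    using mixed_system_solvable[of "{}" "\<lambda>i. if i = j then -1 else 0"] by auto
  have "Estar G j = x" unfolding Estar_def
  proof (rule the_equality)
    show "x \<in> dualLat G \<and> (\<forall>i. form G x (basis i) = (if i = j then -1 else 0))"
      using x by (intro conjI dualLatI allI) auto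
    fix y assume "y \<in> dualLat G \<and> (\<forall>i. form G y (basis i) = (if i = j then -1 else 0))"
    thus "y = x" using x by (intro form_eqI) simp
  qed
  thus ?thesis using x by simp
qed

lemma form_sum_left:
  assumes "finite A"
  shows "form G (\<lambda>i. \<Sum>a\<in>A. c a * f a i) z = (\<Sum>a\<in>A. c a * form G (f a) z)"
  using assms
proof (induction A)
  case empty
  show ?case using form_zero(1)[of G z] by (simp add: zero_fun_def)
next
  case (insert a A)
  have eq: "(\<lambda>i. \<Sum>a\<in>insert a A. c a * f a i) = (\<lambda>i. c a * f a i) + (\<lambda>i. \<Sum>a\<in>A. c a * f a i)"
    using insert(1,2) by (simp add: fun_eq_iff)
  show ?case unfolding eq form_add_left form_scale_left insert.IH using insert(1,2) by simp
qed

lemma form_Estar_combination: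
  "form G (\<lambda>i. \<Sum>j\<in>UNIV. c j * Estar G j i) (basis i) = - c i"
  unfolding form_sum_left[OF finite_class.finite_UNIV] Estar
  by (simp add: if_distrib[of "\<lambda>x. _ * x"] cong: if_cong)

text \<open>Pairing with the basis recovers the exponents, so at most one multi-index contributes.\<close>
lemma zeta_coeff_eq:
  assumes n: "\<And>j. form G z (basis j) = - of_int (n j)"
  shows "zeta_coeff G z = (\<Prod>j\<in>UNIV. binomial_coeff (int (valency G j) - 2) (n j))"
proof (cases "\<forall>j. 0 \<le> n j")
  case True
  have "{m :: 'v \<Rightarrow> nat. (\<lambda>i. \<Sum>j\<in>UNIV. of_nat (m j) * Estar G j i) = z} = {\<lambda>j. nat (n j)}"
  proof (intro set_eqI iffI)
    fix m :: "'v \<Rightarrow> nat" assume "m \<in> {m. (\<lambda>i. \<Sum>j\<in>UNIV. of_nat (m j) * Estar G j i) = z}"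
    hence "form G z (basis j) = - of_nat (m j)" for j using form_Estar_combination[of "\<lambda>j. of_nat (m j)" j] by simp
    hence "(of_int (n j) :: rat) = of_int (int (m j))" for j using n[of j] by simp
    hence "n j = int (m j)" for j by (simp only: of_int_eq_iff)
    thus "m \<in> {\<lambda>j. nat (n j)}" by auto
  next
    fix m :: "'v \<Rightarrow> nat" assume m: "m \<in> {\<lambda>j. nat (n j)}"
    have "(\<lambda>i. \<Sum>j\<in>UNIV. of_nat (m j) * Estar G j i) = z"
    proof (rule form_eqI)
      fix j
      show "form G (\<lambda>i. \<Sum>j\<in>UNIV. of_nat (m j) * Estar G j i) (basis j) = form G z (basis j)"
        unfolding form_Estar_combination n using m True by simp
    qed
    thus "m \<in> {m. (\<lambda>i. \<Sum>j\<in>UNIV. of_nat (m j) * Estar G j i) = z}" by simp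
  qed
  moreover have "\<not> n j < 0" for j using True by (simp add: not_less)
  ultimately show ?thesis unfolding zeta_coeff_def binomial_coeff_def by simp
next
  case False
  then obtain l where l: "n l < 0" by (auto simp: not_le)
  have "{m :: 'v \<Rightarrow> nat. (\<lambda>i. \<Sum>j\<in>UNIV. of_nat (m j) * Estar G j i) = z} = {}"
  proof (rule ccontr)
    assume "\<not> ?thesis"
    then obtain m :: "'v \<Rightarrow> nat" where "(\<lambda>i. \<Sum>j\<in>UNIV. of_nat (m j) * Estar G j i) = z" by blast
    hence "(of_int (n l) :: rat) = of_int (int (m l))" using form_Estar_combination[of "\<lambda>j. of_nat (m j)" l] n[of l] by simp
    hence "n l = int (m l)" by (simp only: of_int_eq_iff)
    thus False using l by simp
  qed
  moreover have "binomial_coeff (int (valency G l) - 2) (n l) = 0" using l by (simp add: binomial_coeff_def)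
  hence "(\<Prod>j\<in>UNIV. binomial_coeff (int (valency G j) - 2) (n j)) = 0"
    using prod_zero[of UNIV "\<lambda>j. binomial_coeff (int (valency G j) - 2) (n j)"] by auto
  ultimately show ?thesis unfolding zeta_coeff_def by simp
qed

lemma zeta_coeff_support:
  assumes "zeta_coeff G z \<noteq> 0"
  shows "form G z (basis j) \<le> 0"
proof -
  have "{m :: 'v \<Rightarrow> nat. (\<lambda>i. \<Sum>j\<in>UNIV. of_nat (m j) * Estar G j i) = z} \<noteq> {}"
  proof
    assume e: "{m :: 'v \<Rightarrow> nat. (\<lambda>i. \<Sum>j\<in>UNIV. of_nat (m j) * Estar G j i) = z} = {}"
    show False using assms unfolding zeta_coeff_def e by simp
  qed
  then obtain m :: "'v \<Rightarrow> nat" where "(\<lambda>i. \<Sum>j\<in>UNIV. of_nat (m j) * Estar G j i) = z" by blast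
  thus ?thesis using form_Estar_combination[of "\<lambda>j. of_nat (m j)" j] by simp
qed

lemma chi_kcan_ind: "chi G (kcan G) (ind J) = of_nat (card J) - edges (adj G) J"
proof -
  have f: "form G (ind J) (basis j) + form G (kcan G) (basis j) = (\<Sum>i\<in>J. of_bool (adj G j i)) - 2" if "j \<in> J" for j
  proof -
    have "(\<Sum>i\<in>{i. adj G j i}. ind J i) = (\<Sum>i\<in>J. of_bool (adj G j i) :: rat)"
      unfolding ind_apply of_bool_def by (simp add: sum.If_cases Int_def conj_commute)
    thus ?thesis unfolding form_basis_expand[of "ind J"] kcan using that by (simp add: ind_apply)
  qed
  have "(\<Sum>j\<in>UNIV. ind J j * (form G (ind J) (basis j) + form G (kcan G) (basis j))) =
     (\<Sum>j\<in>J. form G (ind J) (basis j) + form G (kcan G) (basis j))"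
    by (rule sum.mono_neutral_cong_right) (auto simp: ind_apply)
  also have "\<dots> = (\<Sum>j\<in>J. (\<Sum>i\<in>J. of_bool (adj G j i)) - 2)" by (rule sum.cong[OF refl]) (rule f)
  finally show ?thesis unfolding chi_kcan_expand edges_def by (simp add: sum_subtractf field_simps)
qed

end

context characteristic_tree begin

text \<open>
  On the vertices of a cube the weight is an affine function minus the number of edges, because the
  form only sees edges between different basis vectors. So the product formula for trees applies.
\<close>
lemma zeta_coeff_cubes:
  assumes y: "y \<in> Lat"
  shows "zeta_coeff G (y + l') = (\<Sum>I\<in>Pow UNIV. (-1) ^ (card I + 1) * cube_weight w (y, I))"
proof -
  have "\<exists>m. form G (y + l') (basis j) = of_int m" for j using form_shift_Ints[OF y, of j] by (auto elim: Ints_cases)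
  then obtain m where m: "\<And>j. form G (y + l') (basis j) = of_int (m j)" by metis
  define n where "n j = - m j" for j
  have n: "form G (y + l') (basis j) = - of_int (n j)" for j using m by (simp add: n_def)
  have sym: "symp (adj G)" and irr: "\<And>v. \<not> adj G v v"
    using tree unfolding connected_tree_def symp_def by blast+
  have wJ: "w (y + ind J) = w y + tree_weight (adj G) n J" for J
  proof -
    have "form G (y + l') (ind J) = (\<Sum>j\<in>J. form G (y + l') (basis j))"
      unfolding form_expand[of G "y + l'" "ind J"] by (rule sum.mono_neutral_cong_right) (auto simp: ind_apply)
    also have "\<dots> = - (\<Sum>j\<in>J. of_int (n j))" by (simp add: n sum_negf)
    finally show ?thesis unfolding w_add chi_kcan_ind tree_weight_def by (simp add: sum.distrib)
  qed
  have "cube_weight w (y, I) = subset_max (\<lambda>J. w y + tree_weight (adj G) n J) I" for I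
    by (simp only: cube_weight_def subset_max_def fst_conv snd_conv wJ)
  hence "(\<Sum>I\<in>Pow UNIV. (-1) ^ (card I + 1) * cube_weight w (y, I)) = alternating_max (\<lambda>J. w y + tree_weight (adj G) n J) UNIV"
    unfolding alternating_max_def by simp
  also have "\<dots> = alternating_max (tree_weight (adj G) n) UNIV" by (rule alternating_max_shift) simp
  also have "\<dots> = (\<Prod>j\<in>UNIV. binomial_coeff (int (card {i\<in>UNIV. adj G j i}) - 2) (n j))"
    by (rule alternating_max_tree[OF connected_tree_grown[OF tree] sym irr])
  also have "\<dots> = zeta_coeff G (y + l')" unfolding zeta_coeff_eq[OF n] valency_def by simp
  finally show ?thesis ..
qed

end

section \<open>Quasipolynomiality of the weights\<close>

lemma polynomial_in_family:
  fixes e :: "'a \<Rightarrow> 'v::finite \<Rightarrow> nat"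
  assumes "finite A" "\<And>x. p x = (\<Sum>a\<in>A. c a * (\<Prod>j\<in>B. x j ^ e a j))"
  shows "polynomial_in B p"
proof -
  define c' where "c' m = (\<Sum>a\<in>{a\<in>A. e a = m}. c a)" for m
  have "p x = (\<Sum>m\<in>e ` A. c' m * (\<Prod>j\<in>B. x j ^ m j))" for x
    unfolding assms(2) sum.image_gen[OF assms(1), of _ e] c'_def sum_distrib_right
    by (intro sum.cong refl) auto
  hence "p = (\<lambda>x. \<Sum>m\<in>e ` A. c' m * (\<Prod>j\<in>B. x j ^ m j))" by (simp add: fun_eq_iff)
  thus ?thesis unfolding polynomial_in_def using assms(1) by blast
qed

lemma polynomial_in_const: "polynomial_in B (\<lambda>x. c)"
  by (rule polynomial_in_family[of "{()}" _ "\<lambda>_. c" "\<lambda>_ _. 0" B]) auto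

lemma polynomial_in_coordinate:
  assumes "l \<in> B"
  shows "polynomial_in B (\<lambda>x. x l)"
proof (rule polynomial_in_family[of "{()}" _ "\<lambda>_. 1" "\<lambda>_ j. if j = l then 1 else 0" B])
  fix x :: "'a qvec"
  have "(\<Prod>j\<in>B. x j ^ (if j = l then 1 else 0)) = (\<Prod>j\<in>B. if j = l then x j else 1)"
    by (rule prod.cong) auto
  also have "\<dots> = x l" using assms by (simp add: prod.delta)
  finally show "x l = (\<Sum>a\<in>{()}. 1 * (\<Prod>j\<in>B. x j ^ (if j = l then 1 else 0)))" by simp
qed simp

lemma polynomial_in_add:
  assumes "polynomial_in B p" "polynomial_in B q"
  shows "polynomial_in B (\<lambda>x. p x + q x)"
proof -
  obtain M c where p: "finite M" "p = (\<lambda>x. \<Sum>m\<in>M. c m * (\<Prod>j\<in>B. x j ^ m j))"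
    using assms(1) unfolding polynomial_in_def by blast
  obtain N d where q: "finite N" "q = (\<lambda>x. \<Sum>m\<in>N. d m * (\<Prod>j\<in>B. x j ^ m j))"
    using assms(2) unfolding polynomial_in_def by blast
  show ?thesis
    by (rule polynomial_in_family[of "M <+> N" _ "case_sum c d" "case_sum (\<lambda>m. m) (\<lambda>m. m)" B])
      (use p q in \<open>auto simp: sum.Plus\<close>)
qed

lemma polynomial_in_mult:
  assumes "polynomial_in B p" "polynomial_in B q"
  shows "polynomial_in B (\<lambda>x. p x * q x)"
proof -
  obtain M c where p: "finite M" "p = (\<lambda>x. \<Sum>m\<in>M. c m * (\<Prod>j\<in>B. x j ^ m j))"
    using assms(1) unfolding polynomial_in_def by blast
  obtain N d where q: "finite N" "q = (\<lambda>x. \<Sum>m\<in>N. d m * (\<Prod>j\<in>B. x j ^ m j))"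
    using assms(2) unfolding polynomial_in_def by blast
  show ?thesis
  proof (rule polynomial_in_family[of "M \<times> N" _ "\<lambda>(m, n). c m * d n" "\<lambda>(m, n) j. m j + n j" B])
    fix x
    show "p x * q x = (\<Sum>a\<in>M \<times> N. (case a of (m, n) \<Rightarrow> c m * d n) * (\<Prod>j\<in>B. x j ^ (case a of (m, n) \<Rightarrow> \<lambda>j. m j + n j) j))"
      unfolding p q sum_product sum.cartesian_product
      by (rule sum.cong[OF refl]) (auto simp: power_add prod.distrib)
  qed (use p q in auto)
qed

lemma polynomial_in_sum:
  assumes "finite A" "\<And>a. a \<in> A \<Longrightarrow> polynomial_in B (p a)"
  shows "polynomial_in B (\<lambda>x. \<Sum>a\<in>A. p a x)"
  using assms by (induction A) (auto intro: polynomial_in_const polynomial_in_add)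

lemma polynomial_in_form:
  assumes "\<And>a. polynomial_in B (\<lambda>x. p x a)"
  shows "polynomial_in B (\<lambda>x. form G (p x) (basis j))"
  unfolding form_basis by (intro polynomial_in_sum polynomial_in_mult polynomial_in_const assms) simp

context bad_tree begin

text \<open>For each \<open>l\<close> in \<open>B\<close> there is a rational vector with projection \<open>E_l\<close> orthogonal to all vertices off \<open>B\<close>. Integral combinations of its multiples by a common denominator can be added to \<open>x(i)\<close> without leaving the set in which \<open>x(i)\<close> is minimal.\<close>
lemma wbar_quasipolynomial: "quasipolynomial_on_quadrant B wb"
proof -
  have "\<exists>u. (\<forall>j\<in>B. u j = (if j = l then 1 else 0)) \<and> (\<forall>j. j \<notin> B \<longrightarrow> form G u (basis j) = 0)" for l
  proof -
    show ?thesis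
    proof (rule mixed_system_solvable[of B "\<lambda>j. if j = l \<and> j \<in> B then 1 else 0"])
      fix x assume x: "\<And>j. j \<in> B \<Longrightarrow> x j = (if j = l \<and> j \<in> B then 1 else 0)"
        "\<And>j. j \<notin> B \<Longrightarrow> form G x (basis j) = (if j = l \<and> j \<in> B then 1 else 0)"
      show ?thesis by (intro exI[of _ x] conjI ballI allI impI) (simp_all add: x)
    qed
  qed
  then obtain u where u: "\<And>l j. j \<in> B \<Longrightarrow> u l j = (if j = l then 1 else 0)"
    "\<And>l j. j \<notin> B \<Longrightarrow> form G (u l) (basis j) = 0" by metis
  have "\<exists>M::nat. M > 0 \<and> (\<lambda>j. of_nat M * u l j) \<in> Lat" for l using integral_multiple_vector[of "u l"] by blast
  then obtain M :: "'v \<Rightarrow> nat" where M: "\<And>l. M l > 0" "\<And>l. (\<lambda>j. of_nat (M l) * u l j) \<in> Lat" by metis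
  define N where "N = (\<Prod>l\<in>UNIV. M l)"
  have N: "N > 0" unfolding N_def using M(1) by (simp add: prod_pos)
  have NL: "of_nat N * u l j \<in> \<int>" for l j
  proof -
    have e: "(of_nat N :: rat) = of_nat (\<Prod>i\<in>UNIV - {l}. M i) * of_nat (M l)"
      unfolding N_def by (simp add: prod.remove[of UNIV l])
    have "of_nat (\<Prod>i\<in>UNIV - {l}. M i) * (of_nat (M l) * u l j) \<in> \<int>"
      by (rule Ints_mult[OF Ints_of_nat]) (use M(2)[of l] in \<open>unfold Lat_def, blast\<close>)
    thus ?thesis unfolding e by (simp only: mult.assoc)
  qed
  define U where "U t = (\<lambda>j. \<Sum>l\<in>B. t l * u l j)" for t :: "'v qvec"
  have UB: "U t j = t j" if "j \<in> B" for t j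
  proof -
    have "U t j = (\<Sum>l\<in>B. if j = l then t l else 0)" unfolding U_def using u(1)[OF that] by (intro sum.cong) auto
    thus ?thesis using that by simp
  qed
  have Uform: "form G (U t) (basis j) = 0" if "j \<notin> B" for t j
  proof -
    have "form G (U t) (basis j) = (\<Sum>i\<in>UNIV. \<Sum>l\<in>B. t l * (of_int (entry G i j) * u l i))"
      unfolding form_basis U_def by (simp add: sum_distrib_left mult_ac)
    also have "\<dots> = (\<Sum>l\<in>B. t l * form G (u l) (basis j))"
      unfolding form_basis sum_distrib_left by (rule sum.swap)
    finally show ?thesis using u(2)[OF that] by simp
  qed
  have shift: "xm i = xm r + U (i - r)"
    if r: "r \<in> Lat" "proj B r = r" and i: "i \<in> Lat" "proj B i = i" and d: "\<forall>j\<in>B. (i j - r j) / of_nat N \<in> \<int>" for i r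
  proof -
    have UL: "U (i - r) \<in> Lat" unfolding Lat_def mem_Collect_eq U_def
    proof (intro allI Ints_sum)
      fix j l assume "l \<in> B"
      hence "(i l - r l) / of_nat N * (of_nat N * u l j) \<in> \<int>" by (intro Ints_mult[OF d[rule_format] NL])
      moreover have "(i l - r l) / of_nat N * (of_nat N * u l j) = (i - r) l * u l j" using N by simp
      ultimately show "(i - r) l * u l j \<in> \<int>" by (simp only:)
    qed
    have le: "xm i \<le> xm r + U (i - r)"
    proof (rule xm_least[OF i])
      show "xm r + U (i - r) \<in> Lat" by (rule Lat_add[OF xm_Lat[OF r] UL])
      show "(xm r + U (i - r)) j = i j" if "j \<in> B" for j using xm_B[OF r that] UB[OF that] by simp
      show "form G (xm r + U (i - r) + l') (basis j) \<le> 0" if "j \<notin> B" for j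
        using xm_form[OF r that] Uform[OF that] by (simp only: form_add_left)
    qed
    have ge: "xm r \<le> xm i - U (i - r)"
    proof (rule xm_least[OF r])
      show "xm i - U (i - r) \<in> Lat" by (rule Lat_diff[OF xm_Lat[OF i] UL])
      show "(xm i - U (i - r)) j = r j" if "j \<in> B" for j using xm_B[OF i that] UB[OF that] by simp
      show "form G (xm i - U (i - r) + l') (basis j) \<le> 0" if "j \<notin> B" for j
        using xm_form[OF i that] Uform[OF that, of "i - r"] by (simp add: form_add_left form_diff_left)
    qed
    have "xm i j = (xm r + U (i - r)) j" for j using le_funD[OF le, of j] le_funD[OF ge, of j] by simp
    thus ?thesis by (rule HOL.ext)
  qed
  show ?thesis unfolding quasipolynomial_on_quadrant_def
  proof (intro exI[of _ N] conjI ballI N)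
    fix r assume "r \<in> quadrant B"
    hence r: "r \<in> Lat" "proj B r = r" unfolding quadrant_def proj_eq_iff by auto
    define p where "p i = wb r + (- (1/2) * (\<Sum>j\<in>UNIV. U (i - r) j * (form G (U (i - r)) (basis j) + form G (kcan G) (basis j))))
        + (-1) * (\<Sum>j\<in>UNIV. U (i - r) j * form G (xm r + l') (basis j))" for i
    have PU: "polynomial_in B (\<lambda>i. U (i - r) j)" for j
    proof -
      have "polynomial_in B (\<lambda>i. \<Sum>l\<in>B. (i l + - r l) * u l j)"
        by (intro polynomial_in_sum polynomial_in_mult polynomial_in_add polynomial_in_const polynomial_in_coordinate) simp_all
      thus ?thesis unfolding U_def by simp
    qed
    have "polynomial_in B p" unfolding p_def
      by (intro polynomial_in_add polynomial_in_mult polynomial_in_sum polynomial_in_const polynomial_in_form PU) simp_all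
    moreover have "wb i = p i" if "i \<in> quadrant B" "\<forall>j\<in>B. (i j - r j) / of_nat N \<in> \<int>" for i
    proof -
      have i: "i \<in> Lat" "proj B i = i" using that(1) unfolding quadrant_def proj_eq_iff by auto
      show ?thesis unfolding wb_eq[of i] shift[OF r i that(2)] w_add p_def wb_eq[of r] chi_kcan_expand
        by (simp only: form_expand[of G "xm r + l'" "U (i - r)"])
    qed
    ultimately show "\<exists>p. polynomial_in B p \<and> (\<forall>i\<in>quadrant B. (\<forall>j\<in>B. (i j - r j) / of_nat N \<in> \<int>) \<longrightarrow> wb i = p i)"
      by blast
  qed
qed

end

section \<open>Counting coefficients\<close>

context bad_tree begin

definition pcoef :: "'v qvec \<Rightarrow> rat" where "pcoef y = zeta_coeff G (y + l')"

definition clamp :: "'v set \<Rightarrow> 'v qvec \<Rightarrow> 'v qvec \<Rightarrow> 'v qvec" where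
  "clamp K c x = (\<lambda>j. if j \<in> K then c j else x j)"

definition half_open :: "'v qvec \<Rightarrow> 'v qvec \<Rightarrow> 'v qvec set" where
  "half_open x c = {y \<in> Lat. x \<le> y \<and> y + ind UNIV \<le> c}"

lemma sum_alternating_subsets:
  "(\<Sum>K\<in>{K. K \<subseteq> S}. (-1) ^ card K) = (if S = {} then 1 else (0 :: rat))" for S :: "'v set"
proof (cases "S = {}")
  case True
  hence "{K. K \<subseteq> S} = {{}}" by auto
  thus ?thesis using True by simp
next
  case False
  thus ?thesis using sum_alternating_Pow[OF False] by (simp add: Pow_def)
qed

lemma finite_half_open: "x \<in> Lat \<Longrightarrow> c \<in> Lat \<Longrightarrow> finite (half_open x c)"
proof -
  have "half_open x c \<subseteq> fst ` box_cubes x c"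
  proof
    fix y assume "y \<in> half_open x c"
    hence y: "y \<in> Lat" "x \<le> y" "y + ind UNIV \<le> c" unfolding half_open_def by auto
    have "y + ind {} \<le> c" unfolding le_fun_def
    proof
      fix j show "(y + ind {}) j \<le> c j" using le_funD[OF y(3), of j] by (simp add: ind_apply)
    qed
    hence "(y, {}) \<in> box_cubes x c" using y(1,2) by (simp add: box_cubes_def)
    thus "y \<in> fst ` box_cubes x c" by (rule rev_image_eqI) simp
  qed
  thus ?thesis by (rule finite_subset) (simp add: finite_box_cubes)
qed

text \<open>Inclusion-exclusion over the upper faces of a box.\<close>
lemma sum_half_open:
  assumes x: "x \<in> Lat" and c: "c \<in> Lat" and xc: "x \<le> c"
  shows "(\<Sum>y\<in>half_open x c. pcoef y) = (\<Sum>K\<in>UNIV. (-1) ^ card K * euler_sum (box_cubes (clamp K c x) c) w)"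
proof -
  define T where "T = box_cubes x c"
  define t where "t \<sigma> = (-1) ^ (card (snd \<sigma>) + 1) * cube_weight w \<sigma>" for \<sigma> :: "'v cube"
  define top where "top \<sigma> = {j. fst \<sigma> j = c j}" for \<sigma> :: "'v cube"
  have finT: "finite T" unfolding T_def by (rule finite_box_cubes)
  have inT: "y j + ind I j \<le> c j" "x j \<le> y j" "y j \<le> c j" if "(y, I) \<in> T" for y I j
    using box_cubesD[OF that[unfolded T_def]] by (auto simp: le_fun_def)
  have face: "box_cubes (clamp K c x) c = {\<sigma> \<in> T. K \<subseteq> top \<sigma>}" for K
  proof (rule set_eqI)
    fix \<sigma> :: "'v cube"
    obtain y I where \<sigma>: "\<sigma> = (y, I)" by (cases \<sigma>)
    show "\<sigma> \<in> box_cubes (clamp K c x) c \<longleftrightarrow> \<sigma> \<in> {\<sigma> \<in> T. K \<subseteq> top \<sigma>}"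
    proof
      assume "\<sigma> \<in> box_cubes (clamp K c x) c"
      note D = box_cubesD[OF this[unfolded \<sigma>]]
      have yK: "y j = c j" if "j \<in> K" for j
        using le_funD[OF D(2), of j] le_funD[OF D(4), of j] that by (simp add: clamp_def)
      have "x \<le> y" unfolding le_fun_def
      proof
        fix j show "x j \<le> y j" using le_funD[OF D(2), of j] le_funD[OF xc, of j] yK[of j]
          by (cases "j \<in> K") (auto simp: clamp_def)
      qed
      thus "\<sigma> \<in> {\<sigma> \<in> T. K \<subseteq> top \<sigma>}" unfolding \<sigma> T_def top_def box_cubes_def using D(1,3) yK by auto
    next
      assume "\<sigma> \<in> {\<sigma> \<in> T. K \<subseteq> top \<sigma>}"
      hence yT: "(y, I) \<in> T" and yK: "\<And>j. j \<in> K \<Longrightarrow> y j = c j" unfolding \<sigma> top_def by auto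
      have "clamp K c x \<le> y" unfolding le_fun_def clamp_def using yK inT(2)[OF yT] by auto
      thus "\<sigma> \<in> box_cubes (clamp K c x) c" using yT unfolding \<sigma> T_def box_cubes_def by auto
    qed
  qed
  have "(\<Sum>K\<in>UNIV. (-1) ^ card K * euler_sum (box_cubes (clamp K c x) c) w) =
      (\<Sum>K\<in>UNIV. \<Sum>\<sigma>\<in>T. if K \<subseteq> top \<sigma> then (-1) ^ card K * t \<sigma> else 0)"
  proof (rule sum.cong[OF refl])
    fix K :: "'v set"
    have "euler_sum (box_cubes (clamp K c x) c) w = (\<Sum>\<sigma>\<in>{\<sigma> \<in> T. K \<subseteq> top \<sigma>}. t \<sigma>)"
      unfolding euler_sum_def face t_def ..
    also have "\<dots> = (\<Sum>\<sigma>\<in>T. if K \<subseteq> top \<sigma> then t \<sigma> else 0)" by (rule sum.inter_filter[OF finT])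
    finally show "(-1) ^ card K * euler_sum (box_cubes (clamp K c x) c) w =
       (\<Sum>\<sigma>\<in>T. if K \<subseteq> top \<sigma> then (-1) ^ card K * t \<sigma> else 0)"
      by (simp add: sum_distrib_left if_distrib[of "\<lambda>u. _ * u"] cong: if_cong)
  qed
  also have "\<dots> = (\<Sum>\<sigma>\<in>T. \<Sum>K\<in>UNIV. if K \<subseteq> top \<sigma> then (-1) ^ card K * t \<sigma> else 0)" by (rule sum.swap)
  also have "\<dots> = (\<Sum>\<sigma>\<in>T. if top \<sigma> = {} then t \<sigma> else 0)"
  proof (rule sum.cong[OF refl])
    fix \<sigma> :: "'v cube"
    have "(\<Sum>K\<in>UNIV. if K \<subseteq> top \<sigma> then (-1) ^ card K * t \<sigma> else 0) = (\<Sum>K\<in>{K. K \<subseteq> top \<sigma>}. (-1) ^ card K * t \<sigma>)"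
      by (rule sum.mono_neutral_cong_right) auto
    also have "\<dots> = (\<Sum>K\<in>{K. K \<subseteq> top \<sigma>}. (-1) ^ card K) * t \<sigma>" by (rule sum_distrib_right[symmetric])
    finally show "(\<Sum>K\<in>UNIV. if K \<subseteq> top \<sigma> then (-1) ^ card K * t \<sigma> else 0) = (if top \<sigma> = {} then t \<sigma> else 0)"
      unfolding sum_alternating_subsets by simp
  qed
  also have "\<dots> = (\<Sum>\<sigma>\<in>{\<sigma> \<in> T. top \<sigma> = {}}. t \<sigma>)" by (rule sum.inter_filter[symmetric, OF finT])
  also have "{\<sigma> \<in> T. top \<sigma> = {}} = half_open x c \<times> Pow UNIV"
  proof (rule set_eqI)
    fix \<sigma> :: "'v cube"
    obtain y I where \<sigma>: "\<sigma> = (y, I)" by (cases \<sigma>)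
    show "\<sigma> \<in> {\<sigma> \<in> T. top \<sigma> = {}} \<longleftrightarrow> \<sigma> \<in> half_open x c \<times> Pow UNIV"
    proof
      assume "\<sigma> \<in> {\<sigma> \<in> T. top \<sigma> = {}}"
      hence yT: "(y, I) \<in> T" and ne: "\<And>j. y j \<noteq> c j" unfolding \<sigma> top_def by auto
      note D = box_cubesD[OF yT[unfolded T_def]]
      have "y j + 1 \<le> c j" for j
      proof (rule Ints_less_imp_le)
        show "y j < c j" using inT(3)[OF yT, of j] ne[of j] by simp
      qed (use D(1) c in \<open>auto simp: Lat_def\<close>)
      thus "\<sigma> \<in> half_open x c \<times> Pow UNIV"
        unfolding \<sigma> half_open_def using D(1,2) by (auto simp: le_fun_def ind_apply)
    next
      assume "\<sigma> \<in> half_open x c \<times> Pow UNIV"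
      hence y: "y \<in> Lat" "x \<le> y" "y + ind UNIV \<le> c" unfolding \<sigma> half_open_def by auto
      have y1: "y j + 1 \<le> c j" for j using le_funD[OF y(3), of j] by (simp add: ind_apply)
      have ne: "y j \<noteq> c j" for j using y1[of j] by linarith
      have "y + ind I \<le> c" unfolding le_fun_def
      proof
        fix j show "(y + ind I) j \<le> c j" using y1[of j] by (simp add: ind_apply)
      qed
      thus "\<sigma> \<in> {\<sigma> \<in> T. top \<sigma> = {}}" unfolding \<sigma> T_def top_def box_cubes_def using y(1,2) ne by auto
    qed
  qed
  also have "(\<Sum>\<sigma>\<in>half_open x c \<times> Pow UNIV. t \<sigma>) = (\<Sum>y\<in>half_open x c. \<Sum>I\<in>Pow UNIV. t (y, I))"
    using sum.cartesian_product[of "\<lambda>y I. t (y, I)" "Pow UNIV" "half_open x c"] by (simp add: case_prod_beta')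
  also have "\<dots> = (\<Sum>y\<in>half_open x c. pcoef y)"
  proof (rule sum.cong[OF refl])
    fix y assume "y \<in> half_open x c"
    hence "y \<in> Lat" unfolding half_open_def by simp
    thus "(\<Sum>I\<in>Pow UNIV. t (y, I)) = pcoef y" unfolding pcoef_def t_def by (simp only: zeta_coeff_cubes fst_conv snd_conv)
  qed
  finally show ?thesis ..
qed

text \<open>
  The face of the coordinates in \<open>K\<close> at a distant upper end: raising the lower end to the least
  vector satisfying the inequalities off \<open>K\<close> passes every prescribed \<open>x\<close>, by the growth estimate.
\<close>
lemma upper_face_independent:
  obtains C :: rat where "C \<ge> 1"
    "\<And>c x K R. deep c \<Longrightarrow> x \<in> Lat \<Longrightarrow> 0 \<le> x \<Longrightarrow> (\<And>j. x j + l' j \<le> R) \<Longrightarrow> (\<And>j. C * R \<le> c j + l' j) \<Longrightarrow> K \<noteq> {} \<Longrightarrow>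
       euler_sum (box_cubes (clamp K c x) c) w = euler_sum (box_cubes (clamp K c 0) c) w"
proof -
  obtain C :: rat where C: "C \<ge> 1"
    "\<And>K z t k j. 0 \<le> z \<Longrightarrow> (\<And>i. i \<in> K \<Longrightarrow> t \<le> z i) \<Longrightarrow> (\<And>i. i \<notin> K \<Longrightarrow> form G z (basis i) \<le> 0)
       \<Longrightarrow> t \<le> z k \<Longrightarrow> t \<le> C * z j" using growth_constant by blast
  show ?thesis
  proof (rule that[OF C(1)])
    fix c x :: "'v qvec" and K :: "'v set" and R :: rat
    assume c: "deep c" and x: "x \<in> Lat" "0 \<le> x" and R: "\<And>j. x j + l' j \<le> R" "\<And>j. C * R \<le> c j + l' j" and K: "K \<noteq> {}"
    obtain k where k: "k \<in> K" using K by blast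
    have cL: "c \<in> Lat" by (rule deepD(1)[OF c])
    have c0: "0 \<le> c j" for j using le_funD[OF deep_nonneg[OF c], of j] by simp
    have l0: "0 \<le> l' j" for j using le_funD[OF ldist_nonneg, of j] by simp
    define X where "X = {y \<in> Lat. (\<forall>j\<in>K. y j = c j) \<and> (\<forall>j. j \<notin> K \<longrightarrow> form G (y + l') (basis j) \<le> 0)}"
    have Xnn: "0 \<le> y + l'" if "y \<in> X" for y
      by (rule nonneg_if_antinef[of K]) (use that c0 l0 in \<open>auto simp: X_def\<close>)
    have cX: "c \<in> X" unfolding X_def using cL deep_form[OF c] ldist_form_nonpos
      by (auto simp: form_add_left intro: add_nonpos_nonpos)
    obtain s where s: "s \<in> X" "\<And>y. y \<in> X \<Longrightarrow> s \<le> y"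
    proof (rule least_lattice_point[of X "- l'"])
      show "X \<subseteq> Lat" unfolding X_def by blast
      show "X \<noteq> {}" using cX by blast
      show "- l' \<le> y" if "y \<in> X" for y unfolding le_fun_def
      proof
        fix j show "(- l') j \<le> y j" using le_funD[OF Xnn[OF that], of j] by simp
      qed
      fix y z assume y: "y \<in> X" and z: "z \<in> X"
      show "(\<lambda>j. min (y j) (z j)) \<in> X" unfolding X_def mem_Collect_eq
      proof (intro conjI ballI allI impI)
        show "(\<lambda>j. min (y j) (z j)) \<in> Lat" using y z unfolding X_def Lat_def by (auto simp: min_def)
        show "min (y j) (z j) = c j" if "j \<in> K" for j using y z that unfolding X_def by auto
        fix j assume j: "j \<notin> K"
        show "form G ((\<lambda>j. min (y j) (z j)) + l') (basis j) \<le> 0"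
        proof (cases "y j \<le> z j")
          case True
          have "form G ((\<lambda>j. min (y j) (z j)) + l') (basis j) \<le> form G (y + l') (basis j)"
            by (rule form_basis_mono) (use True in auto)
          also have "\<dots> \<le> 0" using y j unfolding X_def by blast
          finally show ?thesis .
        next
          case False
          have "form G ((\<lambda>j. min (y j) (z j)) + l') (basis j) \<le> form G (z + l') (basis j)"
            by (rule form_basis_mono) (use False in auto)
          also have "\<dots> \<le> 0" using z j unfolding X_def by blast
          finally show ?thesis .
        qed
      qed
    qed (use that in blast)
    have sL: "s \<in> Lat" and sK: "\<And>j. j \<in> K \<Longrightarrow> s j = c j" and sf: "\<And>j. j \<notin> K \<Longrightarrow> form G (s + l') (basis j) \<le> 0"
      using s(1) unfolding X_def by auto
    have xs: "x \<le> s" unfolding le_fun_def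
    proof
      fix j
      have "C * R \<le> C * (s + l') j"
      proof (rule C(2)[of "s + l'" K _ k])
        show "0 \<le> s + l'" by (rule Xnn[OF s(1)])
        show "C * R \<le> (s + l') i" if "i \<in> K" for i using R(2)[of i] sK[OF that] by simp
        show "form G (s + l') (basis i) \<le> 0" if "i \<notin> K" for i by (rule sf[OF that])
        show "C * R \<le> (s + l') k" using R(2)[of k] sK[OF k] by simp
      qed
      hence "R \<le> (s + l') j" using C(1) by simp
      thus "x j \<le> s j" using R(1)[of j] by simp
    qed
    have raise: "euler_sum (box_cubes (clamp K c u) c) w = euler_sum (box_cubes s c) w" if u: "u \<in> Lat" "u \<le> s" for u
    proof (rule euler_sum_raise_bottom[OF sL s(2)[OF cX] sf])
      show "clamp K c u \<in> Lat" using u(1) cL by (auto simp: clamp_def Lat_def)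
      show "clamp K c u \<le> s" using le_funD[OF u(2)] sK by (auto simp: clamp_def le_fun_def)
      show "clamp K c u j = s j" if "j \<in> K" for j using sK[OF that] that by (simp add: clamp_def)
      fix y assume y: "y \<in> Lat" "\<And>j. j \<in> K \<Longrightarrow> y j = s j" "\<And>j. j \<notin> K \<Longrightarrow> form G (y + l') (basis j) \<le> 0"
      have "y \<in> X" unfolding X_def mem_Collect_eq
      proof (intro conjI ballI allI impI)
        show "y \<in> Lat" by (rule y(1))
        show "y j = c j" if "j \<in> K" for j using y(2)[OF that] sK[OF that] by simp
        show "form G (y + l') (basis j) \<le> 0" if "j \<notin> K" for j by (rule y(3)[OF that])
      qed
      thus "s \<le> y" by (rule s(2))
    qed
    have "0 \<le> s" using x(2) xs by (rule order_trans)
    show "euler_sum (box_cubes (clamp K c x) c) w = euler_sum (box_cubes (clamp K c 0) c) w"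
      unfolding raise[OF x(1) xs] raise[OF Lat_zero \<open>0 \<le> s\<close>] ..
  qed
qed

lemma pcoef_support: "y \<in> Lat \<Longrightarrow> pcoef y \<noteq> 0 \<Longrightarrow> 0 \<le> y"
  unfolding pcoef_def by (rule ldist_minimal) (auto intro: zeta_coeff_support)

definition partial_support :: "'v qvec \<Rightarrow> 'v qvec set" where
  "partial_support i = {y \<in> Lat. pcoef y \<noteq> 0 \<and> \<not> i \<le> proj B y}"

lemma le_proj_iff: "i \<in> quadrant B \<Longrightarrow> 0 \<le> y \<Longrightarrow> i \<le> proj B y \<longleftrightarrow> i \<le> y"
proof -
  assume i: "i \<in> quadrant B" and y: "0 \<le> y"
  show "i \<le> proj B y \<longleftrightarrow> i \<le> y" unfolding le_fun_def
  proof (intro iffI allI)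
    fix j assume "\<forall>j. i j \<le> proj B y j"
    hence "i j \<le> proj B y j" by (rule spec)
    thus "i j \<le> y j" using le_funD[OF y, of j] by (simp add: proj_apply split: if_splits)
  next
    fix j assume "\<forall>j. i j \<le> y j"
    hence "i j \<le> y j" by (rule spec)
    thus "i j \<le> proj B y j" using quadrantD(4)[OF i, of j] by (simp add: proj_apply)
  qed
qed

lemma quadrant_bound:
  assumes "i \<in> quadrant B"
  obtains m :: nat where "\<And>j. i j + l' j \<le> of_nat m"
  using finite_max_nat[of "\<lambda>j. i j + l' j"] by blast

text \<open>A point that is not above \<open>i\<close> is small in one coordinate, and the growth estimate bounds the others.\<close>
lemma partial_support_bounded:
  assumes i: "i \<in> quadrant B"
  obtains R where "\<And>y j. y \<in> partial_support i \<Longrightarrow> y j \<le> R"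
proof -
  obtain C :: rat where C: "C \<ge> 1"
    "\<And>K z t k j. 0 \<le> z \<Longrightarrow> (\<And>i. i \<in> K \<Longrightarrow> t \<le> z i) \<Longrightarrow> (\<And>i. i \<notin> K \<Longrightarrow> form G z (basis i) \<le> 0)
       \<Longrightarrow> t \<le> z k \<Longrightarrow> t \<le> C * z j" using growth_constant by blast
  obtain m :: nat where m: "\<And>j. i j + l' j \<le> of_nat m" using quadrant_bound[OF i] by blast
  show ?thesis
  proof (rule that)
    fix y k assume "y \<in> partial_support i"
    hence y: "y \<in> Lat" "pcoef y \<noteq> 0" "\<not> i \<le> proj B y" unfolding partial_support_def by auto
    have y0: "0 \<le> y" by (rule pcoef_support[OF y(1,2)])
    obtain j where j: "y j < i j" using y(3) unfolding le_proj_iff[OF i y0] by (auto simp: le_fun_def not_le)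
    have l0: "0 \<le> l' a" for a using le_funD[OF ldist_nonneg, of a] by simp
    have nn: "0 \<le> y + l'" unfolding le_fun_def
    proof
      fix a show "0 a \<le> (y + l') a" using le_funD[OF y0, of a] l0[of a] by simp
    qed
    have "(y + l') k \<le> C * (y + l') j"
    proof (rule C(2)[of "y + l'" "{}" _ k, OF nn])
      show "form G (y + l') (basis a) \<le> 0" for a using y(2) unfolding pcoef_def by (rule zeta_coeff_support)
    qed auto
    also have "\<dots> \<le> C * of_nat m"
    proof (rule mult_left_mono)
      show "(y + l') j \<le> of_nat m" using j m[of j] by simp
    qed (use C(1) in simp)
    finally show "y k \<le> C * of_nat m" using l0[of k] by simp
  qed
qed

lemma finite_partial_support:
  assumes i: "i \<in> quadrant B"
  shows "finite (partial_support i)"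
proof -
  obtain R where R: "\<And>y j. y \<in> partial_support i \<Longrightarrow> y j \<le> R" using partial_support_bounded[OF i] by blast
  obtain n :: nat where n: "R + 1 \<le> of_nat n" using real_arch_simple by blast
  have "partial_support i \<subseteq> half_open 0 (\<lambda>j. of_nat n)"
  proof
    fix y assume y: "y \<in> partial_support i"
    have "0 \<le> y" "y \<in> Lat" using y pcoef_support unfolding partial_support_def by auto
    moreover have "y + ind UNIV \<le> (\<lambda>j. of_nat n)" unfolding le_fun_def
    proof
      fix j show "(y + ind UNIV) j \<le> of_nat n" using R[OF y, of j] n by (simp add: ind_apply)
    qed
    ultimately show "y \<in> half_open 0 (\<lambda>j. of_nat n)" unfolding half_open_def by simp
  qed
  moreover have "finite (half_open 0 (\<lambda>j. of_nat n))" by (rule finite_half_open) (auto simp: Lat_def)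
  ultimately show ?thesis by (rule finite_subset)
qed

text \<open>Inclusion-exclusion over upper faces at the lower corners \<open>0\<close> and \<open>i\<close>: all proper faces cancel.\<close>
lemma sum_partial_support:
  assumes i: "i \<in> quadrant B"
  obtains R where "\<And>c. deep c \<Longrightarrow> (\<And>j. R \<le> c j) \<Longrightarrow> i \<le> proj B c \<and>
     (\<Sum>y\<in>partial_support i. pcoef y) = of_int (eu_graph G k) - euler_sum (box_cubes i (proj B c)) wb"
proof -
  obtain C :: rat where C: "C \<ge> 1"
    "\<And>c x K R. deep c \<Longrightarrow> x \<in> Lat \<Longrightarrow> 0 \<le> x \<Longrightarrow> (\<And>j. x j + l' j \<le> R) \<Longrightarrow> (\<And>j. C * R \<le> c j + l' j) \<Longrightarrow> K \<noteq> {} \<Longrightarrow>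
       euler_sum (box_cubes (clamp K c x) c) w = euler_sum (box_cubes (clamp K c 0) c) w"
    using upper_face_independent by blast
  obtain m :: nat where m: "\<And>j. i j + l' j \<le> of_nat m" using quadrant_bound[OF i] by blast
  obtain R where R: "\<And>y j. y \<in> partial_support i \<Longrightarrow> y j \<le> R" using partial_support_bounded[OF i] by blast
  note q = quadrantD[OF i]
  have l0: "0 \<le> l' a" for a using le_funD[OF ldist_nonneg, of a] by simp
  show ?thesis
  proof (rule that[of "C * of_nat m + \<bar>R\<bar> + 1"])
    fix c assume c: "deep c" and cR: "\<And>j. C * of_nat m + \<bar>R\<bar> + 1 \<le> c j"
    have Cm: "of_nat m \<le> C * of_nat m" using mult_right_mono[OF C(1), of "of_nat m"] by simp
    have c1: "C * of_nat m \<le> c j + l' j" "of_nat m \<le> c j" "R + 1 \<le> c j" for j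
      using cR[of j] l0[of j] Cm abs_ge_self[of R] abs_ge_zero[of R] by linarith+
    have cL: "c \<in> Lat" by (rule deepD(1)[OF c])
    have ic: "i \<le> c" unfolding le_fun_def
    proof
      fix j show "i j \<le> c j" using m[of j] l0[of j] c1(2)[of j] by linarith
    qed
    have ipc: "i \<le> proj B c" using le_proj_iff[OF i deep_nonneg[OF c]] ic by blast
    have "(\<Sum>y\<in>partial_support i. pcoef y) = (\<Sum>y\<in>half_open 0 c - half_open i c. pcoef y)"
    proof (rule sum.mono_neutral_left)
      show "finite (half_open 0 c - half_open i c)" using finite_half_open[OF Lat_zero cL] by simp
      show "partial_support i \<subseteq> half_open 0 c - half_open i c"
      proof
        fix y assume yS: "y \<in> partial_support i"
        hence y: "y \<in> Lat" "pcoef y \<noteq> 0" "\<not> i \<le> proj B y" unfolding partial_support_def by auto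
        have y0: "0 \<le> y" by (rule pcoef_support[OF y(1,2)])
        have "y + ind UNIV \<le> c" unfolding le_fun_def
        proof
          fix j show "(y + ind UNIV) j \<le> c j" using R[OF yS, of j] c1(3)[of j] by (simp add: ind_apply)
        qed
        thus "y \<in> half_open 0 c - half_open i c" using y y0 le_proj_iff[OF i y0] unfolding half_open_def by simp
      qed
      show "\<forall>y\<in>half_open 0 c - half_open i c - partial_support i. pcoef y = 0"
        using le_proj_iff[OF i] unfolding half_open_def partial_support_def by auto
    qed
    also have "\<dots> = (\<Sum>y\<in>half_open 0 c. pcoef y) - (\<Sum>y\<in>half_open i c. pcoef y)"
    proof (rule sum_diff)
      show "finite (half_open 0 c)" by (rule finite_half_open[OF Lat_zero cL])
      show "half_open i c \<subseteq> half_open 0 c" unfolding half_open_def using order_trans[OF q(2)] by auto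
    qed
    also have "\<dots> = (\<Sum>K\<in>UNIV. (-1) ^ card K * euler_sum (box_cubes (clamp K c 0) c) w) -
        (\<Sum>K\<in>UNIV. (-1) ^ card K * euler_sum (box_cubes (clamp K c i) c) w)"
      unfolding sum_half_open[OF Lat_zero cL deep_nonneg[OF c]] sum_half_open[OF q(1) cL ic] ..
    also have "\<dots> = (\<Sum>K\<in>UNIV. (-1) ^ card K * euler_sum (box_cubes (clamp K c 0) c) w -
        (-1) ^ card K * euler_sum (box_cubes (clamp K c i) c) w)" by (rule sum_subtractf[symmetric])
    also have "\<dots> = (\<Sum>K\<in>{{}}. (-1) ^ card K * euler_sum (box_cubes (clamp K c 0) c) w -
        (-1) ^ card K * euler_sum (box_cubes (clamp K c i) c) w)"
    proof (rule sum.mono_neutral_right)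
      show "\<forall>K\<in>UNIV - {{}}. (-1) ^ card K * euler_sum (box_cubes (clamp K c 0) c) w -
        (-1) ^ card K * euler_sum (box_cubes (clamp K c i) c) w = 0"
        using C(2)[OF c q(1,2) m c1(1)] by simp
    qed auto
    also have "\<dots> = euler_sum (box_cubes 0 c) w - euler_sum (box_cubes i c) w"
    proof -
      have "clamp {} c u = u" for u by (simp add: clamp_def)
      thus ?thesis by simp
    qed
    also have "\<dots> = of_int (eu_graph G k) - euler_sum (box_cubes i (proj B c)) wb"
      unfolding eu_graph_eq[OF c] euler_sum_box_eq[OF i c ipc] ..
    finally show "i \<le> proj B c \<and>
      (\<Sum>y\<in>partial_support i. pcoef y) = of_int (eu_graph G k) - euler_sum (box_cubes i (proj B c)) wb"
      using ipc by blast
  qed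
qed

definition pbar :: "'v qvec \<Rightarrow> rat" where "pbar i = Zbar_coeff G B l' (i + proj B l')"

lemma pbar_eq_fibre_sum: "pbar i = (\<Sum>y\<in>{y \<in> Lat. proj B y = i \<and> pcoef y \<noteq> 0}. pcoef y)"
proof -
  have "{z \<in> dualLat G. z - l' \<in> Lat \<and> proj B z = i + proj B l' \<and> zeta_coeff G z \<noteq> 0} =
      (\<lambda>y. y + l') ` {y \<in> Lat. proj B y = i \<and> pcoef y \<noteq> 0}"
  proof (intro set_eqI iffI)
    fix z assume z: "z \<in> {z \<in> dualLat G. z - l' \<in> Lat \<and> proj B z = i + proj B l' \<and> zeta_coeff G z \<noteq> 0}"
    have e: "(z - l') + l' = z" by simp
    hence "proj B (z - l') + proj B l' = i + proj B l'" using z unfolding proj_add[symmetric] by simp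
    hence "proj B (z - l') = i" by simp
    hence "z - l' \<in> {y \<in> Lat. proj B y = i \<and> pcoef y \<noteq> 0}" using z unfolding pcoef_def by simp
    thus "z \<in> (\<lambda>y. y + l') ` {y \<in> Lat. proj B y = i \<and> pcoef y \<noteq> 0}" by (rule rev_image_eqI) simp
  next
    fix z assume "z \<in> (\<lambda>y. y + l') ` {y \<in> Lat. proj B y = i \<and> pcoef y \<noteq> 0}"
    then obtain y where y: "z = y + l'" "y \<in> Lat" "proj B y = i" "pcoef y \<noteq> 0" by blast
    have "z \<in> dualLat G" unfolding y(1) using y(2) Lat_dualLat ldist_dualLat by (intro dualLat_add) auto
    thus "z \<in> {z \<in> dualLat G. z - l' \<in> Lat \<and> proj B z = i + proj B l' \<and> zeta_coeff G z \<noteq> 0}"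
      using y unfolding pcoef_def by (simp add: proj_add)
  qed
  moreover have "inj_on (\<lambda>y. y + l') S" for S by (simp add: inj_on_def)
  ultimately show ?thesis unfolding pbar_def Zbar_coeff_def by (simp add: sum.reindex pcoef_def)
qed

text \<open>The sets \<open>J\<close> that occur are the subsets of the set of coordinates in which \<open>t\<close> exceeds \<open>i\<close>.\<close>
lemma sum_alternating_lower:
  assumes i: "i \<in> quadrant B" and t: "t \<in> Lat" "proj B t = t"
  shows "(\<Sum>J\<in>Pow B. (-1) ^ card J * of_bool (i + ind J \<le> t)) = (of_bool (t = i) :: rat)"
proof (cases "i \<le> t")
  case True
  note q = quadrantD[OF i]
  define S where "S = {j. i j + 1 \<le> t j}"
  have t0: "t j = 0" if "j \<notin> B" for j using t(2) that unfolding proj_eq_iff by blast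
  have SB: "S \<subseteq> B" unfolding S_def using t0 q(4) by fastforce
  have eq: "i + ind J \<le> t \<longleftrightarrow> J \<subseteq> S" for J
  proof
    assume le: "i + ind J \<le> t"
    show "J \<subseteq> S"
    proof
      fix j assume "j \<in> J" thus "j \<in> S" using le_funD[OF le, of j] by (simp add: S_def ind_apply)
    qed
  next
    assume "J \<subseteq> S"
    show "i + ind J \<le> t" unfolding le_fun_def
    proof
      fix j show "(i + ind J) j \<le> t j" using \<open>J \<subseteq> S\<close> le_funD[OF True, of j] by (auto simp: S_def ind_apply)
    qed
  qed
  have "(\<Sum>J\<in>Pow B. (-1) ^ card J * of_bool (i + ind J \<le> t)) = (\<Sum>J\<in>{J. J \<subseteq> S}. (-1 :: rat) ^ card J)"
    unfolding eq by (rule sum.mono_neutral_cong_right) (use SB in auto)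
  moreover have "S = {} \<longleftrightarrow> t = i"
  proof
    assume "S = {}"
    have "i j = t j" for j
    proof (rule ccontr)
      assume "i j \<noteq> t j"
      hence "i j < t j" using le_funD[OF True, of j] by simp
      hence "i j + 1 \<le> t j" by (intro Ints_less_imp_le) (use q(1) t(1) in \<open>auto simp: Lat_def\<close>)
      thus False using \<open>S = {}\<close> unfolding S_def by blast
    qed
    thus "t = i" by (simp add: fun_eq_iff)
  qed (auto simp: S_def)
  ultimately show ?thesis unfolding sum_alternating_subsets by simp
next
  case False
  have "\<not> i + ind J \<le> t" for J
  proof
    assume le: "i + ind J \<le> t"
    have "i \<le> t" unfolding le_fun_def
    proof
      fix j show "i j \<le> t j" using le_funD[OF le, of j] ind_nonneg[of J] by (auto simp: ind_apply split: if_splits)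
    qed
    thus False using False by blast
  qed
  moreover have "t \<noteq> i" using False by blast
  ultimately show ?thesis by simp
qed

lemma quadrant_add_ind: "i \<in> quadrant B \<Longrightarrow> J \<subseteq> B \<Longrightarrow> i + ind J \<in> quadrant B"
  unfolding quadrant_def by (auto simp: le_fun_def ind_apply intro: add_nonneg_nonneg)

text \<open>Only the cubes whose lowest vertex is exactly \<open>i\<close> survive the inclusion-exclusion.\<close>
lemma alternating_euler_sum_corner:
  assumes i: "i \<in> quadrant B" and C: "i + ind B \<le> proj B c"
  shows "(\<Sum>J\<in>Pow B. (-1) ^ card J * euler_sum (box_cubes (i + ind J) (proj B c)) wb) =
    (\<Sum>I\<in>Pow B. (-1) ^ (card I + 1) * cube_weight wb (i, I))"
proof -
  note q = quadrantD[OF i]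
  define T where "T = box_cubes i (proj B c)"
  define t where "t \<sigma> = (-1) ^ (card (snd \<sigma>) + 1) * cube_weight wb \<sigma>" for \<sigma> :: "'v cube"
  have finT: "finite T" unfolding T_def by (rule finite_box_cubes)
  have TD: "y \<in> Lat" "i \<le> y" "y + ind I \<le> proj B c" "proj B y = y" "I \<subseteq> B" if "(y, I) \<in> T" for y I
  proof -
    note D = box_cubesD[OF that[unfolded T_def]]
    show "y \<in> Lat" "i \<le> y" "y + ind I \<le> proj B c" by (rule D)+
    have o: "y j = 0 \<and> j \<notin> I" if "j \<notin> B" for j
      using le_funD[OF D(2), of j] le_funD[OF D(3), of j] q(4)[OF that] that
      by (auto simp: proj_apply ind_apply split: if_splits)
    show "proj B y = y" unfolding proj_eq_iff using o by auto
    show "I \<subseteq> B" using o by auto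
  qed
  have sub: "box_cubes (i + ind J) (proj B c) = {\<sigma> \<in> T. i + ind J \<le> fst \<sigma>}" for J
  proof -
    have "i \<le> y" if "i + ind J \<le> y" for y unfolding le_fun_def
    proof
      fix j show "i j \<le> y j" using le_funD[OF that, of j] by (auto simp: ind_apply split: if_splits)
    qed
    thus ?thesis unfolding T_def box_cubes_def by auto
  qed
  have "(\<Sum>J\<in>Pow B. (-1) ^ card J * euler_sum (box_cubes (i + ind J) (proj B c)) wb) =
      (\<Sum>J\<in>Pow B. \<Sum>\<sigma>\<in>T. (-1) ^ card J * of_bool (i + ind J \<le> fst \<sigma>) * t \<sigma>)"
  proof (rule sum.cong[OF refl])
    fix J
    have "euler_sum (box_cubes (i + ind J) (proj B c)) wb = (\<Sum>\<sigma>\<in>{\<sigma> \<in> T. i + ind J \<le> fst \<sigma>}. t \<sigma>)"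
      unfolding euler_sum_def sub t_def ..
    also have "\<dots> = (\<Sum>\<sigma>\<in>T. if i + ind J \<le> fst \<sigma> then t \<sigma> else 0)" by (rule sum.inter_filter[OF finT])
    also have "\<dots> = (\<Sum>\<sigma>\<in>T. of_bool (i + ind J \<le> fst \<sigma>) * t \<sigma>)" by (rule sum.cong) auto
    finally have e: "euler_sum (box_cubes (i + ind J) (proj B c)) wb = (\<Sum>\<sigma>\<in>T. of_bool (i + ind J \<le> fst \<sigma>) * t \<sigma>)" .
    show "(-1) ^ card J * euler_sum (box_cubes (i + ind J) (proj B c)) wb =
       (\<Sum>\<sigma>\<in>T. (-1) ^ card J * of_bool (i + ind J \<le> fst \<sigma>) * t \<sigma>)"
      unfolding e sum_distrib_left mult.assoc ..
  qed
  also have "\<dots> = (\<Sum>\<sigma>\<in>T. \<Sum>J\<in>Pow B. (-1) ^ card J * of_bool (i + ind J \<le> fst \<sigma>) * t \<sigma>)" by (rule sum.swap)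
  also have "\<dots> = (\<Sum>\<sigma>\<in>T. if fst \<sigma> = i then t \<sigma> else 0)"
  proof (rule sum.cong[OF refl])
    fix \<sigma> assume "\<sigma> \<in> T"
    then obtain y I where \<sigma>: "\<sigma> = (y, I)" "(y, I) \<in> T" by (cases \<sigma>) auto
    show "(\<Sum>J\<in>Pow B. (-1) ^ card J * of_bool (i + ind J \<le> fst \<sigma>) * t \<sigma>) = (if fst \<sigma> = i then t \<sigma> else 0)"
      unfolding sum_distrib_right[symmetric] \<sigma>(1) fst_conv
      unfolding sum_alternating_lower[OF i TD(1)[OF \<sigma>(2)] TD(4)[OF \<sigma>(2)]] by simp
  qed
  also have "\<dots> = (\<Sum>\<sigma>\<in>{\<sigma> \<in> T. fst \<sigma> = i}. t \<sigma>)" by (rule sum.inter_filter[symmetric, OF finT])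
  also have "{\<sigma> \<in> T. fst \<sigma> = i} = Pair i ` Pow B"
  proof (intro set_eqI iffI)
    fix \<sigma> assume "\<sigma> \<in> {\<sigma> \<in> T. fst \<sigma> = i}"
    then obtain I where \<sigma>: "\<sigma> = (i, I)" "(i, I) \<in> T" by (cases \<sigma>) auto
    thus "\<sigma> \<in> Pair i ` Pow B" using TD(5)[OF \<sigma>(2)] by blast
  next
    fix \<sigma> assume "\<sigma> \<in> Pair i ` Pow B"
    then obtain I where \<sigma>: "\<sigma> = (i, I)" "I \<subseteq> B" by blast
    have "i + ind I \<le> proj B c" unfolding le_fun_def
    proof
      fix j show "(i + ind I) j \<le> proj B c j" using \<sigma>(2) le_funD[OF C, of j] by (auto simp: ind_apply split: if_splits)
    qed
    thus "\<sigma> \<in> {\<sigma> \<in> T. fst \<sigma> = i}" unfolding \<sigma>(1) T_def box_cubes_def using q(1) by simp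
  qed
  also have "(\<Sum>\<sigma>\<in>Pair i ` Pow B. t \<sigma>) = (\<Sum>I\<in>Pow B. t (i, I))"
    by (subst sum.reindex) (auto simp: inj_on_def)
  finally show ?thesis unfolding t_def fst_conv snd_conv .
qed

lemma sum_partial_support_mask:
  assumes i: "i \<in> quadrant B" "J \<subseteq> B"
  shows "(\<Sum>y\<in>partial_support (i + ind J). pcoef y) =
    (\<Sum>y\<in>partial_support (i + ind B). pcoef y - of_bool (i + ind J \<le> proj B y) * pcoef y)"
proof -
  have fin: "finite (partial_support (i + ind B))"
    by (rule finite_partial_support[OF quadrant_add_ind[OF i(1) order_refl]])
  have "i + ind J \<le> i + ind B" using i(2) by (auto simp: le_fun_def ind_apply)
  hence "partial_support (i + ind J) = {y \<in> partial_support (i + ind B). \<not> i + ind J \<le> proj B y}"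
    unfolding partial_support_def using order_trans by blast
  hence "(\<Sum>y\<in>partial_support (i + ind J). pcoef y) = (\<Sum>y\<in>partial_support (i + ind B). if \<not> i + ind J \<le> proj B y then pcoef y else 0)"
    using sum.inter_filter[OF fin] by simp
  also have "\<dots> = (\<Sum>y\<in>partial_support (i + ind B). pcoef y - of_bool (i + ind J \<le> proj B y) * pcoef y)"
    by (rule sum.cong) auto
  finally show ?thesis .
qed

text \<open>The constant \<open>eu\<close> cancels because \<open>B\<close> is nonempty, and what remains is the contribution of the corner \<open>i\<close>.\<close>
lemma pbar_eq:
  assumes i: "i \<in> quadrant B" and B: "B \<noteq> {}"
  shows "pbar i = (\<Sum>I\<in>Pow B. (-1) ^ (card I + 1) * cube_weight wb (i, I))"
proof -
  define S where "S = partial_support (i + ind B)"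
  have finS: "finite S" unfolding S_def by (rule finite_partial_support[OF quadrant_add_ind[OF i order_refl]])
  have "\<forall>J. \<exists>R. J \<subseteq> B \<longrightarrow> (\<forall>c. deep c \<longrightarrow> (\<forall>j. R \<le> c j) \<longrightarrow> i + ind J \<le> proj B c \<and>
     (\<Sum>y\<in>partial_support (i + ind J). pcoef y) = of_int (eu_graph G k) - euler_sum (box_cubes (i + ind J) (proj B c)) wb)"
  proof
    fix J
    show "\<exists>R. J \<subseteq> B \<longrightarrow> (\<forall>c. deep c \<longrightarrow> (\<forall>j. R \<le> c j) \<longrightarrow> i + ind J \<le> proj B c \<and>
     (\<Sum>y\<in>partial_support (i + ind J). pcoef y) = of_int (eu_graph G k) - euler_sum (box_cubes (i + ind J) (proj B c)) wb)"
    proof (cases "J \<subseteq> B")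
      case True
      show ?thesis using sum_partial_support[OF quadrant_add_ind[OF i True]] by blast
    qed blast
  qed
  from choice[OF this] obtain R :: "'v set \<Rightarrow> rat" where R: "\<And>J c. J \<subseteq> B \<Longrightarrow> deep c \<Longrightarrow> (\<forall>j. R J \<le> c j) \<Longrightarrow>
     i + ind J \<le> proj B c \<and> (\<Sum>y\<in>partial_support (i + ind J). pcoef y) =
       of_int (eu_graph G k) - euler_sum (box_cubes (i + ind J) (proj B c)) wb" by blast
  obtain n :: nat where n: "(\<Sum>J\<in>Pow B. \<bar>R J\<bar>) \<le> of_nat n" using real_arch_simple by blast
  obtain M where M: "\<And>n. n \<ge> M \<Longrightarrow> deep (\<lambda>j. of_nat n * dv j)" using deep_exists by metis
  define c where "c = (\<lambda>j. of_nat (M + n) * dv j)"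
  have c: "deep c" unfolding c_def by (rule M) simp
  have RB: "\<forall>j. R J \<le> c j" if "J \<subseteq> B" for J
  proof
    fix j
    have "R J \<le> \<bar>R J\<bar>" by (rule abs_ge_self)
    also have "\<dots> \<le> (\<Sum>J\<in>Pow B. \<bar>R J\<bar>)" by (rule member_le_sum) (use that in auto)
    also have "\<dots> \<le> of_nat (M + n) * 1" using n by simp
    also have "\<dots> \<le> c j" unfolding c_def using dv(2)[of j] by (intro mult_left_mono) auto
    finally show "R J \<le> c j" .
  qed
  have RQ: "(\<Sum>y\<in>partial_support (i + ind J). pcoef y) =
       of_int (eu_graph G k) - euler_sum (box_cubes (i + ind J) (proj B c)) wb" if "J \<subseteq> B" for J
    using R[OF that c RB[OF that]] by blast
  have top: "i + ind B \<le> proj B c" using R[OF order_refl c RB[OF order_refl]] by blast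
  have "pbar i = (\<Sum>y\<in>S. of_bool (proj B y = i) * pcoef y)"
    unfolding pbar_eq_fibre_sum
  proof (rule sum.mono_neutral_cong_left[OF finS])
    show "{y \<in> Lat. proj B y = i \<and> pcoef y \<noteq> 0} \<subseteq> S"
    proof
      fix y assume y: "y \<in> {y \<in> Lat. proj B y = i \<and> pcoef y \<noteq> 0}"
      obtain j where j: "j \<in> B" using B by blast
      have "\<not> i + ind B \<le> i"
      proof
        assume "i + ind B \<le> i"
        from le_funD[OF this, of j] j show False by (simp add: ind_apply)
      qed
      thus "y \<in> S" unfolding S_def partial_support_def using y by simp
    qed
    show "\<forall>y\<in>S - {y \<in> Lat. proj B y = i \<and> pcoef y \<noteq> 0}. of_bool (proj B y = i) * pcoef y = 0"
      unfolding S_def partial_support_def by auto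
  qed auto
  also have "\<dots> = (\<Sum>y\<in>S. \<Sum>J\<in>Pow B. (-1) ^ card J * (of_bool (i + ind J \<le> proj B y) * pcoef y))"
  proof (rule sum.cong[OF refl])
    fix y assume "y \<in> S"
    hence "y \<in> Lat" unfolding S_def partial_support_def by simp
    hence p: "proj B y \<in> Lat" "proj B (proj B y) = proj B y" by (simp, simp add: proj_def fun_eq_iff)
    show "of_bool (proj B y = i) * pcoef y = (\<Sum>J\<in>Pow B. (-1) ^ card J * (of_bool (i + ind J \<le> proj B y) * pcoef y))"
      unfolding sum_alternating_lower[OF i p, symmetric] sum_distrib_right mult.assoc ..
  qed
  also have "\<dots> = (\<Sum>J\<in>Pow B. \<Sum>y\<in>S. (-1) ^ card J * (of_bool (i + ind J \<le> proj B y) * pcoef y))" by (rule sum.swap)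
  also have "\<dots> = (\<Sum>J\<in>Pow B. (-1) ^ card J * ((\<Sum>y\<in>S. pcoef y) - of_int (eu_graph G k)) +
      (-1) ^ card J * euler_sum (box_cubes (i + ind J) (proj B c)) wb)"
  proof (rule sum.cong[OF refl])
    fix J assume J: "J \<in> Pow B"
    have "(\<Sum>y\<in>S. of_bool (i + ind J \<le> proj B y) * pcoef y) =
        (\<Sum>y\<in>S. pcoef y) - (\<Sum>y\<in>partial_support (i + ind J). pcoef y)"
      unfolding sum_partial_support_mask[OF i PowD[OF J]] S_def[symmetric] sum_subtractf by simp
    also have "\<dots> = ((\<Sum>y\<in>S. pcoef y) - of_int (eu_graph G k)) + euler_sum (box_cubes (i + ind J) (proj B c)) wb"
      unfolding RQ[OF PowD[OF J]] by simp
    finally show "(\<Sum>y\<in>S. (-1) ^ card J * (of_bool (i + ind J \<le> proj B y) * pcoef y)) =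
      (-1) ^ card J * ((\<Sum>y\<in>S. pcoef y) - of_int (eu_graph G k)) +
      (-1) ^ card J * euler_sum (box_cubes (i + ind J) (proj B c)) wb"
      unfolding sum_distrib_left[symmetric] by (simp only: distrib_left)
  qed
  also have "\<dots> = (\<Sum>J\<in>Pow B. (-1) ^ card J * euler_sum (box_cubes (i + ind J) (proj B c)) wb)"
    unfolding sum.distrib sum_distrib_right[symmetric] sum_alternating_Pow[OF B] by simp
  also have "\<dots> = (\<Sum>I\<in>Pow B. (-1) ^ (card I + 1) * cube_weight wb (i, I))"
    by (rule alternating_euler_sum_corner[OF i top])
  finally show ?thesis .
qed

lemma Zbar_coeff_support:
  assumes "Zbar_coeff G B l' e \<noteq> 0"
  shows "\<exists>i\<in>quadrant B. e = i + proj B l'"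
proof -
  have "{z \<in> dualLat G. z - l' \<in> Lat \<and> proj B z = e \<and> zeta_coeff G z \<noteq> 0} \<noteq> {}"
  proof
    assume e: "{z \<in> dualLat G. z - l' \<in> Lat \<and> proj B z = e \<and> zeta_coeff G z \<noteq> 0} = {}"
    show False using assms unfolding Zbar_coeff_def e by simp
  qed
  then obtain z where z: "z - l' \<in> Lat" "proj B z = e" "zeta_coeff G z \<noteq> 0" by blast
  have zz: "(z - l') + l' = z" by simp
  have "0 \<le> z - l'" by (rule pcoef_support[OF z(1)]) (simp add: pcoef_def z(3))
  hence "proj B (z - l') \<in> quadrant B" by (rule quadrant_proj[OF z(1)])
  moreover have "e = proj B (z - l') + proj B l'" unfolding proj_add[symmetric] zz z(2) ..
  ultimately show ?thesis by blast
qed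

text \<open>Grouping the lattice points by their projections.\<close>
lemma sum_pbar:
  assumes i: "i \<in> quadrant B"
  shows "finite {i' \<in> quadrant B. \<not> i \<le> i' \<and> pbar i' \<noteq> 0}"
    and "(\<Sum>i'\<in>{i' \<in> quadrant B. \<not> i \<le> i' \<and> pbar i' \<noteq> 0}. pbar i') = (\<Sum>y\<in>partial_support i. pcoef y)"
proof -
  define S where "S = partial_support i"
  define T where "T = {i' \<in> quadrant B. \<not> i \<le> i' \<and> pbar i' \<noteq> 0}"
  have finS: "finite S" unfolding S_def by (rule finite_partial_support[OF i])
  have fib: "pbar i' = (\<Sum>y\<in>{y \<in> S. proj B y = i'}. pcoef y)" if "\<not> i \<le> i'" for i'
  proof -
    have "{y \<in> Lat. proj B y = i' \<and> pcoef y \<noteq> 0} = {y \<in> S. proj B y = i'}"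
      unfolding S_def partial_support_def using that by auto
    thus ?thesis unfolding pbar_eq_fibre_sum by simp
  qed
  have sub: "T \<subseteq> proj B ` S"
  proof
    fix i' assume "i' \<in> T"
    hence i': "\<not> i \<le> i'" "pbar i' \<noteq> 0" unfolding T_def by auto
    have "{y \<in> S. proj B y = i'} \<noteq> {}"
    proof
      assume e: "{y \<in> S. proj B y = i'} = {}"
      show False using i'(2) unfolding fib[OF i'(1)] e by simp
    qed
    thus "i' \<in> proj B ` S" by blast
  qed
  have SN: "\<not> i \<le> i'" "i' \<in> quadrant B" if h: "i' \<in> proj B ` S" for i'
  proof -
    obtain y where y: "y \<in> S" "i' = proj B y" using h by blast
    show "\<not> i \<le> i'" using y unfolding S_def partial_support_def by simp
    have "y \<in> Lat" "0 \<le> y" using y(1) pcoef_support unfolding S_def partial_support_def by auto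
    thus "i' \<in> quadrant B" unfolding y(2) by (rule quadrant_proj)
  qed
  show "finite {i' \<in> quadrant B. \<not> i \<le> i' \<and> pbar i' \<noteq> 0}" using finite_subset[OF sub] finS unfolding T_def by simp
  have "(\<Sum>i'\<in>T. pbar i') = (\<Sum>i'\<in>proj B ` S. pbar i')"
    by (rule sum.mono_neutral_left) (use finS sub SN in \<open>auto simp: T_def\<close>)
  also have "\<dots> = (\<Sum>i'\<in>proj B ` S. \<Sum>y\<in>{y \<in> S. proj B y = i'}. pcoef y)"
    by (rule sum.cong[OF refl]) (rule fib[OF SN(1)])
  also have "\<dots> = (\<Sum>y\<in>S. pcoef y)" by (rule sum.image_gen[symmetric, OF finS])
  finally show "(\<Sum>i'\<in>{i' \<in> quadrant B. \<not> i \<le> i' \<and> pbar i' \<noteq> 0}. pbar i') = (\<Sum>y\<in>partial_support i. pcoef y)"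
    unfolding T_def S_def .
qed

lemma sum_partial_support_deep:
  assumes z: "deep z"
  shows "(\<Sum>y\<in>partial_support (proj B z). pcoef y) = wb (proj B z) + of_int (eu_graph G k)"
proof -
  have i: "proj B z \<in> quadrant B" by (rule quadrant_proj[OF deepD(1)[OF z] deep_nonneg[OF z]])
  obtain R where R: "\<And>c. deep c \<Longrightarrow> (\<And>j. R \<le> c j) \<Longrightarrow> proj B z \<le> proj B c \<and>
     (\<Sum>y\<in>partial_support (proj B z). pcoef y) = of_int (eu_graph G k) - euler_sum (box_cubes (proj B z) (proj B c)) wb"
    using sum_partial_support[OF i] by blast
  obtain n :: nat where n: "R \<le> of_nat n" using real_arch_simple by blast
  define c where "c = z + (\<lambda>j. of_nat n * dv j)"
  have "R \<le> c j" for j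
  proof -
    have "of_nat n * 1 \<le> of_nat n * dv j" using dv(2)[of j] by (intro mult_left_mono) auto
    thus ?thesis using n le_funD[OF deep_nonneg[OF z], of j] unfolding c_def by simp
  qed
  from R[OF deep_add_dv[OF z, of n, folded c_def] this] show ?thesis
    using euler_sum_deep[OF z, of n, folded c_def] by simp
qed

lemma deep_translates: "\<exists>i0\<in>Sbar G B. \<forall>y\<in>Sbar G B. \<exists>z. deep z \<and> i0 + y = proj B z"
proof -
  obtain M where M: "\<And>n. n \<ge> M \<Longrightarrow> deep (\<lambda>j. of_nat n * dv j)" using deep_exists by metis
  define m where "m = (\<lambda>j. of_nat M * dv j)"
  have m: "deep m" unfolding m_def by (rule M) simp
  show ?thesis
  proof (rule bexI[of _ "proj B m"], rule ballI)
    have "m \<in> lipman G \<inter> Lat" using deepD(1)[OF m] deep_form[OF m] Lat_dualLat unfolding lipman_def by blast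
    thus "proj B m \<in> Sbar G B" unfolding Sbar_def by (rule imageI)
    fix y assume "y \<in> Sbar G B"
    then obtain s where s: "s \<in> lipman G" "s \<in> Lat" "y = proj B s" unfolding Sbar_def by blast
    have "deep (m + s)" by (rule deep_add[OF m s(2)]) (use s(1) in \<open>auto simp: lipman_def\<close>)
    thus "\<exists>z. deep z \<and> proj B m + y = proj B z" unfolding s(3) proj_add[symmetric] by blast
  qed
qed

end

theorem theorem4p5p2p3:
  fixes G :: "'v::finite plumbing" and k :: "'v qvec" and B :: "'v set"
  assumes "connected_tree (adj G)"
    and "negative_definite G"
    and "k \<in> characteristic G"
    and "B \<noteq> {}"
    and "bad_family G B"
  defines "pbar \<equiv> Zbar_coeff G B (ldist G k)"
    and "w \<equiv> wbar G k B"
    and "s \<equiv> proj B (ldist G k)"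
  shows
    "((\<forall>e. pbar e \<noteq> 0 \<longrightarrow> (\<exists>i\<in>quadrant B. e = i + s)) \<and>
      (\<forall>i\<in>quadrant B.
         pbar (i + s) = (\<Sum>I\<in>Pow B. (-1) ^ (card I + 1) * cube_weight w (i, I)))) \<and>
     (\<exists>i0\<in>Sbar G B. \<forall>i\<in>{i0 + y | y. y \<in> Sbar G B}.
        finite {i' \<in> quadrant B. \<not> i \<le> i' \<and> pbar (i' + s) \<noteq> 0} \<and>
        (\<Sum>i'\<in>{i' \<in> quadrant B. \<not> i \<le> i' \<and> pbar (i' + s) \<noteq> 0}. pbar (i' + s))
          = w i + of_int (eu_quadrant G k B)) \<and>
     quasipolynomial_on_quadrant B w \<and>
     eu_quadrant G k B = eu_graph G k"
proof -
  interpret T: bad_tree G k B by unfold_locales (rule assms)+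
  have pb: "pbar (i + s) = T.pbar i" for i unfolding pbar_def s_def T.pbar_def ..
  obtain i0 where i0: "i0 \<in> Sbar G B" "\<forall>y\<in>Sbar G B. \<exists>z. T.deep z \<and> i0 + y = proj B z"
    using T.deep_translates by (rule bexE)
  have part2: "finite {i' \<in> quadrant B. \<not> i \<le> i' \<and> T.pbar i' \<noteq> 0} \<and>
      (\<Sum>i'\<in>{i' \<in> quadrant B. \<not> i \<le> i' \<and> T.pbar i' \<noteq> 0}. T.pbar i') = w i + of_int (eu_quadrant G k B)"
    if h: "i \<in> {i0 + y | y. y \<in> Sbar G B}" for i
  proof -
    obtain y where y: "y \<in> Sbar G B" "i = i0 + y" using h by blast
    obtain z where z: "T.deep z" "i = proj B z" using bspec[OF i0(2) y(1)] unfolding y(2) by blast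
    have i: "i \<in> quadrant B" unfolding z(2) by (rule T.quadrant_proj[OF T.deepD(1)[OF z(1)] T.deep_nonneg[OF z(1)]])
    show ?thesis using T.sum_pbar[OF i] T.sum_partial_support_deep[OF z(1)]
      unfolding z(2)[symmetric] w_def T.eu_quadrant_eq_eu_graph by simp
  qed
  show ?thesis unfolding pb
  proof (intro conjI allI impI ballI bexI[OF _ i0(1)])
    show "\<exists>i\<in>quadrant B. e = i + s" if "pbar e \<noteq> 0" for e
      using T.Zbar_coeff_support[of e] that unfolding pbar_def s_def by blast
    show "T.pbar i = (\<Sum>I\<in>Pow B. (-1) ^ (card I + 1) * cube_weight w (i, I))" if "i \<in> quadrant B" for i
      unfolding w_def by (rule T.pbar_eq[OF that assms(4)])
    show "quasipolynomial_on_quadrant B w" unfolding w_def by (rule T.wbar_quasipolynomial)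
    show "eu_quadrant G k B = eu_graph G k" by (rule T.eu_quadrant_eq_eu_graph)
  qed (use part2 in blast)+
qed

end
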